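(* Let $E$ be a $W^*$-correspondence over a $W^*$-algebra $M$, let $\pi:M\to B(H)$ be a faithful normal representation, and let $\rho=\rho_\pi$ be the induced representation of $H^\infty(E)$ on $\mathcal{F}(E)\otimes_\pi H$. Let $Y\in\mathcal{L}(\mathcal{F}(E))$ be such that $Y\otimes I_H\in Alg\,Lat\,\rho(H^{\infty}(E))$. Then: 1) There exists a sequence $\{a_s\}_{s\ge0}\subset M$ such that $(\Phi_0(Y)\otimes I_H)|_H=\pi(a_0)$ and $(\Phi_0(Y)\otimes I_H)|_{E^{\otimes s}\otimes_\pi H}=\phi_s(a_s)\otimes I_H$ for every $s>0$. Hence, with respect to the decomposition $\mathcal{F}(E)\otimes_\pi H=\sum^\oplus_{s\ge0}E^{\otimes s}\otimes_\pi H$, the operator $\Phi_0(Y)\otimes I_H$ is represented by the diagonal matrix $\mathrm{diag}(\pi(a_0),\phi_1(a_1)\otimes I_H,\phi_2(a_2)\otimes I_H,\dots)$. 2) For every $j\ge1$ there exists a sequence $\{\xi^{(j)}_s\}_{s\ge0}\subset E^{\otimes j}$ such that for every $s\ge 0$ $$(\Phi_j(Y)\otimes I_H)|_{E^{\otimes s}\otimes_\pi H}=(T_{\xi^{(j)}_s}\otimes I_H)|_{E^{\otimes s}\otimes_\pi H}=L^{(s)}_{\xi^{(j)}_s}.$$ Thus, with respect to the decomposition $\mathcal{F}(E)\otimes_\pi H=\sum^\oplus_{s\ge0}E^{\otimes s}\otimes_\pi H$, the operator $\Phi_j(Y)\otimes I_H$ is represented by the matrix whose only nonzero entries are on the $j$-th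 subdiagonal, the entry in position $(s+j,s)$ being $L^{(s)}_{\xi^{(j)}_s}$, $s\ge0$.
   Context: A Hilbert $W^*$-module over a $W^*$-algebra $M$ is a self-dual right Hilbert $C^*$-module $E$ over $M$ (the $M$-valued inner product is linear in the second variable); $\mathcal{L}(E)$ is the $W^*$-algebra of adjointable operators on $E$. $E$ is a dual Banach space; its weak$^*$-topology is called the $\sigma$-topology. A $W^*$-correspondence over $M$ is a Hilbert $W^*$-module $E$ over $M$ with a left action given by a normal $*$-homomorphism $\phi:M\to\mathcal{L}(E)$; it is always assumed essential: $\phi(M)E$ is dense in $E$ in the $\sigma$-topology. $E^{\otimes 0}=M$ with $\phi_0(a)b=ab$; for $n\ge1$, $E^{\otimes n}$ is the self-dual completion of the internal tensor power balanced over $\phi$ (inner product $\langle\xi_1\otimes\eta_1,\xi_2\otimes\eta_2\rangle=\langle\eta_1,\phi(\langle\xi_1,\xi_2\rangle)\eta_2\rangle$), with left action $\phi_n(a)(\xi_1\otimes\dots\otimes\xi_n)=(\phi(a)\xi_1)\otimes\xi_2\otimes\dots\otimes\xi_n$. The full Fock space $\mathcal{F}(E)=\sum^{\oplus}_{n\ge0}E^{\otimes n}$ is the ultraweak direct sum (self-dual completion of the Hilbert module direct sum), with left action $\phi_\infty(a)=\sum_{n\ge 0}\phi_n(a)$. For $\xi\in E^{\otimes j}$, $j\ge1$, $T_\xi\in\mathcal{L}(\mathcal{F}(E))$ is $T_\xi\eta=\xi\otimes\eta$. The Hardy algebra $H^\infty(E)$ is the weak$^*$ (ultraweak) closure in $\mathcal{L}(\mathcal{F}(E))$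 of the algebra generated by all $T_\xi$ ($\xi\in E$) and all $\phi_\infty(a)$ ($a\in M$). For a normal (nondegenerate) representation $\pi:M\to B(H)$ and a Hilbert $W^*$-module $F$ over $M$, $F\otimes_\pi H$ is the Hilbert space completion of the algebraic tensor product with $\langle\xi_1\otimes h_1,\xi_2\otimes h_2\rangle=\langle h_1,\pi(\langle\xi_1,\xi_2\rangle)h_2\rangle$. $M\otimes_\pi H$ is identified with $H$ via $a\otimes h\mapsto\pi(a)h$, so $\mathcal{F}(E)\otimes_\pi H=\sum^\oplus_{n\ge0}E^{\otimes n}\otimes_\pi H$ has $H$ as its $0$-th summand. The induced representation is $\rho_\pi(X)=X\otimes I_H$, $X\in H^\infty(E)$. For $x\in E^{\otimes j}$, $L^{(s)}_x:E^{\otimes s}\otimes_\pi H\to E^{\otimes s+j}\otimes_\pi H$ is $\zeta\otimes h\mapsto x\otimes\zeta\otimes h$ (for $s=0$: $h\mapsto x\otimes h$). Fourier coefficients: let $P_n\in\mathcal{L}(\mathcal{F}(E))$ be the projection onto $E^{\otimes n}$, $W_t=\sum_{n\ge0}e^{int}P_n$, $\gamma_t(T)=W_tTW_t^*$ ($t\in\mathbb{R}$). For $T\in\mathcal{L}(\mathcal{F}(E))$ and $j\in\mathbb{Z}$, $\Phi_j(T)=\frac1{2\pi}\int_0^{2\pi}e^{-ijt}\gamma_t(T)\,dt$ (weak$^*$-convergent integral); equivalently $\Phi_j(T)=\sum_kP_{k+j}TP_k$. For a subalgebra $\mathcal{A}\subseteq B(K)$, $Lat\,\mathcal{A}$ is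 the lattice of closed $\mathcal{A}$-invariant subspaces of $K$, and $Alg\,Lat\,\mathcal{A}=\{T\in B(K):T\mathcal{N}\subseteq\mathcal{N}\ \forall \mathcal{N}\in Lat\,\mathcal{A}\}$. *)

theory Defs
  imports "HOL-Analysis.Analysis" "HOL-Library.Function_Algebras"
begin

section \<open>Complex vector spaces, Hilbert spaces, C*- and W*-algebras\<close>

class complex_vector = ab_group_add +
  fixes scaleC :: "complex \<Rightarrow> 'a \<Rightarrow> 'a" (infixr "*\<^sub>C" 75)
  assumes scaleC_add_right: "c *\<^sub>C (x + y) = c *\<^sub>C x + c *\<^sub>C y"
    and scaleC_add_left: "(c + d) *\<^sub>C x = c *\<^sub>C x + d *\<^sub>C x"
    and scaleC_scaleC: "c *\<^sub>C d *\<^sub>C x = (c * d) *\<^sub>C x"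
    and scaleC_one: "1 *\<^sub>C x = x"

global_interpretation complex_vector: vector_space "scaleC :: complex \<Rightarrow> 'a \<Rightarrow> 'a::complex_vector"
  by unfold_locales (rule scaleC_add_right scaleC_add_left scaleC_scaleC scaleC_one)+

abbreviation csubspace :: "'a::complex_vector set \<Rightarrow> bool"
  where "csubspace \<equiv> module.subspace scaleC"

abbreviation cspan :: "'a::complex_vector set \<Rightarrow> 'a set"
  where "cspan \<equiv> module.span scaleC"

instantiation "fun" :: (type, complex_vector) complex_vector
begin

definition scaleC_fun :: "complex \<Rightarrow> ('a \<Rightarrow> 'b) \<Rightarrow> 'a \<Rightarrow> 'b"
  where "scaleC_fun c f = (\<lambda>x. c *\<^sub>C f x)"

instance
  by standard
    (simp_all add: scaleC_fun_def fun_eq_iff scaleC_add_right scaleC_add_left scaleC_scaleC scaleC_one)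

end

class complex_normed_vector = complex_vector + real_normed_vector +
  assumes scaleR_scaleC: "r *\<^sub>R x = complex_of_real r *\<^sub>C x"
    and norm_scaleC: "norm (c *\<^sub>C x) = cmod c * norm x"

text \<open>Inner products are linear in the second variable.\<close>

class chilbert_space = complex_normed_vector + banach +
  fixes cinner :: "'a \<Rightarrow> 'a \<Rightarrow> complex"
  assumes cinner_commute: "cinner x y = cnj (cinner y x)"
    and cinner_add_right: "cinner x (y + z) = cinner x y + cinner x z"
    and cinner_scaleC_right: "cinner x (c *\<^sub>C y) = c * cinner x y"
    and cinner_self: "cinner x x = complex_of_real ((norm x)\<^sup>2)"

text \<open>Unital C*-algebras; the zero algebra is allowed, hence \<^class>\<open>monoid_mult\<close> rather than
  \<^class>\<open>ring_1\<close>.\<close>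

class cstar_algebra = complex_normed_vector + real_normed_algebra + monoid_mult + banach +
  fixes star :: "'a \<Rightarrow> 'a"
  assumes mult_scaleC_left: "(c *\<^sub>C x) * y = c *\<^sub>C (x * y)"
    and mult_scaleC_right: "x * (c *\<^sub>C y) = c *\<^sub>C (x * y)"
    and star_add: "star (x + y) = star x + star y"
    and star_scaleC: "star (c *\<^sub>C x) = cnj c *\<^sub>C star x"
    and star_mult: "star (x * y) = star y * star x"
    and star_star: "star (star x) = x"
    and norm_star_mult: "norm (star x * x) = (norm x)\<^sup>2"

context complex_normed_vector
begin

definition bounded_functional :: "('a \<Rightarrow> complex) \<Rightarrow> bool"
  where "bounded_functional f \<longleftrightarrow>
    (\<forall>x y. f (x + y) = f x + f y) \<and> (\<forall>c x. f (c *\<^sub>C x) = c * f x) \<and>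
    (\<exists>C. \<forall>x. cmod (f x) \<le> C * norm x)"

text \<open>This is \<^const>\<open>onorm\<close>, restated inside the class so that further class axioms can use it.\<close>

definition functional_norm :: "('a \<Rightarrow> complex) \<Rightarrow> real"
  where "functional_norm f = (SUP x. cmod (f x) / norm x)"

end

text \<open>A W*-algebra is a C*-algebra that is isometrically the dual of a Banach space. The predual
  is carried as a norm-closed space of bounded functionals such that evaluation identifies the
  algebra isometrically with its dual; by Sakai's theorem it is unique, so carrying
  it is no extra choice.\<close>

class wstar_algebra = cstar_algebra +
  fixes predual :: "('a \<Rightarrow> complex) set"
  assumes predual_bounded: "f \<in> predual \<Longrightarrow> bounded_functional f"
    and predual_zero: "(\<lambda>_. 0) \<in> predual"
    and predual_add: "f \<in> predual \<Longrightarrow> g \<in> predual \<Longrightarrow> (\<lambda>x. f x + g x) \<in> predual"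
    and predual_scale: "f \<in> predual \<Longrightarrow> (\<lambda>x. c * f x) \<in> predual"
    and predual_closed: "bounded_functional f \<Longrightarrow>
          (\<And>e. 0 < e \<Longrightarrow> \<exists>g\<in>predual. functional_norm (\<lambda>x. f x - g x) < e) \<Longrightarrow> f \<in> predual"
    and predual_isometric: "norm a = (SUP f\<in>{f \<in> predual. functional_norm f \<le> 1}. cmod (f a))"
    and predual_onto: "(\<And>f g. f \<in> predual \<Longrightarrow> g \<in> predual \<Longrightarrow> \<Lambda> (\<lambda>x. f x + g x) = \<Lambda> f + \<Lambda> g) \<Longrightarrow>
          (\<And>c f. f \<in> predual \<Longrightarrow> \<Lambda> (\<lambda>x. c * f x) = c * \<Lambda> f) \<Longrightarrow>
          (\<And>f. f \<in> predual \<Longrightarrow> cmod (\<Lambda> f) \<le> C * functional_norm f) \<Longrightarrow>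
          \<exists>a. \<forall>f\<in>predual. \<Lambda> f = f a"

definition weak_topology :: "'a set \<Rightarrow> ('a \<Rightarrow> complex) set \<Rightarrow> 'a topology"
  where "weak_topology C \<Omega> = topology_generated_by {{x \<in> C. \<omega> x \<in> U} | \<omega> U. \<omega> \<in> \<Omega> \<and> open U}"

definition weakstar :: "'m::wstar_algebra topology"
  where "weakstar = weak_topology UNIV predual"


section \<open>Hilbert W*-modules\<close>

text \<open>The carrier is a complex subspace of an ambient complex vector space; the operations are
  only constrained on the carrier.\<close>

record ('m, 'e) hmod =
  carr :: "'e set"
  act :: "'e \<Rightarrow> 'm \<Rightarrow> 'e"
  ip :: "'e \<Rightarrow> 'e \<Rightarrow> 'm"

definition hnorm :: "('m::cstar_algebra, 'e) hmod \<Rightarrow> 'e \<Rightarrow> real"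
  where "hnorm E x = sqrt (norm (ip E x x))"

locale hilbert_cstar_module =
  fixes E :: "('m::cstar_algebra, 'e::complex_vector) hmod"
  assumes carr_subspace: "csubspace (carr E)"
    and act_closed: "x \<in> carr E \<Longrightarrow> act E x a \<in> carr E"
    and act_add_left: "x \<in> carr E \<Longrightarrow> y \<in> carr E \<Longrightarrow> act E (x + y) a = act E x a + act E y a"
    and act_add_right: "x \<in> carr E \<Longrightarrow> act E x (a + b) = act E x a + act E x b"
    and act_mult: "x \<in> carr E \<Longrightarrow> act E x (a * b) = act E (act E x a) b"
    and act_one: "x \<in> carr E \<Longrightarrow> act E x 1 = x"
    and act_scaleC_left: "x \<in> carr E \<Longrightarrow> act E (c *\<^sub>C x) a = c *\<^sub>C act E x a"
    and act_scaleC_right: "x \<in> carr E \<Longrightarrow> act E x (c *\<^sub>C a) = c *\<^sub>C act E x a"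
    and ip_add: "x \<in> carr E \<Longrightarrow> y \<in> carr E \<Longrightarrow> z \<in> carr E \<Longrightarrow> ip E x (y + z) = ip E x y + ip E x z"
    and ip_scaleC: "x \<in> carr E \<Longrightarrow> y \<in> carr E \<Longrightarrow> ip E x (c *\<^sub>C y) = c *\<^sub>C ip E x y"
    and ip_act: "x \<in> carr E \<Longrightarrow> y \<in> carr E \<Longrightarrow> ip E x (act E y a) = ip E x y * a"
    and ip_star: "x \<in> carr E \<Longrightarrow> y \<in> carr E \<Longrightarrow> star (ip E x y) = ip E y x"
    and ip_positive: "x \<in> carr E \<Longrightarrow> \<exists>b. ip E x x = star b * b"
    and ip_definite: "x \<in> carr E \<Longrightarrow> ip E x x = 0 \<Longrightarrow> x = 0"
    and complete: "(\<And>n. s n \<in> carr E) \<Longrightarrow>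
          (\<And>e. 0 < e \<Longrightarrow> \<exists>N. \<forall>m\<ge>N. \<forall>n\<ge>N. hnorm E (s m - s n) < e) \<Longrightarrow>
          \<exists>x\<in>carr E. (\<lambda>n. hnorm E (s n - x)) \<longlonglongrightarrow> 0"

definition bounded_module_map :: "('m::cstar_algebra, 'e::complex_vector) hmod \<Rightarrow> ('e \<Rightarrow> 'm) \<Rightarrow> bool"
  where "bounded_module_map E \<tau> \<longleftrightarrow>
    (\<forall>x\<in>carr E. \<forall>y\<in>carr E. \<tau> (x + y) = \<tau> x + \<tau> y) \<and>
    (\<forall>x\<in>carr E. \<forall>c. \<tau> (c *\<^sub>C x) = c *\<^sub>C \<tau> x) \<and>
    (\<forall>x\<in>carr E. \<forall>a. \<tau> (act E x a) = \<tau> x * a) \<and>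
    (\<exists>C. \<forall>x\<in>carr E. norm (\<tau> x) \<le> C * hnorm E x)"

locale hilbert_wstar_module = hilbert_cstar_module E
  for E :: "('m::wstar_algebra, 'e::complex_vector) hmod" +
  assumes self_dual: "bounded_module_map E \<tau> \<Longrightarrow> \<exists>y\<in>carr E. \<forall>x\<in>carr E. \<tau> x = ip E y x"

text \<open>The canonical predual of a self-dual module consists of the functionals
  \<open>x \<mapsto> \<Sum>n. f n (\<langle>y n, x\<rangle>)\<close> with absolutely summable norms; it induces the \<open>\<sigma>\<close>-topology.\<close>

definition module_functionals :: "('m::wstar_algebra, 'e) hmod \<Rightarrow> ('e \<Rightarrow> complex) set"
  where "module_functionals E =
    {\<lambda>x. \<Sum>n. f n (ip E (y n) x) | f y. (\<forall>n. f n \<in> predual \<and> y n \<in> carr E) \<and>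
       summable (\<lambda>n::nat. functional_norm (f n) * hnorm E (y n))}"

definition sigma_topology :: "('m::wstar_algebra, 'e) hmod \<Rightarrow> 'e topology"
  where "sigma_topology E = weak_topology (carr E) (module_functionals E)"

text \<open>Adjointable operators are represented by functions that are \<^const>\<open>undefined\<close> off the
  carrier. Adjointable maps are automatically linear and bounded.\<close>

definition adjointable :: "('m::wstar_algebra, 'e) hmod \<Rightarrow> ('e \<Rightarrow> 'e) set"
  where "adjointable E =
    {T \<in> carr E \<rightarrow>\<^sub>E carr E. \<exists>S \<in> carr E \<rightarrow>\<^sub>E carr E.
       \<forall>x\<in>carr E. \<forall>y\<in>carr E. ip E (T x) y = ip E x (S y)}"

text \<open>The predual of the W*-algebra of adjointable operators on a self-dual module (Paschke).\<close>

definition operator_functionals :: "('m::wstar_algebra, 'e) hmod \<Rightarrow> (('e \<Rightarrow> 'e) \<Rightarrow> complex) set"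
  where "operator_functionals E =
    {\<lambda>T. \<Sum>n. f n (ip E (x n) (T (y n))) | f x y.
       (\<forall>n. f n \<in> predual \<and> x n \<in> carr E \<and> y n \<in> carr E) \<and>
       summable (\<lambda>n::nat. functional_norm (f n) * hnorm E (x n) * hnorm E (y n))}"

definition operator_weakstar :: "('m::wstar_algebra, 'e) hmod \<Rightarrow> ('e \<Rightarrow> 'e) topology"
  where "operator_weakstar E = weak_topology (adjointable E) (operator_functionals E)"

text \<open>The subalgebra (not assumed unital) generated by a set of operators on \<open>E\<close>.\<close>

inductive_set operator_algebra ::
    "('m, 'e::complex_vector) hmod \<Rightarrow> ('e \<Rightarrow> 'e) set \<Rightarrow> ('e \<Rightarrow> 'e) set"
  for E :: "('m, 'e) hmod" and G :: "('e \<Rightarrow> 'e) set"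
  where
    generator: "T \<in> G \<Longrightarrow> T \<in> operator_algebra E G"
  | add: "S \<in> operator_algebra E G \<Longrightarrow> T \<in> operator_algebra E G \<Longrightarrow>
      restrict (\<lambda>x. S x + T x) (carr E) \<in> operator_algebra E G"
  | scale: "T \<in> operator_algebra E G \<Longrightarrow> restrict (\<lambda>x. c *\<^sub>C T x) (carr E) \<in> operator_algebra E G"
  | mult: "S \<in> operator_algebra E G \<Longrightarrow> T \<in> operator_algebra E G \<Longrightarrow>
      compose (carr E) S T \<in> operator_algebra E G"


section \<open>W*-correspondences, tensor powers and the full Fock space\<close>

text \<open>In the last condition no linear span is needed: \<open>\<phi>(M)E = \<phi>(1)E\<close> is a subspace.\<close>

locale wstar_correspondence = hilbert_wstar_module E
  for E :: "('m::wstar_algebra, 'e::complex_vector) hmod" +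
  fixes \<phi> :: "'m \<Rightarrow> 'e \<Rightarrow> 'e"
  assumes left_adjointable: "\<phi> a \<in> adjointable E"
    and left_add: "x \<in> carr E \<Longrightarrow> \<phi> (a + b) x = \<phi> a x + \<phi> b x"
    and left_scaleC: "x \<in> carr E \<Longrightarrow> \<phi> (c *\<^sub>C a) x = c *\<^sub>C \<phi> a x"
    and left_mult: "x \<in> carr E \<Longrightarrow> \<phi> (a * b) x = \<phi> a (\<phi> b x)"
    and left_star: "x \<in> carr E \<Longrightarrow> y \<in> carr E \<Longrightarrow> ip E (\<phi> a x) y = ip E x (\<phi> (star a) y)"
    and left_normal: "continuous_map weakstar (operator_weakstar E) \<phi>"
    and essential: "sigma_topology E closure_of {\<phi> a x | a x. x \<in> carr E} = carr E"

text \<open>\<open>Z\<close> together with the bilinear map \<open>\<tau>\<close> is the self-dual completion of the internal tensor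
  product of \<open>X\<close> and \<open>Y\<close> balanced over the left action \<open>\<psi>\<close> on \<open>Y\<close>. The conditions
  determine \<open>(Z, \<tau>)\<close> up to unitary equivalence; balancedness of \<open>\<tau>\<close> follows from the formula for
  the inner product.\<close>

locale internal_tensor =
  fixes X :: "('m::wstar_algebra, 'x::complex_vector) hmod"
    and Y :: "('m, 'y::complex_vector) hmod"
    and \<psi> :: "'m \<Rightarrow> 'y \<Rightarrow> 'y"
    and Z :: "('m, 'z::complex_vector) hmod"
    and \<tau> :: "'x \<Rightarrow> 'y \<Rightarrow> 'z"
  assumes target_module: "hilbert_wstar_module Z"
    and tensor_closed: "x \<in> carr X \<Longrightarrow> y \<in> carr Y \<Longrightarrow> \<tau> x y \<in> carr Z"
    and tensor_add_left: "x \<in> carr X \<Longrightarrow> x' \<in> carr X \<Longrightarrow> y \<in> carr Y \<Longrightarrow> \<tau> (x + x') y = \<tau> x y + \<tau> x' y"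
    and tensor_add_right: "x \<in> carr X \<Longrightarrow> y \<in> carr Y \<Longrightarrow> y' \<in> carr Y \<Longrightarrow> \<tau> x (y + y') = \<tau> x y + \<tau> x y'"
    and tensor_scaleC_left: "x \<in> carr X \<Longrightarrow> y \<in> carr Y \<Longrightarrow> \<tau> (c *\<^sub>C x) y = c *\<^sub>C \<tau> x y"
    and tensor_scaleC_right: "x \<in> carr X \<Longrightarrow> y \<in> carr Y \<Longrightarrow> \<tau> x (c *\<^sub>C y) = c *\<^sub>C \<tau> x y"
    and tensor_act: "x \<in> carr X \<Longrightarrow> y \<in> carr Y \<Longrightarrow> \<tau> x (act Y y a) = act Z (\<tau> x y) a"
    and tensor_ip: "x \<in> carr X \<Longrightarrow> x' \<in> carr X \<Longrightarrow> y \<in> carr Y \<Longrightarrow> y' \<in> carr Y \<Longrightarrow>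
          ip Z (\<tau> x y) (\<tau> x' y') = ip Y y (\<psi> (ip X x x') y')"
    and tensor_dense: "sigma_topology Z closure_of cspan {\<tau> x y | x y. x \<in> carr X \<and> y \<in> carr Y} = carr Z"

text \<open>The tensor powers of a correspondence: \<open>X n\<close> is the \<open>n\<close>-th power with left action \<open>\<psi> n\<close>,
  \<open>\<iota>\<close> identifies \<open>M\<close> with \<open>X 0\<close>, and \<open>\<tau> j k\<close> is the (associative) product of
  the \<open>j\<close>-th and \<open>k\<close>-th powers, with values in the \<open>(j + k)\<close>-th. All powers live in one ambient
  vector space. The data are unique up to unitary equivalence.\<close>

locale tensor_powers =
  fixes E :: "('m::wstar_algebra, 't::complex_vector) hmod"
    and \<phi> :: "'m \<Rightarrow> 't \<Rightarrow> 't"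
    and X :: "nat \<Rightarrow> ('m, 't) hmod"
    and \<psi> :: "nat \<Rightarrow> 'm \<Rightarrow> 't \<Rightarrow> 't"
    and \<iota> :: "'m \<Rightarrow> 't"
    and \<tau> :: "nat \<Rightarrow> nat \<Rightarrow> 't \<Rightarrow> 't \<Rightarrow> 't"
  assumes zeroth_module: "hilbert_wstar_module (X 0)"
    and zeroth_bij: "bij_betw \<iota> UNIV (carr (X 0))"
    and zeroth_add: "\<iota> (a + b) = \<iota> a + \<iota> b"
    and zeroth_scaleC: "\<iota> (c *\<^sub>C a) = c *\<^sub>C \<iota> a"
    and zeroth_act: "act (X 0) (\<iota> a) b = \<iota> (a * b)"
    and zeroth_ip: "ip (X 0) (\<iota> a) (\<iota> b) = star a * b"
    and zeroth_left: "\<psi> 0 a (\<iota> b) = \<iota> (a * b)"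
    and first_module: "X 1 = E"
    and first_left: "\<psi> 1 = \<phi>"
    and left_adjointable: "\<psi> n a \<in> adjointable (X n)"
    and tensor: "internal_tensor (X j) (X k) (\<psi> k) (X (j + k)) (\<tau> j k)"
    and left_tensor: "x \<in> carr (X j) \<Longrightarrow> y \<in> carr (X k) \<Longrightarrow> \<psi> (j + k) a (\<tau> j k x y) = \<tau> j k (\<psi> j a x) y"
    and tensor_assoc: "x \<in> carr (X i) \<Longrightarrow> y \<in> carr (X j) \<Longrightarrow> z \<in> carr (X k) \<Longrightarrow>
          \<tau> (i + j) k (\<tau> i j x y) z = \<tau> i (j + k) x (\<tau> j k y z)"
    and tensor_unit_left: "y \<in> carr (X k) \<Longrightarrow> \<tau> 0 k (\<iota> a) y = \<psi> k a y"
    and tensor_unit_right: "x \<in> carr (X j) \<Longrightarrow> \<tau> j 0 x (\<iota> a) = act (X j) x a"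

text \<open>The ultraweak direct sum: sequences for which the partial sums of \<open>\<Sum>n. \<langle>x n, x n\<rangle>\<close> are bounded,
  with \<open>\<langle>x, y\<rangle>\<close> the weak* sum of the \<open>\<langle>x n, y n\<rangle>\<close>. It is Paschke's concrete form of the
  self-dual completion of the Hilbert module direct sum.\<close>

definition fock :: "(nat \<Rightarrow> ('m::wstar_algebra, 't::complex_vector) hmod) \<Rightarrow> ('m, nat \<Rightarrow> 't) hmod"
  where "fock X = \<lparr>
    carr = {x. (\<forall>n. x n \<in> carr (X n)) \<and> (\<exists>C. \<forall>N. norm (\<Sum>n<N. ip (X n) (x n) (x n)) \<le> C)},
    act = (\<lambda>x a n. act (X n) (x n) a),
    ip = (\<lambda>x y. THE b. \<forall>f\<in>predual. (\<lambda>n. f (ip (X n) (x n) (y n))) sums f b)\<rparr>"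

definition fock_incl :: "nat \<Rightarrow> 't::zero \<Rightarrow> nat \<Rightarrow> 't"
  where "fock_incl n x = (\<lambda>k. if k = n then x else 0)"

definition fock_left ::
    "(nat \<Rightarrow> ('m::wstar_algebra, 't::complex_vector) hmod) \<Rightarrow> (nat \<Rightarrow> 'm \<Rightarrow> 't \<Rightarrow> 't) \<Rightarrow> 'm \<Rightarrow>
      (nat \<Rightarrow> 't) \<Rightarrow> nat \<Rightarrow> 't"
  where "fock_left X \<psi> a = restrict (\<lambda>x n. \<psi> n a (x n)) (carr (fock X))"

definition creation ::
    "(nat \<Rightarrow> ('m::wstar_algebra, 't::complex_vector) hmod) \<Rightarrow> (nat \<Rightarrow> nat \<Rightarrow> 't \<Rightarrow> 't \<Rightarrow> 't) \<Rightarrow>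
      nat \<Rightarrow> 't \<Rightarrow> (nat \<Rightarrow> 't) \<Rightarrow> nat \<Rightarrow> 't"
  where "creation X \<tau> j \<xi> =
    restrict (\<lambda>x n. if j \<le> n then \<tau> j (n - j) \<xi> (x (n - j)) else 0) (carr (fock X))"

definition hardy_algebra ::
    "(nat \<Rightarrow> ('m::wstar_algebra, 't::complex_vector) hmod) \<Rightarrow> (nat \<Rightarrow> 'm \<Rightarrow> 't \<Rightarrow> 't) \<Rightarrow>
      (nat \<Rightarrow> nat \<Rightarrow> 't \<Rightarrow> 't \<Rightarrow> 't) \<Rightarrow> ((nat \<Rightarrow> 't) \<Rightarrow> nat \<Rightarrow> 't) set"
  where "hardy_algebra X \<psi> \<tau> =
    operator_weakstar (fock X) closure_of
      operator_algebra (fock X) (creation X \<tau> 1 ` carr (X 1) \<union> range (fock_left X \<psi>))"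

definition gauge_unitary :: "real \<Rightarrow> (nat \<Rightarrow> 't::complex_vector) \<Rightarrow> nat \<Rightarrow> 't"
  where "gauge_unitary t x = (\<lambda>n. cis (real n * t) *\<^sub>C x n)"

text \<open>The adjoint of \<open>W t\<close> is \<open>W (- t)\<close>.\<close>

definition gauge ::
    "(nat \<Rightarrow> ('m::wstar_algebra, 't::complex_vector) hmod) \<Rightarrow> real \<Rightarrow>
      ((nat \<Rightarrow> 't) \<Rightarrow> nat \<Rightarrow> 't) \<Rightarrow> (nat \<Rightarrow> 't) \<Rightarrow> nat \<Rightarrow> 't"
  where "gauge X t T =
    restrict (\<lambda>x. gauge_unitary t (T (gauge_unitary (- t) x))) (carr (fock X))"

text \<open>The weak* integral of \<open>exp (- \<i> j t) \<gamma>\<^sub>t(T) / (2 \<pi>)\<close> over \<open>[0, 2 \<pi>]\<close>.\<close>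

definition fourier_coeff ::
    "(nat \<Rightarrow> ('m::wstar_algebra, 't::complex_vector) hmod) \<Rightarrow> int \<Rightarrow>
      ((nat \<Rightarrow> 't) \<Rightarrow> nat \<Rightarrow> 't) \<Rightarrow> (nat \<Rightarrow> 't) \<Rightarrow> nat \<Rightarrow> 't"
  where "fourier_coeff X j T =
    (THE S. S \<in> adjointable (fock X) \<and>
       (\<forall>\<omega>\<in>operator_functionals (fock X).
          ((\<lambda>t. cis (- (real_of_int j * t)) * \<omega> (gauge X t T)) has_integral
             complex_of_real (2 * pi) * \<omega> S) {0..2 * pi}))"


section \<open>Hilbert space operators and induced representations\<close>

definition bounded_clinear_on :: "'a::chilbert_space set \<Rightarrow> ('a \<Rightarrow> 'b::chilbert_space) \<Rightarrow> bool"
  where "bounded_clinear_on D T \<longleftrightarrow>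
    (\<forall>x\<in>D. \<forall>y\<in>D. T (x + y) = T x + T y) \<and>
    (\<forall>x\<in>D. \<forall>c. T (c *\<^sub>C x) = c *\<^sub>C T x) \<and>
    (\<exists>C. \<forall>x\<in>D. norm (T x) \<le> C * norm x)"

definition bounded_operators :: "('h::chilbert_space \<Rightarrow> 'h) set"
  where "bounded_operators = {T. bounded_clinear_on UNIV T}"

definition ultraweak :: "('h::chilbert_space \<Rightarrow> 'h) topology"
  where "ultraweak = weak_topology bounded_operators
    {\<lambda>T. \<Sum>n. cinner (x n) (T (y n)) | x y.
       summable (\<lambda>n::nat. (norm (x n))\<^sup>2) \<and> summable (\<lambda>n::nat. (norm (y n))\<^sup>2)}"

text \<open>In the last condition no linear span is needed: \<open>\<pi>(M)H = \<pi>(1)H\<close> is a subspace.\<close>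

locale normal_representation =
  fixes \<pi> :: "'m::wstar_algebra \<Rightarrow> 'h::chilbert_space \<Rightarrow> 'h"
  assumes rep_bounded: "\<pi> a \<in> bounded_operators"
    and rep_add: "\<pi> (a + b) h = \<pi> a h + \<pi> b h"
    and rep_scaleC: "\<pi> (c *\<^sub>C a) h = c *\<^sub>C \<pi> a h"
    and rep_mult: "\<pi> (a * b) h = \<pi> a (\<pi> b h)"
    and rep_star: "cinner (\<pi> a h) k = cinner h (\<pi> (star a) k)"
    and rep_normal: "continuous_map weakstar ultraweak \<pi>"
    and rep_nondegenerate: "closure {\<pi> a h | a h. True} = UNIV"

text \<open>The Hilbert space \<^typ>\<open>'k\<close> with the bilinear map \<open>t\<close> is the completed tensor product of \<open>F\<close> and
  \<^typ>\<open>'h\<close> over \<open>\<pi>\<close>; the conditions determine it up to unitary equivalence.\<close>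

locale hilbert_tensor =
  fixes F :: "('m::wstar_algebra, 'f::complex_vector) hmod"
    and \<pi> :: "'m \<Rightarrow> 'h::chilbert_space \<Rightarrow> 'h"
    and t :: "'f \<Rightarrow> 'h \<Rightarrow> 'k::chilbert_space"
  assumes tensor_add_left: "x \<in> carr F \<Longrightarrow> y \<in> carr F \<Longrightarrow> t (x + y) h = t x h + t y h"
    and tensor_add_right: "x \<in> carr F \<Longrightarrow> t x (h + k) = t x h + t x k"
    and tensor_scaleC_left: "x \<in> carr F \<Longrightarrow> t (c *\<^sub>C x) h = c *\<^sub>C t x h"
    and tensor_scaleC_right: "x \<in> carr F \<Longrightarrow> t x (c *\<^sub>C h) = c *\<^sub>C t x h"
    and tensor_cinner: "x \<in> carr F \<Longrightarrow> y \<in> carr F \<Longrightarrow> cinner (t x h) (t y k) = cinner h (\<pi> (ip F x y) k)"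
    and tensor_dense: "closure (cspan {t x h | x h. x \<in> carr F}) = UNIV"

definition tensor_space :: "'f set \<Rightarrow> ('f \<Rightarrow> 'h \<Rightarrow> 'k::chilbert_space) \<Rightarrow> 'k set"
  where "tensor_space S t = closure (cspan {t x h | x h. x \<in> S})"

text \<open>\<open>T \<otimes> I\<close> as the bounded operator, defined on \<^term>\<open>tensor_space S t\<close> and undefined elsewhere,
  with \<open>x \<otimes> h \<mapsto> T x \<otimes> h\<close>, where \<open>t\<close> and \<open>t'\<close> are the tensor maps of
  domain and codomain.\<close>

definition tensor_op ::
    "'f set \<Rightarrow> ('f \<Rightarrow> 'h \<Rightarrow> 'k::chilbert_space) \<Rightarrow> ('g \<Rightarrow> 'h \<Rightarrow> 'k) \<Rightarrow> ('f \<Rightarrow> 'g) \<Rightarrow> 'k \<Rightarrow> 'k"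
  where "tensor_op S t t' T =
    (THE Z. Z \<in> extensional (tensor_space S t) \<and> bounded_clinear_on (tensor_space S t) Z \<and>
       (\<forall>x\<in>S. \<forall>h. Z (t x h) = t' (T x) h))"

definition amplification ::
    "('m, 'f) hmod \<Rightarrow> ('f \<Rightarrow> 'h \<Rightarrow> 'k::chilbert_space) \<Rightarrow> ('f \<Rightarrow> 'f) \<Rightarrow> 'k \<Rightarrow> 'k"
  where "amplification F t T = tensor_op (carr F) t t T"

text \<open>The summands of \<open>\<F>(E) \<otimes> H\<close>: the \<open>s\<close>-th one is the closed span of the \<open>x \<otimes> h\<close> with
  \<open>x \<in> X s\<close>.\<close>

definition level :: "((nat \<Rightarrow> 't::zero) \<Rightarrow> 'h \<Rightarrow> 'k) \<Rightarrow> nat \<Rightarrow> 't \<Rightarrow> 'h \<Rightarrow> 'k"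
  where "level t s x = t (fock_incl s x)"

definition summand ::
    "(nat \<Rightarrow> ('m, 't::zero) hmod) \<Rightarrow> ((nat \<Rightarrow> 't) \<Rightarrow> 'h \<Rightarrow> 'k::chilbert_space) \<Rightarrow> nat \<Rightarrow> 'k set"
  where "summand X t s = tensor_space (carr (X s)) (level t s)"

text \<open>The identification \<open>h \<mapsto> 1 \<otimes> h\<close> of \<open>H\<close> with the summand \<open>M \<otimes> H\<close>, inverse to
  \<open>a \<otimes> h \<mapsto> \<pi>(a) h\<close>, and the operator on that summand corresponding to an operator on \<open>H\<close>.\<close>

definition vacuum :: "('m::wstar_algebra \<Rightarrow> 't::zero) \<Rightarrow> ((nat \<Rightarrow> 't) \<Rightarrow> 'h \<Rightarrow> 'k) \<Rightarrow> 'h \<Rightarrow> 'k"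
  where "vacuum \<iota> t h = level t 0 (\<iota> 1) h"

definition on_vacuum ::
    "(nat \<Rightarrow> ('m::wstar_algebra, 't::zero) hmod) \<Rightarrow> ('m \<Rightarrow> 't) \<Rightarrow>
      ((nat \<Rightarrow> 't) \<Rightarrow> 'h \<Rightarrow> 'k::chilbert_space) \<Rightarrow> ('h \<Rightarrow> 'h) \<Rightarrow> 'k \<Rightarrow> 'k"
  where "on_vacuum X \<iota> t S =
    restrict (\<lambda>k. vacuum \<iota> t (S (inv (vacuum \<iota> t) k))) (summand X t 0)"

definition level_op ::
    "(nat \<Rightarrow> ('m, 't::zero) hmod) \<Rightarrow> ((nat \<Rightarrow> 't) \<Rightarrow> 'h \<Rightarrow> 'k::chilbert_space) \<Rightarrow>
      nat \<Rightarrow> ('t \<Rightarrow> 't) \<Rightarrow> 'k \<Rightarrow> 'k"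
  where "level_op X t s T = tensor_op (carr (X s)) (level t s) (level t s) T"

definition level_creation ::
    "(nat \<Rightarrow> ('m, 't::zero) hmod) \<Rightarrow> (nat \<Rightarrow> nat \<Rightarrow> 't \<Rightarrow> 't \<Rightarrow> 't) \<Rightarrow>
      ((nat \<Rightarrow> 't) \<Rightarrow> 'h \<Rightarrow> 'k::chilbert_space) \<Rightarrow> nat \<Rightarrow> nat \<Rightarrow> 't \<Rightarrow> 'k \<Rightarrow> 'k"
  where "level_creation X \<tau> t j s \<xi> =
    tensor_op (carr (X s)) (level t s) (level t (s + j)) (\<tau> j s \<xi>)"

definition orthogonal_projection :: "'k::chilbert_space set \<Rightarrow> 'k \<Rightarrow> 'k"
  where "orthogonal_projection N k = (THE p. p \<in> N \<and> (\<forall>q\<in>N. cinner q (k - p) = 0))"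

definition has_matrix ::
    "(nat \<Rightarrow> ('m, 't::zero) hmod) \<Rightarrow> ((nat \<Rightarrow> 't) \<Rightarrow> 'h \<Rightarrow> 'k::chilbert_space) \<Rightarrow>
      ('k \<Rightarrow> 'k) \<Rightarrow> (nat \<Rightarrow> nat \<Rightarrow> 'k \<Rightarrow> 'k) \<Rightarrow> bool"
  where "has_matrix X t Z A \<longleftrightarrow>
    (\<forall>r s. restrict (\<lambda>k. orthogonal_projection (summand X t r) (Z k)) (summand X t s) = A r s)"

definition zero_entry ::
    "(nat \<Rightarrow> ('m, 't::zero) hmod) \<Rightarrow> ((nat \<Rightarrow> 't) \<Rightarrow> 'h \<Rightarrow> 'k::chilbert_space) \<Rightarrow> nat \<Rightarrow> 'k \<Rightarrow> 'k"
  where "zero_entry X t s = restrict (\<lambda>_. 0) (summand X t s)"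

definition Lat :: "('k::chilbert_space \<Rightarrow> 'k) set \<Rightarrow> 'k set set"
  where "Lat A = {N. csubspace N \<and> closed N \<and> (\<forall>T\<in>A. T ` N \<subseteq> N)}"

definition AlgLat :: "('k::chilbert_space \<Rightarrow> 'k) set \<Rightarrow> ('k \<Rightarrow> 'k) set"
  where "AlgLat A = {T \<in> bounded_operators. \<forall>N\<in>Lat A. T ` N \<subseteq> N}"

end

theory Submission
  imports Defs
begin

text \<open>A vector \<open>u\<close> of the \<open>s\<close>-th summand generates a closed invariant subspace whose component of degree
  \<open>j + s\<close> is the closure of all \<open>L\<^sub>\<xi> u\<close> with \<open>\<xi> \<in> E\<^sup>\<otimes>\<^sup>j\<close>. Hence the \<open>(j + s, s)\<close> entry \<open>R\<close> of \<open>Y \<otimes> I\<close> satisfies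
  \<open>R u \<in> closure {L\<^sub>\<xi> u}\<close> for every \<open>u\<close>. For each \<open>\<eta> \<in> E\<^sup>\<otimes>\<^sup>j\<close> the operator \<open>L\<^sub>\<eta>\<^sup>* R\<close> then leaves the invariant
  subspaces of the von Neumann algebra \<open>\<phi>\<^sub>s(M) \<otimes> I\<close> invariant, so it belongs to this algebra by
  the double commutant theorem: \<open>L\<^sub>\<eta>\<^sup>* R = \<phi>\<^sub>s(b \<eta>) \<otimes> I\<close>. Choosing \<open>b \<eta>\<close> in the complement of the kernel
  of \<open>\<phi>\<^sub>s\<close> makes \<open>b\<close> a bounded module map (up to adjoints), and self-duality yields \<open>\<xi>\<close> with
  \<open>b \<eta> = \<langle>\<eta>, \<xi>\<rangle>\<close>, whence \<open>R = L\<^sub>\<xi>\<close>. The entries of the Fourier coefficients are entries of \<open>Y \<otimes> I\<close>.\<close>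

text \<open>The assumptions give little analytic structure: the inner product of
  \<open>fock X\<close> is a definite description whose value must first be shown to exist, only the
  action on \<open>E\<close> is assumed normal, and simple tensors are dense only in the sigma
  topology. Work is therefore moved to bounded operators on \<open>'k\<close>, and facts about
  \<open>M\<close> and its modules are recovered from the forms \<open>cinner h (\<pi> a k)\<close>,
  which determine \<open>a\<close> because \<open>\<pi>\<close> is injective. The double commutant
  theorem is proved with a bound: each operator has a preimage of norm at most 8 times its own. The
  bound replaces the isometry of faithful representations, and the factor 8 in later estimates comes
  from it. It arises from Kaplansky approximation by elements \<open>r b r\<^sup>*\<close> of norm
  at most 1: a self-adjoint operator of norm at most 1/4 is reached this way, which costs a factor
  4, and real and imaginary part together cost 4 + 4. Invariant subspaces only show that an operator
  commutes with the projections of the commutant. The usual passage to the whole commutant is the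
  spectral theorem; here a repeated bisection of the spectrum makes the commutator arbitrarily
  small.\<close>

lemma scaleC_zero_left [simp]: "0 *\<^sub>C (x::'a::complex_vector) = 0"
  by (rule complex_vector.scale_zero_left)

lemma scaleC_diff_right: "c *\<^sub>C (x - y::'a::complex_vector) = c *\<^sub>C x - c *\<^sub>C y"
  by (rule complex_vector.scale_right_diff_distrib)

lemma scaleC_diff_left: "(c - d) *\<^sub>C (x::'a::complex_vector) = c *\<^sub>C x - d *\<^sub>C x"
  by (rule complex_vector.scale_left_diff_distrib)

lemma scaleC_sum_right: "c *\<^sub>C (\<Sum>i\<in>A. f i :: 'a::complex_vector) = (\<Sum>i\<in>A. c *\<^sub>C f i)"
  by (rule complex_vector.scale_sum_right)

lemma csubspace_iff: "csubspace S \<longleftrightarrow> 0 \<in> S \<and> (\<forall>x\<in>S. \<forall>y\<in>S. x + y \<in> S) \<and> (\<forall>c. \<forall>x\<in>S. c *\<^sub>C x \<in> S)"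
  by (rule complex_vector.subspace_def)

lemma csubspaceI:
  "0 \<in> S \<Longrightarrow> (\<And>x y. x \<in> S \<Longrightarrow> y \<in> S \<Longrightarrow> x + y \<in> S) \<Longrightarrow> (\<And>c x. x \<in> S \<Longrightarrow> c *\<^sub>C x \<in> S) \<Longrightarrow> csubspace S"
  by (simp add: csubspace_iff)

lemma tendsto_scaleC [tendsto_intros]:
  fixes f :: "'b \<Rightarrow> 'a::complex_normed_vector"
  assumes "(f \<longlongrightarrow> a) F"
  shows "((\<lambda>x. c *\<^sub>C f x) \<longlongrightarrow> c *\<^sub>C a) F"
proof -
  have "((\<lambda>x. cmod c * norm (f x - a)) \<longlongrightarrow> 0) F"
    using assms by (intro tendsto_mult_right_zero) (simp add: tendsto_norm_zero LIM_zero)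
  then have "((\<lambda>x. norm (c *\<^sub>C f x - c *\<^sub>C a)) \<longlongrightarrow> 0) F"
    by (simp add: norm_scaleC flip: scaleC_diff_right)
  then show ?thesis
    by (simp add: LIM_zero_iff tendsto_norm_zero_iff)
qed

lemma csubspace_closure:
  fixes S :: "'a::complex_normed_vector set"
  assumes "csubspace S"
  shows "csubspace (closure S)"
proof (rule csubspaceI)
  show "0 \<in> closure S"
    using assms closure_subset by (auto simp: csubspace_iff)
  fix x y assume "x \<in> closure S" "y \<in> closure S"
  then obtain f g where "\<forall>n. f n \<in> S" "f \<longlonglongrightarrow> x" "\<forall>n. g n \<in> S" "g \<longlonglongrightarrow> y"
    by (auto simp: closure_sequential)
  then show "x + y \<in> closure S"
    using assms unfolding closure_sequential csubspace_iff
    by (intro exI[of _ "\<lambda>n. f n + g n"]) (auto intro: tendsto_add)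
next
  fix c x assume "x \<in> closure S"
  then obtain f where "\<forall>n. f n \<in> S" "f \<longlonglongrightarrow> x"
    by (auto simp: closure_sequential)
  then show "c *\<^sub>C x \<in> closure S"
    using assms unfolding closure_sequential csubspace_iff
    by (intro exI[of _ "\<lambda>n. c *\<^sub>C f n"]) (auto intro: tendsto_scaleC)
qed

abbreviation clspan :: "'a::complex_normed_vector set \<Rightarrow> 'a set"
  where "clspan S \<equiv> closure (cspan S)"

lemma csubspace_clspan: "csubspace (clspan S)"
  by (simp add: csubspace_closure)

lemma clspan_base: "x \<in> S \<Longrightarrow> x \<in> clspan S"
  using closure_subset complex_vector.span_base by blast

lemma clspan_minimal: "S \<subseteq> V \<Longrightarrow> csubspace V \<Longrightarrow> closed V \<Longrightarrow> clspan S \<subseteq> V"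
  by (simp add: closure_minimal complex_vector.span_minimal)

lemma scaleR_scaleC': "r *\<^sub>R (x::'a::complex_normed_vector) = complex_of_real r *\<^sub>C x"
  by (rule scaleR_scaleC)

section \<open>Inner products, orthogonal projections and the Riesz theorem\<close>

context chilbert_space begin

lemma cinner_add_left: "cinner (x + y) z = cinner x z + cinner y z"
  by (metis cinner_commute cinner_add_right complex_cnj_add)

lemma cinner_scaleC_left: "cinner (c *\<^sub>C x) y = cnj c * cinner x y"
  by (metis cinner_commute cinner_scaleC_right complex_cnj_mult)

end

lemma cinner_zero_right [simp]: "cinner x (0::'a::chilbert_space) = 0"
  using cinner_scaleC_right[of x 0 0] by simp

lemma cinner_zero_left [simp]: "cinner (0::'a::chilbert_space) x = 0"
  using cinner_scaleC_left[of 0 0 x] by simp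

lemma cinner_minus_right [simp]: "cinner x (- y::'a::chilbert_space) = - cinner x y"
  using cinner_scaleC_right[of x "-1" y] by simp

lemma cinner_minus_left [simp]: "cinner (- x::'a::chilbert_space) y = - cinner x y"
  using cinner_scaleC_left[of "-1" x y] by simp

lemma cinner_diff_right: "cinner x (y - z::'a::chilbert_space) = cinner x y - cinner x z"
  using cinner_add_right[of x y "- z"] by simp

lemma cinner_diff_left: "cinner (x - y::'a::chilbert_space) z = cinner x z - cinner y z"
  using cinner_add_left[of x "- y" z] by simp

lemma cinner_scaleR_right: "cinner x (r *\<^sub>R y::'a::chilbert_space) = of_real r * cinner x y"
  by (simp add: scaleR_scaleC' cinner_scaleC_right)

lemma cinner_scaleR_left: "cinner (r *\<^sub>R x::'a::chilbert_space) y = of_real r * cinner x y"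
  by (simp add: scaleR_scaleC' cinner_scaleC_left)

lemma cinner_sum_right: "cinner x (\<Sum>i\<in>A. f i :: 'a::chilbert_space) = (\<Sum>i\<in>A. cinner x (f i))"
  by (induction A rule: infinite_finite_induct) (auto simp: cinner_add_right)

lemma cinner_sum_left: "cinner (\<Sum>i\<in>A. f i :: 'a::chilbert_space) x = (\<Sum>i\<in>A. cinner (f i) x)"
  by (induction A rule: infinite_finite_induct) (auto simp: cinner_add_left)

lemmas cinner_simps = cinner_add_left cinner_add_right cinner_diff_left cinner_diff_right
  cinner_scaleC_left cinner_scaleC_right cinner_scaleR_left cinner_scaleR_right

lemma norm_sq_cinner: "(norm (x::'a::chilbert_space))\<^sup>2 = Re (cinner x x)"
  by (simp add: cinner_self)

lemma cinner_self_eq_zero [simp]: "cinner x x = 0 \<longleftrightarrow> (x::'a::chilbert_space) = 0"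
  by (simp add: cinner_self)

lemma Re_cinner_commute: "Re (cinner x y) = Re (cinner y (x::'a::chilbert_space))"
  by (subst cinner_commute) simp

lemma norm_add_sq: "(norm (x + y::'a::chilbert_space))\<^sup>2 = (norm x)\<^sup>2 + 2 * Re (cinner x y) + (norm y)\<^sup>2"
  using Re_cinner_commute[of x y] by (simp add: norm_sq_cinner cinner_simps)

lemma norm_diff_sq: "(norm (x - y::'a::chilbert_space))\<^sup>2 = (norm x)\<^sup>2 - 2 * Re (cinner x y) + (norm y)\<^sup>2"
  using norm_add_sq[of x "- y"] by simp

text \<open>The triangle inequality is part of the class, so the Cauchy-Schwarz inequality for the
  real part can be read off from the expansion of \<open>norm (x + y)\<close> squared. Multiplying
  \<open>y\<close> by a phase turns the modulus into a real part.\<close>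

lemma cmod_cinner_le: "cmod (cinner x y) \<le> norm x * norm (y::'a::chilbert_space)"
proof -
  have re: "Re (cinner x y) \<le> norm x * norm y" for x y :: 'a
    using norm_add_sq[of x y] norm_triangle_ineq[of x y] power_mono[of "norm (x+y)" "norm x + norm y" 2]
    by (simp add: power2_sum)
  obtain u where u: "cmod u = 1" "u * cinner x y = of_real (cmod (cinner x y))"
  proof (cases "cinner x y = 0")
    case False
    let ?u = "cnj (cinner x y) / of_real (cmod (cinner x y))"
    show ?thesis
    proof (rule that[of ?u])
      show "cmod ?u = 1" using False by (simp add: norm_divide)
      show "?u * cinner x y = of_real (cmod (cinner x y))"
        using False complex_norm_square[of "cinner x y"]
        by (simp add: field_simps power2_eq_square)
    qed
  qed (use that[of 1] in auto)
  have "cmod (cinner x y) = Re (cinner x (u *\<^sub>C y))"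
    by (simp add: cinner_scaleC_right u)
  also have "\<dots> \<le> norm x * norm y"
    using re[of x "u *\<^sub>C y"] by (simp add: norm_scaleC u)
  finally show ?thesis .
qed

lemma bounded_bilinear_cinner: "bounded_bilinear (cinner :: 'a::chilbert_space \<Rightarrow> 'a \<Rightarrow> complex)"
  by unfold_locales
    (auto simp: cinner_simps scaleR_conv_of_real intro!: exI[of _ 1] cmod_cinner_le)

lemmas tendsto_cinner [tendsto_intros] = bounded_bilinear.tendsto[OF bounded_bilinear_cinner]
lemmas continuous_on_cinner [continuous_intros] = bounded_bilinear.continuous_on[OF bounded_bilinear_cinner]

lemma cinner_eqI: "(\<And>k. cinner k x = cinner k y) \<Longrightarrow> x = (y::'a::chilbert_space)"
  using cinner_self_eq_zero[of "x - y"] by (simp add: cinner_diff_right)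

lemma pythagoras: "cinner x y = 0 \<Longrightarrow> (norm (x + y::'a::chilbert_space))\<^sup>2 = (norm x)\<^sup>2 + (norm y)\<^sup>2"
  by (simp add: norm_add_sq)

lemma norm_sum_orthogonal:
  fixes f :: "'i \<Rightarrow> 'a::chilbert_space"
  assumes "finite A" "\<And>i j. i \<in> A \<Longrightarrow> j \<in> A \<Longrightarrow> i \<noteq> j \<Longrightarrow> cinner (f i) (f j) = 0"
  shows "(norm (\<Sum>i\<in>A. f i))\<^sup>2 = (\<Sum>i\<in>A. (norm (f i))\<^sup>2)"
  using assms
proof (induction A)
  case (insert a A)
  have "cinner (f a) (\<Sum>i\<in>A. f i) = (\<Sum>i\<in>A. 0)"
    unfolding cinner_sum_right using insert by (intro sum.cong) auto
  with insert show ?case by (simp add: pythagoras)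
qed simp

lemma parallelogram:
  "(norm (x + y))\<^sup>2 + (norm (x - y::'a::chilbert_space))\<^sup>2 = 2 * (norm x)\<^sup>2 + 2 * (norm y)\<^sup>2"
  by (simp add: norm_add_sq norm_diff_sq)

text \<open>Stated for real subspaces, since Kaplansky's density theorem below approximates by
  self-adjoint elements.\<close>

lemma real_projection_exists:
  fixes V :: "'a::chilbert_space set"
  assumes "subspace V" "closed V"
  shows "\<exists>p\<in>V. \<forall>q\<in>V. Re (cinner q (x - p)) = 0"
proof -
  define d where "d = (INF v\<in>V. norm (x - v))"
  have ne: "V \<noteq> {}" using assms subspace_0 by auto
  have bdd: "bdd_below ((\<lambda>v. norm (x - v)) ` V)" by (rule bdd_belowI2[of _ 0]) simp
  have dle: "d \<le> norm (x - v)" if "v \<in> V" for v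
    unfolding d_def by (rule cINF_lower[OF bdd that])
  have d0: "0 \<le> d" unfolding d_def by (rule cINF_greatest[OF ne]) simp
  have "\<exists>v\<in>V. (norm (x - v))\<^sup>2 < d\<^sup>2 + 1 / Suc n" for n
  proof -
    have "d < sqrt (d\<^sup>2 + 1 / Suc n)"
      using d0 by (intro real_less_rsqrt) auto
    then obtain v where "v \<in> V" "norm (x - v) < sqrt (d\<^sup>2 + 1 / Suc n)"
      unfolding d_def using cINF_less_iff[OF ne bdd] by auto
    then show ?thesis
      by (metis abs_norm_cancel real_sqrt_abs real_sqrt_less_iff)
  qed
  then obtain v where v: "\<And>n. v n \<in> V" "\<And>n. (norm (x - v n))\<^sup>2 < d\<^sup>2 + 1 / Suc n" by metis
  \<comment> \<open>The midpoint of \<open>v m\<close> and \<open>v n\<close> lies in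
    \<open>V\<close>, so its distance to \<open>x\<close> is at least \<open>d\<close>; the
    parallelogram law then makes the minimising sequence Cauchy.\<close>
  have diff: "(norm (v m - v n))\<^sup>2 \<le> 2 / Suc m + 2 / Suc n" for m n
  proof -
    have "(1/2) *\<^sub>R (v m + v n) \<in> V"
      using assms v by (simp add: subspace_add subspace_scale)
    from dle[OF this] have "d\<^sup>2 \<le> (norm (x - (1/2) *\<^sub>R (v m + v n)))\<^sup>2"
      using d0 by (simp add: power_mono)
    moreover have "x - v m + (x - v n) = 2 *\<^sub>R (x - (1/2) *\<^sub>R (v m + v n))"
      by (simp add: scaleR_diff_right scaleR_add_right flip: scaleR_2)
    then have "(norm (x - v m + (x - v n)))\<^sup>2 = 4 * (norm (x - (1/2) *\<^sub>R (v m + v n)))\<^sup>2"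
      by (simp add: power_mult_distrib)
    moreover have "norm (x - v m - (x - v n)) = norm (v m - v n)"
      by (simp add: norm_minus_commute)
    ultimately show ?thesis
      using parallelogram[of "x - v m" "x - v n"] v(2)[of m] v(2)[of n] by simp
  qed
  have "Cauchy v"
  proof (rule metric_CauchyI)
    fix e :: real assume "0 < e"
    then obtain N where N: "4 / Suc N < e\<^sup>2"
      using reals_Archimedean[of "e\<^sup>2/4"] by (auto simp: field_simps)
    have "dist (v m) (v n) < e" if "m \<ge> N" "n \<ge> N" for m n
    proof -
      have "2 / real (Suc m) \<le> 2 / Suc N" "2 / real (Suc n) \<le> 2 / Suc N"
        using that by (auto intro!: divide_left_mono)
      then have "(norm (v m - v n))\<^sup>2 < e\<^sup>2" using diff[of m n] N by simp
      then show ?thesis using \<open>0 < e\<close> by (simp add: dist_norm power2_less_imp_less)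
    qed
    then show "\<exists>M. \<forall>m\<ge>M. \<forall>n\<ge>M. dist (v m) (v n) < e" by blast
  qed
  then obtain p where p: "v \<longlonglongrightarrow> p" using Cauchy_convergent convergentD by blast
  have pV: "p \<in> V" using assms(2) p v(1) closed_sequentially by blast
  have "(\<lambda>n. (norm (x - v n))\<^sup>2) \<longlonglongrightarrow> (norm (x - p))\<^sup>2"
    by (intro tendsto_intros p)
  moreover have "(\<lambda>n. d\<^sup>2 + 1 / Suc n) \<longlonglongrightarrow> d\<^sup>2 + 0"
    by (intro tendsto_intros LIMSEQ_Suc[OF lim_1_over_n])
  ultimately have pd: "(norm (x - p))\<^sup>2 \<le> d\<^sup>2"
    using LIMSEQ_le v(2) by (metis (no_types, lifting) add.right_neutral less_imp_le)
  have "Re (cinner q (x - p)) = 0" if "q \<in> V" for q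
  proof (rule ccontr)
    define c where "c = Re (cinner q (x - p))"
    assume "Re (cinner q (x - p)) \<noteq> 0"
    then have c0: "c \<noteq> 0" by (simp add: c_def)
    then have q0: "q \<noteq> 0" by (auto simp: c_def)
    \<comment> \<open>The minimiser of the quadratic function
      \<open>s \<mapsto> norm (x - p - s q)\<close> squared; moving \<open>p\<close> by this
      multiple of \<open>q\<close> would come closer to \<open>x\<close> than
      \<open>d\<close>.\<close>
    define s where "s = c / (norm q)\<^sup>2"
    have "d\<^sup>2 \<le> (norm (x - (p + s *\<^sub>R q)))\<^sup>2"
      using dle[of "p + s *\<^sub>R q"] pV that assms(1) d0 by (simp add: power_mono subspace_add subspace_scale)
    also have "x - (p + s *\<^sub>R q) = (x - p) - s *\<^sub>R q" by simp
    also have "(norm \<dots>)\<^sup>2 = (norm (x - p))\<^sup>2 - 2 * s * c + s\<^sup>2 * (norm q)\<^sup>2"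
      unfolding norm_diff_sq c_def
      by (simp add: cinner_simps power_mult_distrib Re_cinner_commute[of q])
    also have "\<dots> = (norm (x - p))\<^sup>2 - c\<^sup>2 / (norm q)\<^sup>2"
      using q0 by (simp add: s_def field_simps power2_eq_square)
    finally have "c\<^sup>2 / (norm q)\<^sup>2 \<le> 0" using pd by simp
    moreover have "c\<^sup>2 / (norm q)\<^sup>2 > 0" using c0 q0 by simp
    ultimately show False by simp
  qed
  with pV show ?thesis by blast
qed

lemma csubspace_imp_subspace: "csubspace V \<Longrightarrow> subspace (V::'a::complex_normed_vector set)"
  by (auto simp: csubspace_iff subspace_def scaleR_scaleC')

lemma csubspace_diff: "csubspace V \<Longrightarrow> x \<in> V \<Longrightarrow> y \<in> V \<Longrightarrow> x - y \<in> V"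
  by (rule complex_vector.subspace_diff)

lemma projection_exists:
  fixes V :: "'a::chilbert_space set"
  assumes "csubspace V" "closed V"
  shows "\<exists>p\<in>V. \<forall>q\<in>V. cinner q (x - p) = 0"
proof -
  obtain p where p: "p \<in> V" "\<And>q. q \<in> V \<Longrightarrow> Re (cinner q (x - p)) = 0"
    using real_projection_exists[OF csubspace_imp_subspace] assms by metis
  have "cinner q (x - p) = 0" if "q \<in> V" for q
  proof -
    \<comment> \<open>Real orthogonality to this vector says that the imaginary part of
      \<open>cinner q (x - p)\<close> vanishes.\<close>
    have "\<i> *\<^sub>C q \<in> V" using assms that by (simp add: csubspace_iff)
    from p(2)[OF this] p(2)[OF that] show ?thesis
      by (simp add: cinner_scaleC_left complex_eq_iff)
  qed
  with p show ?thesis by blast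
qed

lemma projection_unique:
  fixes V :: "'a::chilbert_space set"
  assumes "csubspace V" "p \<in> V" "p' \<in> V"
    "\<forall>q\<in>V. cinner q (x - p) = 0" "\<forall>q\<in>V. cinner q (x - p') = 0"
  shows "p = p'"
proof -
  have "p - p' \<in> V" using assms by (simp add: csubspace_diff)
  then have "cinner (p - p') (x - p') - cinner (p - p') (x - p) = 0" using assms by simp
  also have "cinner (p - p') (x - p') - cinner (p - p') (x - p) = cinner (p - p') (p - p')"
    by (simp add: cinner_diff_right)
  finally show ?thesis by simp
qed

text \<open>The residual of the projection of \<open>x\<close> is orthogonal to \<open>V\<close>,
  hence by hypothesis to \<open>x\<close>, hence to itself.\<close>

lemma in_closed_subspace_if_orthogonal:
  fixes V :: "'a::chilbert_space set"
  assumes "csubspace V" "closed V" "\<And>k. (\<And>v. v \<in> V \<Longrightarrow> cinner v k = 0) \<Longrightarrow> cinner k x = 0"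
  shows "x \<in> V"
proof -
  obtain p where p: "p \<in> V" "\<And>q. q \<in> V \<Longrightarrow> cinner q (x - p) = 0"
    using projection_exists[OF assms(1,2)] by metis
  have "cinner (x - p) x = 0" using assms(3) p(2) by blast
  moreover have "cinner (x - p) p = 0"
    using p cinner_commute[of "x - p" p] by simp
  ultimately have "cinner (x - p) (x - p) = 0" by (simp add: cinner_diff_right)
  with p(1) show ?thesis by simp
qed

lemma riesz_representation:
  fixes f :: "'a::chilbert_space \<Rightarrow> complex"
  assumes add: "\<And>x y. f (x + y) = f x + f y" and sc: "\<And>c x. f (c *\<^sub>C x) = c * f x"
    and bd: "\<And>x. cmod (f x) \<le> C * norm x"
  shows "\<exists>y. \<forall>x. f x = cinner y x"
proof (cases "\<forall>x. f x = 0")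
  case True then show ?thesis by (intro exI[of _ 0]) simp
next
  case False
  then obtain x where x: "f x \<noteq> 0" by blast
  have f0: "f 0 = 0" using sc[of 0 0] by simp
  have fdiff: "f (u - v) = f u - f v" for u v using add[of "u - v" v] by simp
  have "bounded_linear f"
    by (rule bounded_linear_intro[of _ C]) (auto simp: add sc bd scaleR_scaleC' scaleR_conv_of_real mult.commute)
  then have "closed (f -` {0})"
    by (intro continuous_closed_vimage) (auto intro: linear_continuous_at)
  moreover have "csubspace (f -` {0})" by (auto simp: csubspace_iff f0 add sc)
  ultimately obtain p where p: "f p = 0" "\<And>q. f q = 0 \<Longrightarrow> cinner q (x - p) = 0"
    using projection_exists[of "f -` {0}" x] by auto
  define z where "z = x - p"
  have fz: "f z \<noteq> 0" using x p(1) by (simp add: z_def fdiff)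
  then have z0: "z \<noteq> 0" using f0 by auto
  have "f u = cinner ((cnj (f z) / cinner z z) *\<^sub>C z) u" for u
  proof -
    \<comment> \<open>The kernel of \<open>f\<close> has codimension one: \<open>u\<close> minus
      this multiple of \<open>z\<close> lies in it, and \<open>z\<close> is orthogonal to
      it.\<close>
    have "f (u - (f u / f z) *\<^sub>C z) = 0" using fz by (simp add: fdiff sc)
    then have "cinner (u - (f u / f z) *\<^sub>C z) z = 0" using p(2) z_def by blast
    then have "cinner z (u - (f u / f z) *\<^sub>C z) = 0" by (subst cinner_commute) simp
    then have "cinner z u = f u / f z * cinner z z" by (simp add: cinner_simps)
    moreover have "cnj (cinner z z) = cinner z z" by (metis cinner_commute)
    ultimately show ?thesis using fz z0 by (simp add: cinner_scaleC_left)
  qed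
  then show ?thesis by blast
qed

section \<open>Square roots and resolvents in C*-algebras\<close>

text \<open>The equation \<open>y = (1/2) *\<^sub>R (x + y * y)\<close> is the same as
  \<open>(1 - y) * (1 - y) = 1 - x\<close>. Its iteration from 0 is not a uniform contraction when
  \<open>norm x = 1\<close>, so it is compared with a scalar iteration. The clause about
  \<open>V\<close> says that the limit inherits every closed property that the iteration preserves;
  self-adjointness and commutation are obtained from it.\<close>

lemma norm_sqrt_iteration_limit:
  fixes x :: "'a::{real_normed_algebra, monoid_mult, banach}"
  assumes "norm x \<le> 1"
  shows "\<exists>y. (1 - y) * (1 - y) = 1 - x \<and> norm y \<le> 1 \<and>
    (\<forall>V. closed V \<longrightarrow> 0 \<in> V \<longrightarrow> (\<forall>v\<in>V. v * x = x * v \<longrightarrow> (1/2) *\<^sub>R (x + v * v) \<in> V) \<longrightarrow> y \<in> V)"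
proof -
  define ys where "ys = rec_nat 0 (\<lambda>_ v. (1/2) *\<^sub>R (x + v * v))"
  have ys0: "ys 0 = 0" and ysS: "ys (Suc n) = (1/2) *\<^sub>R (x + ys n * ys n)" for n
    by (simp_all add: ys_def)
  \<comment> \<open>The same iteration for the scalar 1. It is increasing and bounded by 1, and its
    increments dominate those of \<open>ys\<close>.\<close>
  define s :: "nat \<Rightarrow> real" where "s = rec_nat 0 (\<lambda>_ v. (1 + v * v) / 2)"
  have s0: "s 0 = 0" and sS: "s (Suc n) = (1 + s n * s n) / 2" for n
    by (simp_all add: s_def)
  have s_range: "0 \<le> s n \<and> s n \<le> 1" for n
  proof (induction n)
    case (Suc n)
    then have "s n * s n \<le> 1" by (simp add: mult_le_one)
    then show ?case by (simp add: sS)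
  qed (simp add: s0)
  have s_mono: "s n \<le> s (Suc n)" for n
    using zero_le_power2[of "s n - 1"] by (simp add: sS power2_eq_square algebra_simps)
  have ys_comm: "ys n * x = x * ys n" for n
    by (induction n) (simp_all add: ys0 ysS algebra_simps, metis mult.assoc)
  have ys_comm2: "ys n * ys m = ys m * ys n" for n m
    by (induction n) (simp_all add: ys0 ysS algebra_simps ys_comm, metis mult.assoc)
  have ys_norm: "norm (ys n) \<le> s n" for n
  proof (induction n)
    case (Suc n)
    have "norm (ys (Suc n)) \<le> (norm x + norm (ys n * ys n)) / 2"
      by (simp add: ysS norm_triangle_ineq)
    also have "norm (ys n * ys n) \<le> s n * s n"
      by (rule order_trans[OF norm_mult_ineq]) (intro mult_mono Suc, auto simp: s_range)
    finally show ?case using assms by (simp add: sS)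
  qed (simp add: ys0 s0)
  have ys_step: "norm (ys (Suc n) - ys n) \<le> s (Suc n) - s n" for n
  proof (induction n)
    case 0 then show ?case using assms by (simp add: ys0 ysS s0 sS)
  next
    case (Suc n)
    have "ys (Suc (Suc n)) - ys (Suc n) = (1/2) *\<^sub>R (x + ys (Suc n) * ys (Suc n)) - (1/2) *\<^sub>R (x + ys n * ys n)"
      using ysS[of "Suc n"] ysS[of n] by argo
    also have "\<dots> = (1/2) *\<^sub>R ((ys (Suc n) + ys n) * (ys (Suc n) - ys n))"
      by (simp add: algebra_simps ys_comm2[of n "Suc n"])
    finally have "ys (Suc (Suc n)) - ys (Suc n) = (1/2) *\<^sub>R ((ys (Suc n) + ys n) * (ys (Suc n) - ys n))" .
    then have "norm (ys (Suc (Suc n)) - ys (Suc n)) \<le> (1/2) * (norm (ys (Suc n) + ys n) * norm (ys (Suc n) - ys n))"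
      by (simp add: norm_mult_ineq)
    also have "\<dots> \<le> (1/2) * ((s (Suc n) + s n) * (s (Suc n) - s n))"
      using Suc ys_norm[of n] ys_norm[of "Suc n"] norm_triangle_ineq[of "ys (Suc n)" "ys n"]
        s_range[of n] s_range[of "Suc n"]
      by (intro mult_left_mono mult_mono) auto
    also have "\<dots> = (1 + s (Suc n) * s (Suc n)) / 2 - (1 + s n * s n) / 2"
      by (simp add: field_simps)
    also have "\<dots> = s (Suc (Suc n)) - s (Suc n)"
      using sS[of n] sS[of "Suc n"] by argo
    finally show ?case .
  qed
  have ys_diff: "norm (ys (n + k) - ys n) \<le> s (n + k) - s n" for n k
  proof (induction k)
    case (Suc k)
    have "norm (ys (n + Suc k) - ys n) \<le> norm (ys (Suc (n + k)) - ys (n + k)) + norm (ys (n + k) - ys n)"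
      by (metis add_Suc_right norm_triangle_ineq diff_add_cancel add_diff_eq)
    with Suc ys_step[of "n + k"] show ?case by simp
  qed simp
  have "convergent s"
    using s_range lift_Suc_mono_le[of s, OF s_mono] by (intro Bseq_mono_convergent BseqI'[of _ 1]) auto
  then have "Cauchy s" by (rule convergent_Cauchy)
  have "Cauchy ys"
  proof (rule CauchyI')
    fix e :: real assume "0 < e"
    then obtain M where M: "\<And>m n. m \<ge> M \<Longrightarrow> n \<ge> M \<Longrightarrow> norm (s m - s n) < e"
      using \<open>Cauchy s\<close> CauchyD by blast
    have "dist (ys m) (ys n) < e" if "m \<ge> M" "n > m" for m n
      using M[of n m] ys_diff[of m "n - m"] that by (simp add: dist_norm norm_minus_commute)
    then show "\<exists>M. \<forall>m\<ge>M. \<forall>n>m. dist (ys m) (ys n) < e" by blast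
  qed
  then obtain y where y: "ys \<longlonglongrightarrow> y" using Cauchy_convergent convergentD by blast
  have "(\<lambda>n. ys (Suc n)) \<longlonglongrightarrow> (1/2) *\<^sub>R (x + y * y)"
    unfolding ysS by (intro tendsto_intros y)
  then have "y = (1/2) *\<^sub>R (x + y * y)" using LIMSEQ_Suc[OF y] LIMSEQ_unique by blast
  then have "2 *\<^sub>R y = x + y * y" by (metis scaleR_scaleR mult.commute nonzero_divide_eq_eq scaleR_one zero_neq_numeral)
  then have "y + y = x + y * y" by (simp add: scaleR_2)
  then have "(1 - y) * (1 - y) = 1 - x" by (simp add: algebra_simps)
  moreover have "norm y \<le> 1"
    using y ys_norm s_range by (intro LIMSEQ_le_const2[OF tendsto_norm[OF y]]) (meson order_trans)
  moreover have "y \<in> V"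
    if "closed V" "0 \<in> V" "\<forall>v\<in>V. v * x = x * v \<longrightarrow> (1/2) *\<^sub>R (x + v * v) \<in> V" for V
  proof -
    have "ys n \<in> V" for n by (induction n) (use that ys0 ysS ys_comm in auto)
    then show ?thesis using that(1) y closed_sequentially by blast
  qed
  ultimately show ?thesis by blast
qed

lemma star_zero [simp]: "star (0::'a::cstar_algebra) = 0"
  using star_scaleC[of 0 "0::'a"] by simp

lemma star_one [simp]: "star (1::'a::cstar_algebra) = 1"
  by (metis mult.left_neutral mult.right_neutral star_mult star_star)

lemma star_minus [simp]: "star (- x::'a::cstar_algebra) = - star x"
  using star_scaleC[of "-1" x] by simp

lemma star_diff: "star (x - y::'a::cstar_algebra) = star x - star y"
  using star_add[of x "- y"] by simp

lemma star_scaleR: "star (r *\<^sub>R x::'a::cstar_algebra) = r *\<^sub>R star x"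
  by (simp add: scaleR_scaleC' star_scaleC)

lemma norm_star [simp]: "norm (star x) = norm (x::'a::cstar_algebra)"
proof -
  have le: "norm x \<le> norm (star x)" for x :: 'a
  proof (cases "x = 0")
    case False
    have "norm x * norm x \<le> norm (star x) * norm x"
      using norm_mult_ineq[of "star x" x] by (simp add: norm_star_mult power2_eq_square)
    with False show ?thesis by simp
  qed simp
  show ?thesis using le[of x] le[of "star x"] by (simp add: star_star)
qed

lemma norm_one_le: "norm (1::'a::cstar_algebra) \<le> 1"
proof -
  have "norm (1::'a) = (norm (1::'a))\<^sup>2" using norm_star_mult[of "1::'a"] by simp
  then show ?thesis by (metis norm_ge_zero mult_cancel_left1 order.refl power2_eq_square zero_le_one)
qed

lemma bounded_linear_star: "bounded_linear (star :: 'a::cstar_algebra \<Rightarrow> 'a)"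
  by (rule bounded_linear_intro[of _ 1]) (auto simp: star_add star_scaleR)

lemmas continuous_on_star [continuous_intros] = bounded_linear.continuous_on[OF bounded_linear_star]

text \<open>The closed sets passed to the iteration are the self-adjoint elements and, for each
  \<open>z\<close> commuting with \<open>x\<close>, the elements commuting with
  \<open>z\<close>.\<close>

lemma cstar_sqrt:
  fixes x :: "'a::cstar_algebra"
  assumes "norm x \<le> 1" "star x = x"
  shows "\<exists>y. (1 - y) * (1 - y) = 1 - x \<and> norm y \<le> 1 \<and> star y = y \<and> (\<forall>z. z * x = x * z \<longrightarrow> z * y = y * z)"
proof -
  obtain y where y: "(1 - y) * (1 - y) = 1 - x" "norm y \<le> 1"
    "\<And>V. closed V \<Longrightarrow> 0 \<in> V \<Longrightarrow> (\<forall>v\<in>V. v * x = x * v \<longrightarrow> (1/2) *\<^sub>R (x + v * v) \<in> V) \<Longrightarrow> y \<in> V"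
    using norm_sqrt_iteration_limit[OF assms(1)] by metis
  have "y \<in> {v. star v = v}"
    by (rule y(3)) (auto simp: star_add star_scaleR star_mult assms(2) intro!: closed_Collect_eq continuous_intros)
  moreover have "y \<in> {v. z * v = v * z}" if "z * x = x * z" for z
  proof (rule y(3))
    show "closed {v. z * v = v * z}" by (intro closed_Collect_eq continuous_intros)
    show "\<forall>v\<in>{v. z * v = v * z}. v * x = x * v \<longrightarrow> (1/2) *\<^sub>R (x + v * v) \<in> {v. z * v = v * z}"
      using that by (auto simp: algebra_simps) (metis mult.assoc)
  qed simp
  ultimately show ?thesis using y by blast
qed

text \<open>A right and a left inverse arise as fixed points of the contractions
  \<open>r \<mapsto> 1 + x * r\<close> and \<open>r \<mapsto> 1 + r * x\<close>; by associativity
  they coincide.\<close>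

lemma neumann_inverse:
  fixes x :: "'a::{real_normed_algebra, monoid_mult, banach}"
  assumes "norm x < 1"
  shows "\<exists>r. (1 - x) * r = 1 \<and> r * (1 - x) = 1"
proof -
  have "\<exists>!r. 1 + x * r = r"
  proof (rule banach_fix_type[of "norm x"])
    have "dist (1 + x * r) (1 + x * s) \<le> norm x * dist r s" for r s
      using norm_mult_ineq[of "r - s" x] norm_mult_ineq[of x "r - s"]
      by (simp add: dist_norm mult.commute left_diff_distrib right_diff_distrib)
    then show "\<forall>r s. dist (1 + x * r) (1 + x * s) \<le> norm x * dist r s" by blast
  qed (use assms in auto)
  then obtain r where r: "1 + x * r = r" by blast
  have "\<exists>!r. 1 + r * x = r"
  proof (rule banach_fix_type[of "norm x"])
    have "dist (1 + r * x) (1 + s * x) \<le> norm x * dist r s" for r s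
      using norm_mult_ineq[of "r - s" x] norm_mult_ineq[of x "r - s"]
      by (simp add: dist_norm mult.commute left_diff_distrib right_diff_distrib)
    then show "\<forall>r s. dist (1 + r * x) (1 + s * x) \<le> norm x * dist r s" by blast
  qed (use assms in auto)
  then obtain l where l: "1 + l * x = l" by blast
  have R: "(1 - x) * r = 1" using r by (simp add: left_diff_distrib) (metis add_diff_cancel_right')
  have L: "l * (1 - x) = 1" using l by (simp add: right_diff_distrib) (metis add_diff_cancel_right')
  have "l = r" by (metis R L mult.assoc mult.left_neutral mult.right_neutral)
  with R L show ?thesis by blast
qed

text \<open>The inverse \<open>r\<close> of \<open>b + \<i>l\<close> is an affine function of the Cayley transform
  \<open>(b - \<i>l) r = 1 - 2 \<i>l r\<close>, which is an isometry.\<close>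

lemma resolvent_norm:
  fixes b r :: "'a::cstar_algebra"
  assumes b: "star b = b" and l: "0 < l"
    and r1: "(b + (\<i> * of_real l) *\<^sub>C 1) * r = 1" and r2: "r * (b + (\<i> * of_real l) *\<^sub>C 1) = 1"
  shows "norm r \<le> 1 / l"
proof -
  let ?p = "b + (\<i> * of_real l) *\<^sub>C 1" and ?m = "b - (\<i> * of_real l) *\<^sub>C 1"
  have sp: "star ?p = ?m" by (simp add: star_add star_scaleC b)
  have sm: "star ?m = ?p" by (simp add: star_diff star_scaleC b)
  have pm: "?p * ?m = ?m * ?p"
    by (simp add: algebra_simps mult_scaleC_left mult_scaleC_right)
  have "star (?p * r) = 1" using r1 by simp
  then have s: "star r * ?m = 1" by (simp add: star_mult sp)
  define u where "u = ?m * r"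
  have "star u * u = star r * ?p * (?m * r)" by (simp add: u_def star_mult sm)
  also have "\<dots> = star r * (?p * ?m) * r" by (simp add: mult.assoc)
  also have "\<dots> = (star r * ?m) * (?p * r)" by (simp add: pm mult.assoc)
  also have "\<dots> = 1" by (simp add: s r1)
  finally have "(norm u)\<^sup>2 \<le> 1" using norm_star_mult[of u] norm_one_le[where 'a='a] by simp
  then have nu: "norm u \<le> 1" by (intro power2_le_imp_le[of "norm u" 1]) auto
  have "?m = ?p - (2 * \<i> * of_real l) *\<^sub>C 1"
    by (simp add: algebra_simps scaleC_add_left[symmetric] mult_2)
  then have "u = 1 - (2 * \<i> * of_real l) *\<^sub>C r"
    unfolding u_def by (simp only: left_diff_distrib r1 mult_scaleC_left mult_1_left)
  then have "(2 * \<i> * of_real l) *\<^sub>C r = 1 - u" by simp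
  then have "2 * l * norm r = norm (1 - u)"
    using l by (metis norm_scaleC norm_mult norm_ii norm_of_real norm_numeral abs_of_pos mult_1_right)
  also have "\<dots> \<le> 2" using norm_triangle_ineq4[of 1 u] nu norm_one_le[where 'a='a] by simp
  finally show ?thesis using l by (simp add: field_simps)
qed

text \<open>For \<open>l = norm b + 1\<close> the element \<open>b + \<i> l\<close> is inverted by a
  Neumann series. Its inverse has norm at most \<open>1 / l\<close>, so the perturbation by
  \<open>\<i> (l - 1)\<close> is small enough, namely \<open>(l - 1) / l < 1\<close>, for a second
  Neumann series to descend from \<open>\<i> l\<close> to \<open>\<i>\<close>.\<close>

lemma resolvent_exists:
  fixes b :: "'a::cstar_algebra"
  assumes b: "star b = b"
  shows "\<exists>r. (b + \<i> *\<^sub>C 1) * r = 1 \<and> r * (b + \<i> *\<^sub>C 1) = 1 \<and> norm r \<le> 1"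
proof -
  define l where "l = norm b + 1"
  have l: "l \<ge> 1" by (simp add: l_def)
  define c where "c = \<i> * of_real l"
  have c0: "c \<noteq> 0" using l by (simp add: c_def)
  have cl: "cmod c = l" using l by (simp add: c_def norm_mult)
  have "norm ((- 1 / c) *\<^sub>C b) < 1"
    using l unfolding norm_scaleC norm_divide cl by (simp add: l_def divide_less_eq add_nonneg_pos)
  then obtain q where q: "(1 - (- 1 / c) *\<^sub>C b) * q = 1" "q * (1 - (- 1 / c) *\<^sub>C b) = 1"
    using neumann_inverse by blast
  have fac: "b + c *\<^sub>C 1 = c *\<^sub>C (1 - (- 1 / c) *\<^sub>C b)"
    using c0 by (simp add: scaleC_diff_right scaleC_add_right scaleC_scaleC add.commute)
  define x where "x = (1 / c) *\<^sub>C q"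
  have x: "(b + c *\<^sub>C 1) * x = 1" "x * (b + c *\<^sub>C 1) = 1"
    unfolding fac x_def using q c0 by (simp_all only: mult_scaleC_left mult_scaleC_right scaleC_scaleC) simp_all
  have nx: "norm x \<le> 1 / l"
    using resolvent_norm[OF b, of l x] x l by (simp add: c_def)
  define d where "d = \<i> * of_real (l - 1)"
  have "norm (d *\<^sub>C x) \<le> (l - 1) * (1 / l)"
    using l nx by (simp add: norm_scaleC d_def norm_mult del: of_real_diff mult_left_mono) (metis mult_left_mono diff_ge_0_iff_ge mult.right_neutral times_divide_eq_right)
  also have "\<dots> < 1" using l by (simp add: field_simps)
  finally obtain q' where q': "(1 - d *\<^sub>C x) * q' = 1" "q' * (1 - d *\<^sub>C x) = 1"
    using neumann_inverse by blast
  have dc: "d = c - \<i>" by (simp add: c_def d_def algebra_simps)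
  have f1: "b + \<i> *\<^sub>C 1 = (b + c *\<^sub>C 1) * (1 - d *\<^sub>C x)"
    by (simp add: right_diff_distrib mult_scaleC_right x dc scaleC_diff_left)
  have f2: "b + \<i> *\<^sub>C 1 = (1 - d *\<^sub>C x) * (b + c *\<^sub>C 1)"
    by (simp add: left_diff_distrib mult_scaleC_left x dc scaleC_diff_left)
  have "(b + \<i> *\<^sub>C 1) * (q' * x) = 1"
    unfolding f1 by (metis mult.assoc mult.right_neutral q'(1) x(1))
  moreover have "(x * q') * (b + \<i> *\<^sub>C 1) = 1"
    unfolding f2 using f1
    by (metis f2 mult.assoc mult.right_neutral q'(2) x(2) f1)
  ultimately have r: "(b + \<i> *\<^sub>C 1) * (q' * x) = 1" "(q' * x) * (b + \<i> *\<^sub>C 1) = 1"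
    by (auto simp: f1, metis mult.assoc mult.left_neutral mult.right_neutral f1)
  then have "norm (q' * x) \<le> 1"
    using resolvent_norm[OF b, of 1 "q' * x"] by simp
  with r show ?thesis by blast
qed

section \<open>The C*-algebra of bounded operators\<close>

lemma bounded_linear_scaleC: "bounded_linear (\<lambda>x::'a::complex_normed_vector. c *\<^sub>C x)"
  by (rule bounded_linear_intro[of _ "cmod c"])
    (auto simp: scaleC_add_right scaleR_scaleC' scaleC_scaleC norm_scaleC mult.commute)

text \<open>Bounded operators form a type so that they can be an instance of
  \<open>cstar_algebra\<close>; the square roots and resolvents above then apply to
  operators.\<close>

typedef (overloaded) 'a cop =
  "{B :: 'a::chilbert_space \<Rightarrow>\<^sub>L 'a. \<forall>c x. blinfun_apply B (c *\<^sub>C x) = c *\<^sub>C blinfun_apply B x}"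
  morphisms cop_blinfun Abs_cop
  by (rule exI[of _ 0]) simp

setup_lifting type_definition_cop

lift_definition capp :: "'a::chilbert_space cop \<Rightarrow> 'a \<Rightarrow> 'a" (infixl "\<cdot>" 75) is blinfun_apply .

lemma cop_eqI: "(\<And>x. S \<cdot> x = T \<cdot> x) \<Longrightarrow> S = T"
  by transfer (rule blinfun_eqI)

instantiation cop :: (chilbert_space) "{complex_normed_vector, real_normed_algebra, monoid_mult}"
begin

lift_definition zero_cop :: "'a cop" is 0 by simp
lift_definition one_cop :: "'a cop" is id_blinfun by simp
lift_definition plus_cop :: "'a cop \<Rightarrow> 'a cop \<Rightarrow> 'a cop" is "(+)"
  by (simp add: blinfun.add_left scaleC_add_right)
lift_definition minus_cop :: "'a cop \<Rightarrow> 'a cop \<Rightarrow> 'a cop" is "(-)"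
  by (simp add: blinfun.diff_left scaleC_diff_right)
lift_definition uminus_cop :: "'a cop \<Rightarrow> 'a cop" is uminus
  by (simp add: blinfun.minus_left)
lift_definition times_cop :: "'a cop \<Rightarrow> 'a cop \<Rightarrow> 'a cop" is blinfun_compose
  by simp
lift_definition scaleR_cop :: "real \<Rightarrow> 'a cop \<Rightarrow> 'a cop" is scaleR
  by (simp add: blinfun.scaleR_left scaleR_scaleC' scaleC_scaleC mult.commute)
lift_definition scaleC_cop :: "complex \<Rightarrow> 'a cop \<Rightarrow> 'a cop"
  is "\<lambda>c B. Blinfun (\<lambda>x. c *\<^sub>C blinfun_apply B x)"
  by (simp add: bounded_linear_Blinfun_apply scaleC_scaleC mult.commute
      bounded_linear_compose[OF bounded_linear_scaleC blinfun.bounded_linear_right])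
lift_definition norm_cop :: "'a cop \<Rightarrow> real" is norm .
lift_definition dist_cop :: "'a cop \<Rightarrow> 'a cop \<Rightarrow> real" is dist .
definition sgn_cop :: "'a cop \<Rightarrow> 'a cop" where "sgn_cop T = scaleR (inverse (norm T)) T"
definition uniformity_cop :: "('a cop \<times> 'a cop) filter"
  where "uniformity_cop = (INF e\<in>{0<..}. principal {(S, T). dist S T < e})"
definition open_cop :: "'a cop set \<Rightarrow> bool"
  where "open_cop U = (\<forall>T\<in>U. \<forall>\<^sub>F (T', S) in uniformity. T' = T \<longrightarrow> S \<in> U)"

lemma capp_scaleC_left: "(c *\<^sub>C T) \<cdot> x = c *\<^sub>C (T \<cdot> (x::'a))"
proof transfer
  fix c :: complex and B :: "'a \<Rightarrow>\<^sub>L 'a" and x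
  have "bounded_linear (\<lambda>x. c *\<^sub>C blinfun_apply B x)"
    by (rule bounded_linear_compose[OF bounded_linear_scaleC blinfun.bounded_linear_right])
  then show "blinfun_apply (Blinfun (\<lambda>x. c *\<^sub>C blinfun_apply B x)) x = c *\<^sub>C blinfun_apply B x"
    by (simp add: bounded_linear_Blinfun_apply)
qed

lemma capp_add_left: "(S + T) \<cdot> x = S \<cdot> x + T \<cdot> (x::'a)"
  by transfer (simp add: blinfun.add_left)

lemma capp_scaleR_left: "(r *\<^sub>R T) \<cdot> x = r *\<^sub>R (T \<cdot> (x::'a))"
  by transfer (simp add: blinfun.scaleR_left)

lemma capp_mult: "(S * T) \<cdot> x = S \<cdot> (T \<cdot> (x::'a))"
  by transfer simp

lemma capp_norm_le: "norm (T \<cdot> x) \<le> norm T * norm (x::'a)"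
  by transfer (rule norm_blinfun)

lemma cop_norm_leI: "0 \<le> C \<Longrightarrow> (\<And>x::'a. norm (T \<cdot> x) \<le> C * norm x) \<Longrightarrow> norm T \<le> C"
  by transfer (rule norm_blinfun_bound)

instance
proof
  fix a b c :: "'a cop" and x y :: complex and r s :: real
  show "a + b + c = a + (b + c)" by transfer simp
  show "a + b = b + a" by transfer simp
  show "0 + a = a" by transfer simp
  show "- a + a = 0" by transfer simp
  show "a - b = a + - b" by transfer simp
  show "r *\<^sub>R (a + b) = r *\<^sub>R a + r *\<^sub>R b" by transfer (rule scaleR_add_right)
  show "(r + s) *\<^sub>R a = r *\<^sub>R a + s *\<^sub>R a" by transfer (rule scaleR_add_left)
  show "r *\<^sub>R s *\<^sub>R a = (r * s) *\<^sub>R a" by transfer simp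
  show "1 *\<^sub>R a = a" by transfer simp
  show "dist a b = norm (a - b)" by transfer (rule dist_norm)
  show "sgn a = scaleR (inverse (norm a)) a" by (rule sgn_cop_def)
  show "uniformity = (INF e\<in>{0<..}. principal {(S::'a cop, T). dist S T < e})" by (rule uniformity_cop_def)
  show "open U = (\<forall>T\<in>U. \<forall>\<^sub>F (T', S) in uniformity. T' = T \<longrightarrow> S \<in> U)" for U :: "'a cop set" by (rule open_cop_def)
  show "(norm a = 0) = (a = 0)" by transfer simp
  show "norm (a + b) \<le> norm a + norm b" by transfer (rule norm_triangle_ineq)
  show "norm (r *\<^sub>R a) = \<bar>r\<bar> * norm a" by transfer simp
  show "x *\<^sub>C (a + b) = x *\<^sub>C a + x *\<^sub>C b"
    by (rule cop_eqI) (simp add: capp_scaleC_left capp_add_left scaleC_add_right)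
  show "(x + y) *\<^sub>C a = x *\<^sub>C a + y *\<^sub>C a"
    by (rule cop_eqI) (simp add: capp_scaleC_left capp_add_left scaleC_add_left)
  show "x *\<^sub>C y *\<^sub>C a = (x * y) *\<^sub>C a"
    by (rule cop_eqI) (simp add: capp_scaleC_left scaleC_scaleC)
  show "1 *\<^sub>C a = a" by (rule cop_eqI) (simp add: capp_scaleC_left)
  show "r *\<^sub>R a = complex_of_real r *\<^sub>C a"
    by (rule cop_eqI) (simp add: capp_scaleC_left capp_scaleR_left scaleR_scaleC')
  show nle: "norm (x *\<^sub>C a) = cmod x * norm a" for x :: complex and a :: "'a cop"
  proof -
    have le: "norm (x *\<^sub>C a) \<le> cmod x * norm a" for x :: complex and a :: "'a cop"
    proof (rule cop_norm_leI)
      have "0 \<le> norm a" by transfer simp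
      then show "0 \<le> cmod x * norm a" by simp
    qed (auto simp: capp_scaleC_left norm_scaleC mult.assoc intro!: mult_left_mono capp_norm_le)
    show ?thesis
    proof (cases "x = 0")
      case True
      have "0 *\<^sub>C a = 0" by (rule cop_eqI) (simp add: capp_scaleC_left, transfer, simp)
      then show ?thesis using True by simp (transfer, simp)
    next
      case False
      have "a = (1 / x) *\<^sub>C x *\<^sub>C a" using False
        by (intro cop_eqI) (simp add: capp_scaleC_left scaleC_scaleC)
      then have "norm a \<le> cmod (1 / x) * norm (x *\<^sub>C a)" using le by metis
      with le[of x a] False show ?thesis by (simp add: norm_divide field_simps)
    qed
  qed
  show "a * b * c = a * (b * c)" by (rule cop_eqI) (simp add: capp_mult)
  show "(a + b) * c = a * c + b * c" by (rule cop_eqI) (simp add: capp_mult capp_add_left)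
  show "a * (b + c) = a * b + a * c"
    by (rule cop_eqI) (transfer, simp add: blinfun.add_left blinfun.add_right)
  show "r *\<^sub>R a * b = r *\<^sub>R (a * b)" by (rule cop_eqI) (simp add: capp_mult capp_scaleR_left)
  show "a * r *\<^sub>R b = r *\<^sub>R (a * b)"
    by (rule cop_eqI) (transfer, simp add: blinfun.scaleR_left blinfun.scaleR_right)
  show "norm (a * b) \<le> norm a * norm b" by transfer (rule norm_blinfun_compose)
  show "1 * a = a" by transfer (auto intro: blinfun_eqI)
  show "a * 1 = a" by transfer (auto intro: blinfun_eqI)
qed

end

lemma capp_add_right: "T \<cdot> (x + y) = T \<cdot> x + T \<cdot> y"
  by transfer (simp add: blinfun.add_right)

lemma capp_scaleC_right: "T \<cdot> (c *\<^sub>C x) = c *\<^sub>C (T \<cdot> x)"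
  by transfer simp

lemma capp_diff_right: "T \<cdot> (x - y) = T \<cdot> x - T \<cdot> y"
  by transfer (simp add: blinfun.diff_right)

lemma capp_diff_left: "(S - T) \<cdot> x = S \<cdot> x - T \<cdot> x"
  by transfer (simp add: blinfun.diff_left)

lemma capp_minus_left: "(- T) \<cdot> x = - (T \<cdot> x)"
  by transfer (simp add: blinfun.minus_left)

lemma capp_scaleR_right: "T \<cdot> (r *\<^sub>R x) = r *\<^sub>R (T \<cdot> x)"
  by transfer (simp add: blinfun.scaleR_right)

lemma capp_zero [simp]: "T \<cdot> 0 = 0" "0 \<cdot> x = 0"
  by (transfer, simp)+

lemma capp_one [simp]: "1 \<cdot> x = x"
  by transfer simp

lemma capp_sum_right: "T \<cdot> (\<Sum>i\<in>A. f i) = (\<Sum>i\<in>A. T \<cdot> f i)"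
  by (induction A rule: infinite_finite_induct) (auto simp: capp_add_right)

lemmas capp_simps = capp_add_left capp_add_right capp_diff_left capp_diff_right capp_minus_left
  capp_scaleC_left capp_scaleC_right capp_scaleR_left capp_scaleR_right capp_mult

lemma bounded_bilinear_capp: "bounded_bilinear (capp :: 'a::chilbert_space cop \<Rightarrow> 'a \<Rightarrow> 'a)"
  by unfold_locales (auto simp: capp_simps intro!: exI[of _ 1] capp_norm_le)

lemmas tendsto_capp [tendsto_intros] = bounded_bilinear.tendsto[OF bounded_bilinear_capp]
lemmas continuous_on_capp [continuous_intros] = bounded_bilinear.continuous_on[OF bounded_bilinear_capp]

definition cop_of :: "('a \<Rightarrow> 'a) \<Rightarrow> 'a::chilbert_space cop"
  where "cop_of f = Abs_cop (Blinfun f)"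

lemma capp_cop_of:
  assumes "bounded_clinear_on UNIV f"
  shows "cop_of f \<cdot> x = f x"
proof -
  from assms have f: "\<And>x y. f (x + y) = f x + f y" "\<And>c x. f (c *\<^sub>C x) = c *\<^sub>C f x"
    and "\<exists>C. \<forall>x. norm (f x) \<le> C * norm x"
    by (auto simp: bounded_clinear_on_def)
  then obtain C where "\<And>x. norm (f x) \<le> C * norm x" by blast
  then have "bounded_linear f"
    by (intro bounded_linear_intro[of _ C]) (auto simp: f scaleR_scaleC' mult.commute)
  then show ?thesis
    by (simp add: cop_of_def capp.rep_eq Abs_cop_inverse bounded_linear_Blinfun_apply f)
qed

lemma cop_exists:
  assumes "\<And>x y. f (x + y) = f x + f y" "\<And>c x. f (c *\<^sub>C x) = c *\<^sub>C f x" "\<And>x. norm (f x) \<le> C * norm x"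
  shows "\<exists>T. \<forall>x. T \<cdot> x = f x"
proof -
  have "bounded_clinear_on UNIV f" using assms by (auto simp: bounded_clinear_on_def)
  then show ?thesis using capp_cop_of by blast
qed

text \<open>Complex linearity passes to limits, so the complex linear operators are closed in the
  complete space of bounded real linear ones.\<close>

instance cop :: (chilbert_space) banach
proof
  fix T :: "nat \<Rightarrow> 'a cop" assume "Cauchy T"
  then have "Cauchy (\<lambda>n. cop_blinfun (T n))"
    by (simp add: Cauchy_def dist_cop.rep_eq)
  then obtain B where B: "(\<lambda>n. cop_blinfun (T n)) \<longlonglongrightarrow> B"
    using Cauchy_convergent convergentD by blast
  have "blinfun_apply B (c *\<^sub>C x) = c *\<^sub>C blinfun_apply B x" for c x
  proof (rule LIMSEQ_unique)
    show "(\<lambda>n. blinfun_apply (cop_blinfun (T n)) (c *\<^sub>C x)) \<longlonglongrightarrow> blinfun_apply B (c *\<^sub>C x)"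
      by (intro tendsto_intros B)
    have "(\<lambda>n. c *\<^sub>C blinfun_apply (cop_blinfun (T n)) x) \<longlonglongrightarrow> c *\<^sub>C blinfun_apply B x"
      by (intro tendsto_intros B)
    moreover have "blinfun_apply (cop_blinfun (T n)) (c *\<^sub>C x) = c *\<^sub>C blinfun_apply (cop_blinfun (T n)) x" for n
      using cop_blinfun[of "T n"] by simp
    ultimately show "(\<lambda>n. blinfun_apply (cop_blinfun (T n)) (c *\<^sub>C x)) \<longlonglongrightarrow> c *\<^sub>C blinfun_apply B x"
      by simp
  qed
  then have "cop_blinfun (Abs_cop B) = B" by (simp add: Abs_cop_inverse)
  then have "T \<longlonglongrightarrow> Abs_cop B"
    using B by (simp add: tendsto_iff dist_cop.rep_eq)
  then show "convergent T" by (auto simp: convergent_def)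
qed

lemma cop_adjoint_exists: "\<exists>S. \<forall>x y. cinner (S \<cdot> x) y = cinner x (T \<cdot> y)"
proof -
  have "\<exists>z. \<forall>y. cinner x (T \<cdot> y) = cinner z y" for x
  proof (rule riesz_representation[of _ "norm x * norm T"])
    show "cmod (cinner x (T \<cdot> y)) \<le> norm x * norm T * norm y" for y
      by (rule order_trans[OF cmod_cinner_le]) (simp add: mult.assoc mult_left_mono capp_norm_le)
  qed (auto simp: capp_simps cinner_simps)
  then obtain f where f: "\<And>x y. cinner x (T \<cdot> y) = cinner (f x) y" by metis
  have eq: "u = v" if "\<And>y. cinner u y = cinner v y" for u v :: 'a
    using cinner_self_eq_zero[of "u - v"] that by (simp add: cinner_diff_left)
  have "norm (f x) \<le> norm T * norm x" for x
  proof (cases "f x = 0")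
    case False
    have "(norm (f x))\<^sup>2 = Re (cinner x (T \<cdot> f x))" by (simp add: norm_sq_cinner f)
    also have "\<dots> \<le> norm x * norm (T \<cdot> f x)"
      using cmod_cinner_le complex_Re_le_cmod order_trans by blast
    also have "\<dots> \<le> norm x * (norm T * norm (f x))" by (simp add: mult_left_mono capp_norm_le)
    finally show ?thesis using False by (simp add: power2_eq_square mult.commute)
  qed simp
  then have "\<exists>S. \<forall>x. S \<cdot> x = f x"
    by (intro cop_exists[of f "norm T"]) (auto intro!: eq simp: cinner_simps simp flip: f)
  then show ?thesis by (metis f)
qed

instantiation cop :: (chilbert_space) cstar_algebra
begin

definition star_cop :: "'a cop \<Rightarrow> 'a cop"
  where "star_cop T = (SOME S. \<forall>x y. cinner (S \<cdot> x) y = cinner x (T \<cdot> y))"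

lemma cinner_star_left: "cinner (star T \<cdot> x) y = cinner x (T \<cdot> (y::'a))"
  unfolding star_cop_def using someI_ex[OF cop_adjoint_exists[of T]] by blast

lemma cinner_star_right: "cinner x (star T \<cdot> y) = cinner (T \<cdot> x) (y::'a)"
  by (metis cinner_commute cinner_star_left)

instance
proof
  fix a b :: "'a cop" and c :: complex
  show "(c *\<^sub>C a) * b = c *\<^sub>C (a * b)" by (rule cop_eqI) (simp add: capp_simps)
  show "a * (c *\<^sub>C b) = c *\<^sub>C (a * b)" by (rule cop_eqI) (simp add: capp_simps)
  show "star (a + b) = star a + star b"
    by (intro cop_eqI cinner_eqI) (simp add: cinner_star_right capp_simps cinner_simps)
  show "star (c *\<^sub>C a) = cnj c *\<^sub>C star a"
    by (intro cop_eqI cinner_eqI) (simp add: cinner_star_right capp_simps cinner_simps)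
  show "star (a * b) = star b * star a"
    by (intro cop_eqI cinner_eqI) (simp add: cinner_star_right capp_simps)
  show "star (star a) = a"
    by (intro cop_eqI cinner_eqI) (simp add: cinner_star_right cinner_star_left)
  have le: "norm (star a) \<le> norm a" for a :: "'a cop"
  proof (rule cop_norm_leI)
    fix x
    show "norm (star a \<cdot> x) \<le> norm a * norm x"
    proof (cases "star a \<cdot> x = 0")
      case False
      have "(norm (star a \<cdot> x))\<^sup>2 = Re (cinner x (a \<cdot> (star a \<cdot> x)))"
        by (simp add: norm_sq_cinner cinner_star_left)
      also have "\<dots> \<le> norm x * norm (a \<cdot> (star a \<cdot> x))"
        using cmod_cinner_le complex_Re_le_cmod order_trans by blast
      also have "\<dots> \<le> norm x * (norm a * norm (star a \<cdot> x))" by (simp add: mult_left_mono capp_norm_le)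
      finally show ?thesis using False by (simp add: power2_eq_square mult.commute)
    qed simp
  qed simp
  show "norm (star a * a) = (norm a)\<^sup>2"
  proof (rule antisym)
    show "norm (star a * a) \<le> (norm a)\<^sup>2"
      using norm_mult_ineq[of "star a" a] le[of a]
      by (metis mult_right_mono norm_ge_zero order_trans power2_eq_square)
    have "norm a \<le> sqrt (norm (star a * a))"
    proof (rule cop_norm_leI)
      fix x
      have "(norm (a \<cdot> x))\<^sup>2 = Re (cinner x ((star a * a) \<cdot> x))"
        by (simp add: norm_sq_cinner capp_mult cinner_star_right)
      also have "\<dots> \<le> norm x * norm ((star a * a) \<cdot> x)"
        using cmod_cinner_le complex_Re_le_cmod order_trans by blast
      also have "\<dots> \<le> norm x * (norm (star a * a) * norm x)" by (simp add: mult_left_mono capp_norm_le)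
      also have "\<dots> = (sqrt (norm (star a * a)) * norm x)\<^sup>2" by (simp add: power_mult_distrib power2_eq_square)
      finally show "norm (a \<cdot> x) \<le> sqrt (norm (star a * a)) * norm x"
        by (rule power2_le_imp_le) simp
    qed simp
    then show "(norm a)\<^sup>2 \<le> norm (star a * a)"
      by (metis norm_ge_zero real_sqrt_ge_zero real_sqrt_pow2 power_mono)
  qed
qed

end

lemma star_eq_iff: "star T = S \<longleftrightarrow> (\<forall>x y. cinner (S \<cdot> x) y = cinner x (T \<cdot> y))"
proof
  assume "\<forall>x y. cinner (S \<cdot> x) y = cinner x (T \<cdot> y)"
  then have *: "cinner y (S \<cdot> x) = cinner (T \<cdot> y) x" for x y by (metis cinner_commute)
  show "star T = S" by (intro cop_eqI cinner_eqI) (simp add: * cinner_star_right)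
qed (auto simp: cinner_star_left)

section \<open>Orthogonal projections as operators\<close>

definition proj :: "'a::chilbert_space set \<Rightarrow> 'a cop"
  where "proj V = (SOME P. \<forall>x. P \<cdot> x \<in> V \<and> (\<forall>q\<in>V. cinner q (x - P \<cdot> x) = 0))"

lemma proj_exists:
  fixes V :: "'a::chilbert_space set"
  assumes "csubspace V" "closed V"
  shows "\<exists>P. \<forall>x. P \<cdot> x \<in> V \<and> (\<forall>q\<in>V. cinner q (x - P \<cdot> x) = 0)"
proof -
  obtain p where p: "\<And>x. p x \<in> V" "\<And>x q. q \<in> V \<Longrightarrow> cinner q (x - p x) = 0"
    using projection_exists[OF assms] by metis
  note V = assms(1)[unfolded csubspace_iff]
  have "norm (p x) \<le> norm x" for x
  proof -
    have "(norm (p x + (x - p x)))\<^sup>2 = (norm (p x))\<^sup>2 + (norm (x - p x))\<^sup>2"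
      by (rule pythagoras) (simp add: p)
    then have "(norm (p x))\<^sup>2 \<le> (norm x)\<^sup>2" by simp
    then show ?thesis by (rule power2_le_imp_le) simp
  qed
  then have "\<exists>P. \<forall>x. P \<cdot> x = p x"
  proof (intro cop_exists[of p 1])
    show "p (x + y) = p x + p y" for x y
      by (rule projection_unique[OF assms(1), of _ _ "x + y"])
        (use V p in \<open>auto simp: add_diff_add cinner_add_right\<close>)
    show "p (c *\<^sub>C x) = c *\<^sub>C p x" for c x
      by (rule projection_unique[OF assms(1), of _ _ "c *\<^sub>C x"])
        (use V p in \<open>auto simp: cinner_scaleC_right simp flip: scaleC_diff_right\<close>)
  qed auto
  then show ?thesis using p by metis
qed

context
  fixes V :: "'a::chilbert_space set"
  assumes V: "csubspace V" "closed V"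
begin

lemma proj_in: "proj V \<cdot> x \<in> V"
  unfolding proj_def using someI_ex[OF proj_exists[OF V]] by blast

lemma proj_orth: "q \<in> V \<Longrightarrow> cinner q (x - proj V \<cdot> x) = 0"
  unfolding proj_def using someI_ex[OF proj_exists[OF V]] by blast

lemma proj_eqI: "p \<in> V \<Longrightarrow> (\<And>q. q \<in> V \<Longrightarrow> cinner q (x - p) = 0) \<Longrightarrow> proj V \<cdot> x = p"
  using projection_unique[OF V(1), of "proj V \<cdot> x" p x] proj_in proj_orth by blast

lemma proj_id: "x \<in> V \<Longrightarrow> proj V \<cdot> x = x"
  by (rule proj_eqI) auto

lemma proj_zero: "(\<And>q. q \<in> V \<Longrightarrow> cinner q x = 0) \<Longrightarrow> proj V \<cdot> x = 0"
  by (rule proj_eqI) (use V in \<open>auto simp: csubspace_iff\<close>)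

lemma proj_idem: "proj V * proj V = proj V"
  by (rule cop_eqI) (simp add: capp_mult proj_id proj_in)

lemma proj_orth': "q \<in> V \<Longrightarrow> cinner (x - proj V \<cdot> x) q = 0"
  using proj_orth[of q x] cinner_commute[of "x - proj V \<cdot> x" q] by simp

lemma star_proj: "star (proj V) = proj V"
  unfolding star_eq_iff
  using proj_orth'[OF proj_in] proj_orth[OF proj_in] by (simp add: cinner_simps)

text \<open>Invariance of \<open>V\<close> under the adjoint is invariance of the orthogonal
  complement under \<open>T\<close>, so both parts of the decomposition of \<open>x\<close> are
  respected.\<close>

lemma proj_commute:
  assumes "\<And>x. x \<in> V \<Longrightarrow> T \<cdot> x \<in> V" "\<And>x. x \<in> V \<Longrightarrow> star T \<cdot> x \<in> V"
  shows "proj V * T = T * proj V"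
proof (rule cop_eqI)
  fix x
  have "proj V \<cdot> (T \<cdot> x) = T \<cdot> (proj V \<cdot> x)"
  proof (rule proj_eqI)
    show "T \<cdot> (proj V \<cdot> x) \<in> V" using assms proj_in by blast
    show "cinner q (T \<cdot> x - T \<cdot> (proj V \<cdot> x)) = 0" if "q \<in> V" for q
      using proj_orth[OF assms(2)[OF that], of x] by (simp add: cinner_star_left capp_diff_right)
  qed
  then show "(proj V * T) \<cdot> x = (T * proj V) \<cdot> x" by (simp add: capp_mult)
qed

end

section \<open>Square-summable sequences\<close>

lemma summable_if_partial_sums_le:
  fixes f :: "nat \<Rightarrow> real"
  assumes "\<And>n. 0 \<le> f n" "\<And>N. (\<Sum>n<N. f n) \<le> C"
  shows "summable f" "suminf f \<le> C"
proof -
  show "summable f"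
    using assms(1) assms(2)[of "Suc _"] by (intro bounded_imp_summable[of f C]) (auto simp: lessThan_Suc_atMost)
  then show "suminf f \<le> C" using assms(2) by (intro suminf_le_const)
qed

lemma sq_sum_add_le:
  fixes f g :: "nat \<Rightarrow> 'a::real_normed_vector"
  assumes "summable (\<lambda>n. (norm (f n))\<^sup>2)" "summable (\<lambda>n. (norm (g n))\<^sup>2)"
  shows "summable (\<lambda>n. (norm (f n + g n))\<^sup>2)"
    and "sqrt (\<Sum>n. (norm (f n + g n))\<^sup>2) \<le> sqrt (\<Sum>n. (norm (f n))\<^sup>2) + sqrt (\<Sum>n. (norm (g n))\<^sup>2)"
      (is "_ \<le> ?S")
proof -
  have "(\<Sum>n<N. (norm (f n + g n))\<^sup>2) \<le> ?S\<^sup>2" for N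
  proof -
    have "sqrt (\<Sum>n<N. (norm (f n + g n))\<^sup>2) \<le> L2_set (\<lambda>n. norm (f n) + norm (g n)) {..<N}"
      unfolding L2_set_def by (intro real_sqrt_le_mono sum_mono power_mono norm_triangle_ineq) auto
    also have "\<dots> \<le> L2_set (\<lambda>n. norm (f n)) {..<N} + L2_set (\<lambda>n. norm (g n)) {..<N}"
      by (rule L2_set_triangle_ineq)
    also have "\<dots> \<le> ?S"
      unfolding L2_set_def using assms by (intro add_mono real_sqrt_le_mono sum_le_suminf) auto
    finally show ?thesis
      using real_sqrt_le_iff sqrt_le_D by blast
  qed
  note * = summable_if_partial_sums_le[of "\<lambda>n. (norm (f n + g n))\<^sup>2", OF _ this, simplified]
  show "summable (\<lambda>n. (norm (f n + g n))\<^sup>2)" by (rule *)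
  have "0 \<le> ?S" using assms by (intro add_nonneg_nonneg real_sqrt_ge_zero suminf_nonneg) auto
  then show "sqrt (\<Sum>n. (norm (f n + g n))\<^sup>2) \<le> ?S" using *(2) by (intro real_le_lsqrt) auto
qed

text \<open>A single space containing all finite tuples of vectors: a statement about
  \<open>n\<close> vectors becomes one about a single vector, whose coordinates from
  \<open>n\<close> on vanish.\<close>

typedef (overloaded) 'a l2 = "{f :: nat \<Rightarrow> 'a::chilbert_space. summable (\<lambda>n. (norm (f n))\<^sup>2)}"
  morphisms l2_nth Abs_l2
  by (rule exI[of _ "\<lambda>_. 0"]) simp

setup_lifting type_definition_l2

lemma l2_eqI: "(\<And>n. l2_nth f n = l2_nth g n) \<Longrightarrow> f = g"
  by transfer auto

lemma summable_l2 [simp]: "summable (\<lambda>n. (norm (l2_nth f n))\<^sup>2)"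
  using l2_nth by blast

lemma summable_cinner_l2:
  fixes f g :: "nat \<Rightarrow> 'a::chilbert_space"
  assumes "summable (\<lambda>n. (norm (f n))\<^sup>2)" "summable (\<lambda>n. (norm (g n))\<^sup>2)"
  shows "summable (\<lambda>n. cinner (f n) (g n))"
proof (rule summable_comparison_test[OF exI])
  show "summable (\<lambda>n. (norm (f n))\<^sup>2 + (norm (g n))\<^sup>2)" by (intro summable_add assms)
  have "cmod (cinner (f n) (g n)) \<le> (norm (f n))\<^sup>2 + (norm (g n))\<^sup>2" for n
    using cmod_cinner_le[of "f n" "g n"] sum_squares_bound[of "norm (f n)" "norm (g n)"]
      mult_nonneg_nonneg[of "norm (f n)" "norm (g n)"]
    by (simp del: mult_nonneg_nonneg)
  then show "\<forall>n\<ge>0. norm (cinner (f n) (g n)) \<le> (norm (f n))\<^sup>2 + (norm (g n))\<^sup>2" by simp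
qed

instantiation l2 :: (chilbert_space) complex_normed_vector
begin

lift_definition zero_l2 :: "'a l2" is "\<lambda>_. 0" by simp
lift_definition plus_l2 :: "'a l2 \<Rightarrow> 'a l2 \<Rightarrow> 'a l2" is "\<lambda>f g n. f n + g n"
  by (rule sq_sum_add_le)
lift_definition uminus_l2 :: "'a l2 \<Rightarrow> 'a l2" is "\<lambda>f n. - f n" by simp
definition minus_l2 :: "'a l2 \<Rightarrow> 'a l2 \<Rightarrow> 'a l2" where "minus_l2 f g = f + - g"
lift_definition scaleR_l2 :: "real \<Rightarrow> 'a l2 \<Rightarrow> 'a l2" is "\<lambda>r f n. r *\<^sub>R f n"
  by (simp add: power_mult_distrib summable_mult)
lift_definition scaleC_l2 :: "complex \<Rightarrow> 'a l2 \<Rightarrow> 'a l2" is "\<lambda>c f n. c *\<^sub>C f n"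
  by (simp add: norm_scaleC power_mult_distrib summable_mult)
definition norm_l2 :: "'a l2 \<Rightarrow> real" where "norm_l2 f = sqrt (\<Sum>n. (norm (l2_nth f n))\<^sup>2)"
definition dist_l2 :: "'a l2 \<Rightarrow> 'a l2 \<Rightarrow> real" where "dist_l2 f g = norm (f - g)"
definition sgn_l2 :: "'a l2 \<Rightarrow> 'a l2" where "sgn_l2 f = scaleR (inverse (norm f)) f"
definition uniformity_l2 :: "('a l2 \<times> 'a l2) filter"
  where "uniformity_l2 = (INF e\<in>{0<..}. principal {(S, T). dist S T < e})"
definition open_l2 :: "'a l2 set \<Rightarrow> bool"
  where "open_l2 U = (\<forall>T\<in>U. \<forall>\<^sub>F (T', S) in uniformity. T' = T \<longrightarrow> S \<in> U)"

instance
proof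
  fix a b c :: "'a l2" and x y :: complex and r s :: real
  show "a + b + c = a + (b + c)" by transfer (simp add: add.assoc)
  show "a + b = b + a" by transfer (simp add: add.commute)
  show "0 + a = a" by transfer simp
  show "- a + a = 0" by transfer simp
  show "a - b = a + - b" by (rule minus_l2_def)
  show "r *\<^sub>R (a + b) = r *\<^sub>R a + r *\<^sub>R b" by transfer (simp add: scaleR_add_right)
  show "(r + s) *\<^sub>R a = r *\<^sub>R a + s *\<^sub>R a" by transfer (simp add: scaleR_add_left)
  show "r *\<^sub>R s *\<^sub>R a = (r * s) *\<^sub>R a" by transfer simp
  show "1 *\<^sub>R a = a" by transfer simp
  show "dist a b = norm (a - b)" by (rule dist_l2_def)
  show "sgn a = scaleR (inverse (norm a)) a" by (rule sgn_l2_def)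
  show "uniformity = (INF e\<in>{0<..}. principal {(S::'a l2, T). dist S T < e})" by (rule uniformity_l2_def)
  show "open U = (\<forall>T\<in>U. \<forall>\<^sub>F (T', S) in uniformity. T' = T \<longrightarrow> S \<in> U)" for U :: "'a l2 set" by (rule open_l2_def)
  have "(\<Sum>n. (norm (l2_nth a n))\<^sup>2) = 0 \<longleftrightarrow> (\<forall>n. (norm (l2_nth a n))\<^sup>2 = 0)"
    by (rule suminf_eq_zero_iff) auto
  then show "(norm a = 0) = (a = 0)"
    by (auto simp: norm_l2_def zero_l2.rep_eq intro: l2_eqI)
  show "norm (a + b) \<le> norm a + norm b"
    unfolding norm_l2_def plus_l2.rep_eq by (rule sq_sum_add_le) auto
  show "norm (r *\<^sub>R a) = \<bar>r\<bar> * norm a"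
    by (simp add: norm_l2_def scaleR_l2.rep_eq power_mult_distrib suminf_mult real_sqrt_mult)
  show "x *\<^sub>C (a + b) = x *\<^sub>C a + x *\<^sub>C b" by transfer (simp add: scaleC_add_right)
  show "(x + y) *\<^sub>C a = x *\<^sub>C a + y *\<^sub>C a" by transfer (simp add: scaleC_add_left)
  show "x *\<^sub>C y *\<^sub>C a = (x * y) *\<^sub>C a" by transfer (simp add: scaleC_scaleC)
  show "1 *\<^sub>C a = a" by transfer simp
  show "r *\<^sub>R a = complex_of_real r *\<^sub>C a" by transfer (simp add: scaleR_scaleC')
  show "norm (x *\<^sub>C a) = cmod x * norm a"
    by (simp add: norm_l2_def scaleC_l2.rep_eq norm_scaleC power_mult_distrib suminf_mult real_sqrt_mult)
qed

end

lemma l2_nth_diff [simp]: "l2_nth (f - g) n = l2_nth f n - l2_nth g n"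
  unfolding minus_l2_def plus_l2.rep_eq uminus_l2.rep_eq by simp

lemma norm_l2_nth_le: "norm (l2_nth f n) \<le> norm f"
proof -
  have "(norm (l2_nth f n))\<^sup>2 \<le> (\<Sum>n. (norm (l2_nth f n))\<^sup>2)"
    using sum_le_suminf[of "\<lambda>n. (norm (l2_nth f n))\<^sup>2" "{n}"] by simp
  then show ?thesis unfolding norm_l2_def by (rule real_le_rsqrt)
qed

instantiation l2 :: (chilbert_space) chilbert_space
begin

definition cinner_l2 :: "'a l2 \<Rightarrow> 'a l2 \<Rightarrow> complex"
  where "cinner_l2 f g = (\<Sum>n. cinner (l2_nth f n) (l2_nth g n))"

instance
proof
  fix x y z :: "'a l2" and c :: complex
  note sm = summable_cinner_l2[OF summable_l2 summable_l2]
  show "cinner x y = cnj (cinner y x)"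
  proof -
    have "(\<lambda>n. cnj (cinner (l2_nth y n) (l2_nth x n))) sums cnj (cinner y x)"
      unfolding cinner_l2_def sums_cnj by (rule summable_sums[OF sm])
    then show ?thesis
      unfolding cinner_l2_def[of x y] by (subst cinner_commute) (rule sums_unique[symmetric])
  qed
  show "cinner x (y + z) = cinner x y + cinner x z"
    by (simp add: cinner_l2_def plus_l2.rep_eq cinner_add_right suminf_add sm)
  show "cinner x (c *\<^sub>C y) = c * cinner x y"
    by (simp add: cinner_l2_def scaleC_l2.rep_eq cinner_scaleC_right suminf_mult sm)
  have "(\<Sum>n. cinner (l2_nth x n) (l2_nth x n)) = of_real (\<Sum>n. (norm (l2_nth x n))\<^sup>2)"
    by (simp add: cinner_self suminf_of_real del: of_real_power)
  then show "cinner x x = complex_of_real ((norm x)\<^sup>2)"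
    by (simp add: cinner_l2_def norm_l2_def suminf_nonneg)
next
  fix u :: "nat \<Rightarrow> 'a l2" assume u: "Cauchy u"
  have "Cauchy (\<lambda>m. l2_nth (u m) n)" for n
  proof (rule metric_CauchyI)
    fix e :: real assume "0 < e"
    then obtain M where "\<forall>m\<ge>M. \<forall>k\<ge>M. dist (u m) (u k) < e" using u metric_CauchyD by blast
    moreover have "dist (l2_nth (u m) n) (l2_nth (u k) n) \<le> dist (u m) (u k)" for m k
      using norm_l2_nth_le[of "u m - u k" n] unfolding dist_norm l2_nth_diff .
    ultimately show "\<exists>M. \<forall>m\<ge>M. \<forall>k\<ge>M. dist (l2_nth (u m) n) (l2_nth (u k) n) < e"
      using le_less_trans by blast
  qed
  then have "\<exists>z. (\<lambda>m. l2_nth (u m) n) \<longlonglongrightarrow> z" for n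
    using Cauchy_convergent convergentD by blast
  then obtain g where g: "\<And>n. (\<lambda>m. l2_nth (u m) n) \<longlonglongrightarrow> g n" by metis
  \<comment> \<open>The Cauchy estimate is applied to finite partial sums before \<open>k\<close>
    tends to infinity, so that only finitely many coordinate limits are taken at a time.\<close>
  have *: "summable (\<lambda>n. (norm (l2_nth (u m) n - g n))\<^sup>2) \<and> (\<Sum>n. (norm (l2_nth (u m) n - g n))\<^sup>2) \<le> e\<^sup>2"
    if M: "\<forall>m\<ge>M. \<forall>k\<ge>M. dist (u m) (u k) < e" "m \<ge> M" for M e m
  proof -
    have "(\<Sum>n<N. (norm (l2_nth (u m) n - g n))\<^sup>2) \<le> e\<^sup>2" for N
    proof (rule LIMSEQ_le_const2)
      show "(\<lambda>k. \<Sum>n<N. (norm (l2_nth (u m) n - l2_nth (u k) n))\<^sup>2) \<longlonglongrightarrow> (\<Sum>n<N. (norm (l2_nth (u m) n - g n))\<^sup>2)"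
        by (intro tendsto_intros g)
      have "(\<Sum>n<N. (norm (l2_nth (u m) n - l2_nth (u k) n))\<^sup>2) \<le> e\<^sup>2" if "k \<ge> M" for k
      proof -
        have "(\<Sum>n<N. (norm (l2_nth (u m - u k) n))\<^sup>2) \<le> (\<Sum>n. (norm (l2_nth (u m - u k) n))\<^sup>2)"
          by (rule sum_le_suminf) (simp_all del: l2_nth_diff)
        also have "\<dots> = (norm (u m - u k))\<^sup>2"
          unfolding norm_l2_def by (subst real_sqrt_pow2) (auto intro: suminf_nonneg simp del: l2_nth_diff)
        also have "\<dots> \<le> e\<^sup>2"
          using M that by (intro power_mono) (auto simp: dist_norm less_imp_le)
        finally show ?thesis by simp
      qed
      then show "\<exists>N'. \<forall>k\<ge>N'. (\<Sum>n<N. (norm (l2_nth (u m) n - l2_nth (u k) n))\<^sup>2) \<le> e\<^sup>2" by blast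
    qed
    from summable_if_partial_sums_le[OF _ this] show ?thesis by simp
  qed
  obtain M where "\<forall>m\<ge>M. \<forall>k\<ge>M. dist (u m) (u k) < 1" using u metric_CauchyD zero_less_one by blast
  from *[OF this order.refl] have "summable (\<lambda>n. (norm (g n - l2_nth (u M) n))\<^sup>2)"
    by (simp add: norm_minus_commute)
  from sq_sum_add_le(1)[OF this summable_l2[of "u M"]] have gs: "summable (\<lambda>n. (norm (g n))\<^sup>2)" by simp
  have "u \<longlonglongrightarrow> Abs_l2 g"
  proof (rule LIMSEQ_I)
    fix e :: real assume e: "0 < e"
    then obtain M where M: "\<forall>m\<ge>M. \<forall>k\<ge>M. dist (u m) (u k) < e/2" using u metric_CauchyD[of u "e/2"] by auto
    have "norm (u m - Abs_l2 g) < e" if "m \<ge> M" for m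
    proof -
      have "norm (u m - Abs_l2 g) \<le> sqrt ((e/2)\<^sup>2)"
        unfolding norm_l2_def using *[OF M that] gs
        by (intro real_sqrt_le_mono) (simp add: Abs_l2_inverse)
      then show ?thesis using e by simp
    qed
    then show "\<exists>M. \<forall>m\<ge>M. norm (u m - Abs_l2 g) < e" by blast
  qed
  then show "convergent u" by (auto simp: convergent_def)
qed

end

lift_definition l2_single :: "nat \<Rightarrow> 'a::chilbert_space \<Rightarrow> 'a l2" is "\<lambda>i x n. if n = i then x else 0"
proof -
  fix i and x :: 'a
  show "summable (\<lambda>n. (norm (if n = i then x else 0))\<^sup>2)"
    by (rule summable_finite[of "{i}"]) auto
qed

lemma l2_single_simps:
  "l2_single i (x + y) = l2_single i x + l2_single i y"
  "l2_single i (c *\<^sub>C x) = c *\<^sub>C l2_single i x"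
  by (transfer, auto)+

lemma norm_l2_single [simp]: "norm (l2_single i x) = norm x"
proof -
  have "(\<Sum>n. (norm (l2_nth (l2_single i x) n))\<^sup>2) = (\<Sum>n\<in>{i}. (norm (l2_nth (l2_single i x) n))\<^sup>2)"
    by (rule suminf_finite) (auto simp: l2_single.rep_eq)
  then show ?thesis by (simp add: norm_l2_def l2_single.rep_eq)
qed

lemma cinner_l2_single: "cinner (l2_single i x) f = cinner x (l2_nth f i)"
proof -
  have "cinner (l2_single i x) f = (\<Sum>n\<in>{i}. cinner (l2_nth (l2_single i x) n) (l2_nth f n))"
    unfolding cinner_l2_def by (rule suminf_finite) (auto simp: l2_single.rep_eq)
  then show ?thesis by (simp add: l2_single.rep_eq)
qed

section \<open>The weak* topology\<close>

lemma bounded_functional_le: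
  fixes f :: "'a::complex_normed_vector \<Rightarrow> complex"
  assumes "bounded_functional f"
  shows "cmod (f x) \<le> functional_norm f * norm x"
proof (cases "x = 0")
  case True
  from assms have "f (0 *\<^sub>C 0) = 0 * f 0" unfolding bounded_functional_def by blast
  with True show ?thesis by simp
next
  case False
  from assms obtain C where C: "\<And>x. cmod (f x) \<le> C * norm x" by (auto simp: bounded_functional_def)
  have "cmod (f y) / norm y \<le> max C 0" for y
    using C[of y] by (cases "y = 0") (auto simp: divide_le_eq le_max_iff_disj)
  then have "bdd_above (range (\<lambda>x. cmod (f x) / norm x))" by (intro bdd_aboveI) auto
  then have "cmod (f x) / norm x \<le> functional_norm f"
    unfolding functional_norm_def by (rule cSUP_upper[OF UNIV_I])
  with False show ?thesis by (simp add: field_simps)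
qed

lemma functional_norm_le:
  fixes f :: "'a::complex_normed_vector \<Rightarrow> complex"
  assumes "0 \<le> C" "\<And>x. cmod (f x) \<le> C * norm x"
  shows "functional_norm f \<le> C"
proof -
  have "cmod (f x) / norm x \<le> C" for x
    using assms(2)[of x] assms(1) by (cases "x = 0") (auto simp: field_simps)
  then show ?thesis unfolding functional_norm_def by (intro cSUP_least) auto
qed

lemma bounded_functionalI:
  "(\<And>x y. f (x + y) = f x + f y) \<Longrightarrow> (\<And>c x. f (c *\<^sub>C x) = c * f x) \<Longrightarrow> (\<And>x. cmod (f x) \<le> C * norm x)
    \<Longrightarrow> bounded_functional (f :: 'a::complex_normed_vector \<Rightarrow> complex)"
  by (auto simp: bounded_functional_def)

lemma functional_norm_nonneg:
  assumes "bounded_functional (f :: 'a::complex_normed_vector \<Rightarrow> complex)"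
  shows "0 \<le> functional_norm f"
proof -
  from assms obtain C where C: "\<And>x. cmod (f x) \<le> C * norm x" by (auto simp: bounded_functional_def)
  have "cmod (f y) / norm y \<le> max C 0" for y
    using C[of y] by (cases "y = 0") (auto simp: divide_le_eq le_max_iff_disj)
  then have "bdd_above (range (\<lambda>x. cmod (f x) / norm x))" by (intro bdd_aboveI) auto
  then have "cmod (f 0) / norm (0::'a) \<le> functional_norm f"
    unfolding functional_norm_def by (rule cSUP_upper[OF UNIV_I])
  then show ?thesis by simp
qed

context
  fixes f :: "'m::wstar_algebra \<Rightarrow> complex"
  assumes f: "f \<in> predual"
begin

lemma predual_map_add: "f (a + b) = f a + f b"
  using predual_bounded[OF f] by (simp add: bounded_functional_def)

lemma predual_map_scaleC: "f (c *\<^sub>C a) = c * f a"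
  using predual_bounded[OF f] by (simp add: bounded_functional_def)

lemma predual_map_zero: "f 0 = 0"
  using predual_map_scaleC[of 0 0] by simp

lemma predual_map_minus: "f (- a) = - f a"
  using predual_map_scaleC[of "-1" a] by simp

lemma predual_map_diff: "f (a - b) = f a - f b"
  using predual_map_add[of a "- b"] by (simp add: predual_map_minus)

lemma predual_map_sum: "f (\<Sum>i\<in>A. g i) = (\<Sum>i\<in>A. f (g i))"
  by (induction A rule: infinite_finite_induct) (auto simp: predual_map_zero predual_map_add)

lemma predual_map_le: "cmod (f a) \<le> functional_norm f * norm a"
  by (rule bounded_functional_le[OF predual_bounded[OF f]])

lemma predual_norm_nonneg: "0 \<le> functional_norm f"
  by (rule functional_norm_nonneg[OF predual_bounded[OF f]])

end

lemma norm_le_if_predual: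
  fixes a :: "'m::wstar_algebra"
  assumes "\<And>f. f \<in> predual \<Longrightarrow> functional_norm f \<le> 1 \<Longrightarrow> cmod (f a) \<le> C"
  shows "norm a \<le> C"
proof -
  have "functional_norm (\<lambda>_::'m. 0) \<le> 1" by (rule functional_norm_le) auto
  then have "{f \<in> predual. functional_norm f \<le> 1} \<noteq> ({} :: ('m \<Rightarrow> complex) set)"
    using predual_zero by blast
  then show ?thesis unfolding predual_isometric[of a] by (rule cSUP_least) (use assms in auto)
qed

lemma predual_separates:
  fixes a b :: "'m::wstar_algebra"
  assumes "\<And>f. f \<in> predual \<Longrightarrow> f a = f b"
  shows "a = b"
proof -
  have "norm (a - b) \<le> 0"
    by (rule norm_le_if_predual) (simp add: assms predual_map_diff)
  then show ?thesis by simp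
qed

lemma predual_if_approximable:
  fixes g :: "'m::wstar_algebra \<Rightarrow> complex"
  assumes "bounded_functional g" "\<And>e. 0 < e \<Longrightarrow> \<exists>h\<in>predual. \<forall>x. cmod (g x - h x) \<le> e * norm x"
  shows "g \<in> predual"
proof (rule predual_closed[OF assms(1)])
  fix e :: real assume "0 < e"
  then obtain h where h: "h \<in> predual" "\<And>x. cmod (g x - h x) \<le> (e/2) * norm x"
    using assms(2)[of "e/2"] by auto
  then have "functional_norm (\<lambda>x. g x - h x) \<le> e / 2"
    using \<open>0 < e\<close> by (intro functional_norm_le) auto
  with h(1) \<open>0 < e\<close> show "\<exists>h\<in>predual. functional_norm (\<lambda>x. g x - h x) < e" by force
qed

text \<open>A functional that vanishes on the common kernel of finitely many others is a linear
  combination of them. The induction subtracts a multiple of \<open>f\<close> chosen so that the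
  difference vanishes at a vector \<open>u\<close> on which all of \<open>F\<close> vanishes but
  \<open>f\<close> does not.\<close>

lemma in_span_if_kernel:
  assumes "finite F" "F \<subseteq> (predual :: ('m::wstar_algebra \<Rightarrow> complex) set)"
    "\<And>a b. g (a + b) = g a + g b" "\<And>c a. g (c *\<^sub>C a) = c * g a"
    "\<And>a. (\<And>f. f \<in> F \<Longrightarrow> f a = 0) \<Longrightarrow> g a = 0"
  shows "g \<in> predual"
  using assms
proof (induction F arbitrary: g)
  case empty
  then have "g = (\<lambda>_. 0)" by auto
  then show ?case by (simp add: predual_zero)
next
  case (insert f F)
  have f: "f \<in> predual" using insert by simp
  have gdiff: "g (a - b) = g a - g b" for a b
    using insert.prems(2)[of "a - b" b] by simp
  show ?case
  proof (cases "\<forall>a. (\<forall>f\<in>F. f a = 0) \<longrightarrow> f a = 0")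
    case True
    show ?thesis
    proof (rule insert.IH)
      show "g a = 0" if "\<And>f'. f' \<in> F \<Longrightarrow> f' a = 0" for a
        by (rule insert.prems(4)) (use True that in blast)
    qed (use insert.prems in auto)
  next
    case False
    then obtain u where u: "\<And>f. f \<in> F \<Longrightarrow> f u = 0" "f u \<noteq> 0" by auto
    define h where "h a = g a + (- (g u / f u)) * f a" for a
    have "h \<in> predual"
    proof (rule insert.IH)
      fix a assume a: "\<And>f'. f' \<in> F \<Longrightarrow> f' a = 0"
      define v where "v = a - (f a / f u) *\<^sub>C u"
      have "f' v = 0" if "f' \<in> insert f F" for f'
      proof -
        have "f' \<in> predual" using that insert.prems(1) by auto
        then show ?thesis using that u(2) u(1)[of f'] a[of f']
          by (cases "f' = f") (auto simp: v_def predual_map_diff predual_map_scaleC)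
      qed
      then have "g v = 0" using insert.prems(4) by blast
      then show "h a = 0" by (simp add: v_def h_def gdiff insert.prems(3))
    qed (use insert.prems f in \<open>auto simp: h_def predual_map_add predual_map_scaleC algebra_simps add_divide_distrib\<close>)
    moreover have "(\<lambda>a. (g u / f u) * f a) \<in> predual" by (rule predual_scale[OF f])
    ultimately have "(\<lambda>a. h a + (g u / f u) * f a) \<in> predual" by (rule predual_add)
    then show ?thesis by (simp add: h_def)
  qed
qed

text \<open>An open set of a generated topology constrains only finitely many functionals near each
  of its points. Asking for equal instead of close values loses nothing for the kernel argument that
  follows.\<close>

lemma openin_weak_topology_finite:
  assumes "openin (weak_topology C \<Omega>) U" "x \<in> U"
  shows "\<exists>F. finite F \<and> F \<subseteq> \<Omega> \<and> (\<forall>y\<in>C. (\<forall>\<omega>\<in>F. \<omega> y = \<omega> x) \<longrightarrow> y \<in> U)"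
proof -
  have "generate_topology_on {{x \<in> C. \<omega> x \<in> U} | \<omega> U. \<omega> \<in> \<Omega> \<and> open U} U"
    using assms(1) by (simp add: weak_topology_def openin_topology_generated_by_iff)
  then show ?thesis using assms(2)
  proof (induction)
    case (Int a b)
    then obtain F G where "finite F" "F \<subseteq> \<Omega>" "\<forall>y\<in>C. (\<forall>\<omega>\<in>F. \<omega> y = \<omega> x) \<longrightarrow> y \<in> a"
      "finite G" "G \<subseteq> \<Omega>" "\<forall>y\<in>C. (\<forall>\<omega>\<in>G. \<omega> y = \<omega> x) \<longrightarrow> y \<in> b" by auto
    then show ?case by (intro exI[of _ "F \<union> G"]) auto
  next
    case (UN K)
    then obtain k where "k \<in> K" "x \<in> k" by auto
    from UN(2)[OF this] obtain F where F: "finite F" "F \<subseteq> \<Omega>" "\<forall>y\<in>C. (\<forall>\<omega>\<in>F. \<omega> y = \<omega> x) \<longrightarrow> y \<in> k"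
      by (elim exE conjE)
    have "\<forall>y\<in>C. (\<forall>\<omega>\<in>F. \<omega> y = \<omega> x) \<longrightarrow> y \<in> \<Union>K"
      using F(3) \<open>k \<in> K\<close> by (meson UnionI)
    with F(1,2) show ?case by (intro exI[of _ F] conjI)
  next
    case (Basis s)
    then obtain \<omega> V where "s = {x \<in> C. \<omega> x \<in> V}" "\<omega> \<in> \<Omega>" by auto
    with Basis(2) show ?case by (intro exI[of _ "{\<omega>}"]) auto
  qed simp
qed

lemma openin_weak_topology_basis:
  "\<omega> \<in> \<Omega> \<Longrightarrow> open U \<Longrightarrow> openin (weak_topology C \<Omega>) {x \<in> C. \<omega> x \<in> U}"
  unfolding weak_topology_def by (rule topology_generated_by_Basis) auto

lemma topspace_weak_topology_subset: "topspace (weak_topology C \<Omega>) \<subseteq> C"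
  unfolding weak_topology_def topology_generated_by_topspace by auto

text \<open>Different values could be separated by disjoint open sets, whose preimages form a
  neighbourhood of \<open>x\<close> that misses \<open>S\<close>. This carries identities from a
  dense set to its closure, both for modules and for the Hardy algebra.\<close>

lemma weak_topology_closure_eq:
  assumes x: "x \<in> weak_topology C \<Omega> closure_of S" and \<omega>: "\<omega> \<in> \<Omega>" "\<omega>' \<in> \<Omega>"
    and eq: "\<And>y. y \<in> S \<Longrightarrow> \<omega> y = \<omega>' y"
  shows "\<omega> x = \<omega>' x"
proof (rule ccontr)
  assume "\<omega> x \<noteq> \<omega>' x"
  then obtain U V where UV: "open U" "open V" "\<omega> x \<in> U" "\<omega>' x \<in> V" "U \<inter> V = {}"
    using hausdorff[of "\<omega> x" "\<omega>' x"] by blast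
  from x have "x \<in> topspace (weak_topology C \<Omega>)"
    and T: "\<forall>T. x \<in> T \<and> openin (weak_topology C \<Omega>) T \<longrightarrow> (\<exists>y. y \<in> S \<and> y \<in> T)"
    unfolding in_closure_of by (rule conjunct1, rule conjunct2)
  then have xC: "x \<in> C" by (rule_tac subsetD[OF topspace_weak_topology_subset])
  let ?T = "{x \<in> C. \<omega> x \<in> U} \<inter> {x \<in> C. \<omega>' x \<in> V}"
  have "openin (weak_topology C \<Omega>) ?T"
    using UV \<omega> by (intro openin_Int openin_weak_topology_basis)
  moreover have "x \<in> ?T" using xC UV by simp
  ultimately have "\<exists>y. y \<in> S \<and> y \<in> ?T" by (intro T[rule_format] conjI)
  then obtain y where "y \<in> S" "y \<in> ?T" by (elim exE conjE)
  then show False using eq[of y] UV(5) by auto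
qed

text \<open>On the common kernel of the finitely many functionals that control the neighbourhood,
  all multiples \<open>c * g a\<close> stay in the unit disc, so \<open>g\<close> vanishes there and
  is a linear combination of these functionals.\<close>

lemma predual_if_weakstar_continuous:
  fixes g :: "'m::wstar_algebra \<Rightarrow> complex"
  assumes add: "\<And>a b. g (a + b) = g a + g b" and sc: "\<And>c a. g (c *\<^sub>C a) = c * g a"
    and cont: "openin weakstar (g -` ball 0 1)"
  shows "g \<in> predual"
proof -
  have g0: "g 0 = 0" using sc[of 0 0] by simp
  then obtain F where F: "finite F" "F \<subseteq> predual" "\<And>a. (\<And>f. f \<in> F \<Longrightarrow> f a = f 0) \<Longrightarrow> a \<in> g -` ball 0 1"
    using openin_weak_topology_finite[OF cont[unfolded weakstar_def], of 0] by auto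
  show ?thesis
  proof (rule in_span_if_kernel[OF F(1,2) add sc])
    fix a assume a: "\<And>f. f \<in> F \<Longrightarrow> f a = 0"
    have small: "cmod (c * g a) < 1" for c
    proof -
      have "c *\<^sub>C a \<in> g -` ball 0 1"
        by (rule F(3)) (use a F(2) in \<open>auto simp: predual_map_scaleC predual_map_zero subset_iff\<close>)
      then show ?thesis by (simp add: sc dist_norm)
    qed
    show "g a = 0"
    proof (rule ccontr)
      assume "g a \<noteq> 0" then show False using small[of "1 / g a"] by simp
    qed
  qed
qed

text \<open>Translates normality from topological continuity, as assumed of \<open>\<phi>\<close>
  and \<open>\<pi>\<close>, into membership of matrix coefficients in the predual, the form used
  from here on.\<close>

lemma weak_continuous_in_predual:
  fixes \<Theta> :: "'m::wstar_algebra \<Rightarrow> 'x"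
  assumes cont: "continuous_map weakstar (weak_topology C \<Omega>) \<Theta>" and "\<omega> \<in> \<Omega>" "range \<Theta> \<subseteq> C"
    and "\<And>a b. \<omega> (\<Theta> (a + b)) = \<omega> (\<Theta> a) + \<omega> (\<Theta> b)" "\<And>c a. \<omega> (\<Theta> (c *\<^sub>C a)) = c * \<omega> (\<Theta> a)"
  shows "(\<lambda>a. \<omega> (\<Theta> a)) \<in> predual"
proof (rule predual_if_weakstar_continuous)
  have "openin (weak_topology C \<Omega>) {x \<in> C. \<omega> x \<in> ball 0 1}"
    by (rule openin_weak_topology_basis) (use assms in auto)
  from openin_continuous_map_preimage[OF cont this]
  have "openin weakstar {x \<in> topspace weakstar. \<Theta> x \<in> {x \<in> C. \<omega> x \<in> ball 0 1}}" .
  moreover have "topspace weakstar = (UNIV :: 'm set)"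
  proof -
    have "openin (weakstar :: 'm topology) {x \<in> UNIV. (\<lambda>_. 0 :: complex) x \<in> UNIV}"
      unfolding weakstar_def by (rule openin_weak_topology_basis) (auto simp: predual_zero)
    then show ?thesis using openin_subset by fastforce
  qed
  ultimately show "openin weakstar ((\<lambda>a. \<omega> (\<Theta> a)) -` ball 0 1)"
    using assms(3) by (simp add: vimage_def image_subset_iff)
qed (use assms in auto)

text \<open>Banach--Alaoglu: the functionals on the predual form a compact product of discs, and
  the limit functional is represented by an element.\<close>

lemma weakstar_cluster_point:
  fixes a :: "'i \<Rightarrow> 'm::wstar_algebra"
  assumes F: "F \<noteq> bot" and bd: "\<And>x. norm (a x) \<le> C"
  shows "\<exists>G m. G \<le> F \<and> G \<noteq> bot \<and> norm m \<le> C \<and> (\<forall>f\<in>predual. ((\<lambda>x. f (a x)) \<longlongrightarrow> f m) G)"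
proof -
  have C0: "0 \<le> C" using bd norm_ge_zero order_trans by blast
  \<comment> \<open>Extended by 0 off the predual, so that the values form a point of a product
    indexed by all functionals and Tychonoff's theorem applies.\<close>
  define \<Phi> :: "'i \<Rightarrow> ('m \<Rightarrow> complex) \<Rightarrow> complex" where "\<Phi> x f = (if f \<in> predual then f (a x) else 0)" for x f
  define K where "K = (\<Pi>\<^sub>E f\<in>UNIV. cball (0::complex) (C * \<bar>functional_norm (f::'m \<Rightarrow> complex)\<bar>))"
  have "compactin (product_topology (\<lambda>f::'m \<Rightarrow> complex. euclidean) UNIV) K"
    unfolding K_def by (simp add: compactin_PiE)
  then have cK: "compact K" by (simp add: euclidean_product_topology)
  have \<Phi>K: "\<Phi> x \<in> K" for x
  proof -
    have "cmod (\<Phi> x f) \<le> C * \<bar>functional_norm f\<bar>" for f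
    proof (cases "f \<in> predual")
      case True
      have "cmod (f (a x)) \<le> functional_norm f * norm (a x)" by (rule predual_map_le[OF True])
      also have "\<dots> \<le> functional_norm f * C" by (rule mult_left_mono[OF bd predual_norm_nonneg[OF True]])
      finally show ?thesis using True predual_norm_nonneg[OF True] by (simp add: \<Phi>_def mult.commute)
    qed (simp add: \<Phi>_def C0)
    then show ?thesis by (auto simp: K_def)
  qed
  have "\<forall>\<^sub>F y in filtermap \<Phi> F. y \<in> K" "filtermap \<Phi> F \<noteq> bot"
    using \<Phi>K F by (auto simp: eventually_filtermap filtermap_bot_iff)
  then obtain g where g: "inf (nhds g) (filtermap \<Phi> F) \<noteq> bot"
    using cK unfolding compact_filter by blast
  \<comment> \<open>The refinement of \<open>F\<close> along which \<open>\<Phi>\<close> converges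
    to its cluster point \<open>g\<close>.\<close>
  define G where "G = inf F (filtercomap \<Phi> (nhds g))"
  have "G \<noteq> bot"
  proof
    assume "G = bot"
    then obtain P Q where "eventually P F" "eventually Q (filtercomap \<Phi> (nhds g))" "\<And>x. \<not> (P x \<and> Q x)"
      unfolding G_def trivial_limit_def eventually_inf by auto
    then obtain R where R: "eventually R (nhds g)" "\<And>x. R (\<Phi> x) \<Longrightarrow> Q x"
      by (auto simp: eventually_filtercomap)
    have "eventually (\<lambda>y. \<exists>x. P x \<and> y = \<Phi> x) (filtermap \<Phi> F)"
      using \<open>eventually P F\<close> by (auto simp: eventually_filtermap elim: eventually_mono)
    with R(1) have "eventually (\<lambda>y. False) (inf (nhds g) (filtermap \<Phi> F))"
      unfolding eventually_inf using R(2) \<open>\<And>x. \<not> (P x \<and> Q x)\<close> by blast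
    with g show False by (simp add: trivial_limit_def)
  qed
  have "filterlim \<Phi> (nhds g) G"
    unfolding G_def by (rule filterlim_mono[OF filterlim_filtercomap]) auto
  then have lim\<Phi>: "((\<lambda>x. \<Phi> x f) \<longlongrightarrow> g f) G" for f
    using continuous_on_tendsto_compose[OF continuous_on_product_coordinates[of f], of \<Phi> g G] by simp
  have lim: "((\<lambda>x. f (a x)) \<longlongrightarrow> g f) G" if "f \<in> predual" for f
    using lim\<Phi>[of f] that by (simp add: \<Phi>_def)
  have gle: "cmod (g f) \<le> C * functional_norm f" if "f \<in> predual" for f
  proof (rule tendsto_upperbound[OF tendsto_norm[OF lim[OF that]] _ \<open>G \<noteq> bot\<close>])
    have "cmod (f (a x)) \<le> C * functional_norm f" for x
      using predual_map_le[OF that, of "a x"] mult_left_mono[OF bd predual_norm_nonneg[OF that], of x]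
      by (simp add: mult.commute)
    then show "\<forall>\<^sub>F x in G. norm (f (a x)) \<le> C * functional_norm f" by simp
  qed
  have "\<exists>m. \<forall>f\<in>predual. g f = f m"
  proof (rule predual_onto[of g C])
    fix f h :: "'m \<Rightarrow> complex" assume fh: "f \<in> predual" "h \<in> predual"
    show "g (\<lambda>x. f x + h x) = g f + g h"
      by (rule tendsto_unique[OF \<open>G \<noteq> bot\<close> lim[OF predual_add[OF fh]]])
        (intro tendsto_add lim fh)
  next
    fix c and f :: "'m \<Rightarrow> complex" assume f: "f \<in> predual"
    show "g (\<lambda>x. c * f x) = c * g f"
      by (rule tendsto_unique[OF \<open>G \<noteq> bot\<close> lim[OF predual_scale[OF f]]])
        (intro tendsto_mult tendsto_const lim f)
  qed (rule gle)
  then obtain m where m: "\<And>f. f \<in> predual \<Longrightarrow> g f = f m" by blast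
  have "norm m \<le> C"
  proof (rule norm_le_if_predual)
    fix f :: "'m \<Rightarrow> complex" assume f: "f \<in> predual" "functional_norm f \<le> 1"
    have "cmod (f m) \<le> C * functional_norm f" using gle m f by metis
    also have "\<dots> \<le> C" using f C0 by (simp add: mult_left_le)
    finally show "cmod (f m) \<le> C" .
  qed
  moreover have "G \<le> F" by (simp add: G_def)
  ultimately show ?thesis using \<open>G \<noteq> bot\<close> lim m by metis
qed

section \<open>Von Neumann algebras: double commutant, density and reflexivity\<close>

text \<open>The modulus of \<open>b\<close>. After scaling to norm 1 it is the square root of
  \<open>c * c = 1 - (1 - c * c)\<close>, in the form \<open>1 - y\<close> with
  \<open>norm y \<le> 1\<close>; this bound on \<open>y\<close> is what makes its form
  nonnegative.\<close>

lemma cop_abs_exists: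
  fixes b :: "'k::chilbert_space cop"
  assumes b: "star b = b"
  shows "\<exists>s. star s = s \<and> s * s = b * b \<and> (\<forall>z. z * b = b * z \<longrightarrow> z * s = s * z) \<and> (\<forall>k. 0 \<le> Re (cinner k (s \<cdot> k)))"
proof (cases "b = 0")
  case True then show ?thesis by (intro exI[of _ 0]) auto
next
  case False
  define n where "n = norm b"
  have n: "n > 0" using False by (simp add: n_def)
  define c where "c = (1 / n) *\<^sub>R b"
  have c: "star c = c" "norm c \<le> 1" using b n by (auto simp: c_def star_scaleR n_def)
  have "norm (1 - c * c) \<le> 1"
  proof (rule cop_norm_leI)
    fix k
    have "(norm ((1 - c * c) \<cdot> k))\<^sup>2 = (norm k)\<^sup>2 - 2 * (norm (c \<cdot> k))\<^sup>2 + (norm (c \<cdot> (c \<cdot> k)))\<^sup>2"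
      using cinner_star_left[of c k "c \<cdot> k"]
      by (simp add: capp_diff_left capp_mult norm_diff_sq c norm_sq_cinner[of "c \<cdot> k"])
    moreover have "norm (c \<cdot> (c \<cdot> k)) \<le> norm (c \<cdot> k)"
      using capp_norm_le[of c "c \<cdot> k"] c(2) mult_right_mono[of "norm c" 1 "norm (c \<cdot> k)"] by simp
    then have "(norm (c \<cdot> (c \<cdot> k)))\<^sup>2 \<le> (norm (c \<cdot> k))\<^sup>2" by (simp add: power_mono)
    ultimately have "(norm ((1 - c * c) \<cdot> k))\<^sup>2 \<le> (norm k)\<^sup>2"
      using zero_le_power2[of "norm (c \<cdot> k)"] by linarith
    then show "norm ((1 - c * c) \<cdot> k) \<le> 1 * norm k"
      using power2_le_imp_le[OF _ norm_ge_zero] by simp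
  qed simp
  then obtain y where y: "(1 - y) * (1 - y) = 1 - (1 - c * c)" "norm y \<le> 1" "star y = y"
    "\<And>z. z * (1 - c * c) = (1 - c * c) * z \<Longrightarrow> z * y = y * z"
    using cstar_sqrt[of "1 - c * c"] by (auto simp: star_diff star_mult c)
  define s where "s = n *\<^sub>R (1 - y)"
  have "star s = s" by (simp add: s_def star_scaleR star_diff y)
  moreover have "s * s = b * b"
    using n y(1) by (simp add: s_def c_def)
  moreover have "z * s = s * z" if "z * b = b * z" for z
  proof -
    have zc: "z * c = c * z" using that by (simp add: c_def)
    then have "z * (c * c) = c * c * z" by (metis mult.assoc)
    then have "z * (1 - c * c) = (1 - c * c) * z"
      by (simp add: right_diff_distrib left_diff_distrib)
    from y(4)[OF this] show ?thesis by (simp add: s_def right_diff_distrib left_diff_distrib)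
  qed
  moreover have "0 \<le> Re (cinner k (s \<cdot> k))" for k
  proof -
    have "Re (cinner k (y \<cdot> k)) \<le> norm k * (norm y * norm k)"
      by (intro order_trans[OF complex_Re_le_cmod] order_trans[OF cmod_cinner_le] mult_left_mono capp_norm_le) simp
    also have "\<dots> \<le> norm k * (1 * norm k)" by (intro mult_left_mono mult_right_mono y) auto
    finally have "Re (cinner k (y \<cdot> k)) \<le> (norm k)\<^sup>2" by (simp add: power2_eq_square)
    then show ?thesis
      using n by (simp add: s_def capp_simps cinner_simps norm_sq_cinner)
  qed
  ultimately show ?thesis by blast
qed

text \<open>The inequality between \<open>s * s\<close> and \<open>r s\<close> at one vector. It
  results from nonnegativity of the form of \<open>s\<close> at
  \<open>k - (1/r) *\<^sub>R (s \<cdot> k)\<close>, with the bound \<open>r\<close> required only at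
  the vector \<open>s \<cdot> k\<close>.\<close>

lemma positive_op_bound:
  fixes s :: "'k::chilbert_space cop"
  assumes s: "star s = s" "\<And>k. 0 \<le> Re (cinner k (s \<cdot> k))"
    and r: "0 \<le> r" "norm (s \<cdot> (s \<cdot> k)) \<le> r * norm (s \<cdot> k)"
  shows "(norm (s \<cdot> k))\<^sup>2 \<le> r * Re (cinner k (s \<cdot> k))"
proof (cases "r = 0")
  case True
  then have "s \<cdot> (s \<cdot> k) = 0" using r by simp
  moreover have "(norm (s \<cdot> k))\<^sup>2 = Re (cinner k (s \<cdot> (s \<cdot> k)))"
    using cinner_star_left[of s k "s \<cdot> k"] s by (simp add: norm_sq_cinner)
  ultimately show ?thesis using True by simp
next
  case False
  define t where "t = 1 / r"
  define l where "l = s \<cdot> k"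
  have sk: "Re (cinner k (s \<cdot> l)) = (norm l)\<^sup>2" "Re (cinner l (s \<cdot> k)) = (norm l)\<^sup>2"
    using cinner_star_left[of s k l] s by (simp_all add: norm_sq_cinner l_def)
  have ll: "Re (cinner l (s \<cdot> l)) \<le> r * (norm l)\<^sup>2"
  proof -
    have "Re (cinner l (s \<cdot> l)) \<le> norm l * norm (s \<cdot> l)"
      using cmod_cinner_le complex_Re_le_cmod order_trans by blast
    also have "\<dots> \<le> norm l * (r * norm l)" using r by (intro mult_left_mono) (auto simp: l_def)
    finally show ?thesis by (simp add: power2_eq_square ac_simps)
  qed
  have "0 \<le> Re (cinner (k - t *\<^sub>R l) (s \<cdot> (k - t *\<^sub>R l)))" by (rule s)
  also have "\<dots> = Re (cinner k (s \<cdot> k)) - 2 * t * (norm l)\<^sup>2 + t\<^sup>2 * Re (cinner l (s \<cdot> l))"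
    using sk by (simp add: capp_simps cinner_simps power2_eq_square algebra_simps)
  also have "\<dots> \<le> Re (cinner k (s \<cdot> k)) - 2 * t * (norm l)\<^sup>2 + t\<^sup>2 * (r * (norm l)\<^sup>2)"
    using ll by (intro add_left_mono mult_left_mono) auto
  also have "\<dots> = Re (cinner k (s \<cdot> k)) - t * (norm l)\<^sup>2"
    using False by (simp add: t_def power2_eq_square field_simps)
  finally show ?thesis using False r by (simp add: t_def l_def field_simps)
qed

text \<open>Completing the square: a spectrum contained in the interval from 0 to \<open>r\<close>
  has distance at most \<open>r/2\<close> from its midpoint.\<close>

lemma norm_shift_bound:
  fixes k u :: "'k::chilbert_space"
  assumes "(norm u)\<^sup>2 \<le> r * Re (cinner k u)" "0 \<le> r"
  shows "norm (u - (r/2) *\<^sub>R k) \<le> (r/2) * norm k"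
proof (rule power2_le_imp_le)
  have "(norm (u - (r/2) *\<^sub>R k))\<^sup>2 = (norm u)\<^sup>2 - r * Re (cinner k u) + (r/2)\<^sup>2 * (norm k)\<^sup>2"
    by (simp add: norm_diff_sq cinner_simps Re_cinner_commute[of u] power_mult_distrib power_divide)
  with assms show "(norm (u - (r/2) *\<^sub>R k))\<^sup>2 \<le> ((r/2) * norm k)\<^sup>2"
    by (simp add: power_mult_distrib power_divide)
qed (use assms in simp)

text \<open>The projection onto the kernel of \<open>\<bar>b\<bar> - b\<close> is the spectral projection of \<open>b\<close> for the
  half-line \<open>[0, \<infinity>)\<close>.\<close>

lemma spectral_split:
  fixes b q :: "'k::chilbert_space cop"
  assumes b: "star b = b" and qb: "q * b = b * q" and qq: "q * q = q"
    and r: "0 \<le> r" "\<And>k. norm (b \<cdot> (q \<cdot> k)) \<le> r * norm (q \<cdot> k)"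
  shows "\<exists>P. P * P = P \<and> star P = P \<and> (\<forall>T. T * b = b * T \<longrightarrow> P * T = T * P) \<and>
    (\<forall>k. norm (b \<cdot> ((q * P) \<cdot> k) - (r/2) *\<^sub>R ((q * P) \<cdot> k)) \<le> (r/2) * norm ((q * P) \<cdot> k)) \<and>
    (\<forall>k. norm (b \<cdot> ((q * (1 - P)) \<cdot> k) + (r/2) *\<^sub>R ((q * (1 - P)) \<cdot> k)) \<le> (r/2) * norm ((q * (1 - P)) \<cdot> k))"
proof -
  obtain s where s: "star s = s" "s * s = b * b" "\<And>z. z * b = b * z \<Longrightarrow> z * s = s * z"
    "\<And>k. 0 \<le> Re (cinner k (s \<cdot> k))"
    using cop_abs_exists[OF b] by blast
  define V where "V = {k. (s - b) \<cdot> k = 0}"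
  have V: "csubspace V" "closed V"
    unfolding V_def by (auto simp: csubspace_iff capp_simps intro!: closed_Collect_eq continuous_intros)
  define P where "P = proj V"
  have comm: "P * T = T * P" if T: "T * b = b * T" for T
    unfolding P_def
  proof (rule proj_commute[OF V])
    have *: "T \<cdot> k \<in> V" if "T * b = b * T" "k \<in> V" for T k
    proof -
      have "(s - b) * T = T * (s - b)" using that(1) s(3)[OF that(1)] by (simp add: algebra_simps)
      then have "(s - b) \<cdot> (T \<cdot> k) = T \<cdot> ((s - b) \<cdot> k)" by (simp flip: capp_mult)
      then show ?thesis using that(2) by (simp add: V_def)
    qed
    show "T \<cdot> k \<in> V" if "k \<in> V" for k using * T that by blast
    have "star T * b = b * star T" using T b by (metis star_mult)
    then show "star T \<cdot> k \<in> V" if "k \<in> V" for k using * that by blast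
  qed
  have PP: "P * P = P" "star P = P" unfolding P_def by (rule proj_idem[OF V] star_proj[OF V])+
  have Pq: "P * q = q * P" by (rule comm[OF qb])
  have Pb: "P * b = b * P" by (rule comm) simp
  have sb: "b * s = s * b" by (rule s(3)) simp
  have Ps: "P * s = s * P" by (rule comm) (simp add: sb)
  have sq: "q * s = s * q" by (rule s(3)[OF qb])
  have onV: "s \<cdot> k = b \<cdot> k" if "P \<cdot> k = k" for k
  proof -
    have "k \<in> V" using proj_in[OF V, of k] that by (simp add: P_def)
    then show ?thesis by (simp add: V_def capp_diff_left)
  qed
  \<comment> \<open>Since \<open>s * s = b * b\<close> and the two commute,
    \<open>(s - b) * (s + b) = 0\<close>, so \<open>s + b\<close> maps into the kernel
    \<open>V\<close> of \<open>s - b\<close>. As \<open>P\<close> commutes with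
    \<open>s + b\<close>, the image of a vector killed by \<open>P\<close> is zero.\<close>
  have offV: "s \<cdot> k = - (b \<cdot> k)" if Pk: "P \<cdot> k = 0" for k
  proof -
    have "(s - b) * (s + b) = 0" using s(2) sb by (simp add: algebra_simps)
    then have "(s - b) \<cdot> ((s + b) \<cdot> k) = 0" by (simp flip: capp_mult)
    then have "(s + b) \<cdot> k \<in> V" by (simp add: V_def)
    then have "(s + b) \<cdot> k = P \<cdot> ((s + b) \<cdot> k)" unfolding P_def by (rule proj_id[OF V, symmetric])
    also have "P * (s + b) = (s + b) * P" by (simp add: algebra_simps Ps Pb)
    then have "P \<cdot> ((s + b) \<cdot> k) = (s + b) \<cdot> (P \<cdot> k)" by (simp flip: capp_mult)
    finally have "(s + b) \<cdot> k = 0" by (simp add: Pk)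
    then show ?thesis by (simp add: capp_add_left eq_neg_iff_add_eq_0)
  qed
  \<comment> \<open>On the range of \<open>q\<close>, within either half, the modulus acts as
    \<open>b\<close> or as \<open>- b\<close>, so it satisfies the bound \<open>r\<close> assumed of
    \<open>b\<close>.\<close>
  have bound: "(norm (s \<cdot> k))\<^sup>2 \<le> r * Re (cinner k (s \<cdot> k))"
    if k: "q \<cdot> k = k" "P \<cdot> k = k \<or> P \<cdot> k = 0" for k
  proof (rule positive_op_bound[OF s(1,4) r(1)])
    have l: "q \<cdot> (s \<cdot> k) = s \<cdot> k"
      using k(1) sq by (metis capp_mult)
    have "P \<cdot> (s \<cdot> k) = s \<cdot> k \<or> P \<cdot> (s \<cdot> k) = 0"
      using k(2) Ps by (metis capp_mult capp_zero(1))
    then have "norm (s \<cdot> (s \<cdot> k)) = norm (b \<cdot> (s \<cdot> k))"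
      using onV offV by fastforce
    also have "\<dots> \<le> r * norm (s \<cdot> k)" using r(2)[of "s \<cdot> k"] l by simp
    finally show "norm (s \<cdot> (s \<cdot> k)) \<le> r * norm (s \<cdot> k)" .
  qed
  have 1: "norm (b \<cdot> ((q * P) \<cdot> k) - (r/2) *\<^sub>R ((q * P) \<cdot> k)) \<le> (r/2) * norm ((q * P) \<cdot> k)" for k
  proof -
    let ?k = "(q * P) \<cdot> k"
    have "q * (q * P) = q * P" "P * (q * P) = q * P" by (metis qq mult.assoc, metis PP(1) Pq mult.assoc)
    then have e: "q \<cdot> ?k = ?k" "P \<cdot> ?k = ?k" by (metis capp_mult)+
    show ?thesis
      using norm_shift_bound[OF bound[OF e(1)] r(1)] onV[OF e(2)] e by simp
  qed
  have 2: "norm (b \<cdot> ((q * (1 - P)) \<cdot> k) + (r/2) *\<^sub>R ((q * (1 - P)) \<cdot> k)) \<le> (r/2) * norm ((q * (1 - P)) \<cdot> k)" for k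
  proof -
    let ?k = "(q * (1 - P)) \<cdot> k"
    have "q * (q * (1 - P)) = q * (1 - P)" by (metis qq mult.assoc)
    moreover have "P * (q * (1 - P)) = q * (P * (1 - P))" by (metis Pq mult.assoc)
    then have "P * (q * (1 - P)) = 0" using PP(1) by (simp add: right_diff_distrib)
    ultimately have e: "q \<cdot> ?k = ?k" "P \<cdot> ?k = 0" by (metis capp_mult, metis capp_mult capp_zero(2))
    have "norm (- (b \<cdot> ?k) - (r/2) *\<^sub>R ?k) \<le> (r/2) * norm ?k"
      using norm_shift_bound[OF bound[OF e(1)] r(1)] offV[OF e(2)] e by simp
    then show ?thesis by (metis minus_add_distrib norm_minus_cancel uminus_add_conv_diff diff_conv_add_uminus)
  qed
  show ?thesis using PP comm 1 2 by blast
qed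

text \<open>The commutator \<open>D = Z c - c Z\<close> is block diagonal with respect to spectral projections of \<open>c\<close>,
  and on a spectral interval of length \<open>2 r\<close> its norm is at most \<open>2 r \<parallel>Z\<parallel>\<close>.\<close>

lemma commutator_bisection:
  fixes Z c :: "'k::chilbert_space cop"
  assumes c: "star c = c"
    and Z: "\<And>q. q * q = q \<Longrightarrow> star q = q \<Longrightarrow> Q q \<Longrightarrow> Z * q = q * Z"
    and Q_mult: "\<And>q p. Q q \<Longrightarrow> Q p \<Longrightarrow> Q (q * p)" and Q_compl: "\<And>q. Q q \<Longrightarrow> Q (1 - q)"
    and Q_comm: "\<And>p. (\<And>T. T * c = c * T \<Longrightarrow> p * T = T * p) \<Longrightarrow> Q p"
    and q: "q * q = q" "star q = q" "Q q" "q * c = c * q"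
    and r: "0 \<le> r" "\<And>k. norm (c \<cdot> (q \<cdot> k) - \<gamma> *\<^sub>R (q \<cdot> k)) \<le> r * norm (q \<cdot> k)"
  shows "norm ((Z * c - c * Z) \<cdot> (q \<cdot> k)) \<le> 2 * norm Z * (r / 2 ^ n) * norm (q \<cdot> k)"
  using q r
proof (induction n arbitrary: q r \<gamma> k)
  case 0
  have Zq: "Z * q = q * Z" using Z 0 by blast
  let ?k = "q \<cdot> k"
  have "(Z * c - c * Z) \<cdot> ?k = Z \<cdot> (c \<cdot> ?k - \<gamma> *\<^sub>R ?k) - (c \<cdot> (Z \<cdot> ?k) - \<gamma> *\<^sub>R (Z \<cdot> ?k))"
    by (simp add: capp_simps)
  also have "Z \<cdot> ?k = q \<cdot> (Z \<cdot> ?k)" using Zq 0(1) by (metis capp_mult)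
  finally have "norm ((Z * c - c * Z) \<cdot> ?k) \<le> norm (Z \<cdot> (c \<cdot> ?k - \<gamma> *\<^sub>R ?k)) +
      norm (c \<cdot> (q \<cdot> (Z \<cdot> ?k)) - \<gamma> *\<^sub>R (q \<cdot> (Z \<cdot> ?k)))"
    by (simp add: norm_triangle_ineq4)
  also have "norm (Z \<cdot> (c \<cdot> ?k - \<gamma> *\<^sub>R ?k)) \<le> norm Z * (r * norm ?k)"
    by (rule order_trans[OF capp_norm_le]) (intro mult_left_mono 0, simp)
  also have "norm (c \<cdot> (q \<cdot> (Z \<cdot> ?k)) - \<gamma> *\<^sub>R (q \<cdot> (Z \<cdot> ?k))) \<le> r * norm (q \<cdot> (Z \<cdot> ?k))" by (rule 0)
  also have "r * norm (q \<cdot> (Z \<cdot> ?k)) \<le> r * (norm Z * norm ?k)"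
    using \<open>Z \<cdot> ?k = q \<cdot> (Z \<cdot> ?k)\<close> capp_norm_le[of Z ?k] 0(5) by (simp add: mult_left_mono)
  finally show ?case by (simp add: algebra_simps)
next
  case (Suc n)
  \<comment> \<open>Recentred so that the two halves of the spectral interval are the negative and
    the nonnegative half-line.\<close>
  define b where "b = c - \<gamma> *\<^sub>R 1"
  have b: "star b = b" "q * b = b * q"
    using c Suc.prems by (simp_all add: b_def star_diff star_scaleR algebra_simps)
  have bc: "T * b = b * T \<longleftrightarrow> T * c = c * T" for T by (simp add: b_def algebra_simps)
  have br: "norm (b \<cdot> (q \<cdot> k)) \<le> r * norm (q \<cdot> k)" for k
    using Suc.prems(6)[of k] by (simp add: b_def capp_simps)
  obtain P where P: "P * P = P" "star P = P" "\<And>T. T * c = c * T \<Longrightarrow> P * T = T * P"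
    and P1: "\<And>k. norm (b \<cdot> ((q * P) \<cdot> k) - (r/2) *\<^sub>R ((q * P) \<cdot> k)) \<le> (r/2) * norm ((q * P) \<cdot> k)"
    and P2: "\<And>k. norm (b \<cdot> ((q * (1 - P)) \<cdot> k) + (r/2) *\<^sub>R ((q * (1 - P)) \<cdot> k)) \<le> (r/2) * norm ((q * (1 - P)) \<cdot> k)"
    using spectral_split[OF b Suc.prems(1) Suc.prems(5) br] bc by metis
  have QP: "Q P" using P(3) by (rule Q_comm)
  have Pq: "P * q = q * P" using P(3) Suc.prems(4) by simp
  have Pc: "P * c = c * P" using P(3) by simp
  note q = Suc.prems
  define q1 where "q1 = q * P"
  define q2 where "q2 = q * (1 - P)"
  have q1: "q1 * q1 = q1" "star q1 = q1" "Q q1" "q1 * c = c * q1"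
  proof -
    show "q1 * q1 = q1" unfolding q1_def by (metis P(1) Pq q(1) mult.assoc)
    show "star q1 = q1" by (simp add: q1_def star_mult P q Pq)
    show "Q q1" unfolding q1_def by (intro Q_mult q QP)
    show "q1 * c = c * q1" unfolding q1_def by (metis Pc q(4) mult.assoc)
  qed
  have P': "(1 - P) * (1 - P) = 1 - P" "(1 - P) * q = q * (1 - P)" "(1 - P) * c = c * (1 - P)"
    using P(1) Pq Pc by (simp_all add: algebra_simps)
  have q2: "q2 * q2 = q2" "star q2 = q2" "Q q2" "q2 * c = c * q2"
  proof -
    show "q2 * q2 = q2" unfolding q2_def by (metis P'(1,2) q(1) mult.assoc)
    show "star q2 = q2" by (simp add: q2_def star_mult star_diff P q P')
    show "Q q2" unfolding q2_def by (intro Q_mult Q_compl q QP)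
    show "q2 * c = c * q2" unfolding q2_def by (metis P'(3) q(4) mult.assoc)
  qed
  let ?D = "Z * c - c * Z"
  have IH1: "norm (?D \<cdot> (q1 \<cdot> k)) \<le> 2 * norm Z * ((r/2) / 2 ^ n) * norm (q1 \<cdot> k)"
    by (rule Suc.IH[OF q1, where \<gamma> = "\<gamma> + r/2"])
      (use P1 q(5) in \<open>simp_all add: q1_def b_def capp_simps scaleR_add_left algebra_simps\<close>)
  have IH2: "norm (?D \<cdot> (q2 \<cdot> k)) \<le> 2 * norm Z * ((r/2) / 2 ^ n) * norm (q2 \<cdot> k)"
  proof (rule Suc.IH[OF q2, where \<gamma> = "\<gamma> - r/2"])
    show "norm (c \<cdot> (q2 \<cdot> k) - (\<gamma> - r / 2) *\<^sub>R (q2 \<cdot> k)) \<le> r / 2 * norm (q2 \<cdot> k)" for k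
      using P2[of k, folded q2_def] by (simp add: b_def capp_diff_left capp_scaleR_left scaleR_diff_left algebra_simps)
  qed (use q(5) in simp)
  let ?B = "2 * norm Z * ((r/2) / 2 ^ n)"
  have B0: "0 \<le> ?B" using q(5) by simp
  have qk: "q \<cdot> k = q1 \<cdot> k + q2 \<cdot> k"
    by (simp add: q1_def q2_def capp_simps)
  have P12: "P * (1 - P) = 0" using P(1) by (simp add: right_diff_distrib)
  have z12: "q1 * q2 = 0"
    unfolding q1_def q2_def by (metis P12 P'(2) Pq mult.assoc mult_zero_left mult_zero_right)
  have orth: "cinner (q1 \<cdot> u) (q2 \<cdot> v) = 0" for u v
  proof -
    have "cinner (q1 \<cdot> u) (q2 \<cdot> v) = cinner u ((q1 * q2) \<cdot> v)"
      using cinner_star_left[of q1 u "q2 \<cdot> v"] q1(2) by (simp add: capp_mult)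
    then show ?thesis by (simp add: z12)
  qed
  have comm: "?D * p = p * ?D" if "p * p = p" "star p = p" "Q p" "p * c = c * p" for p
  proof -
    have Zp: "Z * p = p * Z" by (rule Z[OF that(1-3)])
    have "Z * c * p = p * (Z * c)" by (metis Zp that(4) mult.assoc)
    moreover have "c * Z * p = p * (c * Z)" by (metis Zp that(4) mult.assoc)
    ultimately show ?thesis by (simp only: left_diff_distrib right_diff_distrib)
  qed
  have D1: "?D \<cdot> (q1 \<cdot> k) = q1 \<cdot> (?D \<cdot> k)" and D2: "?D \<cdot> (q2 \<cdot> k) = q2 \<cdot> (?D \<cdot> k)"
    using comm[OF q1] comm[OF q2] by (metis capp_mult)+
  \<comment> \<open>The commutator maps the two halves to orthogonal vectors, so squares of norms
    add and the constants of the halves are not summed. This is why the bound really shrinks by 2 at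
    each bisection.\<close>
  have "(norm (?D \<cdot> (q \<cdot> k)))\<^sup>2 = (norm (?D \<cdot> (q1 \<cdot> k)))\<^sup>2 + (norm (?D \<cdot> (q2 \<cdot> k)))\<^sup>2"
    unfolding qk capp_add_right by (rule pythagoras) (simp add: D1 D2 orth)
  also have "\<dots> \<le> (?B * norm (q1 \<cdot> k))\<^sup>2 + (?B * norm (q2 \<cdot> k))\<^sup>2"
    by (intro add_mono power_mono IH1 IH2) auto
  also have "\<dots> = ?B\<^sup>2 * ((norm (q1 \<cdot> k))\<^sup>2 + (norm (q2 \<cdot> k))\<^sup>2)"
    by (simp only: power_mult_distrib distrib_left)
  also have "(norm (q1 \<cdot> k))\<^sup>2 + (norm (q2 \<cdot> k))\<^sup>2 = (norm (q \<cdot> k))\<^sup>2"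
    unfolding qk by (rule pythagoras[symmetric]) (rule orth)
  finally have "(norm (?D \<cdot> (q \<cdot> k)))\<^sup>2 \<le> (?B * norm (q \<cdot> k))\<^sup>2"
    by (simp only: power_mult_distrib)
  then have "norm (?D \<cdot> (q \<cdot> k)) \<le> ?B * norm (q \<cdot> k)"
    by (rule power2_le_imp_le) (rule mult_nonneg_nonneg[OF B0 norm_ge_zero])
  then show ?case by simp
qed

section \<open>Diagonal operators on square-summable sequences, and normal representations\<close>

lift_definition l2_amp_fun :: "'k::chilbert_space cop \<Rightarrow> 'k l2 \<Rightarrow> 'k l2" is "\<lambda>T f n. T \<cdot> f n"
proof -
  fix T :: "'k cop" and f :: "nat \<Rightarrow> 'k" assume f: "summable (\<lambda>n. (norm (f n))\<^sup>2)"
  have "(norm (T \<cdot> f n))\<^sup>2 \<le> (norm T)\<^sup>2 * (norm (f n))\<^sup>2" for n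
    using power_mono[OF capp_norm_le[of T "f n"], of 2] by (simp add: power_mult_distrib)
  then show "summable (\<lambda>n. (norm (T \<cdot> f n))\<^sup>2)"
    by (intro summable_comparison_test[OF _ summable_mult[OF f]]) auto
qed

definition l2_amp :: "'k::chilbert_space cop \<Rightarrow> 'k l2 cop"
  where "l2_amp T = (SOME A. \<forall>f. A \<cdot> f = l2_amp_fun T f)"

lemma l2_nth_amp [simp]: "l2_nth (l2_amp T \<cdot> f) n = T \<cdot> l2_nth f n"
proof -
  have "\<exists>A. \<forall>f. A \<cdot> f = l2_amp_fun T f"
  proof (rule cop_exists[of _ "norm T"])
    show "norm (l2_amp_fun T f) \<le> norm T * norm f" for f
    proof -
      have le: "(norm (l2_nth (l2_amp_fun T f) n))\<^sup>2 \<le> (norm T)\<^sup>2 * (norm (l2_nth f n))\<^sup>2" for n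
        using power_mono[OF capp_norm_le[of T "l2_nth f n"], of 2]
        by (simp add: power_mult_distrib l2_amp_fun.rep_eq)
      have "(\<Sum>n. (norm (l2_nth (l2_amp_fun T f) n))\<^sup>2) \<le> (\<Sum>n. (norm T)\<^sup>2 * (norm (l2_nth f n))\<^sup>2)"
        by (rule suminf_le[OF le]) (auto intro: summable_mult)
      also have "\<dots> = (norm T)\<^sup>2 * (\<Sum>n. (norm (l2_nth f n))\<^sup>2)" by (simp add: suminf_mult)
      finally have "sqrt (\<Sum>n. (norm (l2_nth (l2_amp_fun T f) n))\<^sup>2) \<le> sqrt ((norm T)\<^sup>2 * (\<Sum>n. (norm (l2_nth f n))\<^sup>2))"
        by (rule real_sqrt_le_mono)
      then show ?thesis by (simp add: norm_l2_def real_sqrt_mult)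
    qed
  qed (auto intro!: l2_eqI simp: l2_amp_fun.rep_eq plus_l2.rep_eq scaleC_l2.rep_eq capp_simps)
  then have "\<forall>f. l2_amp T \<cdot> f = l2_amp_fun T f" unfolding l2_amp_def by (rule someI_ex)
  then show ?thesis by (simp add: l2_amp_fun.rep_eq)
qed

lemma star_l2_amp: "star (l2_amp T) = l2_amp (star T)"
  unfolding star_eq_iff by (simp add: cinner_l2_def cinner_star_left)

lemma l2_nth_add [simp]: "l2_nth (f + g) n = l2_nth f n + l2_nth g n"
  by (simp add: plus_l2.rep_eq)

lemma l2_nth_scaleC [simp]: "l2_nth (c *\<^sub>C f) n = c *\<^sub>C l2_nth f n"
  by (simp add: scaleC_l2.rep_eq)

lemma l2_amp_single: "l2_amp T \<cdot> l2_single i x = l2_single i (T \<cdot> x)"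
  by (rule l2_eqI) (simp add: l2_single.rep_eq)

text \<open>Here \<open>\<theta> 1\<close> may be a proper projection: the representation on the
  \<open>n\<close>-th summand is realised as \<open>Th a * P n\<close> on all of
  \<open>'k\<close>.\<close>

locale star_rep =
  fixes \<theta> :: "'m::wstar_algebra \<Rightarrow> 'k::chilbert_space cop"
  assumes rep_add: "\<theta> (a + b) = \<theta> a + \<theta> b"
    and rep_scaleC: "\<theta> (c *\<^sub>C a) = c *\<^sub>C \<theta> a"
    and rep_mult: "\<theta> (a * b) = \<theta> a * \<theta> b"
    and rep_star: "\<theta> (star a) = star (\<theta> a)"
    and rep_normal: "(\<lambda>a. cinner x (\<theta> a \<cdot> y)) \<in> predual"
begin

lemma rep_diff: "\<theta> (a - b) = \<theta> a - \<theta> b"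
  using rep_add[of "a - b" b] by simp

lemma rep_zero: "\<theta> 0 = 0"
  using rep_diff[of 0 0] by simp

lemma rep_scaleR: "\<theta> (r *\<^sub>R a) = r *\<^sub>R \<theta> a"
  by (simp add: scaleR_scaleC' rep_scaleC)

text \<open>For \<open>norm b = 1\<close> the square root of \<open>1 - star b * b\<close> exhibits
  the squared norm of \<open>\<theta> b \<cdot> k\<close> as that of
  \<open>\<theta> 1 \<cdot> k\<close> minus another square.\<close>

lemma rep_contractive: "norm (\<theta> a) \<le> norm a"
proof (cases "a = 0")
  case True then show ?thesis by (simp add: rep_zero)
next
  case False
  define b where "b = (1 / norm a) *\<^sub>R a"
  have "norm b = 1" using False by (simp add: b_def)
  then have "norm (star b * b) \<le> 1" by (simp add: norm_star_mult)
  then obtain y where y: "(1 - y) * (1 - y) = 1 - star b * b" "star y = y"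
    using cstar_sqrt[of "star b * b"] by (auto simp: star_mult star_star)
  have e: "star (\<theta> 1) * \<theta> 1 = \<theta> 1" by (simp flip: rep_star rep_mult)
  have "norm (\<theta> b) \<le> 1"
  proof (rule cop_norm_leI)
    fix k
    have sq: "(norm (\<theta> c \<cdot> k))\<^sup>2 = Re (cinner k (\<theta> (star c * c) \<cdot> k))" for c
      by (simp add: rep_mult rep_star capp_mult cinner_star_right norm_sq_cinner)
    have ek: "norm (\<theta> 1 \<cdot> k) \<le> norm k"
    proof (cases "\<theta> 1 \<cdot> k = 0")
      case False
      have "(norm (\<theta> 1 \<cdot> k))\<^sup>2 = Re (cinner k (\<theta> 1 \<cdot> k))" using sq[of 1] by simp
      also have "\<dots> \<le> norm k * norm (\<theta> 1 \<cdot> k)" using cmod_cinner_le complex_Re_le_cmod order_trans by blast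
      finally show ?thesis using False by (simp add: power2_eq_square)
    qed simp
    have "star b * b = 1 - star (1 - y) * (1 - y)" using y by (simp add: star_diff)
    then have "(norm (\<theta> b \<cdot> k))\<^sup>2 = (norm (\<theta> 1 \<cdot> k))\<^sup>2 - (norm (\<theta> (1 - y) \<cdot> k))\<^sup>2"
      unfolding sq by (simp add: rep_diff capp_diff_left cinner_diff_right)
    also have "\<dots> \<le> (norm (\<theta> 1 \<cdot> k))\<^sup>2" by simp
    also have "\<dots> \<le> (norm k)\<^sup>2" by (rule power_mono[OF ek]) simp
    finally show "norm (\<theta> b \<cdot> k) \<le> 1 * norm k" using power2_le_imp_le[OF _ norm_ge_zero] by simp
  qed simp
  then show ?thesis using False by (simp add: b_def rep_scaleR field_simps)
qed

end

lemma real_subspace_closure: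
  fixes S :: "'a::real_normed_vector set"
  assumes "subspace S"
  shows "subspace (closure S)"
  unfolding subspace_def
proof (intro conjI ballI allI)
  show "0 \<in> closure S" using assms closure_subset subspace_0 by blast
  fix x assume "x \<in> closure S"
  then obtain f where f: "\<forall>n. f n \<in> S" "f \<longlonglongrightarrow> x" by (auto simp: closure_sequential)
  then show "c *\<^sub>R x \<in> closure S" for c
    using assms unfolding closure_sequential
    by (intro exI[of _ "\<lambda>n. c *\<^sub>R f n"]) (auto intro: tendsto_intros subspace_scale)
  fix y assume "y \<in> closure S"
  then obtain g where "\<forall>n. g n \<in> S" "g \<longlonglongrightarrow> y" by (auto simp: closure_sequential)
  with f show "x + y \<in> closure S"
    using assms unfolding closure_sequential
    by (intro exI[of _ "\<lambda>n. f n + g n"]) (auto intro: tendsto_intros subspace_add)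
qed

lemma sum_lessThan_add: "(\<Sum>i<n + m. f i) = (\<Sum>i<n. f i) + (\<Sum>i<m. f (n + i::nat))"
  for f :: "nat \<Rightarrow> 'b::comm_monoid_add"
  by (induction m) (simp_all add: add.assoc)

text \<open>\<open>J\<close> is a weak* closed two-sided ideal, with closedness expressed by
  annihilating functionals. Two cases occur: the whole algebra, for the ordinary double commutant
  theorem, and the kernel of a second representation, for finding its unit.\<close>

locale star_rep_ideal = star_rep \<theta> for \<theta> :: "'m::wstar_algebra \<Rightarrow> 'k::chilbert_space cop" +
  fixes J :: "'m set"
  assumes J_subspace: "csubspace J"
    and J_left: "a \<in> J \<Longrightarrow> b * a \<in> J" and J_right: "a \<in> J \<Longrightarrow> a * b \<in> J"
    and J_star: "a \<in> J \<Longrightarrow> star a \<in> J"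
    and J_closed: "(\<And>f. f \<in> predual \<Longrightarrow> (\<And>a. a \<in> J \<Longrightarrow> f a = 0) \<Longrightarrow> f m = 0) \<Longrightarrow> m \<in> J"
begin

definition commutant :: "'k cop set"
  where "commutant = {c. \<forall>a\<in>J. c * \<theta> a = \<theta> a * c}"

text \<open>An ideal may act degenerately, and then the double commutant also contains operators
  that are nonzero on the vectors annihilated by \<open>\<theta>\<close> on \<open>J\<close>. The
  second condition excludes these.\<close>

definition bicommutant :: "'k cop set"
  where "bicommutant = {Z. (\<forall>c\<in>commutant. Z * c = c * Z) \<and> (\<forall>k. (\<forall>a\<in>J. \<theta> a \<cdot> k = 0) \<longrightarrow> Z \<cdot> k = 0)}"

lemma J_add: "a \<in> J \<Longrightarrow> b \<in> J \<Longrightarrow> a + b \<in> J" and J_scaleC: "a \<in> J \<Longrightarrow> c *\<^sub>C a \<in> J" and J_zero: "0 \<in> J"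
  using J_subspace by (auto simp: csubspace_iff)

lemma commutant_star: "c \<in> commutant \<Longrightarrow> star c \<in> commutant"
  unfolding commutant_def by (auto, metis J_star rep_star star_mult star_star)

lemma commutant_ops:
  "1 \<in> commutant" "c \<in> commutant \<Longrightarrow> d \<in> commutant \<Longrightarrow> c * d \<in> commutant"
  "c \<in> commutant \<Longrightarrow> d \<in> commutant \<Longrightarrow> c - d \<in> commutant"
  "c \<in> commutant \<Longrightarrow> d \<in> commutant \<Longrightarrow> c + d \<in> commutant"
  "c \<in> commutant \<Longrightarrow> x *\<^sub>C c \<in> commutant"
  unfolding commutant_def
  by (auto simp: algebra_simps mult_scaleC_left mult_scaleC_right) (metis mult.assoc)

text \<open>Vanishing on the null space \<open>K0\<close> is not visibly symmetric. The projection
  \<open>e\<close> onto \<open>K0\<close> lies in the commutant, so \<open>Z * e = 0\<close> becomes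
  \<open>e * Z = 0\<close>, whose adjoint is the required equation.\<close>

lemma bicommutant_star:
  assumes "Z \<in> bicommutant"
  shows "star Z \<in> bicommutant"
proof -
  define K0 where "K0 = {k. \<forall>a\<in>J. \<theta> a \<cdot> k = 0}"
  have K0: "csubspace K0" unfolding K0_def by (auto simp: csubspace_iff capp_simps)
  have cK0: "closed K0"
  proof -
    have "K0 = (\<Inter>a\<in>J. {k. \<theta> a \<cdot> k = 0})" by (auto simp: K0_def)
    then show ?thesis by (auto intro!: closed_INT closed_Collect_eq continuous_intros)
  qed
  define e where "e = proj K0"
  have e: "star e = e" unfolding e_def by (rule star_proj[OF K0 cK0])
  have \<theta>e: "\<theta> a * e = 0" if "a \<in> J" for a
    using proj_in[OF K0 cK0] that by (intro cop_eqI) (auto simp: e_def K0_def capp_mult)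
  have e\<theta>: "e * \<theta> a = 0" if "a \<in> J" for a
  proof -
    have "star (e * \<theta> a) = 0" using \<theta>e[OF J_star[OF that]] by (simp add: star_mult e rep_star)
    then show ?thesis by (metis star_star star_zero)
  qed
  have eN: "e \<in> commutant" by (simp add: commutant_def \<theta>e e\<theta>)
  have "Z * e = 0"
    using assms proj_in[OF K0 cK0] by (intro cop_eqI) (auto simp: bicommutant_def e_def K0_def capp_mult)
  then have "e * Z = 0" using assms eN by (simp add: bicommutant_def)
  then have "star (e * Z) = 0" by simp
  then have Ze: "star Z * e = 0" by (simp add: star_mult e)
  have "star Z \<cdot> k = 0" if "k \<in> K0" for k
    using Ze proj_id[OF K0 cK0 that] by (metis capp_mult capp_zero(2) e_def)
  moreover have "star Z * c = c * star Z" if "c \<in> commutant" for c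
  proof -
    have "star (Z * star c) = star (star c * Z)"
      using assms commutant_star[OF that] by (simp add: bicommutant_def)
    then show ?thesis by (simp add: star_mult star_star)
  qed
  ultimately show ?thesis by (auto simp: bicommutant_def K0_def)
qed

lemma bicommutant_ops:
  "Z \<in> bicommutant \<Longrightarrow> W \<in> bicommutant \<Longrightarrow> Z + W \<in> bicommutant"
  "Z \<in> bicommutant \<Longrightarrow> c *\<^sub>C Z \<in> bicommutant"
  unfolding bicommutant_def
  by (auto simp: algebra_simps mult_scaleC_left mult_scaleC_right capp_simps)

text \<open>Ranges of projections in the commutant, and their complements, are invariant under
  \<open>\<theta>\<close> on \<open>J\<close>, hence under \<open>Z\<close>, so \<open>Z\<close>
  commutes with these projections. Bisecting the spectrum of a self-adjoint element of the commutant
  bounds its commutator with \<open>Z\<close> by every power of 1/2.\<close>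

lemma local_imp_bicommutant:
  assumes loc: "\<And>k. Z \<cdot> k \<in> closure {\<theta> a \<cdot> k | a. a \<in> J}"
  shows "Z \<in> bicommutant"
proof -
  have inv: "Z \<cdot> k \<in> V" if "closed V" "k \<in> V" "\<And>a k. a \<in> J \<Longrightarrow> k \<in> V \<Longrightarrow> \<theta> a \<cdot> k \<in> V" for V k
    using loc[of k] closure_minimal[of "{\<theta> a \<cdot> k | a. a \<in> J}" V] that by blast
  have Zq: "Z * q = q * Z" if q: "q * q = q" "q \<in> commutant" for q
  proof -
    have inv2: "p * (Z * p) = Z * p" if p: "p * p = p" "p \<in> commutant" for p
    proof (rule cop_eqI)
      fix k
      have "Z \<cdot> (p \<cdot> k) \<in> {k. p \<cdot> k = k}"
      proof (rule inv)
        show "closed {k. p \<cdot> k = k}" by (intro closed_Collect_eq continuous_intros)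
        show "p \<cdot> k \<in> {k. p \<cdot> k = k}" using p(1) by (simp flip: capp_mult)
        show "\<theta> a \<cdot> u \<in> {k. p \<cdot> k = k}" if "a \<in> J" "u \<in> {k. p \<cdot> k = k}" for a u
          using that p(2) unfolding commutant_def by (auto, metis capp_mult)
      qed
      then show "(p * (Z * p)) \<cdot> k = (Z * p) \<cdot> k" by (simp add: capp_mult)
    qed
    have "(1 - q) * (1 - q) = 1 - q" using q(1) by (simp add: algebra_simps)
    then have "(1 - q) * (Z * (1 - q)) = Z * (1 - q)"
      by (rule inv2) (intro commutant_ops q)
    then have "q * Z = q * (Z * q)" by (simp add: algebra_simps)
    with inv2[OF q] show ?thesis by simp
  qed
  have sa: "Z * c = c * Z" if c: "c \<in> commutant" "star c = c" for c
  proof -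
    have "(Z * c - c * Z) \<cdot> k = 0" for k
    proof -
      have "norm ((Z * c - c * Z) \<cdot> (1 \<cdot> k)) \<le> 2 * norm Z * (norm c / 2 ^ n) * norm (1 \<cdot> k)" for n
      \<comment> \<open>The bisection starts from the full space, \<open>q = 1\<close>, with a
        spectral interval of centre 0 and radius \<open>norm c\<close>. The spectral projections
        stay in the commutant because they commute with everything that commutes with
        \<open>c\<close>.\<close>
      proof (rule commutator_bisection[where Q = "\<lambda>q. q \<in> commutant" and \<gamma> = 0])
        show "p \<in> commutant" if "\<And>T. T * c = c * T \<Longrightarrow> p * T = T * p" for p
          using that c(1) by (auto simp: commutant_def)
      qed (use Zq c commutant_ops in \<open>auto simp: capp_norm_le\<close>)
      then have *: "norm ((Z * c - c * Z) \<cdot> k) \<le> (2 * norm Z * norm c * norm k) * (1/2) ^ n" for n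
        by (simp add: power_one_over field_simps)
      have "(\<lambda>n. (2 * norm Z * norm c * norm k) * (1/2) ^ n) \<longlonglongrightarrow> 0"
        by (intro tendsto_mult_right_zero LIMSEQ_realpow_zero) auto
      then have "norm ((Z * c - c * Z) \<cdot> k) \<le> 0"
        by (rule LIMSEQ_le_const) (use * in blast)
      then show ?thesis by simp
    qed
    then have "Z * c - c * Z = 0" by (intro cop_eqI) simp
    then show ?thesis by simp
  qed
  have "Z * c = c * Z" if c: "c \<in> commutant" for c
  proof -
    define c1 where "c1 = (1/2) *\<^sub>C (c + star c)"
    define c2 where "c2 = (- \<i>/2) *\<^sub>C (c - star c)"
    have "c1 \<in> commutant" "c2 \<in> commutant"
      unfolding c1_def c2_def by (intro commutant_ops commutant_star c)+
    moreover have "star c1 = c1" "star c2 = c2"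
      by (simp_all add: c1_def c2_def star_scaleC star_add star_diff star_star add.commute scaleC_diff_right)
    ultimately have "Z * c1 = c1 * Z" "Z * c2 = c2 * Z" using sa by auto
    moreover have "c = c1 + \<i> *\<^sub>C c2"
      by (simp add: c1_def c2_def scaleC_scaleC scaleC_add_right scaleC_diff_right)
        (simp flip: scaleC_add_left)
    ultimately show ?thesis by (simp add: algebra_simps mult_scaleC_left mult_scaleC_right)
  qed
  moreover have "Z \<cdot> k = 0" if "\<forall>a\<in>J. \<theta> a \<cdot> k = 0" for k
    using inv[of "{k}" k] inv[of "{u. \<forall>a\<in>J. \<theta> a \<cdot> u = 0} \<inter> {0}"] that loc[of k]
      closure_mono[of "{\<theta> a \<cdot> k | a. a \<in> J}" "{0}"] by auto
  ultimately show ?thesis by (simp add: bicommutant_def)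
qed

text \<open>The vectors \<open>y i\<close> are bundled into one vector \<open>Y\<close>, and
  \<open>S Z\<close> is shown to lie in the closure of its orbit. By duality this says that a finite
  sum of matrix coefficients vanishing on \<open>\<theta>\<close> of \<open>J\<close> vanishes at
  \<open>Z\<close>.\<close>

lemma double_commutant_functional:
  fixes n :: nat
  assumes Z: "Z \<in> bicommutant"
    and vanish: "\<And>a. a \<in> J \<Longrightarrow> (\<Sum>i<n. cinner (x i) (\<theta> a \<cdot> y i)) = 0"
  shows "(\<Sum>i<n. cinner (x i) (Z \<cdot> y i)) = 0"
proof -
  define S where "S T = (\<Sum>i<n. l2_single i (T \<cdot> y i))" for T :: "'k cop"
  define Y where "Y = (\<Sum>i<n. l2_single i (y i))"
  have SY: "S T = l2_amp T \<cdot> Y" for T by (simp add: S_def Y_def capp_sum_right l2_amp_single)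
  have lin: "l2_amp (T + T') \<cdot> f = l2_amp T \<cdot> f + l2_amp T' \<cdot> f" "l2_amp (c *\<^sub>C T) \<cdot> f = c *\<^sub>C (l2_amp T \<cdot> f)"
    "l2_amp (T * T') \<cdot> f = l2_amp T \<cdot> (l2_amp T' \<cdot> f)" "l2_amp 0 \<cdot> f = 0" for T T' c f
    by (auto intro!: l2_eqI simp: capp_simps zero_l2.rep_eq)
  define V0 where "V0 = {l2_amp (\<theta> a) \<cdot> Y | a. a \<in> J}"
  define V where "V = closure V0"
  have V0: "csubspace V0"
    unfolding V0_def
    by (rule csubspaceI) (auto, metis J_zero rep_zero lin(4), metis J_add rep_add lin(1), metis J_scaleC rep_scaleC lin(2))
  have V: "csubspace V" "closed V" unfolding V_def using V0 by (auto intro: csubspace_closure)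
  define P where "P = proj V"
  have inv: "l2_amp (\<theta> a) \<cdot> v \<in> V" if "v \<in> V" "a \<in> J" for v a
  proof -
    have "V \<subseteq> {v. l2_amp (\<theta> a) \<cdot> v \<in> V}"
      unfolding V_def
    proof (rule closure_minimal)
      show "V0 \<subseteq> {v. l2_amp (\<theta> a) \<cdot> v \<in> closure V0}"
        unfolding V0_def using that(2)
        by (auto intro!: closure_subset[THEN subsetD]) (metis J_left rep_mult lin(3))
      have "closed ((\<lambda>v. l2_amp (\<theta> a) \<cdot> v) -` closure V0)"
        by (intro continuous_closed_vimage) (auto intro!: continuous_on_interior[of UNIV] continuous_intros)
      then show "closed {v. l2_amp (\<theta> a) \<cdot> v \<in> closure V0}" by (simp add: vimage_def)
    qed
    with that show ?thesis by blast
  qed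
  have Pcomm: "P * l2_amp (\<theta> a) = l2_amp (\<theta> a) * P" if "a \<in> J" for a
    unfolding P_def
    by (rule proj_commute[OF V]) (use inv that J_star in \<open>auto simp: star_l2_amp simp flip: rep_star\<close>)
  text \<open>The matrix entries of \<open>P\<close> lie in the commutant, so \<open>P\<close> commutes with the amplification of \<open>Z\<close>.\<close>
  have ZP: "l2_amp Z \<cdot> (P \<cdot> l2_single j k) = P \<cdot> l2_single j (Z \<cdot> k)" for j k
  proof (rule l2_eqI)
    fix i
    have "\<exists>p. \<forall>k. p \<cdot> k = l2_nth (P \<cdot> l2_single j k) i"
    proof (rule cop_exists[of _ "norm P"])
      show "norm (l2_nth (P \<cdot> l2_single j k) i) \<le> norm P * norm k" for k
        by (metis norm_l2_nth_le capp_norm_le norm_l2_single order_trans)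
    qed (simp_all add: l2_single_simps capp_simps)
    then obtain p where p: "\<And>k. p \<cdot> k = l2_nth (P \<cdot> l2_single j k) i" by blast
    have "p * \<theta> a = \<theta> a * p" if "a \<in> J" for a
    proof (rule cop_eqI)
      fix k
      have "P \<cdot> (l2_amp (\<theta> a) \<cdot> l2_single j k) = l2_amp (\<theta> a) \<cdot> (P \<cdot> l2_single j k)"
        using Pcomm[OF that] by (metis capp_mult)
      then show "(p * \<theta> a) \<cdot> k = (\<theta> a * p) \<cdot> k" by (simp add: capp_mult p l2_amp_single)
    qed
    then have "p \<in> commutant" by (simp add: commutant_def)
    then have "Z * p = p * Z" using Z by (simp add: bicommutant_def)
    then have "Z \<cdot> (p \<cdot> k) = p \<cdot> (Z \<cdot> k)" by (metis capp_mult)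
    then show "l2_nth (l2_amp Z \<cdot> (P \<cdot> l2_single j k)) i = l2_nth (P \<cdot> l2_single j (Z \<cdot> k)) i"
      by (simp add: p)
  qed
  have ZPY: "l2_amp Z \<cdot> (P \<cdot> Y) = P \<cdot> (l2_amp Z \<cdot> Y)"
    by (simp add: Y_def capp_sum_right ZP l2_amp_single)
  \<comment> \<open>\<open>Y\<close> may lie outside \<open>V\<close>, since \<open>J\<close> may
    act degenerately. The remainder \<open>w\<close> is annihilated in each coordinate by
    \<open>\<theta>\<close> on \<open>J\<close>, hence by \<open>Z\<close>, so \<open>Z\<close> acts
    on \<open>Y\<close> and on its projection in the same way.\<close>
  define w where "w = Y - P \<cdot> Y"
  have "l2_amp (\<theta> a) \<cdot> w = 0" if "a \<in> J" for a
  proof -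
    have "l2_amp (\<theta> a) \<cdot> Y \<in> V" unfolding V_def V0_def using that closure_subset by fast
    then have "P \<cdot> (l2_amp (\<theta> a) \<cdot> Y) = l2_amp (\<theta> a) \<cdot> Y" unfolding P_def by (rule proj_id[OF V])
    moreover have "P \<cdot> (l2_amp (\<theta> a) \<cdot> Y) = l2_amp (\<theta> a) \<cdot> (P \<cdot> Y)"
      using Pcomm[OF that] by (metis capp_mult)
    ultimately show ?thesis by (simp add: w_def capp_diff_right)
  qed
  then have "\<theta> a \<cdot> l2_nth w i = 0" if "a \<in> J" for a i
    using that by (metis l2_nth_amp zero_l2.rep_eq)
  then have "Z \<cdot> l2_nth w i = 0" for i using Z by (simp add: bicommutant_def)
  then have "l2_amp Z \<cdot> w = 0" by (intro l2_eqI) (simp add: zero_l2.rep_eq)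
  then have "l2_amp Z \<cdot> Y = P \<cdot> (l2_amp Z \<cdot> Y)" by (simp add: w_def capp_diff_right ZPY)
  then have inV: "S Z \<in> V" using proj_in[OF V] by (metis P_def SY)
  define X where "X = (\<Sum>i<n. l2_single i (x i))"
  have nth: "l2_nth (S T) i = T \<cdot> y i" if "i < n" for T i
  proof -
    have "l2_nth (\<Sum>j\<in>A. l2_single j (T \<cdot> y j)) i = (if i \<in> A then T \<cdot> y i else 0)" if "finite A" for A
      using that by (induction A) (auto simp: zero_l2.rep_eq l2_single.rep_eq)
    from this[of "{..<n}"] that show ?thesis by (simp add: S_def)
  qed
  have XS: "cinner X (S T) = (\<Sum>i<n. cinner (x i) (T \<cdot> y i))" for T
    by (simp add: X_def cinner_sum_left cinner_l2_single nth)
  have "V \<subseteq> {v. cinner X v = 0}"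
    unfolding V_def
  proof (rule closure_minimal)
    show "V0 \<subseteq> {v. cinner X v = 0}" by (auto simp: V0_def vanish XS simp flip: SY)
    show "closed {v. cinner X v = 0}" by (intro closed_Collect_eq continuous_intros)
  qed
  with inV have "cinner X (S Z) = 0" by blast
  then show ?thesis by (simp add: XS)
qed

text \<open>The self-adjoint elements form only a real subspace, which explains the use of real
  projections. The residual \<open>z\<close> is orthogonal in the real sense to all approximants;
  symmetrising that condition gives a complex linear sum of coefficients, to which the preceding
  duality applies.\<close>

lemma approximate_selfadjoint:
  fixes n :: nat
  assumes W: "W \<in> bicommutant" "star W = W" and e: "0 < e"
  shows "\<exists>b\<in>J. star b = b \<and> (\<forall>i<n. norm (\<theta> b \<cdot> y i - W \<cdot> y i) < e)"
proof -
  define S where "S T = (\<Sum>i<n. l2_single i (T \<cdot> y i))" for T :: "'k cop"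
  have nth: "l2_nth (S T) i = T \<cdot> y i" if "i < n" for T i
  proof -
    have "l2_nth (\<Sum>j\<in>A. l2_single j (T \<cdot> y j)) i = (if i \<in> A then T \<cdot> y i else 0)" if "finite A" for A
      using that by (induction A) (auto simp: zero_l2.rep_eq l2_single.rep_eq)
    from this[of "{..<n}"] that show ?thesis by (simp add: S_def)
  qed
  have cS: "cinner (S T) z = (\<Sum>i<n. cinner (T \<cdot> y i) (l2_nth z i))" for T z
    by (simp add: S_def cinner_sum_left cinner_l2_single)
  have S_add: "S (T + T') = S T + S T'" for T T'
    by (simp add: S_def capp_simps l2_single_simps sum.distrib)
  have S_scale: "S (r *\<^sub>R T) = r *\<^sub>R S T" for r T
    by (simp add: S_def capp_simps l2_single_simps scaleR_scaleC' scaleC_sum_right)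
  define V0 where "V0 = {S (\<theta> b) | b. b \<in> J \<and> star b = b}"
  have "subspace V0"
    unfolding V0_def subspace_def
  proof (intro conjI ballI allI)
    show "0 \<in> {S (\<theta> b) |b. b \<in> J \<and> star b = b}"
      using J_zero S_scale[of 0 0] by (auto intro!: exI[of _ 0] simp: rep_zero)
    fix u assume "u \<in> {S (\<theta> b) |b. b \<in> J \<and> star b = b}"
    then obtain b where b: "u = S (\<theta> b)" "b \<in> J" "star b = b" by blast
    show "r *\<^sub>R u \<in> {S (\<theta> b) |b. b \<in> J \<and> star b = b}" for r
    proof (intro CollectI exI[of _ "r *\<^sub>R b"] conjI)
      show "r *\<^sub>R b \<in> J" using J_scaleC[OF b(2), of "of_real r"] by (simp add: scaleR_scaleC')
    qed (simp_all add: b S_scale rep_scaleR star_scaleR)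
    fix v assume "v \<in> {S (\<theta> b) |b. b \<in> J \<and> star b = b}"
    then obtain c where c: "v = S (\<theta> c)" "c \<in> J" "star c = c" by blast
    show "u + v \<in> {S (\<theta> b) |b. b \<in> J \<and> star b = b}"
      using b c by (intro CollectI exI[of _ "b + c"]) (auto simp: S_add rep_add star_add J_add)
  qed
  then have "subspace (closure V0)" by (rule real_subspace_closure)
  then obtain p where p: "p \<in> closure V0" "\<And>q. q \<in> closure V0 \<Longrightarrow> Re (cinner q (S W - p)) = 0"
    using real_projection_exists[of "closure V0" "S W"] by auto
  define z where "z = S W - p"
  define zz where "zz i = l2_nth z i" for i
  \<comment> \<open>The \<open>2 n\<close> coefficients pairing \<open>zz\<close> with
    \<open>y\<close> and then \<open>y\<close> with \<open>zz\<close>. At a self-adjoint operator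
    \<open>T\<close> their sum is twice the real part of \<open>cinner (S T) z\<close>.\<close>
  define x' where "x' i = (if i < n then zz i else y (i - n))" for i
  define y' where "y' i = (if i < n then y i else zz (i - n))" for i
  have split: "(\<Sum>i<n + n. cinner (x' i) (T \<cdot> y' i)) = (\<Sum>i<n. cinner (zz i) (T \<cdot> y i)) + (\<Sum>i<n. cinner (y i) (T \<cdot> zz i))" for T
    unfolding sum_lessThan_add by (intro arg_cong2[of _ _ _ _ "(+)"] sum.cong) (auto simp: x'_def y'_def)
  have sa: "(\<Sum>i<n + n. cinner (x' i) (T \<cdot> y' i)) = of_real (2 * Re (cinner (S T) z))" if T: "star T = T" for T
  proof -
    have "(\<Sum>i<n. cinner (y i) (T \<cdot> zz i)) = cinner (S T) z"
      unfolding cS zz_def using cinner_star_left[of T] T by simp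
    moreover have "(\<Sum>i<n. cinner (zz i) (T \<cdot> y i)) = cnj (cinner (S T) z)"
      unfolding cS zz_def by (subst cinner_commute) simp
    ultimately show ?thesis by (simp add: split complex_add_cnj add.commute)
  qed
  have "(\<Sum>i<n + n. cinner (x' i) (\<theta> b \<cdot> y' i)) = 0" if b: "b \<in> J" "star b = b" for b
  proof -
    have "Re (cinner (S (\<theta> b)) z) = 0"
      unfolding z_def by (rule p(2)) (use b closure_subset in \<open>force simp: V0_def\<close>)
    then show ?thesis using sa[of "\<theta> b"] b by (simp flip: rep_star)
  qed note van = this
  have "(\<Sum>i<n + n. cinner (x' i) (W \<cdot> y' i)) = 0"
  proof (rule double_commutant_functional[OF W(1)])
    fix a assume a: "a \<in> J"
    define b1 where "b1 = (1/2) *\<^sub>C (a + star a)"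
    define b2 where "b2 = (- \<i>/2) *\<^sub>C (a - star a)"
    have "b1 \<in> J" unfolding b1_def by (intro J_scaleC J_add J_star a)
    moreover have "b2 \<in> J" unfolding b2_def by (intro J_scaleC csubspace_diff[OF J_subspace] J_star a)
    moreover have "star b1 = b1" "star b2 = b2"
      by (simp_all add: b1_def b2_def star_scaleC star_add star_diff star_star add.commute scaleC_diff_right)
    ultimately have v: "(\<Sum>i<n + n. cinner (x' i) (\<theta> b1 \<cdot> y' i)) = 0" "(\<Sum>i<n + n. cinner (x' i) (\<theta> b2 \<cdot> y' i)) = 0"
      using van by auto
    have "a = b1 + \<i> *\<^sub>C b2"
      by (simp add: b1_def b2_def scaleC_scaleC scaleC_add_right scaleC_diff_right)
        (simp flip: scaleC_add_left)
    then have "(\<Sum>i<n + n. cinner (x' i) (\<theta> a \<cdot> y' i)) =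
      (\<Sum>i<n + n. cinner (x' i) (\<theta> b1 \<cdot> y' i)) + \<i> * (\<Sum>i<n + n. cinner (x' i) (\<theta> b2 \<cdot> y' i))"
      by (simp add: rep_add rep_scaleC capp_simps cinner_simps sum.distrib sum_distrib_left)
    then show "(\<Sum>i<n + n. cinner (x' i) (\<theta> a \<cdot> y' i)) = 0" by (simp add: v)
  qed
  then have "Re (cinner (S W) z) = 0" using sa[OF W(2)] by simp
  moreover have "Re (cinner p z) = 0" unfolding z_def by (rule p(2)[OF p(1)])
  ultimately have "(norm z)\<^sup>2 = 0" by (simp add: norm_sq_cinner z_def cinner_diff_left)
  then have "S W \<in> closure V0" using p(1) by (simp add: z_def)
  then obtain v where "v \<in> V0" "dist v (S W) < e" using e closure_approachable by blast
  then obtain b where b: "b \<in> J" "star b = b" "norm (S (\<theta> b) - S W) < e" by (auto simp: V0_def dist_norm)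
  have "norm (\<theta> b \<cdot> y i - W \<cdot> y i) < e" if "i < n" for i
    using norm_l2_nth_le[of "S (\<theta> b) - S W" i] b(3) nth[OF that] by simp
  with b show ?thesis by blast
qed

end

text \<open>\<open>Re ((b + \<i>)\<^sup>-\<^sup>1) = b (1 + b\<^sup>2)\<^sup>-\<^sup>1\<close>, written as \<open>r b r\<^sup>*\<close> with \<open>r = (b + \<i>)\<^sup>-\<^sup>1\<close>; the map
  \<open>b \<mapsto> r b r\<^sup>*\<close> is strongly continuous and bounded.\<close>

lemma resolvent_star:
  fixes b r :: "'a::cstar_algebra"
  assumes "star b = b" "(b + \<i> *\<^sub>C 1) * r = 1" "r * (b + \<i> *\<^sub>C 1) = 1"
  shows "(b - \<i> *\<^sub>C 1) * star r = 1" "star r * (b - \<i> *\<^sub>C 1) = 1"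
proof -
  have "star (b + \<i> *\<^sub>C 1) = b - \<i> *\<^sub>C 1" by (simp add: star_add star_scaleC assms)
  then show "(b - \<i> *\<^sub>C 1) * star r = 1" "star r * (b - \<i> *\<^sub>C 1) = 1"
    using assms by (metis star_mult star_one)+
qed

text \<open>The last claim characterises \<open>r * b * star r\<close> by an equation that any
  homomorphism respects. It identifies the image of this element under \<open>\<theta>\<close>,
  although \<open>\<theta> r\<close> need not be a resolvent of \<open>\<theta> b\<close> when
  \<open>\<theta> 1\<close> is a proper projection.\<close>

lemma resolvent_real_part:
  fixes b r :: "'a::cstar_algebra"
  assumes "star b = b" "(b + \<i> *\<^sub>C 1) * r = 1" "r * (b + \<i> *\<^sub>C 1) = 1"
  shows "r * b * star r = (1/2) *\<^sub>C (r + star r)" "(r * b * star r) * (b * b + 1) = b"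
    "\<And>u. u * (b * b + 1) = b \<Longrightarrow> u = r * b * star r"
proof -
  note s = resolvent_star[OF assms]
  have "r + star r = r * ((b - \<i> *\<^sub>C 1) * star r) + (r * (b + \<i> *\<^sub>C 1)) * star r"
    by (simp add: s assms)
  also have "\<dots> = r * (b + b) * star r"
    by (simp add: algebra_simps mult_scaleC_left mult_scaleC_right)
  finally show "r * b * star r = (1/2) *\<^sub>C (r + star r)"
    by (simp add: algebra_simps scaleC_add_right flip: scaleC_add_left)
  have fac: "b * b + 1 = (b - \<i> *\<^sub>C 1) * (b + \<i> *\<^sub>C 1)"
    by (simp add: algebra_simps mult_scaleC_left mult_scaleC_right scaleC_scaleC)
  have fac': "b * b + 1 = (b + \<i> *\<^sub>C 1) * (b - \<i> *\<^sub>C 1)"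
    by (simp add: algebra_simps mult_scaleC_left mult_scaleC_right scaleC_scaleC)
  have comm: "b * (b + \<i> *\<^sub>C 1) = (b + \<i> *\<^sub>C 1) * b"
    by (simp add: algebra_simps mult_scaleC_left mult_scaleC_right)
  have "(r * b * star r) * (b * b + 1) = r * b * (star r * (b - \<i> *\<^sub>C 1)) * (b + \<i> *\<^sub>C 1)"
    unfolding fac by (simp only: mult.assoc)
  also have "\<dots> = r * ((b + \<i> *\<^sub>C 1) * b)" by (simp add: s(2) mult.assoc comm)
  also have "\<dots> = b" by (metis assms(3) mult.assoc mult_1)
  finally show main: "(r * b * star r) * (b * b + 1) = b" .
  fix u assume u: "u * (b * b + 1) = b"
  have "(b * b + 1) * (star r * r) = (b + \<i> *\<^sub>C 1) * ((b - \<i> *\<^sub>C 1) * star r) * r"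
    unfolding fac' by (simp only: mult.assoc)
  then have inv: "(b * b + 1) * (star r * r) = 1" by (simp add: s(1) assms)
  have "u = u * ((b * b + 1) * (star r * r))" by (simp add: inv)
  also have "\<dots> = (r * b * star r) * (b * b + 1) * (star r * r)" by (metis u main mult.assoc)
  finally show "u = r * b * star r" by (metis inv mult.assoc mult.right_neutral)
qed

section \<open>Kaplansky density and the double commutant theorem with a norm bound\<close>

context star_rep_ideal
begin

text \<open>The self-adjoint approximants of \<open>W\<close> have no common bound, but their images
  under \<open>b \<mapsto> r b r\<^sup>*\<close> lie in \<open>J\<close> with norm at most 1 and
  converge strongly to the image of \<open>W\<close>. A weak* cluster point of them is the preimage
  sought.\<close>

lemma kaplansky_resolvent:
  assumes W: "W \<in> bicommutant" "star W = W"
    and R: "(W + \<i> *\<^sub>C 1) * R = 1" "R * (W + \<i> *\<^sub>C 1) = 1"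
  shows "\<exists>m\<in>J. norm m \<le> 1 \<and> \<theta> m = R * W * star R"
proof -
  \<comment> \<open>The resolvent identity \<open>Q - R = Q * (W - B) * R\<close> and its adjoint
    analogue involve the approximation error only at \<open>R \<cdot> v\<close> and
    \<open>star R \<cdot> v\<close>, so these are the vectors to control.\<close>
  have "\<exists>b. b \<in> J \<and> star b = b \<and>
      (\<forall>v\<in>F. norm ((\<theta> b - W) \<cdot> (R \<cdot> v)) < 1 / Suc n \<and> norm ((\<theta> b - W) \<cdot> (star R \<cdot> v)) < 1 / Suc n)"
    if F: "finite F" for F n
  proof -
    have "finite ((\<lambda>v. R \<cdot> v) ` F \<union> (\<lambda>v. star R \<cdot> v) ` F)" (is "finite ?G") using F by simp
    then obtain N :: nat and y where y: "?G = y ` {..<N}"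
      using finite_imp_nat_seg_image_inj_on[of ?G] unfolding lessThan_def by auto
    obtain b where b: "b \<in> J" "star b = b" "\<And>i. i < N \<Longrightarrow> norm (\<theta> b \<cdot> y i - W \<cdot> y i) < 1 / Suc n"
      using approximate_selfadjoint[OF W, of "1 / Suc n" N y] by auto
    have G: "norm ((\<theta> b - W) \<cdot> u) < 1 / Suc n" if "u \<in> ?G" for u
      using that b(3) unfolding y by (auto simp: capp_diff_left)
    show ?thesis
      by (intro exI[of _ b] conjI ballI b G) auto
  qed
  then obtain b where b: "\<And>F n. finite F \<Longrightarrow> b F n \<in> J" "\<And>F n. finite F \<Longrightarrow> star (b F n) = b F n"
    "\<And>F n v. finite F \<Longrightarrow> v \<in> F \<Longrightarrow> norm ((\<theta> (b F n) - W) \<cdot> (R \<cdot> v)) < 1 / Suc n"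
    "\<And>F n v. finite F \<Longrightarrow> v \<in> F \<Longrightarrow> norm ((\<theta> (b F n) - W) \<cdot> (star R \<cdot> v)) < 1 / Suc n"
    by metis
  have "\<exists>c. c \<in> J \<and> norm c \<le> 1 \<and> (\<forall>v\<in>F. norm (\<theta> c \<cdot> v - (R * W * star R) \<cdot> v) \<le> 1 / Suc n)"
    if F: "finite F" for F n
  proof -
    let ?b = "b F n"
    obtain r where r: "(?b + \<i> *\<^sub>C 1) * r = 1" "r * (?b + \<i> *\<^sub>C 1) = 1" "norm r \<le> 1"
      using resolvent_exists[OF b(2)[OF F]] by metis
    define c where "c = r * ?b * star r"
    note c_props = resolvent_real_part[OF b(2)[OF F] r(1,2)]
    have "c \<in> J" unfolding c_def by (intro J_left J_right b F)
    have "norm c = (1/2) * norm (r + star r)"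
      unfolding c_def c_props(1) by (simp add: norm_scaleC)
    also have "\<dots> \<le> 1" using norm_triangle_ineq[of r "star r"] r(3) by simp
    finally have nc: "norm c \<le> 1" .
    let ?B = "\<theta> ?b"
    have B: "star ?B = ?B" using b(2)[OF F] by (simp flip: rep_star)
    obtain Q where Q: "(?B + \<i> *\<^sub>C 1) * Q = 1" "Q * (?B + \<i> *\<^sub>C 1) = 1" "norm Q \<le> 1"
      using resolvent_exists[OF B] by metis
    have "\<theta> c * (?B * ?B + 1) = \<theta> (c * (?b * ?b + 1))"
      by (simp add: rep_mult rep_add distrib_left)
    also have "\<dots> = ?B" using c_props(2) by (simp add: c_def)
    finally have \<theta>c: "\<theta> c = Q * ?B * star Q" by (rule resolvent_real_part(3)[OF B Q(1,2)])
    have QR: "Q - R = Q * (W - ?B) * R"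
    proof -
      have "Q * (W - ?B) * R = Q * ((W + \<i> *\<^sub>C 1) * R) - (Q * (?B + \<i> *\<^sub>C 1)) * R"
        by (simp add: algebra_simps mult_scaleC_left mult_scaleC_right)
      then show ?thesis by (simp add: R Q)
    qed
    note sQ = resolvent_star[OF B Q(1,2)] and sR = resolvent_star[OF W(2) R]
    have QR': "star Q - star R = star Q * (W - ?B) * star R"
    proof -
      have "star Q * (W - ?B) * star R = star Q * ((W - \<i> *\<^sub>C 1) * star R) - (star Q * (?B - \<i> *\<^sub>C 1)) * star R"
        by (simp add: algebra_simps mult_scaleC_left mult_scaleC_right)
      then show ?thesis by (simp add: sR sQ)
    qed
    have bound: "norm (\<theta> c \<cdot> v - (R * W * star R) \<cdot> v) \<le> 1 / Suc n" if v: "v \<in> F" for v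
    proof -
      have 1: "norm (Q \<cdot> v - R \<cdot> v) \<le> 1 / Suc n"
      proof -
        have "Q \<cdot> v - R \<cdot> v = - (Q \<cdot> ((?B - W) \<cdot> (R \<cdot> v)))"
          using arg_cong[OF QR, of "\<lambda>T. T \<cdot> v"] by (simp add: capp_simps)
        then have "norm (Q \<cdot> v - R \<cdot> v) \<le> norm Q * norm ((?B - W) \<cdot> (R \<cdot> v))" using capp_norm_le by simp
        also have "\<dots> \<le> 1 * (1 / Suc n)"
          by (intro mult_mono Q less_imp_le[OF b(3)] F v) auto
        finally show ?thesis by simp
      qed
      have 2: "norm (star Q \<cdot> v - star R \<cdot> v) \<le> 1 / Suc n"
      proof -
        have "star Q \<cdot> v - star R \<cdot> v = - (star Q \<cdot> ((?B - W) \<cdot> (star R \<cdot> v)))"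
          using arg_cong[OF QR', of "\<lambda>T. T \<cdot> v"] by (simp add: capp_simps)
        then have "norm (star Q \<cdot> v - star R \<cdot> v) \<le> norm (star Q) * norm ((?B - W) \<cdot> (star R \<cdot> v))"
          using capp_norm_le[of "star Q"] by (simp del: norm_star)
        also have "\<dots> \<le> 1 * (1 / Suc n)"
          using Q(3) by (intro mult_mono less_imp_le[OF b(4)] F v) auto
        finally show ?thesis by simp
      qed
      have "\<theta> c \<cdot> v - (R * W * star R) \<cdot> v = (1/2) *\<^sub>C ((Q \<cdot> v - R \<cdot> v) + (star Q \<cdot> v - star R \<cdot> v))"
        unfolding \<theta>c resolvent_real_part(1)[OF B Q(1,2)] resolvent_real_part(1)[OF W(2) R]
        by (simp add: capp_simps scaleC_diff_right scaleC_add_right)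
      then have "norm (\<theta> c \<cdot> v - (R * W * star R) \<cdot> v) \<le> (1/2) * (norm (Q \<cdot> v - R \<cdot> v) + norm (star Q \<cdot> v - star R \<cdot> v))"
        using norm_triangle_ineq by (simp add: norm_scaleC)
      with 1 2 show ?thesis by simp
    qed
    show ?thesis using \<open>c \<in> J\<close> nc bound by blast
  qed
  then obtain c where c: "\<And>F n. finite F \<Longrightarrow> c F n \<in> J" "\<And>F n. finite F \<Longrightarrow> norm (c F n) \<le> 1"
    "\<And>F n v. finite F \<Longrightarrow> v \<in> F \<Longrightarrow> norm (\<theta> (c F n) \<cdot> v - (R * W * star R) \<cdot> v) \<le> 1 / Suc n"
    by metis
  define a where "a = (\<lambda>(F, n). if finite F then c F n else 0)"
  \<comment> \<open>Along this filter the finite test set \<open>F\<close> grows and the error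
    \<open>1 / Suc n\<close> shrinks, independently of each other.\<close>
  define \<F> where "\<F> = finite_subsets_at_top (UNIV :: 'k set) \<times>\<^sub>F (sequentially :: nat filter)"
  have \<F>: "\<F> \<noteq> bot" by (simp add: \<F>_def prod_filter_eq_bot)
  have na: "norm (a p) \<le> 1" for p using c(2) by (auto simp: a_def split: prod.splits)
  have aJ: "a p \<in> J" for p using c(1) J_zero by (auto simp: a_def split: prod.splits)
  have lim: "((\<lambda>p. \<theta> (a p) \<cdot> v) \<longlongrightarrow> (R * W * star R) \<cdot> v) \<F>" for v
  proof (rule LIM_zero_cancel, rule tendsto_norm_zero_cancel, rule tendsto_sandwich[where f = "\<lambda>_. 0"])
    have "\<forall>\<^sub>F F in finite_subsets_at_top (UNIV :: 'k set). finite F \<and> v \<in> F"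
      using eventually_finite_subsets_at_top_weakI[of UNIV finite] 
        eventually_finite_subsets_at_top[of "\<lambda>F. finite F \<and> v \<in> F" UNIV] by (auto intro!: exI[of _ "{v}"])
    then have "\<forall>\<^sub>F p in \<F>. (finite (fst p) \<and> v \<in> fst p) \<and> True"
      unfolding \<F>_def by (intro eventually_prodI[of _ _ "\<lambda>_. True"]) auto
    then show "\<forall>\<^sub>F p in \<F>. norm (\<theta> (a p) \<cdot> v - (R * W * star R) \<cdot> v) \<le> 1 / Suc (snd p)"
      by eventually_elim (use c(3) in \<open>auto simp: a_def split: prod.splits\<close>)
    have "filterlim snd sequentially \<F>" unfolding \<F>_def by (rule filterlim_snd)
    then show "((\<lambda>p. 1 / Suc (snd p)) \<longlongrightarrow> 0) \<F>"
      by (rule filterlim_compose[OF LIMSEQ_Suc[OF lim_1_over_n]])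
  qed auto
  obtain G m where G: "G \<le> \<F>" "G \<noteq> bot" and m: "norm m \<le> 1" "\<And>f. f \<in> predual \<Longrightarrow> ((\<lambda>p. f (a p)) \<longlongrightarrow> f m) G"
    using weakstar_cluster_point[OF \<F>, of a 1] na by blast
  have "\<theta> m = R * W * star R"
  proof (intro cop_eqI cinner_eqI)
    fix v k
    have "((\<lambda>p. cinner k (\<theta> (a p) \<cdot> v)) \<longlongrightarrow> cinner k ((R * W * star R) \<cdot> v)) G"
      by (intro tendsto_cinner tendsto_const tendsto_mono[OF G(1) lim])
    with m(2)[OF rep_normal[of k v]] show "cinner k (\<theta> m \<cdot> v) = cinner k ((R * W * star R) \<cdot> v)"
      using tendsto_unique[OF G(2)] by blast
  qed
  moreover have "m \<in> J"
  proof (rule J_closed)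
    fix f assume f: "f \<in> predual" "\<And>a. a \<in> J \<Longrightarrow> f a = 0"
    have "((\<lambda>p. 0) \<longlongrightarrow> f m) G" using m(2)[OF f(1)] f(2)[OF aJ] by simp
    then show "f m = 0" using G(2) tendsto_const_iff by metis
  qed
  ultimately show ?thesis using m(1) by blast
qed

text \<open>\<open>Z\<close> is written as \<open>W (1 + W\<^sup>2)\<^sup>-\<^sup>1\<close> by solving \<open>W = Z (1 + W\<^sup>2)\<close> with Banach's fixed point theorem.\<close>

lemma double_commutant_small:
  assumes Z: "Z \<in> bicommutant" "star Z = Z" "norm Z \<le> 1/4"
  shows "\<exists>m\<in>J. norm m \<le> 1 \<and> \<theta> m = Z"
proof -
  \<comment> \<open>Closed conditions preserved by the iteration. The radius 1/2 fits since
    \<open>1/4 * (1 + 1/4) \<le> 1/2\<close>, and it gives the Lipschitz constant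
    \<open>1/4 * (1/2 + 1/2) = 1/4\<close>.\<close>
  define S where "S = {W. star W = W \<and> W * Z = Z * W \<and> W \<in> cball 0 (1/2) \<and> (\<forall>c\<in>commutant. W * c = c * W)}"
  have "closed S"
  proof -
    have "S = {W. star W = W} \<inter> {W. W * Z = Z * W} \<inter> cball 0 (1/2) \<inter> (\<Inter>c\<in>commutant. {W. W * c = c * W})"
      by (auto simp: S_def)
    then show ?thesis
      by (auto intro!: closed_Int closed_INT closed_Collect_eq continuous_intros)
  qed
  then have "complete S" by (simp add: complete_eq_closed)
  have Sn: "norm W \<le> 1/2" if "W \<in> S" for W using that by (simp add: S_def)
  have "\<exists>!W\<in>S. Z * (1 + W * W) = W"
  proof (rule Banach_fix[of _ "1/4"])
    show "complete S" by fact
    have "0 \<in> S" by (simp add: S_def)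
    then show "S \<noteq> {}" by blast
    show "(\<lambda>W. Z * (1 + W * W)) ` S \<subseteq> S"
    proof safe
      fix W assume W: "W \<in> S"
      have nWW: "norm (1 + W * W) \<le> 1 + 1/4"
      proof -
        have "norm (W * W) \<le> 1/2 * (1/2)"
          by (rule order_trans[OF norm_mult_ineq]) (intro mult_mono Sn W, auto)
        then show ?thesis using norm_triangle_ineq[of 1 "W * W"] norm_one_le[where 'a="'k cop"] by simp
      qed
      have WZ: "W * Z = Z * W" and sW: "star W = W" using W by (auto simp: S_def)
      have WWZ: "W * W * Z = Z * (W * W)" by (metis WZ mult.assoc)
      have "norm (Z * (1 + W * W)) \<le> 1/4 * (1 + 1/4)"
        by (rule order_trans[OF norm_mult_ineq]) (intro mult_mono nWW Z, auto)
      moreover have "star (Z * (1 + W * W)) = Z * (1 + W * W)"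
        by (simp add: star_mult star_add sW Z distrib_left distrib_right WWZ)
      moreover have "Z * (1 + W * W) * Z = Z * (Z * (1 + W * W))"
      proof -
        have "(1 + W * W) * Z = Z * (1 + W * W)"
          by (simp only: distrib_left distrib_right WWZ mult_1_left mult_1_right)
        then show ?thesis by (metis mult.assoc)
      qed
      moreover have "Z * (1 + W * W) * c = c * (Z * (1 + W * W))" if "c \<in> commutant" for c
      proof -
        have a: "W * c = c * W" "Z * c = c * Z" using W Z(1) that by (auto simp: S_def bicommutant_def)
        then have "(1 + W * W) * c = c * (1 + W * W)" by (simp add: algebra_simps) (metis mult.assoc)
        then show ?thesis by (metis a(2) mult.assoc)
      qed
      ultimately show "Z * (1 + W * W) \<in> S" by (auto simp: S_def)
    qed
    fix W V assume WV: "W \<in> S" "V \<in> S"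
    have eq: "Z * (1 + W * W) - Z * (1 + V * V) = Z * (W * (W - V) + (W - V) * V)"
      by (simp add: algebra_simps)
    have "norm (W * (W - V) + (W - V) * V) \<le> 1/2 * norm (W - V) + norm (W - V) * (1/2)"
      by (intro order_trans[OF norm_triangle_ineq] add_mono order_trans[OF norm_mult_ineq] mult_mono Sn WV) auto
    then have "norm (Z * (W * (W - V) + (W - V) * V)) \<le> 1/4 * norm (W - V)"
      by (intro order_trans[OF norm_mult_ineq] mult_mono Z) auto
    then show "dist (Z * (1 + W * W)) (Z * (1 + V * V)) \<le> 1/4 * dist W V"
      by (simp add: dist_norm eq)
  qed auto
  then obtain W where W: "W \<in> S" "Z * (1 + W * W) = W" by blast
  have sW: "star W = W" "W * Z = Z * W" using W by (auto simp: S_def)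
  have WB: "W \<in> bicommutant"
  proof -
    have "W \<cdot> k = 0" if "\<forall>a\<in>J. \<theta> a \<cdot> k = 0" for k
    proof -
      have "Z \<cdot> k = 0" using Z(1) that by (simp add: bicommutant_def)
      moreover have "W = (1 + W * W) * Z" using W(2) sW(2) by (simp add: algebra_simps) (metis mult.assoc)
      ultimately show ?thesis by (metis capp_mult capp_zero(1))
    qed
    then show ?thesis using W(1) by (auto simp: bicommutant_def S_def)
  qed
  obtain R where R: "(W + \<i> *\<^sub>C 1) * R = 1" "R * (W + \<i> *\<^sub>C 1) = 1"
    using resolvent_exists[OF sW(1)] by metis
  have "Z * (W * W + 1) = W" using W(2) by (simp add: add.commute)
  then have "Z = R * W * star R" by (rule resolvent_real_part(3)[OF sW(1) R])
  then show ?thesis using kaplansky_resolvent[OF WB sW(1) R] by simp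
qed

lemma double_commutant_selfadjoint:
  assumes Z: "Z \<in> bicommutant" "star Z = Z"
  shows "\<exists>m\<in>J. norm m \<le> 4 * norm Z \<and> \<theta> m = Z"
proof (cases "Z = 0")
  case True then show ?thesis using J_zero rep_zero by (intro bexI[of _ 0]) auto
next
  case False
  \<comment> \<open>Scales \<open>Z\<close> to norm 1/4; undoing the scaling produces the factor
    4.\<close>
  define z where "z = 1 / (4 * norm Z)"
  have z: "z > 0" using False by (simp add: z_def)
  have "\<exists>m\<in>J. norm m \<le> 1 \<and> \<theta> m = of_real z *\<^sub>C Z"
  proof (rule double_commutant_small)
    show "of_real z *\<^sub>C Z \<in> bicommutant" by (intro bicommutant_ops Z)
    show "norm (of_real z *\<^sub>C Z) \<le> 1/4" using False by (simp add: norm_scaleC z_def norm_divide norm_mult)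
  qed (simp add: star_scaleC Z)
  then obtain m where m: "m \<in> J" "norm m \<le> 1" "\<theta> m = of_real z *\<^sub>C Z" by blast
  have "\<theta> (of_real (1 / z) *\<^sub>C m) = Z" using m(3) z by (simp add: rep_scaleC scaleC_scaleC)
  moreover have "norm (of_real (1 / z) *\<^sub>C m) \<le> 4 * norm Z"
    using m(2) z False by (simp add: norm_scaleC z_def mult_left_le)
  ultimately show ?thesis using J_scaleC[OF m(1)] by blast
qed

text \<open>The real and imaginary parts contribute 4 each. With the bound, preimages can be chosen
  so as to depend boundedly on the operator, which self-duality demands later.\<close>

theorem double_commutant:
  assumes Z: "Z \<in> bicommutant"
  shows "\<exists>m\<in>J. norm m \<le> 8 * norm Z \<and> \<theta> m = Z"
proof -
  define A where "A = (1/2) *\<^sub>C (Z + star Z)"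
  define B where "B = (- \<i>/2) *\<^sub>C (Z + (-1) *\<^sub>C star Z)"
  have AB: "A \<in> bicommutant" "B \<in> bicommutant"
    unfolding A_def B_def by (intro bicommutant_ops bicommutant_star Z)+
  have sAB: "star A = A" "star B = B"
    by (simp_all add: A_def B_def star_scaleC star_add star_diff star_star add.commute scaleC_add_right scaleC_diff_right)
  have ZAB: "Z = A + \<i> *\<^sub>C B"
    by (simp add: A_def B_def scaleC_scaleC scaleC_add_right scaleC_diff_right) (simp flip: scaleC_add_left)
  have nAB: "norm A \<le> norm Z" "norm B \<le> norm Z"
    using norm_triangle_ineq[of Z "star Z"] norm_triangle_ineq4[of Z "star Z"]
    by (simp_all add: A_def B_def norm_scaleC norm_divide)
  obtain a b where ab: "a \<in> J" "norm a \<le> 4 * norm A" "\<theta> a = A" "b \<in> J" "norm b \<le> 4 * norm B" "\<theta> b = B"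
    using double_commutant_selfadjoint AB sAB by metis
  show ?thesis
  proof (intro bexI conjI)
    show "a + \<i> *\<^sub>C b \<in> J" by (intro J_add J_scaleC ab)
    show "\<theta> (a + \<i> *\<^sub>C b) = Z" by (simp add: rep_add rep_scaleC ab ZAB)
    show "norm (a + \<i> *\<^sub>C b) \<le> 8 * norm Z"
      using norm_triangle_ineq[of a "\<i> *\<^sub>C b"] ab nAB by (simp add: norm_scaleC)
  qed
qed

end

lemma (in star_rep) star_rep_ideal_UNIV: "star_rep_ideal \<theta> UNIV"
  by unfold_locales (auto simp: csubspace_iff)

text \<open>The kernel is weak* closed because it is cut out by the matrix coefficients of
  \<open>\<theta>'\<close>, which belong to the predual.\<close>

lemma (in star_rep) star_rep_ideal_kernel:
  assumes "star_rep \<theta>'"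
  shows "star_rep_ideal \<theta> {a. \<theta>' a = 0}"
proof -
  interpret r: star_rep \<theta>' by fact
  show ?thesis
  proof unfold_locales
    show "csubspace {a. \<theta>' a = 0}" by (auto simp: csubspace_iff r.rep_zero r.rep_add r.rep_scaleC)
    fix m assume *: "\<And>f. f \<in> predual \<Longrightarrow> (\<And>a. a \<in> {a. \<theta>' a = 0} \<Longrightarrow> f a = 0) \<Longrightarrow> f m = 0"
    have "cinner k (\<theta>' m \<cdot> x) = 0" for k x by (rule *[OF r.rep_normal]) simp
    then have "\<theta>' m = 0" by (intro cop_eqI cinner_eqI) simp
    then show "m \<in> {a. \<theta>' a = 0}" by simp
  qed (auto simp: r.rep_mult r.rep_star)
qed

section \<open>Extension of operators and orthogonal series\<close>

lemma clinear_extension: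
  fixes f :: "'k::chilbert_space \<Rightarrow> 'k"
  assumes D: "csubspace D" "closure D = UNIV"
    and add: "\<And>x y. x \<in> D \<Longrightarrow> y \<in> D \<Longrightarrow> f (x + y) = f x + f y"
    and sc: "\<And>c x. x \<in> D \<Longrightarrow> f (c *\<^sub>C x) = c *\<^sub>C f x"
    and bd: "\<And>x. x \<in> D \<Longrightarrow> norm (f x) \<le> C * norm x" and C: "0 \<le> C"
  shows "\<exists>T. (\<forall>x\<in>D. T \<cdot> x = f x) \<and> norm T \<le> C"
proof -
  have fdiff: "f (x - y) = f x - f y" if "x \<in> D" "y \<in> D" for x y
    using add[of "x - y" y] that csubspace_diff[OF D(1)] by simp
  have "uniformly_continuous_on D f"
    unfolding uniformly_continuous_on_def
  proof (intro allI impI)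
    fix e :: real assume e: "0 < e"
    have "dist (f x) (f y) < e" if "x \<in> D" "y \<in> D" "dist x y < e / (C + 1)" for x y
    proof -
      have "dist (f x) (f y) \<le> C * dist x y"
        using bd[of "x - y"] that csubspace_diff[OF D(1)] by (simp add: dist_norm fdiff)
      also have "\<dots> \<le> (C + 1) * dist x y" by (simp add: mult_right_mono)
      also have "\<dots> < e" using that(3) C by (simp add: field_simps)
      finally show ?thesis .
    qed
    then show "\<exists>d>0. \<forall>x\<in>D. \<forall>x'\<in>D. dist x' x < d \<longrightarrow> dist (f x') (f x) < e"
      using e C by (intro exI[of _ "e / (C + 1)"]) auto
  qed
  then obtain g where g: "uniformly_continuous_on (closure D) g" "\<And>x. x \<in> D \<Longrightarrow> f x = g x"
    using uniformly_continuous_on_extension_on_closure by metis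
  have gc: "continuous_on UNIV g" using g(1) uniformly_continuous_imp_continuous D(2) by metis
  have approx: "\<exists>s. (\<forall>n. s n \<in> D) \<and> s \<longlonglongrightarrow> x" for x
    using D(2) closure_sequential[of x D] by auto
  have glim: "(\<lambda>n. g (s n)) \<longlonglongrightarrow> g x" if "s \<longlonglongrightarrow> x" for s x
    using continuous_on_tendsto_compose[OF gc that] by simp
  have "\<exists>T. \<forall>x. T \<cdot> x = g x"
  proof (rule cop_exists[of _ C])
    fix x y c
    obtain s r where s: "\<And>n. s n \<in> D" "s \<longlonglongrightarrow> x" and r: "\<And>n. r n \<in> D" "r \<longlonglongrightarrow> y"
      using approx by metis
    have "(\<lambda>n. g (s n + r n)) \<longlonglongrightarrow> g (x + y)" by (intro glim tendsto_intros s r)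
    moreover have "g (s n + r n) = g (s n) + g (r n)" for n
      using add[OF s(1) r(1)] g(2) s(1) r(1) D(1) by (metis csubspace_iff)
    then have "(\<lambda>n. g (s n + r n)) \<longlonglongrightarrow> g x + g y" by (simp add: tendsto_add glim s r)
    ultimately show "g (x + y) = g x + g y" by (rule LIMSEQ_unique)
    have "(\<lambda>n. g (c *\<^sub>C s n)) \<longlonglongrightarrow> g (c *\<^sub>C x)" by (intro glim tendsto_intros s)
    moreover have "g (c *\<^sub>C s n) = c *\<^sub>C g (s n)" for n
      using sc[OF s(1)] g(2) s(1) D(1) by (metis csubspace_iff)
    then have "(\<lambda>n. g (c *\<^sub>C s n)) \<longlonglongrightarrow> c *\<^sub>C g x" by (simp add: tendsto_scaleC glim s)
    ultimately show "g (c *\<^sub>C x) = c *\<^sub>C g x" by (rule LIMSEQ_unique)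
    show "norm (g x) \<le> C * norm x"
    proof (rule LIMSEQ_le)
      show "(\<lambda>n. norm (g (s n))) \<longlonglongrightarrow> norm (g x)" by (intro tendsto_intros glim s)
      show "(\<lambda>n. C * norm (s n)) \<longlonglongrightarrow> C * norm x" by (intro tendsto_intros s)
      show "\<exists>N. \<forall>n\<ge>N. norm (g (s n)) \<le> C * norm (s n)" using bd g(2) s(1) by metis
    qed
  qed
  then obtain T where T: "\<And>x. T \<cdot> x = g x" by blast
  have "norm (g x) \<le> C * norm x" for x
  proof -
    obtain s where s: "\<And>n. s n \<in> D" "s \<longlonglongrightarrow> x" using approx by metis
    show ?thesis
    proof (rule LIMSEQ_le)
      show "(\<lambda>n. norm (g (s n))) \<longlonglongrightarrow> norm (g x)" by (intro tendsto_intros glim s)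
      show "(\<lambda>n. C * norm (s n)) \<longlonglongrightarrow> C * norm x" by (intro tendsto_intros s)
      show "\<exists>N. \<forall>n\<ge>N. norm (g (s n)) \<le> C * norm (s n)" using bd g(2) s(1) by metis
    qed
  qed
  then have "norm T \<le> C" using C by (intro cop_norm_leI) (auto simp: T)
  with T g(2) show ?thesis by auto
qed

text \<open>The index \<open>m\<close> stands for the power \<open>2 ^ m\<close>. If the conclusion
  failed, the ratio \<open>a 0 / (C * u)\<close> would exceed 1 and be squared at each step, while
  the growth hypothesis keeps \<open>a m / (u * C ^ (2 ^ m))\<close> below
  \<open>D / u\<close>.\<close>

lemma log_convex_bound:
  fixes a :: "nat \<Rightarrow> real"
  assumes "0 < u" "0 < C" "\<And>n. 0 \<le> a n" "\<And>m. (a m)\<^sup>2 \<le> u * a (Suc m)"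
    and "\<And>m. a m \<le> D * C ^ (2 ^ m)"
  shows "a 0 \<le> C * u"
proof (rule ccontr)
  assume "\<not> a 0 \<le> C * u"
  define q where "q = a 0 / (C * u)"
  have q: "q > 1" using \<open>\<not> a 0 \<le> C * u\<close> assms by (simp add: q_def field_simps)
  have "q ^ (2 ^ m) \<le> a m / (u * C ^ (2 ^ m))" for m
  proof (induction m)
    case 0 then show ?case by (simp add: q_def field_simps)
  next
    case (Suc m)
    have "q ^ (2 ^ Suc m) = (q ^ (2 ^ m))\<^sup>2" by (simp add: power_mult[symmetric] mult.commute)
    also have "\<dots> \<le> (a m / (u * C ^ (2 ^ m)))\<^sup>2" using Suc q by (intro power_mono) auto
    also have "\<dots> = (a m)\<^sup>2 / (u\<^sup>2 * C ^ (2 ^ Suc m))"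
      by (simp add: power_divide power_mult_distrib power_mult[symmetric] mult.commute)
    also have "\<dots> \<le> (u * a (Suc m)) / (u\<^sup>2 * C ^ (2 ^ Suc m))"
      using assms by (intro divide_right_mono assms(4)) auto
    also have "\<dots> = a (Suc m) / (u * C ^ (2 ^ Suc m))"
      using assms by (simp add: power2_eq_square)
    finally show ?case .
  qed
  have le: "q ^ (2 ^ m) \<le> D / u" for m
  proof -
    have "q ^ (2 ^ m) \<le> a m / (u * C ^ (2 ^ m))" by fact
    also have "\<dots> \<le> D * C ^ (2 ^ m) / (u * C ^ (2 ^ m))"
      using assms by (intro divide_right_mono) auto
    also have "\<dots> = D / u" using assms(2) by simp
    finally show ?thesis .
  qed
  obtain n where "D / u < q ^ n" using real_arch_pow[OF q] by blast
  also have "\<dots> \<le> q ^ (2 ^ n)" using q by (intro power_increasing) (auto simp: less_imp_le)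
  finally show False using le[of n] by simp
qed

text \<open>If \<open>\<Sum> c i e i \<mapsto> \<Sum> c i e (\<alpha> i)\<close> is formally self-adjoint with geometric growth along orbits, then
  log-convexity of its powers shows that it is bounded by the growth rate. Here it plays the role of
  \<open>T\<^sup>* T\<close> for the map \<open>e i \<mapsto> e' i\<close>.\<close>

lemma gram_extension:
  fixes e e' :: "'i \<Rightarrow> 'k::chilbert_space"
  assumes total: "clspan (e ` I) = UNIV"
    and \<alpha>: "\<And>i. i \<in> I \<Longrightarrow> \<alpha> i \<in> I"
    and gram: "\<And>i j. i \<in> I \<Longrightarrow> j \<in> I \<Longrightarrow> cinner (e' i) (e' j) = cinner (e i) (e (\<alpha> j))"
    and sym: "\<And>i j. i \<in> I \<Longrightarrow> j \<in> I \<Longrightarrow> cinner (e (\<alpha> i)) (e j) = cinner (e i) (e (\<alpha> j))"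
    and growth: "\<And>i. i \<in> I \<Longrightarrow> \<exists>c. \<forall>n. norm (e ((\<alpha> ^^ n) i)) \<le> c * C ^ n" and C: "0 < C"
  shows "\<exists>T. (\<forall>i\<in>I. T \<cdot> e i = e' i) \<and> norm T \<le> sqrt C"
proof -
  have \<alpha>n: "(\<alpha> ^^ n) i \<in> I" if "i \<in> I" for n i by (induction n) (auto simp: that \<alpha>)
  have symn: "cinner (e ((\<alpha> ^^ n) i)) (e j) = cinner (e i) (e ((\<alpha> ^^ n) j))" if "i \<in> I" "j \<in> I" for n i j
    using that
  proof (induction n arbitrary: j)
    case (Suc n)
    have "cinner (e ((\<alpha> ^^ Suc n) i)) (e j) = cinner (e ((\<alpha> ^^ n) i)) (e (\<alpha> j))"
      using sym[OF \<alpha>n[OF Suc.prems(1)] Suc.prems(2)] by simp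
    also have "\<dots> = cinner (e i) (e ((\<alpha> ^^ n) (\<alpha> j)))" using Suc \<alpha> by blast
    finally show ?case by (simp add: funpow_swap1)
  qed simp
  have key: "norm (\<Sum>i\<in>A. c i *\<^sub>C e' i) \<le> sqrt C * norm (\<Sum>i\<in>A. c i *\<^sub>C e i)"
    if A: "finite A" "A \<subseteq> I" for A c
  proof -
    define u where "u n = (\<Sum>i\<in>A. c i *\<^sub>C e ((\<alpha> ^^ n) i))" for n
    have ip: "cinner (u n) (u n) = cinner (u 0) (u (n + n))" for n
    proof -
      have "cinner (e ((\<alpha> ^^ n) i)) (e ((\<alpha> ^^ n) j)) = cinner (e i) (e ((\<alpha> ^^ (n + n)) j))"
        if "i \<in> A" "j \<in> A" for i j
        using symn[of i "(\<alpha> ^^ n) j" n] that A \<alpha>n by (auto simp: funpow_add)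
      then show ?thesis
        unfolding u_def cinner_sum_left cinner_sum_right cinner_scaleC_left cinner_scaleC_right
        by (intro sum.cong refl) simp
    qed
    \<comment> \<open>Log-convexity: Cauchy-Schwarz together with formal self-adjointness, which
      moves all powers of \<open>\<alpha>\<close> to one side.\<close>
    have sq: "(norm (u n))\<^sup>2 \<le> norm (u 0) * norm (u (n + n))" for n
      using cmod_cinner_le[of "u 0" "u (n + n)"] by (simp add: ip[symmetric] cinner_self norm_power)
    obtain d where d: "\<And>i n. i \<in> A \<Longrightarrow> norm (e ((\<alpha> ^^ n) i)) \<le> d i * C ^ n"
      using growth A(2) by (metis subsetD)
    define D where "D = (\<Sum>i\<in>A. cmod (c i) * d i)"
    have gr: "norm (u n) \<le> D * C ^ n" for n
    proof -
      have "norm (u n) \<le> (\<Sum>i\<in>A. norm (c i *\<^sub>C e ((\<alpha> ^^ n) i)))" unfolding u_def by (rule norm_sum)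
      also have "\<dots> \<le> (\<Sum>i\<in>A. cmod (c i) * (d i * C ^ n))"
        by (intro sum_mono) (auto simp: norm_scaleC intro!: mult_left_mono d)
      finally show ?thesis by (simp add: D_def sum_distrib_right mult.assoc)
    qed
    have u1: "norm (u 1) \<le> C * norm (u 0)"
    proof (cases "u 0 = 0")
      case True
      then show ?thesis using sq[of 1] by simp
    next
      case False
      have "norm (u (2 ^ 0)) \<le> C * norm (u 0)"
      proof (rule log_convex_bound[where a = "\<lambda>m. norm (u (2 ^ m))"])
        show "(norm (u (2 ^ m)))\<^sup>2 \<le> norm (u 0) * norm (u (2 ^ Suc m))" for m
          using sq[of "2 ^ m"] by (simp add: mult_2)
      qed (use False C gr in auto)
      then show ?thesis by simp
    qed
    have "cinner (\<Sum>i\<in>A. c i *\<^sub>C e' i) (\<Sum>i\<in>A. c i *\<^sub>C e' i) = cinner (u 0) (u 1)"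
      unfolding u_def cinner_sum_left cinner_sum_right cinner_scaleC_left cinner_scaleC_right
      using A(2) by (intro sum.cong refl) (auto simp: gram subset_iff)
    then have "(norm (\<Sum>i\<in>A. c i *\<^sub>C e' i))\<^sup>2 = cmod (cinner (u 0) (u 1))"
      by (metis cinner_self norm_of_real abs_power2)
    also have "\<dots> \<le> norm (u 0) * (C * norm (u 0))"
      by (rule order_trans[OF cmod_cinner_le]) (intro mult_left_mono u1, simp)
    also have "\<dots> = (sqrt C * norm (u 0))\<^sup>2" using C by (simp add: power_mult_distrib power2_eq_square)
    finally have "norm (\<Sum>i\<in>A. c i *\<^sub>C e' i) \<le> sqrt C * norm (u 0)"
      by (rule power2_le_imp_le) (use C in simp)
    then show ?thesis by (simp add: u_def)
  qed
  \<comment> \<open>The same vector may be a combination of the \<open>e i\<close> in many ways, so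
    the operator is first a relation; the norm estimate \<open>key\<close> makes it
    single-valued.\<close>
  define rel where "rel x y \<longleftrightarrow> (\<exists>A c. finite A \<and> A \<subseteq> I \<and> x = (\<Sum>i\<in>A. c i *\<^sub>C e i) \<and> y = (\<Sum>i\<in>A. c i *\<^sub>C e' i))" for x y
  have ext: "(\<Sum>i\<in>A. c i *\<^sub>C v i) = (\<Sum>i\<in>A \<union> B. (if i \<in> A then c i else 0) *\<^sub>C v i)"
    if "finite A" "finite B" for A B :: "'i set" and c and v :: "'i \<Rightarrow> 'k"
    using that by (intro sum.mono_neutral_cong_left) auto
  have rel_add: "rel (x + x') (y + y')" if r1: "rel x y" and r2: "rel x' y'" for x x' y y'
  proof -
    obtain A c where A: "finite A" "A \<subseteq> I" "x = (\<Sum>i\<in>A. c i *\<^sub>C e i)" "y = (\<Sum>i\<in>A. c i *\<^sub>C e' i)"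
      using r1 unfolding rel_def by (elim exE conjE)
    obtain B d where B: "finite B" "B \<subseteq> I" "x' = (\<Sum>i\<in>B. d i *\<^sub>C e i)" "y' = (\<Sum>i\<in>B. d i *\<^sub>C e' i)"
      using r2 unfolding rel_def by (elim exE conjE)
    show ?thesis
      unfolding rel_def
      by (rule exI[of _ "A \<union> B"], rule exI[of _ "\<lambda>i. (if i \<in> A then c i else 0) + (if i \<in> B then d i else 0)"])
        (simp only: A(3,4) B(3,4) ext[OF A(1) B(1)] ext[OF B(1) A(1)] Un_commute[of B A]
          scaleC_add_left sum.distrib, use A(1,2) B(1,2) in auto)
  qed
  have rel_scale: "rel (d *\<^sub>C x) (d *\<^sub>C y)" if r1: "rel x y" for d x y
  proof -
    obtain A c where A: "finite A" "A \<subseteq> I" "x = (\<Sum>i\<in>A. c i *\<^sub>C e i)" "y = (\<Sum>i\<in>A. c i *\<^sub>C e' i)"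
      using r1 unfolding rel_def by (elim exE conjE)
    then show ?thesis unfolding rel_def
      by (intro exI[of _ A] exI[of _ "\<lambda>i. d * c i"]) (simp add: scaleC_sum_right scaleC_scaleC)
  qed
  have rel_norm: "norm y \<le> sqrt C * norm x" if "rel x y" for x y
    using that key by (auto simp: rel_def)
  have rel_unique: "y = y'" if "rel x y" "rel x y'" for x y y'
    using rel_norm[OF rel_add[OF that(1) rel_scale[OF that(2), of "-1"]]] by simp
  have rel_base: "rel (e i) (e' i)" if "i \<in> I" for i
    unfolding rel_def by (rule exI[of _ "{i}"], rule exI[of _ "\<lambda>_. 1"]) (use that in simp)
  define D where "D = {x. \<exists>y. rel x y}"
  define f where "f x = (THE y. rel x y)" for x
  have f: "rel x (f x)" if xD: "x \<in> D" for x
  proof -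
    obtain y where y: "rel x y" using xD unfolding D_def by blast
    show ?thesis unfolding f_def by (rule theI[where P = "rel x", OF y]) (rule rel_unique[OF _ y])
  qed
  have f_eq: "f x = y" if "rel x y" for x y
    unfolding f_def by (rule the_equality[where P = "rel x", OF that]) (rule rel_unique[OF _ that])
  have "rel 0 0" unfolding rel_def by (rule exI[of _ "{}"]) simp
  then have D: "csubspace D"
    unfolding D_def by (auto simp: csubspace_iff intro: rel_add rel_scale)
  have "e ` I \<subseteq> D" using rel_base by (auto simp: D_def)
  then have "cspan (e ` I) \<subseteq> D" using D by (rule complex_vector.span_minimal)
  then have dense: "closure D = UNIV" using total closure_mono by blast
  have "\<exists>T. (\<forall>x\<in>D. T \<cdot> x = f x) \<and> norm T \<le> sqrt C"
  proof (rule clinear_extension[OF D dense])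
    show "f (x + y) = f x + f y" if "x \<in> D" "y \<in> D" for x y by (intro f_eq rel_add f that)
    show "f (c *\<^sub>C x) = c *\<^sub>C f x" if "x \<in> D" for c x by (intro f_eq rel_scale f that)
    show "norm (f x) \<le> sqrt C * norm x" if "x \<in> D" for x by (intro rel_norm f that)
  qed (use C in simp)
  then show ?thesis using \<open>e ` I \<subseteq> D\<close> f_eq[OF rel_base] by (metis image_subset_iff)
qed

lemma orthogonal_summable:
  fixes v :: "nat \<Rightarrow> 'k::chilbert_space"
  assumes orth: "\<And>m n. m \<noteq> n \<Longrightarrow> cinner (v m) (v n) = 0" and bd: "\<And>N. (\<Sum>n<N. (norm (v n))\<^sup>2) \<le> C"
  shows "summable v"
proof -
  have s: "summable (\<lambda>n. (norm (v n))\<^sup>2)" using bd by (rule summable_if_partial_sums_le(1)[rotated]) simp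
  show ?thesis
    unfolding summable_Cauchy
  proof (intro allI impI)
    fix e :: real assume e: "0 < e"
    then have "0 < e\<^sup>2" by simp
    then obtain N where N: "\<And>m n. m \<ge> N \<Longrightarrow> norm (\<Sum>i=m..<n. (norm (v i))\<^sup>2) < e\<^sup>2"
      using s unfolding summable_Cauchy by blast
    have "norm (sum v {m..<n}) < e" if "m \<ge> N" for m n
    proof -
      have "(norm (sum v {m..<n}))\<^sup>2 = (\<Sum>i=m..<n. (norm (v i))\<^sup>2)"
        by (rule norm_sum_orthogonal) (auto simp: orth)
      also have "\<dots> < e\<^sup>2" using N[OF that, of n] by (simp add: sum_nonneg)
      finally show ?thesis using e by (simp add: power2_less_imp_less)
    qed
    then show "\<exists>N. \<forall>m\<ge>N. \<forall>n. norm (sum v {m..<n}) < e" by blast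
  qed
qed

section \<open>Hilbert modules\<close>

context hilbert_cstar_module
begin

lemma carr_zero: "0 \<in> carr E" and carr_add: "x \<in> carr E \<Longrightarrow> y \<in> carr E \<Longrightarrow> x + y \<in> carr E"
  and carr_scaleC: "x \<in> carr E \<Longrightarrow> c *\<^sub>C x \<in> carr E"
  using carr_subspace by (auto simp: csubspace_iff)

lemma carr_diff: "x \<in> carr E \<Longrightarrow> y \<in> carr E \<Longrightarrow> x - y \<in> carr E"
  using carr_subspace by (rule complex_vector.subspace_diff)

lemma ip_zero_right: "x \<in> carr E \<Longrightarrow> ip E x 0 = 0"
  using ip_scaleC[of x 0 0] carr_zero by simp

lemma ip_zero_left: "x \<in> carr E \<Longrightarrow> ip E 0 x = 0"
  using ip_star[of x 0] carr_zero ip_zero_right[of x] by simp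

lemma ip_diff: "x \<in> carr E \<Longrightarrow> y \<in> carr E \<Longrightarrow> z \<in> carr E \<Longrightarrow> ip E x (y - z) = ip E x y - ip E x z"
  using ip_add[of x "y - z" z] carr_diff by simp

lemma ip_add_left: "x \<in> carr E \<Longrightarrow> y \<in> carr E \<Longrightarrow> z \<in> carr E \<Longrightarrow> ip E (x + y) z = ip E x z + ip E y z"
  using ip_star[of z "x + y"] ip_star[of z x] ip_star[of z y] ip_add[of z x y]
  by (simp add: carr_add star_add)

lemma ip_scaleC_left: "x \<in> carr E \<Longrightarrow> y \<in> carr E \<Longrightarrow> ip E (c *\<^sub>C x) y = cnj c *\<^sub>C ip E x y"
  using ip_star[of y "c *\<^sub>C x"] ip_star[of y x] ip_scaleC[of y x c] by (simp add: carr_scaleC star_scaleC)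

lemma ip_eqI:
  assumes "x \<in> carr E" "y \<in> carr E" "\<And>z. z \<in> carr E \<Longrightarrow> ip E z x = ip E z y"
  shows "x = y"
proof -
  have "ip E (x - y) (x - y) = 0" using assms carr_diff by (simp add: ip_diff)
  then have "x - y = 0" using ip_definite carr_diff assms by blast
  then show ?thesis by simp
qed

end

context hilbert_wstar_module
begin

lemma adjointable_closed: "T \<in> adjointable E \<Longrightarrow> x \<in> carr E \<Longrightarrow> T x \<in> carr E"
  by (auto simp: adjointable_def)

lemma adjointable_adj:
  assumes "T \<in> adjointable E"
  obtains S where "S \<in> adjointable E"
    "\<And>x y. x \<in> carr E \<Longrightarrow> y \<in> carr E \<Longrightarrow> ip E (T x) y = ip E x (S y)"
    "\<And>x y. x \<in> carr E \<Longrightarrow> y \<in> carr E \<Longrightarrow> ip E (S x) y = ip E x (T y)"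
proof -
  obtain S where S: "S \<in> carr E \<rightarrow>\<^sub>E carr E" "\<forall>x\<in>carr E. \<forall>y\<in>carr E. ip E (T x) y = ip E x (S y)"
    using assms by (auto simp: adjointable_def)
  have T: "T \<in> carr E \<rightarrow>\<^sub>E carr E" using assms by (auto simp: adjointable_def)
  have 2: "ip E (S x) y = ip E x (T y)" if "x \<in> carr E" "y \<in> carr E" for x y
  proof -
    have "S x \<in> carr E" "T y \<in> carr E" using S T that by auto
    then show ?thesis using ip_star[of y "S x"] ip_star[of "T y" x] S(2) that by simp
  qed
  with S T have "S \<in> adjointable E" unfolding adjointable_def by blast
  with 2 S(2) that show thesis by blast
qed

lemma adjointable_add:
  assumes "T \<in> adjointable E" "x \<in> carr E" "y \<in> carr E"
  shows "T (x + y) = T x + T y"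
proof -
  obtain S where S: "S \<in> adjointable E" "\<And>x y. x \<in> carr E \<Longrightarrow> y \<in> carr E \<Longrightarrow> ip E (S x) y = ip E x (T y)"
    using adjointable_adj[OF assms(1)] by metis
  show ?thesis
    by (rule ip_eqI) (use assms S adjointable_closed carr_add ip_add in \<open>auto simp flip: S(2)\<close>)
qed

lemma adjointable_scaleC:
  assumes "T \<in> adjointable E" "x \<in> carr E"
  shows "T (c *\<^sub>C x) = c *\<^sub>C T x"
proof -
  obtain S where S: "S \<in> adjointable E" "\<And>x y. x \<in> carr E \<Longrightarrow> y \<in> carr E \<Longrightarrow> ip E (S x) y = ip E x (T y)"
    using adjointable_adj[OF assms(1)] by metis
  show ?thesis
    by (rule ip_eqI) (use assms S adjointable_closed carr_scaleC ip_scaleC in \<open>auto simp flip: S(2)\<close>)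
qed

end

lemma functional_norm_zero: "functional_norm (\<lambda>_::'a::complex_normed_vector. 0) = 0"
  unfolding functional_norm_def by simp

lemma suminf_first: "(\<And>n. 0 < n \<Longrightarrow> f n = 0) \<Longrightarrow> (\<Sum>n. f n) = f (0::nat)"
  for f :: "nat \<Rightarrow> 'a::{comm_monoid_add,t2_space}"
  by (subst suminf_finite[of "{0}"]) auto

lemma summable_first: "(\<And>n. 0 < n \<Longrightarrow> f n = 0) \<Longrightarrow> summable f"
  for f :: "nat \<Rightarrow> 'a::{comm_monoid_add,t2_space}"
  by (rule summable_finite[of "{0}"]) auto

lemma suminf_single_map: "(\<Sum>n. (if n = (0::nat) then f else (\<lambda>_. 0)) (g n)) = f (g 0)"
  for f :: "'b \<Rightarrow> 'a::{comm_monoid_add,t2_space}"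
  by (subst suminf_first) auto

lemma operator_functional_single:
  fixes E :: "('m::wstar_algebra, 'e) hmod"
  assumes "f \<in> predual" "x \<in> carr E" "y \<in> carr E"
  shows "(\<lambda>T. f (ip E x (T y))) \<in> operator_functionals E"
proof -
  have eq: "(\<lambda>T. f (ip E x (T y))) = (\<lambda>T. \<Sum>n. (if n = (0::nat) then f else (\<lambda>_. 0)) (ip E x (T y)))"
    by (simp only: suminf_single_map)
  show ?thesis
    unfolding operator_functionals_def
    by (intro CollectI exI[of _ "\<lambda>n. if n = 0 then f else (\<lambda>_. 0)"] exI[of _ "\<lambda>_. x"] exI[of _ "\<lambda>_. y"] conjI)
      (rule eq, auto simp: assms predual_zero functional_norm_zero intro!: summable_first)
qed

context hilbert_wstar_module
begin

lemma module_functional_single: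
  assumes "f \<in> predual" "z \<in> carr E"
  shows "(\<lambda>x. f (ip E z x)) \<in> module_functionals E"
proof -
  have eq: "(\<lambda>x. f (ip E z x)) = (\<lambda>x. \<Sum>n. (if n = (0::nat) then f else (\<lambda>_. 0)) (ip E z x))"
    by (simp only: suminf_single_map)
  show ?thesis
    unfolding module_functionals_def
    by (intro CollectI exI[of _ "\<lambda>n. if n = 0 then f else (\<lambda>_. 0)"] exI[of _ "\<lambda>_. z"] conjI)
      (rule eq, auto simp: assms predual_zero functional_norm_zero intro!: summable_first)
qed

text \<open>The functional \<open>x \<mapsto> f (ip E z x)\<close> vanishes on \<open>S\<close>,
  hence on its closure, hence at \<open>z\<close>, for every \<open>f\<close> in the
  predual.\<close>

lemma sigma_total:
  assumes dense: "sigma_topology E closure_of S = carr E" and z: "z \<in> carr E"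
    and orth: "\<And>y. y \<in> S \<Longrightarrow> ip E z y = 0"
  shows "z = 0"
proof -
  have "f (ip E z z) = f 0" if f: "f \<in> predual" for f
  proof -
    have "z \<in> weak_topology (carr E) (module_functionals E) closure_of S"
      using dense z by (simp add: sigma_topology_def)
    moreover have "(\<lambda>x. 0) \<in> module_functionals E"
      using module_functional_single[OF predual_zero z] .
    ultimately have "f (ip E z z) = 0"
      using weak_topology_closure_eq[OF _ module_functional_single[OF f z], of z "carr E" S "\<lambda>_. 0"]
      by (simp add: orth predual_map_zero[OF f])
    then show ?thesis by (simp add: predual_map_zero[OF f])
  qed
  then have "ip E z z = 0" by (rule predual_separates)
  then show ?thesis using ip_definite z by blast
qed

end

section \<open>Tensor powers\<close>

locale fock_representation =
  corr: wstar_correspondence E \<phi> + pow: tensor_powers E \<phi> X \<psi> \<iota> \<tau> +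
  rep: normal_representation \<pi> + ten: hilbert_tensor "fock X" \<pi> t
  for E :: "('m::wstar_algebra, 't::complex_vector) hmod"
    and \<phi> :: "'m \<Rightarrow> 't \<Rightarrow> 't"
    and X :: "nat \<Rightarrow> ('m, 't) hmod"
    and \<psi> :: "nat \<Rightarrow> 'm \<Rightarrow> 't \<Rightarrow> 't"
    and \<iota> :: "'m \<Rightarrow> 't"
    and \<tau> :: "nat \<Rightarrow> nat \<Rightarrow> 't \<Rightarrow> 't \<Rightarrow> 't"
    and \<pi> :: "'m \<Rightarrow> 'h::chilbert_space \<Rightarrow> 'h"
    and t :: "(nat \<Rightarrow> 't) \<Rightarrow> 'h \<Rightarrow> 'k::chilbert_space" +
  assumes \<pi>_inj: "inj \<pi>"
begin

text \<open>\<open>X n\<close> is the target of the tensor product of \<open>X 0\<close> and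
  \<open>X n\<close>, and the locale of tensor products asserts that its target is a Hilbert module
  of the required kind.\<close>

sublocale Xm: hilbert_wstar_module "X n" for n
  using internal_tensor.target_module[OF pow.tensor[of 0 n]] by simp

lemmas \<tau>_closed = internal_tensor.tensor_closed[OF pow.tensor]
  and \<tau>_add_left = internal_tensor.tensor_add_left[OF pow.tensor]
  and \<tau>_scaleC_left = internal_tensor.tensor_scaleC_left[OF pow.tensor]
  and \<tau>_scaleC_right = internal_tensor.tensor_scaleC_right[OF pow.tensor]
  and \<tau>_ip = internal_tensor.tensor_ip[OF pow.tensor]

lemma \<tau>_total:
  assumes z: "z \<in> carr (X (j + k))"
    and orth: "\<And>x y. x \<in> carr (X j) \<Longrightarrow> y \<in> carr (X k) \<Longrightarrow> ip (X (j + k)) (\<tau> j k x y) z = 0"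
  shows "z = 0"
proof (rule Xm.sigma_total[OF internal_tensor.tensor_dense[OF pow.tensor] z])
  let ?V = "{y \<in> carr (X (j + k)). ip (X (j + k)) z y = 0}"
  fix y assume "y \<in> cspan {\<tau> j k x y |x y. x \<in> carr (X j) \<and> y \<in> carr (X k)}"
  moreover have "cspan {\<tau> j k x y |x y. x \<in> carr (X j) \<and> y \<in> carr (X k)} \<subseteq> ?V"
  proof (rule complex_vector.span_minimal)
    have "ip (X (j + k)) z (\<tau> j k x y) = 0" if "x \<in> carr (X j)" "y \<in> carr (X k)" for x y
      using Xm.ip_star[OF \<tau>_closed[OF that] z] orth[OF that] by simp
    then show "{\<tau> j k x y |x y. x \<in> carr (X j) \<and> y \<in> carr (X k)} \<subseteq> ?V" by (auto intro: \<tau>_closed)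
    show "csubspace ?V"
      by (auto simp: csubspace_iff Xm.carr_zero Xm.ip_zero_right z Xm.carr_add Xm.ip_add Xm.carr_scaleC Xm.ip_scaleC)
  qed
  ultimately show "ip (X (j + k)) z y = 0" by blast
qed

lemma \<tau>_eqI:
  assumes "u \<in> carr (X (j + k))" "v \<in> carr (X (j + k))"
    and "\<And>x y. x \<in> carr (X j) \<Longrightarrow> y \<in> carr (X k) \<Longrightarrow>
      ip (X (j + k)) (\<tau> j k x y) u = ip (X (j + k)) (\<tau> j k x y) v"
  shows "u = v"
proof -
  have "u - v = 0"
    by (rule \<tau>_total[of _ j k]) (use assms in \<open>auto simp: Xm.carr_diff Xm.ip_diff \<tau>_closed\<close>)
  then show ?thesis by simp
qed

lemma \<iota>_closed: "\<iota> a \<in> carr (X 0)"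
  using pow.zeroth_bij by (auto simp: bij_betw_def)

lemma zeroth_cases: "x \<in> carr (X 0) \<Longrightarrow> (\<And>a. x = \<iota> a \<Longrightarrow> P) \<Longrightarrow> P"
  using pow.zeroth_bij by (auto simp: bij_betw_def)

lemma \<psi>_closed: "x \<in> carr (X n) \<Longrightarrow> \<psi> n a x \<in> carr (X n)"
  using pow.left_adjointable Xm.adjointable_closed by blast

lemma \<psi>_\<tau>: "x \<in> carr (X 1) \<Longrightarrow> y \<in> carr (X k) \<Longrightarrow> \<psi> (1 + k) a (\<tau> 1 k x y) = \<tau> 1 k (\<phi> a x) y"
  using pow.left_tensor[of x 1 y k a] pow.first_left by simp

lemma \<phi>_closed: "x \<in> carr (X 1) \<Longrightarrow> \<phi> a x \<in> carr (X 1)"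
  using \<psi>_closed[of x 1 a] pow.first_left by simp

text \<open>The vector \<open>x - \<phi> 1 x\<close> is annihilated by the left action, hence
  orthogonal to its range, which is dense by essentiality.\<close>

lemma \<phi>_one: "x \<in> carr (X 1) \<Longrightarrow> \<phi> 1 x = x"
proof -
  assume x: "x \<in> carr (X 1)"
  then have xE: "x \<in> carr E" using pow.first_module by simp
  define z where "z = x - \<phi> 1 x"
  have pE: "\<phi> a u \<in> carr E" if "u \<in> carr E" for a u using \<phi>_closed that pow.first_module by simp
  have z: "z \<in> carr E" unfolding z_def by (intro corr.carr_diff xE pE)
  have "z = 0"
  proof (rule corr.sigma_total[OF corr.essential z])
    fix y assume "y \<in> {\<phi> a x |a x. x \<in> carr E}"
    then obtain a u where y: "y = \<phi> a u" "u \<in> carr E" by blast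
    have "\<phi> (star a) (x - \<phi> 1 x) = \<phi> (star a) x - \<phi> (star a) (\<phi> 1 x)"
      using corr.adjointable_add[OF corr.left_adjointable z pE[OF xE], of "star a" 1]
      by (simp add: z_def)
    also have "\<dots> = 0" using corr.left_mult[OF xE, of "star a" 1] by simp
    finally have "\<phi> (star a) z = 0" by (simp add: z_def)
    then have "ip E (\<phi> (star a) z) u = 0" using corr.ip_zero_left y by simp
    then show "ip E z y = 0" using corr.left_star[OF z y(2), of "star a"] y by (simp add: star_star)
  qed
  then show ?thesis by (simp add: z_def)
qed

text \<open>Of the higher left actions only adjointability and their effect on tensor products are
  assumed. The adjoint is identified on simple tensors, where \<open>\<psi>\<close> acts through
  \<open>\<phi>\<close> on the first factor, first with a simple left argument and then, by density,
  in general.\<close>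

lemma \<psi>_star:
  assumes "x \<in> carr (X n)" "y \<in> carr (X n)"
  shows "ip (X n) (\<psi> n a x) y = ip (X n) x (\<psi> n (star a) y)"
proof (cases n)
  case 0
  from assms obtain b c where "x = \<iota> b" "y = \<iota> c" by (auto simp: 0 elim!: zeroth_cases)
  then show ?thesis by (simp add: 0 pow.zeroth_left pow.zeroth_ip star_mult mult.assoc)
next
  case (Suc k)
  then have n: "n = 1 + k" by simp
  have simple: "ip (X n) (\<psi> n a (\<tau> 1 k u v)) y = ip (X n) (\<tau> 1 k u v) (\<psi> n (star a) y)"
    if uv: "u \<in> carr (X 1)" "v \<in> carr (X k)" and y: "y \<in> carr (X n)" for u v y a
  proof -
    obtain S where S: "\<And>x y. x \<in> carr (X n) \<Longrightarrow> y \<in> carr (X n) \<Longrightarrow> ip (X n) (S x) y = ip (X n) x (\<psi> n (star a) y)"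
      "S \<in> adjointable (X n)"
      using Xm.adjointable_adj[OF pow.left_adjointable[of n "star a"]] by metis
    have x: "\<tau> 1 k u v \<in> carr (X n)" unfolding n by (rule \<tau>_closed[OF uv])
    have "\<psi> n a (\<tau> 1 k u v) = S (\<tau> 1 k u v)"
      unfolding n
    proof (rule \<tau>_eqI)
      fix u' v' assume uv': "u' \<in> carr (X 1)" "v' \<in> carr (X k)"
      have x': "\<tau> 1 k u' v' \<in> carr (X n)" unfolding n by (rule \<tau>_closed[OF uv'])
      have "ip E u' (\<phi> a u) = ip E (\<phi> (star a) u') u"
        using corr.left_star[of u' u "star a"] uv uv' pow.first_module by (simp add: star_star)
      then have "ip (X (1 + k)) (\<tau> 1 k u' v') (\<tau> 1 k (\<phi> a u) v) = ip (X (1 + k)) (\<tau> 1 k (\<phi> (star a) u') v') (\<tau> 1 k u v)"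
        using uv uv' \<phi>_closed by (simp only: \<tau>_ip pow.first_module)
      also have "\<dots> = ip (X n) (\<psi> n (star a) (\<tau> 1 k u' v')) (\<tau> 1 k u v)"
        unfolding n using \<psi>_\<tau>[OF uv'] by simp
      also have "\<dots> = star (ip (X n) (\<tau> 1 k u v) (\<psi> n (star a) (\<tau> 1 k u' v')))"
        by (rule Xm.ip_star[symmetric]) (intro x \<psi>_closed x')+
      also have "\<dots> = star (ip (X n) (S (\<tau> 1 k u v)) (\<tau> 1 k u' v'))"
          using S(1)[OF x x'] by simp
      also have "\<dots> = ip (X n) (\<tau> 1 k u' v') (S (\<tau> 1 k u v))"
        by (intro Xm.ip_star Xm.adjointable_closed[OF S(2)] x x')
      finally show "ip (X (1 + k)) (\<tau> 1 k u' v') (\<psi> (1 + k) a (\<tau> 1 k u v)) = ip (X (1 + k)) (\<tau> 1 k u' v') (S (\<tau> 1 k u v))"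
        using \<psi>_\<tau>[OF uv] by (simp only: n)
    qed (use x \<psi>_closed Xm.adjointable_closed[OF S(2)] in \<open>auto simp only: n\<close>)
    then show ?thesis using S(1)[OF x y] by simp
  qed
  obtain S where S: "\<And>x y. x \<in> carr (X n) \<Longrightarrow> y \<in> carr (X n) \<Longrightarrow> ip (X n) (\<psi> n a x) y = ip (X n) x (S y)"
    "S \<in> adjointable (X n)"
    using Xm.adjointable_adj[OF pow.left_adjointable[of n a]] by metis
  have "S y = \<psi> n (star a) y"
  proof (rule \<tau>_eqI[of _ 1 k, folded n])
    fix u v assume uv: "u \<in> carr (X 1)" "v \<in> carr (X k)"
    have "\<tau> 1 k u v \<in> carr (X n)" unfolding n by (rule \<tau>_closed[OF uv])
    then show "ip (X n) (\<tau> 1 k u v) (S y) = ip (X n) (\<tau> 1 k u v) (\<psi> n (star a) y)"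
      using S(1)[OF _ assms(2), of "\<tau> 1 k u v"] simple[OF uv assms(2), of a] by simp
  qed (use assms \<psi>_closed Xm.adjointable_closed[OF S(2)] in auto)
  then show ?thesis using S(1) assms by simp
qed

text \<open>Simple tensors are dense only in the sigma topology. Testing by inner products against
  them moves the operators to their adjoints, so it is \<open>T'\<close> and \<open>S'\<close> that
  have to agree on simple tensors. Degree 0 is treated through \<open>\<iota>\<close>.\<close>

lemma \<psi>_eqI:
  assumes x: "x \<in> carr (X n)" and T: "\<And>x. x \<in> carr (X n) \<Longrightarrow> T x \<in> carr (X n)" "\<And>x. x \<in> carr (X n) \<Longrightarrow> S x \<in> carr (X n)"
    and adj: "\<And>x y. x \<in> carr (X n) \<Longrightarrow> y \<in> carr (X n) \<Longrightarrow> ip (X n) x (T y) = ip (X n) (T' x) y"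
      "\<And>x y. x \<in> carr (X n) \<Longrightarrow> y \<in> carr (X n) \<Longrightarrow> ip (X n) x (S y) = ip (X n) (S' x) y"
    and eq0: "\<And>b. n = 0 \<Longrightarrow> T (\<iota> b) = S (\<iota> b)"
    and eq1: "\<And>u v k. n = 1 + k \<Longrightarrow> u \<in> carr (X 1) \<Longrightarrow> v \<in> carr (X k) \<Longrightarrow> T' (\<tau> 1 k u v) = S' (\<tau> 1 k u v)"
  shows "T x = S x"
proof (cases n)
  case 0
  then show ?thesis using x eq0 by (auto elim!: zeroth_cases)
next
  case (Suc k)
  then have n: "n = 1 + k" by simp
  show ?thesis
  proof (rule \<tau>_eqI[of _ 1 k, folded n])
    fix u v assume uv: "u \<in> carr (X 1)" "v \<in> carr (X k)"
    have c: "\<tau> 1 k u v \<in> carr (X n)" unfolding n by (rule \<tau>_closed[OF uv])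
    show "ip (X n) (\<tau> 1 k u v) (T x) = ip (X n) (\<tau> 1 k u v) (S x)"
      using adj[OF c x] eq1[OF n uv] by simp
  qed (use x T in auto)
qed

lemma \<psi>_add:
  assumes x: "x \<in> carr (X n)"
  shows "\<psi> n (a + b) x = \<psi> n a x + \<psi> n b x"
proof (rule \<psi>_eqI[where T' = "\<psi> n (star (a + b))" and S' = "\<lambda>x. \<psi> n (star a) x + \<psi> n (star b) x" and S = "\<lambda>x. \<psi> n a x + \<psi> n b x", OF x])
  fix u v k assume "n = 1 + k" and uv: "u \<in> carr (X 1)" "v \<in> carr (X k)"
  then show "\<psi> n (star (a + b)) (\<tau> 1 k u v) = \<psi> n (star a) (\<tau> 1 k u v) + \<psi> n (star b) (\<tau> 1 k u v)"
    using \<psi>_\<tau>[OF uv] corr.left_add[of u] \<phi>_closed \<tau>_add_left[of _ 1] pow.first_module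
    by (simp only: star_add)
qed (auto simp: \<psi>_closed Xm.carr_add Xm.ip_add Xm.ip_add_left \<psi>_star star_star pow.zeroth_left distrib_right pow.zeroth_add)

lemma \<psi>_scaleC:
  assumes x: "x \<in> carr (X n)"
  shows "\<psi> n (c *\<^sub>C a) x = c *\<^sub>C \<psi> n a x"
proof (rule \<psi>_eqI[where T' = "\<psi> n (star (c *\<^sub>C a))" and S' = "\<lambda>x. cnj c *\<^sub>C \<psi> n (star a) x" and S = "\<lambda>x. c *\<^sub>C \<psi> n a x", OF x])
  fix u v k assume "n = 1 + k" and uv: "u \<in> carr (X 1)" "v \<in> carr (X k)"
  then show "\<psi> n (star (c *\<^sub>C a)) (\<tau> 1 k u v) = cnj c *\<^sub>C \<psi> n (star a) (\<tau> 1 k u v)"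
    using \<psi>_\<tau>[OF uv] corr.left_scaleC[of u] \<phi>_closed \<tau>_scaleC_left[of _ 1] pow.first_module
    by (simp only: star_scaleC)
qed (auto simp: \<psi>_closed Xm.carr_scaleC Xm.ip_scaleC Xm.ip_scaleC_left \<psi>_star star_star pow.zeroth_left mult_scaleC_left pow.zeroth_scaleC)

lemma \<psi>_mult:
  assumes x: "x \<in> carr (X n)"
  shows "\<psi> n (a * b) x = \<psi> n a (\<psi> n b x)"
proof (rule \<psi>_eqI[where T' = "\<psi> n (star (a * b))" and S' = "\<lambda>x. \<psi> n (star b) (\<psi> n (star a) x)" and S = "\<lambda>x. \<psi> n a (\<psi> n b x)", OF x])
  fix u v k assume "n = 1 + k" and uv: "u \<in> carr (X 1)" "v \<in> carr (X k)"
  then show "\<psi> n (star (a * b)) (\<tau> 1 k u v) = \<psi> n (star b) (\<psi> n (star a) (\<tau> 1 k u v))"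
    using \<psi>_\<tau>[OF uv] \<psi>_\<tau>[OF \<phi>_closed[OF uv(1)] uv(2)] corr.left_mult[of u] pow.first_module
    by (simp only: star_mult)
qed (auto simp: \<psi>_closed \<psi>_star star_star pow.zeroth_left mult.assoc)

lemma \<psi>_one:
  assumes x: "x \<in> carr (X n)"
  shows "\<psi> n 1 x = x"
proof (rule \<psi>_eqI[where T' = "\<psi> n (star 1)" and S' = "\<lambda>x. x" and S = "\<lambda>x. x", OF x])
  fix u v k assume "n = 1 + k" and uv: "u \<in> carr (X 1)" "v \<in> carr (X k)"
  then show "\<psi> n (star 1) (\<tau> 1 k u v) = \<tau> 1 k u v"
    using \<psi>_\<tau>[OF uv] \<phi>_one[OF uv(1)] by (simp only: star_one)
qed (auto simp: \<psi>_closed \<psi>_star star_star pow.zeroth_left)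

lemma \<psi>_zero: "x \<in> carr (X n) \<Longrightarrow> \<psi> n 0 x = 0"
  using \<psi>_scaleC[of x n 0 0] by simp

lemma \<psi>_diff: "x \<in> carr (X n) \<Longrightarrow> \<psi> n (a - b) x = \<psi> n a x - \<psi> n b x"
  using \<psi>_add[of x n "a - b" b] by simp

lemma \<tau>_zero_left: "y \<in> carr (X k) \<Longrightarrow> \<tau> j k 0 y = 0"
  using \<tau>_scaleC_left[of 0 j y k 0] Xm.carr_zero by simp

lemma \<tau>_zero_right: "x \<in> carr (X j) \<Longrightarrow> \<tau> j k x 0 = 0"
  using \<tau>_scaleC_right[of x j 0 k 0] Xm.carr_zero by simp

lemma \<tau>_balanced:
  assumes "x \<in> carr (X j)" "y \<in> carr (X k)"
  shows "\<tau> j k (act (X j) x a) y = \<tau> j k x (\<psi> k a y)"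
proof (rule \<tau>_eqI)
  fix u v assume uv: "u \<in> carr (X j)" "v \<in> carr (X k)"
  show "ip (X (j + k)) (\<tau> j k u v) (\<tau> j k (act (X j) x a) y) = ip (X (j + k)) (\<tau> j k u v) (\<tau> j k x (\<psi> k a y))"
    using assms uv by (simp add: \<tau>_ip Xm.act_closed \<psi>_closed Xm.ip_act \<psi>_mult)
qed (use assms in \<open>auto intro: \<tau>_closed Xm.act_closed \<psi>_closed\<close>)

section \<open>The representation on the base Hilbert space\<close>

definition Pi :: "'m \<Rightarrow> 'h cop"
  where "Pi a = cop_of (\<pi> a)"

lemma Pi_app [simp]: "Pi a \<cdot> h = \<pi> a h"
  unfolding Pi_def using rep.rep_bounded[of a] by (intro capp_cop_of) (simp add: bounded_operators_def)

lemma \<pi>_normal: "(\<lambda>a. cinner x (\<pi> a y)) \<in> predual"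
proof (rule weak_continuous_in_predual[OF rep.rep_normal[unfolded ultraweak_def]])
  let ?x = "\<lambda>n. if n = (0::nat) then x else 0"
  show "(\<lambda>T. cinner x (T y)) \<in> {\<lambda>T. \<Sum>n. cinner (x n) (T (y n)) | x y.
       summable (\<lambda>n::nat. (norm (x n))\<^sup>2) \<and> summable (\<lambda>n::nat. (norm (y n))\<^sup>2)}"
  proof (intro CollectI exI conjI)
    show "(\<lambda>T. cinner x (T y)) = (\<lambda>T. \<Sum>n. cinner (if n = (0::nat) then x else 0) (T (if n = 0 then y else 0)))"
      by (rule ext, subst suminf_first) auto
  qed (auto intro!: summable_first)
qed (auto simp: rep.rep_bounded rep.rep_add rep.rep_scaleC cinner_simps)

sublocale Pi: star_rep Pi
proof
  show "Pi (star a) = star (Pi a)" for a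
    by (rule sym) (simp add: star_eq_iff rep.rep_star star_star)
qed (auto intro!: cop_eqI simp: capp_simps rep.rep_add rep.rep_scaleC rep.rep_mult \<pi>_normal)

sublocale PiU: star_rep_ideal Pi UNIV
  by (rule Pi.star_rep_ideal_UNIV)

lemma \<pi>_one: "\<pi> 1 h = h"
proof -
  have "closed {h. Pi 1 \<cdot> h = h}" by (intro closed_Collect_eq continuous_intros)
  moreover have "{\<pi> a h | a h. True} \<subseteq> {h. Pi 1 \<cdot> h = h}" by (auto simp flip: rep.rep_mult)
  ultimately have "closure {\<pi> a h | a h. True} \<subseteq> {h. Pi 1 \<cdot> h = h}" by (rule closure_minimal[rotated])
  then show ?thesis using rep.rep_nondegenerate by auto
qed

lemma Pi_inj: "Pi a = Pi b \<Longrightarrow> a = b"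
  using \<pi>_inj by (metis Pi_app ext injD)

lemma Pi_double_commutant:
  assumes "\<And>c. (\<And>a. c * Pi a = Pi a * c) \<Longrightarrow> Z * c = c * Z"
  shows "\<exists>m. Pi m = Z \<and> norm m \<le> 8 * norm Z"
proof -
  have "Z \<in> PiU.bicommutant"
    unfolding PiU.bicommutant_def PiU.commutant_def
  proof (intro CollectI conjI allI impI ballI)
    show "Z \<cdot> k = 0" if "\<forall>a\<in>UNIV. Pi a \<cdot> k = 0" for k
      using that[rule_format, of 1] by (simp add: \<pi>_one)
  qed (use assms in blast)
  then show ?thesis using PiU.double_commutant by blast
qed

text \<open>By injectivity the norm-controlled preimage of \<open>Pi a\<close> supplied by the
  double commutant theorem is \<open>a\<close> itself.\<close>

lemma norm_le_Pi: "norm a \<le> 8 * norm (Pi a)"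
proof -
  obtain m where "Pi m = Pi a" "norm m \<le> 8 * norm (Pi a)"
    using Pi_double_commutant[of "Pi a"] by metis
  then show ?thesis using Pi_inj by metis
qed

text \<open>The device by which norm estimates in \<open>M\<close> are reduced, up to the factor 8,
  to estimates of forms on the Hilbert space.\<close>

lemma norm_le_if_form_le:
  assumes "\<And>h k. cmod (cinner h (\<pi> a k)) \<le> c * norm h * norm k" "0 \<le> c"
  shows "norm a \<le> 8 * c"
proof -
  have "norm (Pi a) \<le> c"
  proof (rule cop_norm_leI[OF assms(2)])
    fix k
    have "norm (\<pi> a k) * norm (\<pi> a k) \<le> norm (\<pi> a k) * (c * norm k)"
      using assms(1)[of "\<pi> a k" k] by (simp add: cinner_self power2_eq_square norm_mult ac_simps)
    then show "norm (Pi a \<cdot> k) \<le> c * norm k"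
      by (cases "\<pi> a k = 0") (use assms(2) in auto)
  qed
  with norm_le_Pi[of a] show ?thesis by simp
qed

lemma form_le: "cmod (cinner h (\<pi> a k)) \<le> norm a * norm h * norm k"
proof -
  have "cmod (cinner h (\<pi> a k)) \<le> norm h * (norm (Pi a) * norm k)"
    using cmod_cinner_le[of h "\<pi> a k"] capp_norm_le[of "Pi a" k] by (simp add: mult_left_mono order_trans)
  also have "\<dots> \<le> norm h * (norm a * norm k)" by (intro mult_left_mono mult_right_mono Pi.rep_contractive) auto
  finally show ?thesis by (simp add: ac_simps)
qed

lemma eq_if_forms_eq: "(\<And>h k. cinner h (\<pi> a k) = cinner h (\<pi> b k)) \<Longrightarrow> a = b"
  by (rule Pi_inj, intro cop_eqI cinner_eqI) simp

text \<open>On bounded sets, convergence of the matrix coefficients of \<open>\<pi>\<close> implies weak* convergence: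
  all weak* cluster points agree.\<close>

lemma weakstar_convergent:
  fixes b :: "'i \<Rightarrow> 'm"
  assumes F: "F \<noteq> bot" and bd: "\<And>i. norm (b i) \<le> C"
    and lim: "\<And>h k. ((\<lambda>i. cinner h (\<pi> (b i) k)) \<longlongrightarrow> L h k) F"
  shows "\<exists>a. norm a \<le> C \<and> (\<forall>f\<in>predual. ((\<lambda>i. f (b i)) \<longlongrightarrow> f a) F)"
proof -
  have cluster: "\<exists>G a. G \<le> F' \<and> G \<noteq> bot \<and> norm a \<le> C \<and> (\<forall>f\<in>predual. ((\<lambda>i. f (b i)) \<longlongrightarrow> f a) G)
      \<and> (\<forall>h k. cinner h (\<pi> a k) = L h k)" if "F' \<noteq> bot" "F' \<le> F" for F'
  proof -
    obtain G a where G: "G \<le> F'" "G \<noteq> bot" "norm a \<le> C" "\<forall>f\<in>predual. ((\<lambda>i. f (b i)) \<longlongrightarrow> f a) G"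
      using weakstar_cluster_point[of F' b C] bd \<open>F' \<noteq> bot\<close> by blast
    have "cinner h (\<pi> a k) = L h k" for h k
      using tendsto_unique[OF G(2)] G(4)[rule_format, OF \<pi>_normal[of h k]]
        tendsto_mono[OF order_trans[OF G(1) \<open>F' \<le> F\<close>] lim[of h k]] by blast
    with G show ?thesis by blast
  qed
  obtain a where a: "norm a \<le> C" "\<And>h k. cinner h (\<pi> a k) = L h k" using cluster[OF F] by blast
  have "((\<lambda>i. f (b i)) \<longlongrightarrow> f a) F" if f: "f \<in> predual" for f
    unfolding tendsto_def
  proof (intro allI impI)
    fix U assume U: "open U" "f a \<in> U"
    define F' where "F' = inf F (principal {i. f (b i) \<notin> U})"
    show "\<forall>\<^sub>F i in F. f (b i) \<in> U"
    proof (rule ccontr)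
      assume "\<not> (\<forall>\<^sub>F i in F. f (b i) \<in> U)"
      then have "F' \<noteq> bot"
        unfolding F'_def trivial_limit_def eventually_inf_principal by simp
      moreover have "F' \<le> F" by (simp add: F'_def)
      ultimately obtain G a' where G: "G \<le> F'" "G \<noteq> bot" "\<forall>f\<in>predual. ((\<lambda>i. f (b i)) \<longlongrightarrow> f a') G"
        "\<And>h k. cinner h (\<pi> a' k) = L h k" using cluster by blast
      have "a' = a" by (rule eq_if_forms_eq) (simp add: a G)
      then have "\<forall>\<^sub>F i in G. f (b i) \<in> U" using G(3) f U by (auto simp: tendsto_def)
      moreover have "\<forall>\<^sub>F i in F'. f (b i) \<notin> U" by (simp add: F'_def eventually_inf_principal)
      then have "\<forall>\<^sub>F i in G. f (b i) \<notin> U" using G(1) by (simp add: filter_leD)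
      ultimately have "\<forall>\<^sub>F i in G. False" by eventually_elim simp
      then show False using G(2) by (simp add: trivial_limit_def)
    qed
  qed
  with a(1) show ?thesis by blast
qed

end

section \<open>The Fock space\<close>

context fock_representation
begin

abbreviation F where "F \<equiv> fock X"
abbreviation lv where "lv \<equiv> level t"

lemma carr_fock: "x \<in> carr F \<longleftrightarrow> (\<forall>n. x n \<in> carr (X n)) \<and> (\<exists>C. \<forall>N. norm (\<Sum>n<N. ip (X n) (x n) (x n)) \<le> C)"
  by (simp add: fock_def)

lemma fock_nth: "x \<in> carr F \<Longrightarrow> x n \<in> carr (X n)"
  by (simp add: carr_fock)

lemma fock_ip_eqI:
  assumes "\<And>f. f \<in> predual \<Longrightarrow> (\<lambda>n. f (ip (X n) (x n) (y n))) sums f b"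
  shows "ip F x y = b"
proof -
  have "(THE b. \<forall>f\<in>predual. (\<lambda>n. f (ip (X n) (x n) (y n))) sums f b) = b"
  proof (rule the_equality)
    show "b' = b" if "\<forall>f\<in>predual. (\<lambda>n. f (ip (X n) (x n) (y n))) sums f b'" for b'
      by (rule predual_separates) (use that assms sums_unique2 in blast)
  qed (use assms in blast)
  then show ?thesis by (simp add: fock_def)
qed

lemma ip_incl_left:
  assumes "x \<in> carr (X n)" "\<And>k. y k \<in> carr (X k)"
  shows "ip F (fock_incl n x) y = ip (X n) x (y n)"
proof (rule fock_ip_eqI)
  fix f :: "'m \<Rightarrow> complex" assume f: "f \<in> predual"
  have "(\<lambda>k. f (ip (X k) (fock_incl n x k) (y k))) sums (\<Sum>k\<in>{n}. f (ip (X k) (fock_incl n x k) (y k)))"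
    by (rule sums_finite) (use assms in \<open>auto simp: fock_incl_def Xm.ip_zero_left predual_map_zero[OF f]\<close>)
  then show "(\<lambda>k. f (ip (X k) (fock_incl n x k) (y k))) sums f (ip (X n) x (y n))"
    by (simp add: fock_incl_def)
qed

lemma ip_incl_right:
  assumes "y \<in> carr (X n)" "\<And>k. x k \<in> carr (X k)"
  shows "ip F x (fock_incl n y) = ip (X n) (x n) y"
proof (rule fock_ip_eqI)
  fix f :: "'m \<Rightarrow> complex" assume f: "f \<in> predual"
  have "(\<lambda>k. f (ip (X k) (x k) (fock_incl n y k))) sums (\<Sum>k\<in>{n}. f (ip (X k) (x k) (fock_incl n y k)))"
    by (rule sums_finite) (use assms in \<open>auto simp: fock_incl_def Xm.ip_zero_right predual_map_zero[OF f]\<close>)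
  then show "(\<lambda>k. f (ip (X k) (x k) (fock_incl n y k))) sums f (ip (X n) (x n) y)"
    by (simp add: fock_incl_def)
qed

lemma incl_closed: "x \<in> carr (X n) \<Longrightarrow> fock_incl n x \<in> carr F"
  unfolding carr_fock
proof (intro conjI allI exI)
  assume x: "x \<in> carr (X n)"
  then show "fock_incl n x k \<in> carr (X k)" for k by (auto simp: fock_incl_def Xm.carr_zero)
  fix N
  have "(\<Sum>k<N. ip (X k) (fock_incl n x k) (fock_incl n x k)) = (\<Sum>k<N. if k = n then ip (X n) x x else 0)"
    by (intro sum.cong) (auto simp: fock_incl_def Xm.ip_zero_left Xm.carr_zero)
  then show "norm (\<Sum>k<N. ip (X k) (fock_incl n x k) (fock_incl n x k)) \<le> norm (ip (X n) x x)"
    by simp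
qed

lemma incl_add: "fock_incl n (x + y) = fock_incl n x + fock_incl n (y::'t)"
  by (auto simp: fock_incl_def)

lemma incl_scaleC: "fock_incl n (c *\<^sub>C x) = c *\<^sub>C fock_incl n (x::'t)"
  by (auto simp: fock_incl_def scaleC_fun_def)

lemma lv_cinner:
  assumes "x \<in> carr (X n)" "y \<in> carr (X m)"
  shows "cinner (lv n x h) (lv m y k) = (if n = m then cinner h (\<pi> (ip (X n) x y) k) else 0)"
proof -
  have "fock_incl m y j \<in> carr (X j)" for j using fock_nth[OF incl_closed[OF assms(2)]] .
  then have "ip F (fock_incl n x) (fock_incl m y) = (if n = m then ip (X n) x y else 0)"
    using ip_incl_left[OF assms(1)] by (auto simp: fock_incl_def Xm.ip_zero_right assms)
  moreover have "\<pi> 0 k = 0" using Pi_app[of 0 k] Pi.rep_zero by simp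
  ultimately show ?thesis
    using ten.tensor_cinner[OF incl_closed[OF assms(1)] incl_closed[OF assms(2)], of h k]
    by (simp add: level_def)
qed

lemma lv_add_left: "x \<in> carr (X n) \<Longrightarrow> y \<in> carr (X n) \<Longrightarrow> lv n (x + y) h = lv n x h + lv n y h"
  by (simp add: level_def incl_add ten.tensor_add_left incl_closed)

lemma lv_scaleC_left: "x \<in> carr (X n) \<Longrightarrow> lv n (c *\<^sub>C x) h = c *\<^sub>C lv n x h"
  by (simp add: level_def incl_scaleC ten.tensor_scaleC_left incl_closed)

lemma lv_zero: "lv n 0 h = 0"
  using lv_scaleC_left[of 0 n 0 h] Xm.carr_zero by simp

lemma lv_add_right: "x \<in> carr (X n) \<Longrightarrow> lv n x (h + k) = lv n x h + lv n x k"
  by (simp add: level_def ten.tensor_add_right incl_closed)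

lemma lv_scaleC_right: "x \<in> carr (X n) \<Longrightarrow> lv n x (c *\<^sub>C h) = c *\<^sub>C lv n x h"
  by (simp add: level_def ten.tensor_scaleC_right incl_closed)

lemma lv_norm_sq: "x \<in> carr (X n) \<Longrightarrow> (norm (lv n x h))\<^sup>2 = Re (cinner h (\<pi> (ip (X n) x x) h))"
  by (simp add: norm_sq_cinner lv_cinner)

lemma lv_norm_le: "x \<in> carr (X n) \<Longrightarrow> norm (lv n x h) \<le> hnorm (X n) x * norm h"
proof -
  assume x: "x \<in> carr (X n)"
  have "(norm (lv n x h))\<^sup>2 \<le> norm (ip (X n) x x) * norm h * norm h"
    using lv_norm_sq[OF x] form_le[of h "ip (X n) x x" h] complex_Re_le_cmod order_trans by metis
  also have "\<dots> = (hnorm (X n) x * norm h)\<^sup>2" by (simp add: hnorm_def power_mult_distrib power2_eq_square)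
  finally show ?thesis by (rule power2_le_imp_le) (simp add: hnorm_def)
qed

lemma lv_orth: "m \<noteq> n \<Longrightarrow> x \<in> carr (X m) \<Longrightarrow> y \<in> carr (X n) \<Longrightarrow> cinner (lv m x h) (lv n y k) = 0"
  by (simp add: lv_cinner)

lemma \<pi>_sum: "\<pi> (\<Sum>i\<in>A. f i) h = (\<Sum>i\<in>A. \<pi> (f i) h)"
  by (induction A rule: infinite_finite_induct)
    (use Pi.rep_zero Pi_app[of 0 h] in \<open>auto simp: rep.rep_add\<close>)

text \<open>Different degrees are orthogonal in \<open>'k\<close>, so partial sums of the Fock inner
  product become inner products of partial sums of vectors. Bounds and limits in \<open>M\<close>
  thereby reduce to orthogonal series.\<close>

lemma partial_form:
  assumes "\<And>n. x n \<in> carr (X n)" "\<And>n. y n \<in> carr (X n)"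
  shows "cinner h (\<pi> (\<Sum>n<N. ip (X n) (x n) (y n)) k) = cinner (\<Sum>n<N. lv n (x n) h) (\<Sum>n<N. lv n (y n) k)"
proof -
  have "cinner (\<Sum>n<N. lv n (x n) h) (\<Sum>n<N. lv n (y n) k) = (\<Sum>n<N. \<Sum>m<N. cinner (lv n (x n) h) (lv m (y m) k))"
    by (simp add: cinner_sum_left cinner_sum_right) (rule sum.swap)
  also have "\<dots> = (\<Sum>n<N. \<Sum>m<N. if n = m then cinner h (\<pi> (ip (X n) (x n) (y n)) k) else 0)"
    by (intro sum.cong) (auto simp: lv_cinner assms)
  also have "\<dots> = (\<Sum>n<N. cinner h (\<pi> (ip (X n) (x n) (y n)) k))"
    by (simp add: sum.delta)
  finally show ?thesis by (simp add: \<pi>_sum cinner_sum_right)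
qed

lemma partial_norm_sq:
  assumes "\<And>n. x n \<in> carr (X n)"
  shows "(norm (\<Sum>n<N. lv n (x n) h))\<^sup>2 = (\<Sum>n<N. (norm (lv n (x n) h))\<^sup>2)"
  by (rule norm_sum_orthogonal) (auto simp: lv_orth assms)

lemma fock_bound:
  assumes "x \<in> carr F"
  obtains c where "0 \<le> c" "\<And>N h. (\<Sum>n<N. (norm (lv n (x n) h))\<^sup>2) \<le> c * (norm h)\<^sup>2"
proof -
  obtain C where C: "\<And>N. norm (\<Sum>n<N. ip (X n) (x n) (x n)) \<le> C" using assms by (auto simp: carr_fock)
  have x: "\<And>n. x n \<in> carr (X n)" using assms by (rule fock_nth)
  show thesis
  proof (rule that[of C])
    show "0 \<le> C" using C[of 0] by simp
    fix N h
    have "(\<Sum>n<N. (norm (lv n (x n) h))\<^sup>2) = Re (cinner h (\<pi> (\<Sum>n<N. ip (X n) (x n) (x n)) h))"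
      by (subst partial_norm_sq[OF x, symmetric], subst norm_sq_cinner, subst partial_form[OF x x]) (rule refl)
    also have "\<dots> \<le> norm (\<Sum>n<N. ip (X n) (x n) (x n)) * norm h * norm h"
      using form_le complex_Re_le_cmod order_trans by blast
    also have "\<dots> \<le> C * norm h * norm h" by (intro mult_right_mono C) auto
    finally show "(\<Sum>n<N. (norm (lv n (x n) h))\<^sup>2) \<le> C * (norm h)\<^sup>2" by (simp add: power2_eq_square mult.assoc)
  qed
qed

text \<open>Converse of \<open>fock_bound\<close>: uniform square-summability of the vectors
  \<open>lv n (x n) h\<close> bounds the forms of the partial sums, and so the partial sums
  themselves by \<open>8 * c\<close>.\<close>

lemma fock_memI:
  assumes x: "\<And>n. x n \<in> carr (X n)" and c: "0 \<le> c" "\<And>N h. (\<Sum>n<N. (norm (lv n (x n) h))\<^sup>2) \<le> c * (norm h)\<^sup>2"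
  shows "x \<in> carr F"
  unfolding carr_fock
proof (intro conjI allI exI)
  fix N
  have n: "norm (\<Sum>n<N. lv n (x n) h) \<le> sqrt c * norm h" for h
  proof (rule power2_le_imp_le)
    show "(norm (\<Sum>n<N. lv n (x n) h))\<^sup>2 \<le> (sqrt c * norm h)\<^sup>2"
      using c by (simp add: partial_norm_sq[OF x] power_mult_distrib)
  qed (use c in simp)
  show "norm (\<Sum>n<N. ip (X n) (x n) (x n)) \<le> 8 * c"
  proof (rule norm_le_if_form_le[OF _ c(1)])
    fix h k
    have "cmod (cinner h (\<pi> (\<Sum>n<N. ip (X n) (x n) (x n)) k)) \<le> (sqrt c * norm h) * (sqrt c * norm k)"
      unfolding partial_form[OF x x]
      by (rule order_trans[OF cmod_cinner_le]) (intro mult_mono n, use c in auto)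
    also have "\<dots> = (sqrt c * sqrt c) * norm h * norm k" by (simp only: ac_simps)
    finally show "cmod (cinner h (\<pi> (\<Sum>n<N. ip (X n) (x n) (x n)) k)) \<le> c * norm h * norm k"
      using c by simp
  qed
qed (rule x)

lemma lv_summable:
  assumes "x \<in> carr F"
  shows "summable (\<lambda>n. lv n (x n) h)"
proof -
  obtain c where "\<And>N h. (\<Sum>n<N. (norm (lv n (x n) h))\<^sup>2) \<le> c * (norm h)\<^sup>2" using fock_bound[OF assms] by metis
  then show ?thesis
    by (intro orthogonal_summable[of _ "c * (norm h)\<^sup>2"]) (auto simp: lv_orth fock_nth[OF assms])
qed

text \<open>This justifies the definite description in \<open>fock\<close>. The partial sums are
  bounded and their forms converge, because the orthogonal series of both vectors converge; such a
  sequence has a weak* limit.\<close>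

lemma fock_ip_sums:
  assumes x: "x \<in> carr F" and y: "y \<in> carr F" and f: "f \<in> predual"
  shows "(\<lambda>n. f (ip (X n) (x n) (y n))) sums f (ip F x y)"
proof -
  note xn = fock_nth[OF x] and yn = fock_nth[OF y]
  obtain c where c: "0 \<le> c" "\<And>N h. (\<Sum>n<N. (norm (lv n (x n) h))\<^sup>2) \<le> c * (norm h)\<^sup>2" using fock_bound[OF x] by metis
  obtain d where d: "0 \<le> d" "\<And>N h. (\<Sum>n<N. (norm (lv n (y n) h))\<^sup>2) \<le> d * (norm h)\<^sup>2" using fock_bound[OF y] by metis
  have nx: "norm (\<Sum>n<N. lv n (x n) h) \<le> sqrt c * norm h" for N h
    by (rule power2_le_imp_le) (use c in \<open>auto simp: partial_norm_sq[OF xn] power_mult_distrib\<close>)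
  have ny: "norm (\<Sum>n<N. lv n (y n) h) \<le> sqrt d * norm h" for N h
    by (rule power2_le_imp_le) (use d in \<open>auto simp: partial_norm_sq[OF yn] power_mult_distrib\<close>)
  define b where "b N = (\<Sum>n<N. ip (X n) (x n) (y n))" for N
  have "norm (b N) \<le> 8 * (sqrt c * sqrt d)" for N
  proof (rule norm_le_if_form_le)
    fix h k
    have "cmod (cinner h (\<pi> (b N) k)) \<le> (sqrt c * norm h) * (sqrt d * norm k)"
      unfolding b_def partial_form[OF xn yn]
      by (rule order_trans[OF cmod_cinner_le]) (intro mult_mono nx ny, use c in auto)
    then show "cmod (cinner h (\<pi> (b N) k)) \<le> sqrt c * sqrt d * norm h * norm k" by (simp only: ac_simps)
  qed (use c d in simp)
  moreover have "(\<lambda>N. cinner h (\<pi> (b N) k)) \<longlonglongrightarrow> cinner (\<Sum>n. lv n (x n) h) (\<Sum>n. lv n (y n) k)" for h k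
    unfolding b_def partial_form[OF xn yn]
    by (intro tendsto_cinner summable_LIMSEQ lv_summable x y)
  ultimately obtain a where a: "\<And>f. f \<in> predual \<Longrightarrow> (\<lambda>N. f (b N)) \<longlonglongrightarrow> f a"
    using weakstar_convergent[of sequentially b "8 * (sqrt c * sqrt d)"
        "\<lambda>h k. cinner (\<Sum>n. lv n (x n) h) (\<Sum>n. lv n (y n) k)"] sequentially_bot by blast
  have sums: "(\<lambda>n. f (ip (X n) (x n) (y n))) sums f a" if "f \<in> predual" for f
    using a[OF that] by (simp add: sums_def b_def predual_map_sum[OF that])
  then have "ip F x y = a" by (rule fock_ip_eqI)
  with sums f show ?thesis by simp
qed

text \<open>The orthogonal series has some sum \<open>u\<close>. The inner products of
  \<open>u\<close> and \<open>t x h\<close> with themselves and with each other all coincide, so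
  their difference has norm zero.\<close>

lemma fock_decomp:
  assumes x: "x \<in> carr F"
  shows "(\<lambda>n. lv n (x n) h) sums t x h"
proof -
  note xn = fock_nth[OF x]
  define u where "u = (\<Sum>n. lv n (x n) h)"
  have u: "(\<lambda>n. lv n (x n) h) sums u" unfolding u_def by (intro summable_sums lv_summable x)
  have xx: "(\<lambda>n. cinner h (\<pi> (ip (X n) (x n) (x n)) h)) sums cinner (t x h) (t x h)"
    using fock_ip_sums[OF x x \<pi>_normal[of h h]] ten.tensor_cinner[OF x x] by simp
  have xl: "cinner (t x h) (lv n (x n) h) = cinner h (\<pi> (ip (X n) (x n) (x n)) h)" for n
    unfolding level_def using ten.tensor_cinner[OF x incl_closed[OF xn]] ip_incl_right[of "x n" n x] xn by simp
  have xu: "cinner (t x h) u = cinner (t x h) (t x h)"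
  proof (rule sums_unique2)
    show "(\<lambda>n. cinner (t x h) (lv n (x n) h)) sums cinner (t x h) (t x h)" using xx by (simp add: xl)
    show "(\<lambda>n. cinner (t x h) (lv n (x n) h)) sums cinner (t x h) u"
      using u unfolding sums_def cinner_sum_right[symmetric] by (intro tendsto_cinner tendsto_const)
  qed
  have uu: "cinner u u = cinner (t x h) (t x h)"
  proof (rule LIMSEQ_unique)
    have "(\<lambda>N. cinner (\<Sum>n<N. lv n (x n) h) (\<Sum>n<N. lv n (x n) h)) \<longlonglongrightarrow> cinner u u"
      using u unfolding sums_def by (intro tendsto_cinner)
    then have "(\<lambda>N. cinner h (\<pi> (\<Sum>n<N. ip (X n) (x n) (x n)) h)) \<longlonglongrightarrow> cinner u u"
      by (simp only: partial_form[OF xn xn])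
    then show "(\<lambda>N. \<Sum>n<N. cinner h (\<pi> (ip (X n) (x n) (x n)) h)) \<longlonglongrightarrow> cinner u u"
      by (simp only: \<pi>_sum cinner_sum_right)
    show "(\<lambda>N. \<Sum>n<N. cinner h (\<pi> (ip (X n) (x n) (x n)) h)) \<longlonglongrightarrow> cinner (t x h) (t x h)"
      using xx by (simp add: sums_def)
  qed
  have "cinner u (t x h) = cnj (cinner (t x h) u)" by (rule cinner_commute)
  also have "\<dots> = cinner (t x h) (t x h)" unfolding xu by (rule cinner_commute[symmetric])
  finally have "cinner (t x h - u) (t x h - u) = 0" by (simp add: cinner_diff_left cinner_diff_right xu uu)
  then have "t x h = u" by simp
  with u show ?thesis by simp
qed

lemma tensor_total: "clspan {t x h | x h. x \<in> carr F} = UNIV"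
  by (rule ten.tensor_dense)

lemma K_orthI:
  assumes "\<And>n x h. x \<in> carr (X n) \<Longrightarrow> cinner (lv n x h) u = 0"
  shows "u = 0"
proof -
  have "cinner (t x h) u = 0" if x: "x \<in> carr F" for x h
  proof -
    have "(\<lambda>N. cinner (\<Sum>n<N. lv n (x n) h) u) \<longlonglongrightarrow> cinner (t x h) u"
      using fock_decomp[OF x, of h] unfolding sums_def by (intro tendsto_cinner tendsto_const)
    moreover have "cinner (\<Sum>n<N. lv n (x n) h) u = 0" for N
      by (simp add: cinner_sum_left assms fock_nth[OF x])
    ultimately show ?thesis by (simp add: LIMSEQ_const_iff)
  qed
  moreover have "closed {w. cinner w u = 0}" by (intro closed_Collect_eq continuous_intros)
  moreover have "csubspace {w. cinner w u = 0}" by (auto simp: csubspace_iff cinner_simps)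
  ultimately have "clspan {t x h | x h. x \<in> carr F} \<subseteq> {w. cinner w u = 0}"
    by (intro clspan_minimal) auto
  then have "cinner u u = 0" using tensor_total by blast
  then show ?thesis by simp
qed

lemma K_eqI:
  assumes "\<And>n x h. x \<in> carr (X n) \<Longrightarrow> cinner (lv n x h) u = cinner (lv n x h) v"
  shows "u = v"
  using K_orthI[of "u - v"] assms by (simp add: cinner_diff_right)

lemma lv_total: "clspan {lv n x h | n x h. x \<in> carr (X n)} = UNIV"
proof -
  have "u \<in> clspan {lv n x h | n x h. x \<in> carr (X n)}" (is "_ \<in> ?V") for u
  proof (rule in_closed_subspace_if_orthogonal)
    show "csubspace ?V" by (rule csubspace_clspan)
    fix k assume "\<And>v. v \<in> ?V \<Longrightarrow> cinner v k = 0"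
    then have "k = 0" by (intro K_orthI) (blast intro: clspan_base)
    then show "cinner k u = 0" by simp
  qed simp
  then show ?thesis by blast
qed

lemma cop_lv_eqI:
  assumes "\<And>n x h. x \<in> carr (X n) \<Longrightarrow> S \<cdot> lv n x h = T \<cdot> lv n x h"
  shows "S = T"
proof (rule cop_eqI)
  fix u
  have "clspan {lv n x h | n x h. x \<in> carr (X n)} \<subseteq> {u. S \<cdot> u = T \<cdot> u}"
    by (rule clspan_minimal)
      (use assms in \<open>auto simp: csubspace_iff capp_simps intro!: closed_Collect_eq continuous_intros\<close>)
  then show "S \<cdot> u = T \<cdot> u" using lv_total by blast
qed

lemma summand_def': "summand X t n = clspan {lv n x h | x h. x \<in> carr (X n)}"
  by (simp add: summand_def tensor_space_def)

lemma summand_csubspace: "csubspace (summand X t n)" and summand_closed: "closed (summand X t n)"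
  unfolding summand_def' by (auto intro: csubspace_clspan)

lemma lv_in_summand: "x \<in> carr (X n) \<Longrightarrow> lv n x h \<in> summand X t n"
  unfolding summand_def' by (rule clspan_base) blast

lemma summand_orth:
  assumes "u \<in> summand X t m" "x \<in> carr (X n)" "m \<noteq> n"
  shows "cinner (lv n x h) u = 0"
proof -
  have "summand X t m \<subseteq> {u. cinner (lv n x h) u = 0}"
    unfolding summand_def'
    by (rule clspan_minimal)
      (use assms in \<open>auto simp: csubspace_iff cinner_simps lv_orth intro!: closed_Collect_eq continuous_intros\<close>)
  with assms show ?thesis by blast
qed

definition P :: "nat \<Rightarrow> 'k cop"
  where "P n = proj (summand X t n)"

lemma P_in: "P n \<cdot> u \<in> summand X t n"
  unfolding P_def by (rule proj_in[OF summand_csubspace summand_closed])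

lemma P_id: "u \<in> summand X t n \<Longrightarrow> P n \<cdot> u = u"
  unfolding P_def by (rule proj_id[OF summand_csubspace summand_closed])

lemma P_star: "star (P n) = P n"
  unfolding P_def by (rule star_proj[OF summand_csubspace summand_closed])

lemma P_summand:
  assumes "u \<in> summand X t m"
  shows "P n \<cdot> u = (if n = m then u else 0)"
proof (cases "n = m")
  case False
  have "P n \<cdot> u = 0"
    unfolding P_def
  proof (rule proj_zero[OF summand_csubspace summand_closed])
    fix q assume "q \<in> summand X t n"
    moreover have "summand X t n \<subseteq> {q. cinner q u = 0}"
      unfolding summand_def'
      by (rule clspan_minimal)
        (use False assms summand_orth in \<open>auto simp: csubspace_iff cinner_simps intro!: closed_Collect_eq continuous_intros\<close>)
    ultimately show "cinner q u = 0" by blast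
  qed
  with False show ?thesis by simp
qed (use assms P_id in simp)

lemma P_lv: "x \<in> carr (X m) \<Longrightarrow> P n \<cdot> lv m x h = (if n = m then lv m x h else 0)"
  by (rule P_summand[OF lv_in_summand])

lemma P_P: "P n \<cdot> (P m \<cdot> u) = (if n = m then P m \<cdot> u else 0)"
  by (rule P_summand[OF P_in])

lemma P_cinner: "cinner (P n \<cdot> u) v = cinner u (P n \<cdot> v)"
  using cinner_star_left[of "P n" u v] by (simp add: P_star)

lemma P_orth: "n \<noteq> m \<Longrightarrow> cinner (P n \<cdot> u) (P m \<cdot> v) = 0"
  by (simp add: P_cinner P_P)

lemma P_bessel: "(\<Sum>n<N. (norm (P n \<cdot> u))\<^sup>2) \<le> (norm u)\<^sup>2"
proof -
  define s where "s = (\<Sum>n<N. P n \<cdot> u)"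
  have 1: "(norm s)\<^sup>2 = (\<Sum>n<N. (norm (P n \<cdot> u))\<^sup>2)"
    unfolding s_def by (rule norm_sum_orthogonal) (auto simp: P_orth)
  have "cinner (P n \<cdot> u) u = cinner (P n \<cdot> u) (P n \<cdot> u)" for n
    using P_cinner[of n "P n \<cdot> u" u] by (simp add: P_P)
  then have "cinner s u = of_real (\<Sum>n<N. (norm (P n \<cdot> u))\<^sup>2)"
    by (simp add: s_def cinner_sum_left cinner_self)
  then have "(norm s)\<^sup>2 = Re (cinner s u)" using 1 by simp
  also have "\<dots> \<le> norm s * norm u" using cmod_cinner_le complex_Re_le_cmod order_trans by blast
  finally have "norm s \<le> norm u" by (cases "s = 0") (auto simp: power2_eq_square)
  then show ?thesis using 1 by (metis norm_ge_zero power_mono)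
qed

lemma P_sums: "(\<lambda>n. P n \<cdot> u) sums u"
proof -
  have "summable (\<lambda>n. P n \<cdot> u)"
    by (rule orthogonal_summable) (auto simp: P_orth intro: P_bessel)
  then obtain v where v: "(\<lambda>n. P n \<cdot> u) sums v" by (auto simp: summable_def)
  have "u = v"
  proof (rule K_eqI)
    fix n x h assume x: "x \<in> carr (X n)"
    have "(\<lambda>m. cinner (lv n x h) (P m \<cdot> u)) sums cinner (lv n x h) v"
      using v unfolding sums_def cinner_sum_right[symmetric] by (intro tendsto_cinner tendsto_const)
    moreover have "(\<lambda>m. cinner (lv n x h) (P m \<cdot> u)) sums (\<Sum>m\<in>{n}. cinner (lv n x h) (P m \<cdot> u))"
      by (rule sums_finite) (auto simp: P_cinner[symmetric] P_lv[OF x])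
    then have "(\<lambda>m. cinner (lv n x h) (P m \<cdot> u)) sums cinner (lv n x h) u"
      by (simp add: P_cinner[symmetric] P_lv[OF x])
    ultimately show "cinner (lv n x h) u = cinner (lv n x h) v" by (rule sums_unique2[rotated])
  qed
  with v show ?thesis by simp
qed

lemma P_eqI: "(\<And>n. P n \<cdot> u = P n \<cdot> v) \<Longrightarrow> u = v"
  using P_sums[of u] P_sums[of v] sums_unique2 by simp

lemma P_t: "x \<in> carr F \<Longrightarrow> P n \<cdot> t x h = lv n (x n) h"
proof -
  assume x: "x \<in> carr F"
  have "(\<lambda>N. P n \<cdot> (\<Sum>m<N. lv m (x m) h)) \<longlonglongrightarrow> P n \<cdot> t x h"
    using fock_decomp[OF x, of h] unfolding sums_def by (intro tendsto_capp tendsto_const)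
  then have "(\<lambda>m. P n \<cdot> lv m (x m) h) sums (P n \<cdot> t x h)" by (simp add: sums_def capp_sum_right)
  moreover have "(\<lambda>m. P n \<cdot> lv m (x m) h) sums (\<Sum>m\<in>{n}. P n \<cdot> lv m (x m) h)"
    by (rule sums_finite) (auto simp: P_lv fock_nth[OF x])
  then have "(\<lambda>m. P n \<cdot> lv m (x m) h) sums lv n (x n) h" by (simp add: P_lv fock_nth[OF x])
  ultimately show ?thesis by (rule sums_unique2)
qed

end

section \<open>The induced representation of the tensor algebra\<close>

context fock_representation
begin

text \<open>The index set of \<open>gram_extension\<close> consists of the simple tensors in all
  degrees. \<open>A\<close> and \<open>B\<close> describe how the prospective
  \<open>T\<^sup>* T\<close> acts on the module factor and on the Hilbert space factor.\<close>

lemma gram_extension_lv: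
  assumes A: "\<And>n x. x \<in> carr (X n) \<Longrightarrow> A n x \<in> carr (X n)"
    and gram: "\<And>n m x y h k. x \<in> carr (X n) \<Longrightarrow> y \<in> carr (X m) \<Longrightarrow>
      cinner (e' n x h) (e' m y k) = cinner (lv n x h) (lv m (A m y) (B k))"
    and sym: "\<And>n m x y h k. x \<in> carr (X n) \<Longrightarrow> y \<in> carr (X m) \<Longrightarrow>
      cinner (lv n (A n x) (B h)) (lv m y k) = cinner (lv n x h) (lv m (A m y) (B k))"
    and growth: "\<And>n x h. x \<in> carr (X n) \<Longrightarrow> \<exists>c. \<forall>i. norm (lv n ((A n ^^ i) x) ((B ^^ i) h)) \<le> c * C ^ i"
    and C: "0 < C"
  shows "\<exists>T. (\<forall>n x h. x \<in> carr (X n) \<longrightarrow> T \<cdot> lv n x h = e' n x h) \<and> norm T \<le> sqrt C"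
proof -
  define I :: "(nat \<times> 't \<times> 'h) set" where "I = {(n, x, h). x \<in> carr (X n)}"
  define \<alpha> where "\<alpha> = (\<lambda>(n, x, h). (n, A n x, B h))"
  have \<alpha>n: "(\<alpha> ^^ i) (n, x, h) = (n, (A n ^^ i) x, (B ^^ i) h)" for i n x h
    by (induction i) (auto simp: \<alpha>_def)
  have "\<exists>T. (\<forall>i\<in>I. T \<cdot> (\<lambda>(n, x, h). lv n x h) i = (\<lambda>(n, x, h). e' n x h) i) \<and> norm T \<le> sqrt C"
  proof (rule gram_extension[where \<alpha> = \<alpha>])
    have "(\<lambda>(n, x, h). lv n x h) ` I = {lv n x h | n x h. x \<in> carr (X n)}" by (force simp: I_def)
    then show "clspan ((\<lambda>(n, x, h). lv n x h) ` I) = UNIV" using lv_total by simp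
    show "\<exists>c. \<forall>m. norm ((\<lambda>(n, x, h). lv n x h) ((\<alpha> ^^ m) i)) \<le> c * C ^ m" if "i \<in> I" for i
      using that growth by (cases i) (auto simp: I_def \<alpha>n)
  qed (use A gram sym C in \<open>auto simp: I_def \<alpha>_def\<close>)
  then show ?thesis by (auto simp: I_def)
qed

lemma lv_\<psi>_adj:
  "x \<in> carr (X n) \<Longrightarrow> y \<in> carr (X m) \<Longrightarrow>
    cinner (lv n (\<psi> n a x) h) (lv m y k) = cinner (lv n x h) (lv m (\<psi> m (star a) y) k)"
  by (auto simp: lv_cinner \<psi>_closed \<psi>_star)

lemma lv_diff_left: "x \<in> carr (X n) \<Longrightarrow> y \<in> carr (X n) \<Longrightarrow> lv n (x - y) h = lv n x h - lv n y h"
  using lv_add_left[of "x - y" n y h] Xm.carr_diff by simp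

text \<open>The difference of squares from \<open>rep_contractive\<close>, carried out on one simple
  tensor. It has to precede the operator \<open>Th a\<close>, whose construction takes its growth
  bound from here.\<close>

lemma \<psi>_norm_le:
  assumes x: "x \<in> carr (X n)"
  shows "norm (lv n (\<psi> n a x) h) \<le> norm a * norm (lv n x h)"
proof (cases "a = 0")
  case True then show ?thesis by (simp add: \<psi>_zero x lv_zero)
next
  case False
  define b where "b = (1 / norm a) *\<^sub>R a"
  have "norm b = 1" using False by (simp add: b_def)
  then have "norm (star b * b) \<le> 1" by (simp add: norm_star_mult)
  then obtain y where y: "(1 - y) * (1 - y) = 1 - star b * b" "star y = y"
    using cstar_sqrt[of "star b * b"] by (auto simp: star_mult star_star)
  have sq: "(norm (lv n (\<psi> n c x) h))\<^sup>2 = Re (cinner (lv n x h) (lv n (\<psi> n (star c * c) x) h))" for c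
    by (simp add: norm_sq_cinner lv_\<psi>_adj \<psi>_closed x \<psi>_mult)
  have "star b * b = 1 - star (1 - y) * (1 - y)" using y by (simp add: star_diff)
  then have "(norm (lv n (\<psi> n b x) h))\<^sup>2 = (norm (lv n x h))\<^sup>2 - (norm (lv n (\<psi> n (1 - y) x) h))\<^sup>2"
    unfolding sq by (simp only: \<psi>_diff[OF x] \<psi>_one[OF x] lv_diff_left[OF x \<psi>_closed[OF x]] cinner_diff_right)
      (simp add: norm_sq_cinner)
  also have "\<dots> \<le> (norm (lv n x h))\<^sup>2" by simp
  finally have "norm (lv n (\<psi> n b x) h) \<le> norm (lv n x h)" by (rule power2_le_imp_le) simp
  moreover have "\<psi> n b x = of_real (1 / norm a) *\<^sub>C \<psi> n a x"
    unfolding b_def scaleR_scaleC' by (rule \<psi>_scaleC[OF x])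
  ultimately show ?thesis
    using False by (simp add: lv_scaleC_left \<psi>_closed x norm_scaleC norm_divide field_simps)
qed

lemma \<psi>_pow_norm_le:
  assumes x: "x \<in> carr (X n)"
  shows "(\<psi> n a ^^ i) x \<in> carr (X n) \<and> norm (lv n ((\<psi> n a ^^ i) x) h) \<le> norm (lv n x h) * norm a ^ i"
proof (induction i)
  case (Suc i)
  have "norm (lv n (\<psi> n a ((\<psi> n a ^^ i) x)) h) \<le> norm a * (norm (lv n x h) * norm a ^ i)"
    using Suc by (intro order_trans[OF \<psi>_norm_le] mult_left_mono) auto
  with Suc show ?case by (simp add: \<psi>_closed ac_simps)
qed (simp add: x)

text \<open>The operator \<open>\<phi>\<^sub>\<infinity>(a) \<otimes> I\<close>.\<close>

definition Th :: "'m \<Rightarrow> 'k cop"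
  where "Th a = (SOME T. (\<forall>n x h. x \<in> carr (X n) \<longrightarrow> T \<cdot> lv n x h = lv n (\<psi> n a x) h) \<and> norm T \<le> norm a)"

lemma Th_props: "(\<forall>n x h. x \<in> carr (X n) \<longrightarrow> Th a \<cdot> lv n x h = lv n (\<psi> n a x) h) \<and> norm (Th a) \<le> norm a"
proof -
  have "\<exists>T. (\<forall>n x h. x \<in> carr (X n) \<longrightarrow> T \<cdot> lv n x h = lv n (\<psi> n a x) h) \<and> norm T \<le> norm a"
  proof (cases "a = 0")
    case True then show ?thesis by (intro exI[of _ 0]) (simp add: \<psi>_zero lv_zero)
  next
    case False
    have "\<exists>T. (\<forall>n x h. x \<in> carr (X n) \<longrightarrow> T \<cdot> lv n x h = lv n (\<psi> n a x) h) \<and> norm T \<le> sqrt ((norm a)\<^sup>2)"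
    proof (rule gram_extension_lv[where A = "\<lambda>n. \<psi> n (star a * a)" and B = "\<lambda>h. h"])
      fix n x and h :: 'h assume x: "x \<in> carr (X n)"
      have "((\<lambda>h. h) ^^ i) h = h" for i by (induction i) auto
      then show "\<exists>c. \<forall>i. norm (lv n ((\<psi> n (star a * a) ^^ i) x) (((\<lambda>h. h) ^^ i) h)) \<le> c * ((norm a)\<^sup>2) ^ i"
        using \<psi>_pow_norm_le[OF x, where a = "star a * a"] by (auto simp: norm_star_mult)
    qed (use False in \<open>auto simp: \<psi>_closed lv_\<psi>_adj \<psi>_mult star_mult star_star\<close>)
    then show ?thesis by simp
  qed
  then show ?thesis unfolding Th_def by (rule someI_ex)
qed

lemma Th_lv: "x \<in> carr (X n) \<Longrightarrow> Th a \<cdot> lv n x h = lv n (\<psi> n a x) h"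
  and Th_norm_le: "norm (Th a) \<le> norm a"
  using Th_props by auto

lemma Th_add: "Th (a + b) = Th a + Th b"
  by (rule cop_lv_eqI) (simp add: Th_lv capp_simps \<psi>_add lv_add_left \<psi>_closed)

lemma Th_scaleC: "Th (c *\<^sub>C a) = c *\<^sub>C Th a"
  by (rule cop_lv_eqI) (simp add: Th_lv capp_simps \<psi>_scaleC lv_scaleC_left \<psi>_closed)

lemma Th_mult: "Th (a * b) = Th a * Th b"
  by (rule cop_lv_eqI) (simp add: Th_lv capp_simps \<psi>_mult \<psi>_closed)

lemma Th_one: "Th 1 = 1"
  by (rule cop_lv_eqI) (simp add: Th_lv \<psi>_one)

lemma Th_star: "Th (star a) = star (Th a)"
proof (rule cop_lv_eqI, rule K_eqI)
  fix n x h m y k assume "x \<in> carr (X n)" "y \<in> carr (X m)"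
  then show "cinner (lv m y k) (Th (star a) \<cdot> lv n x h) = cinner (lv m y k) (star (Th a) \<cdot> lv n x h)"
    by (simp add: cinner_star_right Th_lv lv_\<psi>_adj)
qed

lemma P_Th: "P n * Th a = Th a * P n"
  by (rule cop_lv_eqI) (simp add: capp_mult Th_lv P_lv \<psi>_closed)

text \<open>The operator \<open>T\<^sub>\<xi> \<otimes> I\<close> for \<open>\<xi>\<close> of degree
  \<open>j\<close>, on all summands at once. It is built directly on \<open>'k\<close>; its
  agreement with the amplified creation operator is proved at the end.\<close>

definition Lam :: "nat \<Rightarrow> 't \<Rightarrow> 'k cop"
  where "Lam j \<xi> = (SOME T. (\<forall>n x h. x \<in> carr (X n) \<longrightarrow> T \<cdot> lv n x h = lv (j + n) (\<tau> j n \<xi> x) h)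
    \<and> norm T \<le> hnorm (X j) \<xi>)"

lemma Lam_props:
  assumes \<xi>: "\<xi> \<in> carr (X j)"
  shows "(\<forall>n x h. x \<in> carr (X n) \<longrightarrow> Lam j \<xi> \<cdot> lv n x h = lv (j + n) (\<tau> j n \<xi> x) h) \<and> norm (Lam j \<xi>) \<le> hnorm (X j) \<xi>"
proof -
  let ?a = "ip (X j) \<xi> \<xi>"
  have "\<exists>T. (\<forall>n x h. x \<in> carr (X n) \<longrightarrow> T \<cdot> lv n x h = lv (j + n) (\<tau> j n \<xi> x) h) \<and> norm T \<le> hnorm (X j) \<xi>"
  proof (cases "?a = 0")
    case True
    then have "\<xi> = 0" using Xm.ip_definite \<xi> by blast
    then show ?thesis by (intro exI[of _ 0]) (simp add: \<tau>_zero_left lv_zero hnorm_def)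
  next
    case False
    have sa: "star ?a = ?a" using Xm.ip_star \<xi> by blast
    have "\<exists>T. (\<forall>n x h. x \<in> carr (X n) \<longrightarrow> T \<cdot> lv n x h = lv (j + n) (\<tau> j n \<xi> x) h) \<and> norm T \<le> sqrt (norm ?a)"
    \<comment> \<open>This choice of \<open>A\<close> anticipates that the product of the adjoint of
      \<open>Lam j \<xi>\<close> with \<open>Lam j \<xi>\<close> is left multiplication by
      \<open>\<langle>\<xi>, \<xi>\<rangle>\<close>.\<close>
    proof (rule gram_extension_lv[where A = "\<lambda>n. \<psi> n ?a" and B = "\<lambda>h. h"])
      fix n x and h :: 'h assume x: "x \<in> carr (X n)"
      have "((\<lambda>h. h) ^^ i) h = h" for i by (induction i) auto
      then show "\<exists>c. \<forall>i. norm (lv n ((\<psi> n ?a ^^ i) x) (((\<lambda>h. h) ^^ i) h)) \<le> c * (norm ?a) ^ i"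
        using \<psi>_pow_norm_le[OF x, where a = ?a] by auto
    next
      fix n m x y h k assume "x \<in> carr (X n)" "y \<in> carr (X m)"
      then show "cinner (lv (j + n) (\<tau> j n \<xi> x) h) (lv (j + m) (\<tau> j m \<xi> y) k) = cinner (lv n x h) (lv m (\<psi> m ?a y) k)"
        by (auto simp: lv_cinner \<tau>_closed \<psi>_closed \<tau>_ip \<xi>)
    qed (use False in \<open>auto simp: \<psi>_closed lv_\<psi>_adj sa\<close>)
    then show ?thesis by (simp add: hnorm_def)
  qed
  then show ?thesis unfolding Lam_def by (rule someI_ex)
qed

lemma Lam_lv: "\<xi> \<in> carr (X j) \<Longrightarrow> x \<in> carr (X n) \<Longrightarrow> Lam j \<xi> \<cdot> lv n x h = lv (j + n) (\<tau> j n \<xi> x) h"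
  and Lam_norm_le: "\<xi> \<in> carr (X j) \<Longrightarrow> norm (Lam j \<xi>) \<le> hnorm (X j) \<xi>"
  using Lam_props by auto

lemma Lam_add: "\<xi> \<in> carr (X j) \<Longrightarrow> \<eta> \<in> carr (X j) \<Longrightarrow> Lam j (\<xi> + \<eta>) = Lam j \<xi> + Lam j \<eta>"
  by (rule cop_lv_eqI) (simp add: Lam_lv capp_simps \<tau>_add_left lv_add_left \<tau>_closed Xm.carr_add)

lemma Lam_scaleC: "\<xi> \<in> carr (X j) \<Longrightarrow> Lam j (c *\<^sub>C \<xi>) = c *\<^sub>C Lam j \<xi>"
  by (rule cop_lv_eqI) (simp add: Lam_lv capp_simps \<tau>_scaleC_left lv_scaleC_left \<tau>_closed Xm.carr_scaleC)

lemma Lam_act: "\<xi> \<in> carr (X j) \<Longrightarrow> Lam j (act (X j) \<xi> a) = Lam j \<xi> * Th a"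
  by (rule cop_lv_eqI) (simp add: Lam_lv Th_lv capp_simps \<tau>_balanced \<psi>_closed Xm.act_closed)

lemma Lam_Lam: "\<xi> \<in> carr (X i) \<Longrightarrow> \<eta> \<in> carr (X j) \<Longrightarrow> Lam i \<xi> * Lam j \<eta> = Lam (i + j) (\<tau> i j \<xi> \<eta>)"
  by (rule cop_lv_eqI) (simp add: Lam_lv capp_simps \<tau>_closed pow.tensor_assoc add.assoc)

lemma Lam_zero: "Lam j 0 = 0"
  using Lam_scaleC[of 0 j 0] Xm.carr_zero by simp

lemma Lam_\<iota>: "Lam 0 (\<iota> a) = Th a"
  by (rule cop_lv_eqI) (simp add: Lam_lv Th_lv \<iota>_closed pow.tensor_unit_left)

lemma Lam_star_Lam:
  assumes "\<eta> \<in> carr (X j)" "\<xi> \<in> carr (X j)"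
  shows "star (Lam j \<eta>) * Lam j \<xi> = Th (ip (X j) \<eta> \<xi>)"
proof (rule cop_lv_eqI, rule K_eqI)
  fix n x h m y k assume "x \<in> carr (X n)" "y \<in> carr (X m)"
  with assms show "cinner (lv m y k) ((star (Lam j \<eta>) * Lam j \<xi>) \<cdot> lv n x h) = cinner (lv m y k) (Th (ip (X j) \<eta> \<xi>) \<cdot> lv n x h)"
    by (auto simp: capp_mult cinner_star_right Th_lv Lam_lv lv_cinner \<tau>_closed \<psi>_closed \<tau>_ip)
qed

lemma P_Lam: "\<xi> \<in> carr (X j) \<Longrightarrow> P (j + n) * Lam j \<xi> = Lam j \<xi> * P n"
  by (rule cop_lv_eqI) (simp add: capp_mult Lam_lv P_lv \<tau>_closed)

lemma P_Lam_P: "\<xi> \<in> carr (X j) \<Longrightarrow> P m \<cdot> (Lam j \<xi> \<cdot> (P n \<cdot> u)) = (if m = j + n then Lam j \<xi> \<cdot> (P n \<cdot> u) else 0)"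
  using P_P[of m "j + n" "Lam j \<xi> \<cdot> u"] arg_cong[OF P_Lam[of \<xi> j n], of "\<lambda>T. T \<cdot> u"] by (simp add: capp_mult)

lemma lv_act:
  assumes "x \<in> carr (X n)"
  shows "lv n (act (X n) x a) h = lv n x (\<pi> a h)"
proof (rule K_eqI)
  fix m y k assume "y \<in> carr (X m)"
  with assms show "cinner (lv m y k) (lv n (act (X n) x a) h) = cinner (lv m y k) (lv n x (\<pi> a h))"
    by (auto simp: lv_cinner Xm.act_closed Xm.ip_act rep.rep_mult)
qed

lemma Pi_commutant_star:
  assumes "\<And>a. C * Pi a = Pi a * C"
  shows "star C * Pi a = Pi a * star C"
  using arg_cong[OF assms[of "star a"], of star] by (simp add: star_mult Pi.rep_star star_star)

text \<open>The operator \<open>I \<otimes> C\<close>, meaningful for \<open>C\<close> in the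
  commutant of \<open>\<pi>(M)\<close>.\<close>

definition amp :: "'h cop \<Rightarrow> 'k cop"
  where "amp C = (SOME T. \<forall>n x h. x \<in> carr (X n) \<longrightarrow> T \<cdot> lv n x h = lv n x (C \<cdot> h))"

lemma amp_lv:
  assumes C: "\<And>a. C * Pi a = Pi a * C" and x: "x \<in> carr (X n)"
  shows "amp C \<cdot> lv n x h = lv n x (C \<cdot> h)"
proof -
  have comm: "C \<cdot> \<pi> a h = \<pi> a (C \<cdot> h)" "star C \<cdot> \<pi> a h = \<pi> a (star C \<cdot> h)" for a h
    using arg_cong[OF C[of a], of "\<lambda>T. T \<cdot> h"] arg_cong[OF Pi_commutant_star[OF C, of a], of "\<lambda>T. T \<cdot> h"]
    by (simp_all add: capp_mult)
  \<comment> \<open>The summand 1 keeps the growth rate positive even when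
    \<open>C = 0\<close>.\<close>
  have "\<exists>T. (\<forall>n x h. x \<in> carr (X n) \<longrightarrow> T \<cdot> lv n x h = lv n x (C \<cdot> h)) \<and> norm T \<le> sqrt (norm (star C * C) + 1)"
  proof (rule gram_extension_lv[where A = "\<lambda>n x. x" and B = "\<lambda>h. (star C * C) \<cdot> h"])
    fix n x h assume x: "x \<in> carr (X n)"
    have "norm (((\<lambda>h. (star C * C) \<cdot> h) ^^ i) h) \<le> norm h * norm (star C * C) ^ i" for i
    proof (induction i)
      case (Suc i)
      have "norm ((star C * C) \<cdot> (((\<lambda>h. (star C * C) \<cdot> h) ^^ i) h)) \<le> norm (star C * C) * (norm h * norm (star C * C) ^ i)"
        by (rule order_trans[OF capp_norm_le mult_left_mono[OF Suc]]) simp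
      then show ?case by (simp add: ac_simps)
    qed simp
    moreover have "norm h * norm (star C * C) ^ i \<le> norm h * (norm (star C * C) + 1) ^ i" for i
      by (intro mult_left_mono power_mono) auto
    ultimately have "norm (((\<lambda>h. (star C * C) \<cdot> h) ^^ i) h) \<le> norm h * (norm (star C * C) + 1) ^ i" for i
      using order_trans by blast
    then have *: "norm (lv n x (((\<lambda>h. (star C * C) \<cdot> h) ^^ i) h)) \<le> hnorm (X n) x * (norm h * (norm (star C * C) + 1) ^ i)" for i
      by (intro order_trans[OF lv_norm_le[OF x]] mult_left_mono) (auto simp: hnorm_def)
    have "((\<lambda>x. x) ^^ i) x = x" for i by (induction i) auto
    then show "\<exists>c. \<forall>i. norm (lv n (((\<lambda>x. x) ^^ i) x) (((\<lambda>h. (star C * C) \<cdot> h) ^^ i) h)) \<le> c * (norm (star C * C) + 1) ^ i"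
      using * by (intro exI[of _ "hnorm (X n) x * norm h"]) (simp add: mult.assoc)
  qed (auto simp: lv_cinner capp_mult cinner_star_left cinner_star_right comm add_nonneg_pos
      cinner_star_left[of "star C", unfolded star_star])
  then have "\<exists>T. \<forall>n x h. x \<in> carr (X n) \<longrightarrow> T \<cdot> lv n x h = lv n x (C \<cdot> h)" by blast
  then have "\<forall>n x h. x \<in> carr (X n) \<longrightarrow> amp C \<cdot> lv n x h = lv n x (C \<cdot> h)" unfolding amp_def by (rule someI_ex)
  with x show ?thesis by blast
qed

lemma star_amp:
  assumes C: "\<And>a. C * Pi a = Pi a * C"
  shows "star (amp C) = amp (star C)"
proof (rule cop_lv_eqI, rule K_eqI)
  fix n x h m y k assume xy: "x \<in> carr (X n)" "y \<in> carr (X m)"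
  have "C \<cdot> \<pi> a h = \<pi> a (C \<cdot> h)" for a h
    using arg_cong[OF C[of a], of "\<lambda>T. T \<cdot> h"] by (simp add: capp_mult)
  moreover have "star C \<cdot> \<pi> a h = \<pi> a (star C \<cdot> h)" for a h
    using arg_cong[OF Pi_commutant_star[OF C, of a], of "\<lambda>T. T \<cdot> h"] by (simp add: capp_mult)
  ultimately show "cinner (lv m y k) (star (amp C) \<cdot> lv n x h) = cinner (lv m y k) (amp (star C) \<cdot> lv n x h)"
    using xy by (simp add: cinner_star_right amp_lv[OF C] amp_lv[OF Pi_commutant_star[OF C]] lv_cinner)
      (metis cinner_star_right)
qed

text \<open>An operator commuting with \<open>I \<otimes> \<pi>(M)'\<close> comes from module elements: its matrix coefficients lie in
  \<open>\<pi>(M)'' = \<pi>(M)\<close>, and self-duality applies.\<close>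

lemma intertwiner_module_element:
  assumes Z: "\<And>C. (\<And>a. C * Pi a = Pi a * C) \<Longrightarrow> Z * amp C = amp C * Z" and x: "x \<in> carr (X n)"
  shows "\<exists>z\<in>carr (X m). \<forall>h. P m \<cdot> (Z \<cdot> lv n x h) = lv m z h"
proof -
  define c where "c = norm Z * hnorm (X n) x"
  have c0: "0 \<le> c" by (simp add: c_def hnorm_def)
  have Zx: "norm (Z \<cdot> lv n x k) \<le> c * norm k" for k
  proof -
    have "norm (Z \<cdot> lv n x k) \<le> norm Z * (hnorm (X n) x * norm k)"
      by (rule order_trans[OF capp_norm_le]) (intro mult_left_mono lv_norm_le x, simp)
    then show ?thesis by (simp add: c_def mult.assoc)
  qed
  have "\<exists>b. (\<forall>h k. cinner h (\<pi> b k) = cinner (lv m y h) (Z \<cdot> lv n x k)) \<and> norm b \<le> 8 * (c * hnorm (X m) y)"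
    if y: "y \<in> carr (X m)" for y
  proof -
    have bound: "cmod (cinner (Z \<cdot> lv n x k) (lv m y h)) \<le> c * hnorm (X m) y * norm k * norm h" for h k
    proof -
      have "cmod (cinner (Z \<cdot> lv n x k) (lv m y h)) \<le> (c * norm k) * (hnorm (X m) y * norm h)"
        by (rule order_trans[OF cmod_cinner_le]) (intro mult_mono Zx lv_norm_le y, use c0 in auto)
      then show ?thesis by (simp add: ac_simps)
    qed
    have "\<exists>z. \<forall>h. cinner (Z \<cdot> lv n x k) (lv m y h) = cinner z h" for k
      by (rule riesz_representation[OF _ _ bound]) (simp_all add: lv_add_right lv_scaleC_right y cinner_simps)
    then obtain f where f: "\<And>k h. cinner (Z \<cdot> lv n x k) (lv m y h) = cinner (f k) h" by metis
    have f': "cinner h (f k) = cinner (lv m y h) (Z \<cdot> lv n x k)" for h k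
      using f by (metis cinner_commute)
    have cy0: "0 \<le> c * hnorm (X m) y" using c0 by (simp add: hnorm_def)
    have fle: "norm (f k) \<le> c * hnorm (X m) y * norm k" for k
    proof (cases "f k = 0")
      case False
      have "norm (f k) * norm (f k) = cmod (cinner (f k) (f k))" by (simp add: cinner_self power2_eq_square norm_mult)
      also have "\<dots> \<le> c * hnorm (X m) y * norm k * norm (f k)" using bound[of k "f k"] by (simp add: f)
      finally show ?thesis using False by simp
    qed (use cy0 in simp)
    have "\<exists>B. \<forall>k. B \<cdot> k = f k"
      by (rule cop_exists[OF _ _ fle])
        (rule cinner_eqI, simp add: f' lv_add_right lv_scaleC_right x capp_simps cinner_simps)+
    then obtain B where B: "\<And>k. B \<cdot> k = f k" by blast
    have "\<exists>b. Pi b = B \<and> norm b \<le> 8 * norm B"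
    proof (rule Pi_double_commutant)
      fix C assume C: "\<And>a. C * Pi a = Pi a * C"
      note C' = Pi_commutant_star[OF C]
      show "B * C = C * B"
      proof (rule cop_eqI, rule cinner_eqI)
        fix k h
        have "cinner h ((B * C) \<cdot> k) = cinner (lv m y h) (Z \<cdot> (amp C \<cdot> lv n x k))"
          by (simp add: capp_mult B f' amp_lv[OF C x])
        also have "\<dots> = cinner (lv m y h) (amp C \<cdot> (Z \<cdot> lv n x k))"
          using Z[OF C] by (metis capp_mult)
        also have "\<dots> = cinner (lv m y (star C \<cdot> h)) (Z \<cdot> lv n x k)"
          using cinner_star_left[of "amp C" "lv m y h"] by (simp add: star_amp[OF C] amp_lv[OF C' y])
        also have "\<dots> = cinner h ((C * B) \<cdot> k)"
          by (simp add: f'[symmetric] cinner_star_left capp_mult B)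
        finally show "cinner h ((B * C) \<cdot> k) = cinner h ((C * B) \<cdot> k)" .
      qed
    qed
    then obtain b where b: "Pi b = B" "norm b \<le> 8 * norm B" by blast
    have "norm B \<le> c * hnorm (X m) y" using fle cy0 by (intro cop_norm_leI) (auto simp: B)
    moreover have "\<pi> b k = f k" for k using b(1) B Pi_app by metis
    ultimately show ?thesis using b(2) f' by (intro exI[of _ b]) auto
  qed
  then obtain b where b: "\<And>y h k. y \<in> carr (X m) \<Longrightarrow> cinner h (\<pi> (b y) k) = cinner (lv m y h) (Z \<cdot> lv n x k)"
    "\<And>y. y \<in> carr (X m) \<Longrightarrow> norm (b y) \<le> 8 * (c * hnorm (X m) y)" by metis
  \<comment> \<open>The coefficient \<open>b y\<close> is to be the inner product of
    \<open>y\<close> with the unknown vector, hence conjugate linear in \<open>y\<close>; its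
    adjoint is the module map to which self-duality applies.\<close>
  have "bounded_module_map (X m) (\<lambda>y. star (b y))"
    unfolding bounded_module_map_def
  proof (intro conjI ballI allI exI)
    fix y z assume yz: "y \<in> carr (X m)" "z \<in> carr (X m)"
    have "b (y + z) = b y + b z"
      by (rule eq_if_forms_eq) (simp add: rep.rep_add b yz Xm.carr_add lv_add_left cinner_simps)
    then show "star (b (y + z)) = star (b y) + star (b z)" by (simp add: star_add)
  next
    fix y d assume y: "y \<in> carr (X m)"
    have "b (d *\<^sub>C y) = cnj d *\<^sub>C b y"
      by (rule eq_if_forms_eq) (simp add: rep.rep_scaleC b y Xm.carr_scaleC lv_scaleC_left cinner_simps)
    then show "star (b (d *\<^sub>C y)) = d *\<^sub>C star (b y)" by (simp add: star_scaleC)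
  next
    fix y a assume y: "y \<in> carr (X m)"
    have "b (act (X m) y a) = star a * b y"
    proof (rule eq_if_forms_eq)
      fix h k
      have "cinner h (\<pi> (star a) (\<pi> (b y) k)) = cinner (\<pi> a h) (\<pi> (b y) k)"
        using rep.rep_star[of a] by simp
      then show "cinner h (\<pi> (b (act (X m) y a)) k) = cinner h (\<pi> (star a * b y) k)"
        by (simp add: b y Xm.act_closed lv_act rep.rep_mult)
    qed
    then show "star (b (act (X m) y a)) = star (b y) * a" by (simp add: star_mult star_star)
  next
    fix y assume "y \<in> carr (X m)"
    then show "norm (star (b y)) \<le> (8 * c) * hnorm (X m) y" using b(2) by (simp add: mult.assoc)
  qed
  then obtain z where z: "z \<in> carr (X m)" "\<And>y. y \<in> carr (X m) \<Longrightarrow> star (b y) = ip (X m) z y"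
    using Xm.self_dual by blast
  have bz: "b y = ip (X m) y z" if "y \<in> carr (X m)" for y
    using z(2)[OF that] Xm.ip_star[OF z(1) that] by (metis star_star)
  have "P m \<cdot> (Z \<cdot> lv n x h) = lv m z h" for h
  proof (rule K_eqI)
    fix m' y k assume y: "y \<in> carr (X m')"
    have "cinner (lv m' y k) (P m \<cdot> (Z \<cdot> lv n x h)) = cinner (P m \<cdot> lv m' y k) (Z \<cdot> lv n x h)"
      by (simp add: P_cinner)
    also have "\<dots> = cinner (lv m' y k) (lv m z h)"
      using b(1)[of y k h] bz y z(1) by (auto simp: P_lv lv_cinner)
    finally show "cinner (lv m' y k) (P m \<cdot> (Z \<cdot> lv n x h)) = cinner (lv m' y k) (lv m z h)" .
  qed
  with z(1) show ?thesis by blast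
qed

text \<open>Sigma density of simple tensors in the module becomes norm density in the Hilbert space.
  The projection \<open>1 - Q\<close> commutes with \<open>I \<otimes> \<pi>(M)'\<close>, so it
  carries \<open>x \<otimes> h\<close> to \<open>z \<otimes> h\<close> with one module element
  \<open>z\<close> for all \<open>h\<close>; this \<open>z\<close> is orthogonal to all simple
  tensors, hence zero.\<close>

lemma simple_tensors_total:
  "clspan {lv (1 + k) (\<tau> 1 k u v) h | u v h. u \<in> carr (X 1) \<and> v \<in> carr (X k)} = summand X t (1 + k)"
proof
  let ?n = "1 + k"
  let ?D = "{lv ?n (\<tau> 1 k u v) h | u v h. u \<in> carr (X 1) \<and> v \<in> carr (X k)}"
  define V where "V = clspan ?D"
  have V: "csubspace V" "closed V" unfolding V_def by (auto intro: csubspace_clspan)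
  have VD: "lv ?n (\<tau> 1 k u v) h \<in> V" if "u \<in> carr (X 1)" "v \<in> carr (X k)" for u v h
    unfolding V_def by (rule clspan_base) (use that in blast)
  show sub: "clspan ?D \<subseteq> summand X t ?n"
    by (rule clspan_minimal[OF _ summand_csubspace summand_closed]) (use lv_in_summand \<tau>_closed[of _ 1 _ k] in blast)
  define Q where "Q = proj V"
  have inv: "amp C \<cdot> w \<in> V" if C: "\<And>a. C * Pi a = Pi a * C" and w: "w \<in> V" for C w
  proof -
    have "V \<subseteq> {w. amp C \<cdot> w \<in> V}"
      unfolding V_def
    proof (rule clspan_minimal)
      show "?D \<subseteq> {w. amp C \<cdot> w \<in> clspan ?D}"
        using amp_lv[OF C] \<tau>_closed[of _ 1 _ k] VD[unfolded V_def] by auto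
      show "csubspace {w. amp C \<cdot> w \<in> clspan ?D}"
        using csubspace_clspan[of ?D] by (auto simp: csubspace_iff capp_simps)
      have "closed ((\<lambda>w. amp C \<cdot> w) -` clspan ?D)"
        by (intro continuous_closed_vimage) (auto intro!: continuous_on_interior[of UNIV] continuous_intros)
      then show "closed {w. amp C \<cdot> w \<in> clspan ?D}" by (simp add: vimage_def)
    qed
    with w show ?thesis by blast
  qed
  have comm: "(1 - Q) * amp C = amp C * (1 - Q)" if C: "\<And>a. C * Pi a = Pi a * C" for C
  proof -
    have "Q * amp C = amp C * Q"
      unfolding Q_def
      by (rule proj_commute[OF V]) (use inv C Pi_commutant_star[OF C] in \<open>auto simp: star_amp[OF C]\<close>)
    then show ?thesis by (simp add: algebra_simps)
  qed
  have "lv ?n x h \<in> V" if x: "x \<in> carr (X ?n)" for x h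
  proof -
    obtain z where z: "z \<in> carr (X ?n)" "\<And>h. P ?n \<cdot> ((1 - Q) \<cdot> lv ?n x h) = lv ?n z h"
      using intertwiner_module_element[OF comm x, of ?n] by blast
    have "(1 - Q) \<cdot> lv ?n x h \<in> summand X t ?n" for h
      using csubspace_diff[OF summand_csubspace lv_in_summand[OF x]] sub proj_in[OF V]
      by (auto simp: Q_def capp_diff_left V_def)
    then have z': "(1 - Q) \<cdot> lv ?n x h = lv ?n z h" for h using z(2) P_id by metis
    have "z = 0"
    proof (rule \<tau>_total[OF z(1)])
      fix u v assume uv: "u \<in> carr (X 1)" "v \<in> carr (X k)"
      show "ip (X ?n) (\<tau> 1 k u v) z = 0"
      proof (rule eq_if_forms_eq)
        fix h k'
        have "cinner (lv ?n (\<tau> 1 k u v) h) ((1 - Q) \<cdot> lv ?n x k') = 0"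
          unfolding Q_def capp_diff_left capp_one by (rule proj_orth[OF V VD[OF uv]])
        then have "cinner h (\<pi> (ip (X ?n) (\<tau> 1 k u v) z) k') = 0"
          unfolding z' lv_cinner[OF \<tau>_closed[OF uv] z(1)] by simp
        then show "cinner h (\<pi> (ip (X ?n) (\<tau> 1 k u v) z) k') = cinner h (\<pi> 0 k')"
          using Pi_app[of 0 k'] Pi.rep_zero by simp
      qed
    qed
    then have "(1 - Q) \<cdot> lv ?n x h = 0" using z' lv_zero by simp
    then have "lv ?n x h = Q \<cdot> lv ?n x h" by (simp add: capp_diff_left)
    then show ?thesis using proj_in[OF V] by (metis Q_def)
  qed
  then show "summand X t ?n \<subseteq> clspan ?D"
    unfolding summand_def' V_def[symmetric] by (intro clspan_minimal V) blast
qed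

end

section \<open>Normality of the left actions and reflexivity on one summand\<close>

context fock_representation
begin

text \<open>The predual is norm closed and coefficients depend continuously on their vectors, so the
  vectors with coefficient in the predual form a closed subspace. The extension from
  \<open>D\<close> is made in one variable and then in the other; as \<open>Th a\<close> commutes
  with \<open>P n\<close>, the left vector may then be arbitrary.\<close>

lemma form_predual_extend:
  assumes D: "clspan D = summand X t n"
    and base: "\<And>u v. u \<in> D \<Longrightarrow> v \<in> D \<Longrightarrow> (\<lambda>a. cinner u (Th a \<cdot> v)) \<in> predual"
  shows "(\<lambda>a. cinner u (Th a \<cdot> (P n \<cdot> v))) \<in> predual"
proof -
  have bf: "bounded_functional (\<lambda>a. cinner u (Th a \<cdot> v))" for u v
  proof (rule bounded_functionalI)
    fix a
    have "cmod (cinner u (Th a \<cdot> v)) \<le> norm u * (norm a * norm v)"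
      by (intro order_trans[OF cmod_cinner_le] mult_left_mono order_trans[OF capp_norm_le] mult_right_mono Th_norm_le) auto
    then show "cmod (cinner u (Th a \<cdot> v)) \<le> (norm u * norm v) * norm a" by (simp add: ac_simps)
  qed (simp_all add: Th_add Th_scaleC capp_simps cinner_simps)
  have bound: "cmod (cinner u (Th a \<cdot> v)) \<le> norm u * norm v * norm a" for u v a
  proof -
    have "cmod (cinner u (Th a \<cdot> v)) \<le> norm u * (norm a * norm v)"
      by (intro order_trans[OF cmod_cinner_le] mult_left_mono order_trans[OF capp_norm_le] mult_right_mono Th_norm_le) auto
    then show ?thesis by (simp add: ac_simps)
  qed
  have lim: "(\<lambda>a. cinner u (Th a \<cdot> v)) \<in> predual"
    if seq: "\<And>i. (\<lambda>a. cinner (us i) (Th a \<cdot> vs i)) \<in> predual" "us \<longlonglongrightarrow> u" "vs \<longlonglongrightarrow> v" for us vs u v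
  proof (rule predual_if_approximable[OF bf])
    fix e :: real assume e: "0 < e"
    have "(\<lambda>i. norm (us i - u) * norm (vs i) + norm u * norm (vs i - v)) \<longlonglongrightarrow> norm (u - u) * norm v + norm u * norm (v - v)"
      by (intro tendsto_intros seq)
    then have "\<forall>\<^sub>F i in sequentially. norm (us i - u) * norm (vs i) + norm u * norm (vs i - v) < e"
      using e by (simp add: order_tendstoD)
    then obtain i where i: "norm (us i - u) * norm (vs i) + norm u * norm (vs i - v) < e"
      by (auto simp: eventually_sequentially)
    have "cmod (cinner u (Th a \<cdot> v) - cinner (us i) (Th a \<cdot> vs i)) \<le> e * norm a" for a
    proof -
      have "cinner u (Th a \<cdot> v) - cinner (us i) (Th a \<cdot> vs i) =
        - (cinner (us i - u) (Th a \<cdot> vs i) + cinner u (Th a \<cdot> (vs i - v)))"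
        by (simp add: cinner_simps capp_simps)
      then have "cmod (cinner u (Th a \<cdot> v) - cinner (us i) (Th a \<cdot> vs i)) \<le>
        norm (us i - u) * norm (vs i) * norm a + norm u * norm (vs i - v) * norm a"
        using norm_triangle_ineq bound order_trans add_mono
        by (smt (verit) norm_minus_cancel)
      also have "\<dots> \<le> e * norm a" using i by (simp add: mult_right_mono flip: distrib_right)
      finally show ?thesis .
    qed
    then show "\<exists>h\<in>predual. \<forall>a. cmod (cinner u (Th a \<cdot> v) - h a) \<le> e * norm a"
      by (intro bexI[OF _ seq(1)[of i]] allI)
  qed
  have 1: "(\<lambda>a. cinner u (Th a \<cdot> v)) \<in> predual" if u: "u \<in> summand X t n" and v: "v \<in> D" for u v
  proof -
    let ?S = "{u. (\<lambda>a. cinner u (Th a \<cdot> v)) \<in> predual}"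
    have "clspan D \<subseteq> ?S"
    proof (rule clspan_minimal)
      show "csubspace ?S"
        by (auto simp: csubspace_iff cinner_simps predual_zero predual_add predual_scale)
      show "closed ?S"
        unfolding closed_sequential_limits using lim[where vs = "\<lambda>_. v" and v = v] by auto
    qed (use base v in blast)
    with u D show ?thesis by blast
  qed
  have 2: "(\<lambda>a. cinner u (Th a \<cdot> v)) \<in> predual" if u: "u \<in> summand X t n" and v: "v \<in> summand X t n" for u v
  proof -
    let ?S = "{v. (\<lambda>a. cinner u (Th a \<cdot> v)) \<in> predual}"
    have "clspan D \<subseteq> ?S"
    proof (rule clspan_minimal)
      show "csubspace ?S"
        by (auto simp: csubspace_iff cinner_simps capp_simps predual_zero predual_add predual_scale)
      show "closed ?S"
        unfolding closed_sequential_limits using lim[where us = "\<lambda>_. u" and u = u] by auto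
    qed (use 1 u in blast)
    with v D show ?thesis by blast
  qed
  have "cinner u (Th a \<cdot> (P n \<cdot> v)) = cinner (P n \<cdot> u) (Th a \<cdot> (P n \<cdot> v))" for a
    using arg_cong[OF P_Th[of n a], of "\<lambda>T. T \<cdot> v"] P_P[of n n "Th a \<cdot> v"]
    by (simp add: capp_mult P_cinner)
  then show ?thesis using 2[OF P_in P_in] by simp
qed

text \<open>On simple tensors \<open>x \<otimes> y \<otimes> h\<close> and
  \<open>x' \<otimes> y' \<otimes> h'\<close> the coefficient is
  \<open>a \<mapsto> g (ip E x (\<phi> a x'))\<close>, where \<open>g\<close> is a coefficient in
  degree \<open>k\<close>. The induction hypothesis puts \<open>g\<close> into the predual, and
  normality of \<open>\<phi>\<close> gives the rest.\<close>

lemma Th_normal: "(\<lambda>a. cinner u (Th a \<cdot> (P n \<cdot> v))) \<in> predual"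
proof (induction n arbitrary: u v)
  case 0
  have "(\<lambda>a. cinner u (Th a \<cdot> v)) \<in> predual" if "u \<in> {lv 0 x h | x h. x \<in> carr (X 0)}" "v \<in> {lv 0 x h | x h. x \<in> carr (X 0)}" for u v
  proof -
    from that obtain b h c k where "u = lv 0 (\<iota> b) h" "v = lv 0 (\<iota> c) k" by (auto elim!: zeroth_cases)
    then have "cinner u (Th a \<cdot> v) = cinner (\<pi> b h) (\<pi> a (\<pi> c k))" for a
      using rep.rep_star[of b h] by (simp add: Th_lv \<iota>_closed pow.zeroth_left lv_cinner pow.zeroth_ip rep.rep_mult)
    then show ?thesis using \<pi>_normal[of "\<pi> b h" "\<pi> c k"] by simp
  qed
  then show ?case using form_predual_extend[OF summand_def'[symmetric]] by blast
next
  case (Suc k)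
  have "(\<lambda>a. cinner u (Th a \<cdot> (P (1 + k) \<cdot> v))) \<in> predual"
  proof (rule form_predual_extend[OF simple_tensors_total])
    fix u v
    assume "u \<in> {lv (1 + k) (\<tau> 1 k u v) h | u v h. u \<in> carr (X 1) \<and> v \<in> carr (X k)}"
      and "v \<in> {lv (1 + k) (\<tau> 1 k u v) h | u v h. u \<in> carr (X 1) \<and> v \<in> carr (X k)}"
    then obtain x y h x' y' h' where u: "u = lv (1 + k) (\<tau> 1 k x y) h" "x \<in> carr (X 1)" "y \<in> carr (X k)"
      and v: "v = lv (1 + k) (\<tau> 1 k x' y') h'" "x' \<in> carr (X 1)" "y' \<in> carr (X k)" by blast
    define g where "g a = cinner (lv k y h) (Th a \<cdot> (P k \<cdot> lv k y' h'))" for a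
    have g: "g \<in> predual" unfolding g_def by (rule Suc.IH)
    have eq: "cinner u (Th a \<cdot> v) = g (ip E x (\<phi> a x'))" for a
    proof -
      have "cinner u (Th a \<cdot> v) = cinner h (\<pi> (ip (X (1 + k)) (\<tau> 1 k x y) (\<tau> 1 k (\<phi> a x') y')) h')"
        unfolding u(1) v(1) using u v \<tau>_closed[of _ 1 _ k] \<phi>_closed
        by (simp only: Th_lv \<psi>_\<tau>) (simp only: lv_cinner simp_thms if_True)
      also have "\<dots> = g (ip (X 1) x (\<phi> a x'))"
        unfolding g_def using u v \<phi>_closed by (simp add: \<tau>_ip P_lv Th_lv lv_cinner \<psi>_closed del: One_nat_def)
      finally show ?thesis using pow.first_module by simp
    qed
    have "(\<lambda>a. (\<lambda>T. g (ip E x (T x'))) (\<phi> a)) \<in> predual"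
    proof (rule weak_continuous_in_predual[OF corr.left_normal[unfolded operator_weakstar_def]])
      show "(\<lambda>T. g (ip E x (T x'))) \<in> operator_functionals E"
        by (rule operator_functional_single[OF g]) (use u v pow.first_module in auto)
      have "x \<in> carr E" "x' \<in> carr E" "\<And>a. \<phi> a x' \<in> carr E" using u v pow.first_module \<phi>_closed by auto
      then show "g (ip E x (\<phi> (a + b) x')) = g (ip E x (\<phi> a x')) + g (ip E x (\<phi> b x'))"
        "g (ip E x (\<phi> (c *\<^sub>C a) x')) = c * g (ip E x (\<phi> a x'))" for a b c
        by (simp_all add: corr.left_add corr.left_scaleC corr.ip_add corr.ip_scaleC predual_map_add[OF g] predual_map_scaleC[OF g])
    qed (use corr.left_adjointable in blast)
    then show "(\<lambda>a. cinner u (Th a \<cdot> v)) \<in> predual" by (simp add: eq)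
  qed
  then show ?case by simp
qed

lemma level_star_rep: "star_rep (\<lambda>a. Th a * P n)"
proof
  show "Th (a * b) * P n = Th a * P n * (Th b * P n)" for a b
  proof -
    have "Th a * P n * (Th b * P n) = Th a * (P n * Th b) * P n" by (simp only: mult.assoc)
    also have "\<dots> = Th a * Th b * (P n * P n)" by (simp only: P_Th mult.assoc)
    also have "P n * P n = P n" by (rule cop_eqI) (simp add: capp_mult P_P)
    finally show ?thesis by (simp add: Th_mult)
  qed
  show "Th (star a) * P n = star (Th a * P n)" for a
    by (simp add: star_mult P_star Th_star[symmetric] P_Th)
qed (simp_all add: Th_add Th_scaleC distrib_right mult_scaleC_left capp_mult Th_normal)

text \<open>The kernel of the (not necessarily faithful) left action on the \<open>n\<close>-th summand is generated by a
  central projection, so its elements can be divided out in a canonical way.\<close>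

lemma kernel_unit:
  "\<exists>z. Th z * P n = 0 \<and> star z = z \<and> (\<forall>a. Th a * P n = 0 \<longrightarrow> z * a = a) \<and> (\<forall>a. z * a = a * z)"
proof -
  interpret K: star_rep "\<lambda>a. Th a * P n" by (rule level_star_rep)
  define J where "J = {a. Th a * P n = 0}"
  interpret J: star_rep_ideal Pi J
    unfolding J_def by (rule Pi.star_rep_ideal_kernel[OF level_star_rep])
  \<comment> \<open>The projection onto the space on which \<open>\<pi>(J)\<close> acts
    nondegenerately is the identity of the algebra generated by \<open>\<pi>(J)\<close>; the double
    commutant theorem for the ideal \<open>J\<close> finds it inside \<open>Pi\<close> of
    \<open>J\<close>.\<close>
  define L where "L = clspan {Pi a \<cdot> h | a h. a \<in> J}"
  have L: "csubspace L" "closed L" unfolding L_def by (auto intro: csubspace_clspan)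
  have base: "Pi a \<cdot> h \<in> L" if "a \<in> J" for a h unfolding L_def by (rule clspan_base) (use that in blast)
  define q where "q = proj L"
  have inv: "c \<cdot> u \<in> L" if c: "c \<in> J.commutant" and u: "u \<in> L" for c u
  proof -
    have "L \<subseteq> {u. c \<cdot> u \<in> L}"
      unfolding L_def
    proof (rule clspan_minimal)
      have "c \<cdot> (Pi a \<cdot> h) = Pi a \<cdot> (c \<cdot> h)" if "a \<in> J" for a h
        using c that unfolding J.commutant_def by (metis (mono_tags, lifting) capp_mult mem_Collect_eq)
      then show "{Pi a \<cdot> h | a h. a \<in> J} \<subseteq> {u. c \<cdot> u \<in> clspan {Pi a \<cdot> h | a h. a \<in> J}}"
        using base unfolding L_def by fastforce
      show "csubspace {u. c \<cdot> u \<in> clspan {Pi a \<cdot> h | a h. a \<in> J}}"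
        using L(1) unfolding L_def by (auto simp: csubspace_iff capp_simps)
      have "closed ((\<lambda>u. c \<cdot> u) -` clspan {Pi a \<cdot> h | a h. a \<in> J})"
        by (intro continuous_closed_vimage) (auto intro!: continuous_on_interior[of UNIV] continuous_intros)
      then show "closed {u. c \<cdot> u \<in> clspan {Pi a \<cdot> h | a h. a \<in> J}}" by (simp add: vimage_def)
    qed
    with u show ?thesis by blast
  qed
  have "q \<in> J.bicommutant"
    unfolding J.bicommutant_def
  proof (intro CollectI conjI ballI allI impI)
    show "q * c = c * q" if "c \<in> J.commutant" for c
      unfolding q_def by (rule proj_commute[OF L]) (use inv that J.commutant_star in auto)
    fix k assume k: "\<forall>a\<in>J. Pi a \<cdot> k = 0"
    show "q \<cdot> k = 0"
      unfolding q_def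
    proof (rule proj_zero[OF L])
      fix u assume "u \<in> L"
      moreover have "L \<subseteq> {u. cinner u k = 0}"
        unfolding L_def
      proof (rule clspan_minimal)
        have "cinner (Pi a \<cdot> h) k = 0" if "a \<in> J" for a h
          using k J.J_star[OF that] cinner_star_right[of h "Pi a" k] by (simp flip: Pi.rep_star del: Pi_app)
        then show "{Pi a \<cdot> h | a h. a \<in> J} \<subseteq> {u. cinner u k = 0}" by blast
      qed (auto simp: csubspace_iff cinner_simps intro!: closed_Collect_eq continuous_intros)
      ultimately show "cinner u k = 0" by blast
    qed
  qed
  then obtain z where z: "z \<in> J" "Pi z = q" using J.double_commutant by blast
  have left: "z * a = a" if "a \<in> J" for a
  proof (rule Pi_inj)
    have "q * Pi a = Pi a"
      by (rule cop_eqI) (simp add: capp_mult q_def proj_id[OF L base[OF that]] del: Pi_app)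
    then show "Pi (z * a) = Pi a" by (simp add: Pi.rep_mult z)
  qed
  have sz: "star z = z" by (rule Pi_inj) (simp add: Pi.rep_star z q_def star_proj[OF L])
  have right: "a * z = a" if "a \<in> J" for a
    using left[OF J.J_star[OF that]] sz by (metis star_mult star_star)
  have "z * a = a * z" for a
    using left[OF J.J_left[OF z(1), of a]] right[OF J.J_right[OF z(1), of a]] by (metis mult.assoc)
  then show ?thesis using z(1) sz left by (auto simp: J_def)
qed

lemma Lam_orbit_subspace: "csubspace {Lam j \<xi> \<cdot> k | \<xi>. \<xi> \<in> carr (X j)}"
proof (rule csubspaceI)
  show "0 \<in> {Lam j \<xi> \<cdot> k | \<xi>. \<xi> \<in> carr (X j)}" using Lam_zero[of j] Xm.carr_zero[of j] by force
  fix u v assume "u \<in> {Lam j \<xi> \<cdot> k | \<xi>. \<xi> \<in> carr (X j)}" "v \<in> {Lam j \<xi> \<cdot> k | \<xi>. \<xi> \<in> carr (X j)}"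
  then obtain \<xi> \<eta> where "u = Lam j \<xi> \<cdot> k" "\<xi> \<in> carr (X j)" "v = Lam j \<eta> \<cdot> k" "\<eta> \<in> carr (X j)" by blast
  then show "u + v \<in> {Lam j \<xi> \<cdot> k | \<xi>. \<xi> \<in> carr (X j)}"
    by (intro CollectI exI[of _ "\<xi> + \<eta>"]) (simp add: Lam_add capp_simps Xm.carr_add)
next
  fix c u assume "u \<in> {Lam j \<xi> \<cdot> k | \<xi>. \<xi> \<in> carr (X j)}"
  then obtain \<xi> where "u = Lam j \<xi> \<cdot> k" "\<xi> \<in> carr (X j)" by blast
  then show "c *\<^sub>C u \<in> {Lam j \<xi> \<cdot> k | \<xi>. \<xi> \<in> carr (X j)}"
    by (intro CollectI exI[of _ "c *\<^sub>C \<xi>"]) (simp add: Lam_scaleC capp_simps Xm.carr_scaleC)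
qed

text \<open>Reflexivity of the space of all \<open>L\<^sub>\<xi>\<close> on the \<open>s\<close>-th summand: the operators \<open>L\<^sub>\<eta>\<^sup>* R\<close> lie in the
  (reflexive) von Neumann algebra of left multiplications, and self-duality yields \<open>\<xi>\<close>.\<close>

theorem level_reflexive:
  assumes R: "\<And>k. R \<cdot> (P s \<cdot> k) \<in> closure {Lam j \<xi> \<cdot> (P s \<cdot> k) | \<xi>. \<xi> \<in> carr (X j)}"
  shows "\<exists>\<xi>\<in>carr (X j). \<forall>k. R \<cdot> (P s \<cdot> k) = Lam j \<xi> \<cdot> (P s \<cdot> k)"
proof -
  define \<theta> where "\<theta> a = Th a * P s" for a
  interpret T: star_rep \<theta> unfolding \<theta>_def[abs_def] by (rule level_star_rep)
  interpret TU: star_rep_ideal \<theta> UNIV by (rule T.star_rep_ideal_UNIV)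
  define Z where "Z \<eta> = star (Lam j \<eta>) * R * P s" for \<eta>
  have "\<exists>b. norm b \<le> 8 * norm (Z \<eta>) \<and> \<theta> b = Z \<eta>" if \<eta>: "\<eta> \<in> carr (X j)" for \<eta>
  proof -
    have "Z \<eta> \<in> TU.bicommutant"
    proof (rule TU.local_imp_bicommutant)
      fix k
      let ?S = "{Lam j \<xi> \<cdot> (P s \<cdot> k) | \<xi>. \<xi> \<in> carr (X j)}"
      have "continuous_on (closure ?S) (\<lambda>u. star (Lam j \<eta>) \<cdot> u)" by (intro continuous_intros)
      then have "(\<lambda>u. star (Lam j \<eta>) \<cdot> u) ` closure ?S \<subseteq> closure ((\<lambda>u. star (Lam j \<eta>) \<cdot> u) ` ?S)"
        using image_closure_subset[OF _ closed_closure closure_subset] by blast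
      moreover have "(\<lambda>u. star (Lam j \<eta>) \<cdot> u) ` ?S \<subseteq> {\<theta> a \<cdot> k | a. a \<in> UNIV}"
      proof clarify
        fix \<xi> assume "\<xi> \<in> carr (X j)"
        then have "star (Lam j \<eta>) \<cdot> (Lam j \<xi> \<cdot> (P s \<cdot> k)) = \<theta> (ip (X j) \<eta> \<xi>) \<cdot> k"
          using arg_cong[OF Lam_star_Lam[OF \<eta>, of \<xi>], of "\<lambda>T. T \<cdot> (P s \<cdot> k)"] by (simp add: capp_mult \<theta>_def)
        then show "\<exists>a. star (Lam j \<eta>) \<cdot> (Lam j \<xi> \<cdot> (P s \<cdot> k)) = \<theta> a \<cdot> k \<and> a \<in> UNIV" by blast
      qed
      moreover have "Z \<eta> \<cdot> k = star (Lam j \<eta>) \<cdot> (R \<cdot> (P s \<cdot> k))" by (simp add: Z_def capp_mult)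
      ultimately show "Z \<eta> \<cdot> k \<in> closure {\<theta> a \<cdot> k | a. a \<in> UNIV}"
        using R[of k] closure_mono by blast
    qed
    then show ?thesis using TU.double_commutant by blast
  qed
  then obtain b where b: "\<And>\<eta>. \<eta> \<in> carr (X j) \<Longrightarrow> norm (b \<eta>) \<le> 8 * norm (Z \<eta>)"
    "\<And>\<eta>. \<eta> \<in> carr (X j) \<Longrightarrow> \<theta> (b \<eta>) = Z \<eta>" by metis
  obtain z where z: "\<theta> z = 0" "star z = z" "\<And>a. \<theta> a = 0 \<Longrightarrow> z * a = a" "\<And>a. z * a = a * z"
    using kernel_unit[of s] unfolding \<theta>_def by metis
  \<comment> \<open>The choice of \<open>b\<close> is arbitrary modulo the kernel of
    \<open>\<theta>\<close>. Multiplication by the central element \<open>c\<close> removes this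
    freedom: \<open>c * a\<close> depends only on \<open>\<theta> a\<close>, so algebraic identities
    between the \<open>Z \<eta>\<close> hold exactly for \<open>c * b \<eta>\<close>.\<close>
  define c where "c = 1 - z"
  have cc: "c * a = a * c" for a by (simp add: c_def left_diff_distrib right_diff_distrib z(4))
  have \<theta>c: "\<theta> (c * a) = \<theta> a" for a
    by (simp add: c_def left_diff_distrib T.rep_diff T.rep_mult z(1))
  have canon: "c * a = c * d" if "\<theta> a = \<theta> d" for a d
  proof -
    have "z * (a - d) = a - d" by (rule z(3)) (simp add: T.rep_diff that)
    then show ?thesis by (simp add: c_def algebra_simps)
  qed
  have "bounded_module_map (X j) (\<lambda>\<eta>. star (c * b \<eta>))"
    unfolding bounded_module_map_def
  proof (intro conjI ballI allI exI)
    fix x y assume xy: "x \<in> carr (X j)" "y \<in> carr (X j)"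
    have "c * b (x + y) = c * (b x + b y)"
      by (rule canon) (simp add: b xy Xm.carr_add T.rep_add Z_def Lam_add star_add distrib_right)
    then show "star (c * b (x + y)) = star (c * b x) + star (c * b y)" by (simp add: distrib_left star_add)
  next
    fix x d assume x: "x \<in> carr (X j)"
    have "c * b (d *\<^sub>C x) = c * (cnj d *\<^sub>C b x)"
      by (rule canon) (simp add: b x Xm.carr_scaleC T.rep_scaleC Z_def Lam_scaleC star_scaleC mult_scaleC_left)
    then show "star (c * b (d *\<^sub>C x)) = d *\<^sub>C star (c * b x)" by (simp add: mult_scaleC_right star_scaleC)
  next
    fix x a assume x: "x \<in> carr (X j)"
    have "\<theta> (star a * b x) = Th (star a) * Z x"
      unfolding b(2)[OF x, symmetric] by (simp add: \<theta>_def Th_mult mult.assoc)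
    then have "\<theta> (b (act (X j) x a)) = \<theta> (star a * b x)"
      by (simp add: b x Xm.act_closed Z_def Lam_act star_mult Th_star mult.assoc)
    then have "c * b (act (X j) x a) = c * (star a * b x)" by (rule canon)
    also have "\<dots> = star a * (c * b x)" by (metis cc mult.assoc)
    finally show "star (c * b (act (X j) x a)) = star (c * b x) * a" by (simp add: star_mult star_star mult.assoc)
  next
    fix x assume x: "x \<in> carr (X j)"
    have "norm (Z x) \<le> norm (Lam j x) * norm (R * P s)"
      using norm_mult_ineq[of "star (Lam j x)" "R * P s"] by (simp add: Z_def mult.assoc)
    also have "\<dots> \<le> hnorm (X j) x * norm (R * P s)" by (intro mult_right_mono Lam_norm_le x) simp
    finally have "norm (c * b x) \<le> norm c * (8 * (hnorm (X j) x * norm (R * P s)))"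
      using b(1)[OF x] by (intro order_trans[OF norm_mult_ineq] mult_left_mono) auto
    then show "norm (star (c * b x)) \<le> (norm c * 8 * norm (R * P s)) * hnorm (X j) x" by (simp add: ac_simps)
  qed
  then obtain y where y: "y \<in> carr (X j)" "\<And>x. x \<in> carr (X j) \<Longrightarrow> star (c * b x) = ip (X j) y x"
    using Xm.self_dual by blast
  have bip: "c * b x = ip (X j) x y" if "x \<in> carr (X j)" for x
    using y(2)[OF that] Xm.ip_star[OF y(1) that] by (metis star_star)
  have key: "star (Lam j x) \<cdot> (R \<cdot> (P s \<cdot> k)) = star (Lam j x) \<cdot> (Lam j y \<cdot> (P s \<cdot> k))" if x: "x \<in> carr (X j)" for x k
  proof -
    have "star (Lam j x) \<cdot> (R \<cdot> (P s \<cdot> k)) = \<theta> (ip (X j) x y) \<cdot> k"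
      unfolding bip[OF x, symmetric] \<theta>c b(2)[OF x] by (simp add: Z_def capp_mult)
    also have "\<dots> = (star (Lam j x) * Lam j y) \<cdot> (P s \<cdot> k)" by (simp add: \<theta>_def capp_mult Lam_star_Lam x y(1))
    finally show ?thesis by (simp add: capp_mult)
  qed
  have "R \<cdot> (P s \<cdot> k) = Lam j y \<cdot> (P s \<cdot> k)" for k
  proof -
    let ?S = "{Lam j \<xi> \<cdot> (P s \<cdot> k) | \<xi>. \<xi> \<in> carr (X j)}"
    \<comment> \<open>The difference belongs to the closure of the orbit and, by \<open>key\<close>,
      is orthogonal to the orbit.\<close>
    define d where "d = R \<cdot> (P s \<cdot> k) - Lam j y \<cdot> (P s \<cdot> k)"
    have "Lam j y \<cdot> (P s \<cdot> k) \<in> closure ?S"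
      by (rule subsetD[OF closure_subset]) (use y(1) in blast)
    then have "d \<in> closure ?S"
      unfolding d_def by (rule csubspace_diff[OF csubspace_closure[OF Lam_orbit_subspace] R])
    moreover have "closure ?S \<subseteq> {u. cinner u d = 0}"
    proof (rule closure_minimal)
      show "?S \<subseteq> {u. cinner u d = 0}"
        using key by (auto simp: d_def cinner_diff_right cinner_star_right[symmetric])
      show "closed {u. cinner u d = 0}" by (intro closed_Collect_eq continuous_intros)
    qed
    ultimately have "cinner d d = 0" by blast
    then show ?thesis by (simp add: d_def)
  qed
  with y(1) show ?thesis by blast
qed

end

section \<open>Adjointable operators on the Fock space\<close>

lemma bounded_clinear_on_diff:
  assumes "bounded_clinear_on V Z" "csubspace V" "x \<in> V" "y \<in> V"
  shows "Z (x - y) = Z x - Z y"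
proof -
  have "x - y \<in> V" using assms(2-4) by (rule csubspace_diff)
  then have "Z (x - y + y) = Z (x - y) + Z y" using assms unfolding bounded_clinear_on_def by blast
  then show ?thesis by simp
qed

lemma bounded_clinear_on_eq:
  assumes Z: "bounded_clinear_on (clspan D) Z" "bounded_clinear_on (clspan D) Z'"
    and eq: "\<And>x. x \<in> D \<Longrightarrow> Z x = Z' x" and x: "x \<in> clspan D"
  shows "Z x = Z' x"
proof -
  have V: "csubspace (clspan D)" by (rule csubspace_clspan)
  have sub: "cspan D \<subseteq> clspan D" by (rule closure_subset)
  have span: "Z u = Z' u" if "u \<in> cspan D" for u
  proof -
    let ?S = "{u \<in> clspan D. Z u = Z' u}"
    have z: "Z 0 = 0" "Z' 0 = 0"
      using bounded_clinear_on_diff[OF Z(1) V, of 0 0] bounded_clinear_on_diff[OF Z(2) V, of 0 0] V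
      by (auto simp: csubspace_iff)
    have "cspan D \<subseteq> ?S"
    proof (rule complex_vector.span_minimal)
      show "D \<subseteq> ?S" using eq clspan_base by blast
      show "csubspace ?S"
        using V Z z unfolding csubspace_iff bounded_clinear_on_def by auto
    qed
    with that show ?thesis by blast
  qed
  obtain s where s: "\<And>n. s n \<in> cspan D" "s \<longlonglongrightarrow> x" using x by (auto simp: closure_sequential)
  have lim: "(\<lambda>n. W (s n)) \<longlonglongrightarrow> W x" if W: "bounded_clinear_on (clspan D) W" for W :: "'a \<Rightarrow> 'b"
  proof -
    obtain C where C: "\<And>u. u \<in> clspan D \<Longrightarrow> norm (W u) \<le> C * norm u"
      using W unfolding bounded_clinear_on_def by blast
    have "norm (W (s n) - W x) \<le> C * norm (s n - x)" for n
    proof -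
      have sn: "s n \<in> clspan D" by (rule subsetD[OF sub s(1)])
      show ?thesis
        using C[OF csubspace_diff[OF V sn x]] by (simp only: bounded_clinear_on_diff[OF W V sn x])
    qed
    then have "\<forall>\<^sub>F n in sequentially. norm (W (s n) - W x) \<le> C * norm (s n - x)" by (intro always_eventually allI)
    moreover have "(\<lambda>n. C * norm (s n - x)) \<longlonglongrightarrow> 0"
      by (intro tendsto_mult_right_zero tendsto_norm_zero LIM_zero s(2))
    ultimately have "(\<lambda>n. W (s n) - W x) \<longlonglongrightarrow> 0" by (rule Lim_null_comparison)
    then show ?thesis by (rule LIM_zero_cancel)
  qed
  show ?thesis
  proof (rule LIMSEQ_unique[OF lim[OF Z(1)]])
    have "Z (s n) = Z' (s n)" for n by (rule span[OF s(1)])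
    then show "(\<lambda>n. Z (s n)) \<longlonglongrightarrow> Z' x" using lim[OF Z(2)] by (simp only:)
  qed
qed

text \<open>Any operator on the whole space with the right values on simple tensors shows that the
  definite description in \<open>tensor_op\<close> denotes; a bounded map is determined by these
  values because their closed span is the domain.\<close>

lemma tensor_op_cop:
  fixes A :: "'k::chilbert_space cop"
  assumes "\<And>x h. x \<in> S \<Longrightarrow> A \<cdot> t x h = t' (T x) h"
  shows "tensor_op S t t' T = restrict (\<lambda>u. A \<cdot> u) (tensor_space S t)"
proof -
  let ?D = "{t x h | x h. x \<in> S}"
  let ?V = "tensor_space S t"
  let ?R = "restrict (\<lambda>u. A \<cdot> u) ?V"
  have V: "csubspace ?V" unfolding tensor_space_def by (rule csubspace_clspan)
  have D: "u \<in> ?D \<Longrightarrow> u \<in> ?V" for u unfolding tensor_space_def by (rule clspan_base)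
  have bl: "bounded_clinear_on ?V ?R"
    using V unfolding bounded_clinear_on_def csubspace_iff
    by (auto simp: capp_simps intro!: exI[of _ "norm A"] capp_norm_le)
  have val: "?R (t x h) = t' (T x) h" if "x \<in> S" for x h
    using D[of "t x h"] assms that by auto
  have unique: "Z = ?R"
    if Z: "Z \<in> extensional ?V \<and> bounded_clinear_on ?V Z \<and> (\<forall>x\<in>S. \<forall>h. Z (t x h) = t' (T x) h)" for Z
  proof
    fix u
    show "Z u = ?R u"
    proof (cases "u \<in> ?V")
      case True
      have "Z v = ?R v" if vD: "v \<in> ?D" for v
      proof -
        obtain x h where v: "v = t x h" "x \<in> S" using vD by blast
        then have "Z v = t' (T x) h" using Z by blast
        then show ?thesis unfolding v(1) using val[OF v(2)] by (simp only:)
      qed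
      then show ?thesis
        using bounded_clinear_on_eq[of ?D Z ?R u] Z bl True unfolding tensor_space_def by blast
    next
      case False
      with Z show ?thesis by (auto simp: extensional_def)
    qed
  qed
  show ?thesis
    unfolding tensor_op_def by (rule the_equality) (use bl val unique in auto)
qed

context fock_representation
begin

lemma t_norm_le: "x \<in> carr F \<Longrightarrow> norm (t x h) \<le> hnorm F x * norm h"
proof -
  assume x: "x \<in> carr F"
  have "(norm (t x h))\<^sup>2 = Re (cinner h (\<pi> (ip F x x) h))" by (simp add: norm_sq_cinner ten.tensor_cinner x)
  also have "\<dots> \<le> norm (ip F x x) * norm h * norm h"
    using form_le complex_Re_le_cmod order_trans by blast
  also have "\<dots> = (hnorm F x * norm h)\<^sup>2" by (simp add: hnorm_def power_mult_distrib power2_eq_square)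
  finally show ?thesis by (rule power2_le_imp_le) (simp add: hnorm_def)
qed

lemma fock_ip_norm_le:
  assumes "x \<in> carr F" "y \<in> carr F" "0 \<le> c" "0 \<le> d"
    and "\<And>h. norm (t x h) \<le> c * norm h" "\<And>h. norm (t y h) \<le> d * norm h"
  shows "norm (ip F x y) \<le> 8 * (c * d)"
proof (rule norm_le_if_form_le)
  fix h k
  have "cmod (cinner h (\<pi> (ip F x y) k)) \<le> (c * norm h) * (d * norm k)"
    unfolding ten.tensor_cinner[OF assms(1,2), symmetric]
    by (rule order_trans[OF cmod_cinner_le]) (intro mult_mono assms, use assms in auto)
  then show "cmod (cinner h (\<pi> (ip F x y) k)) \<le> c * d * norm h * norm k" by (simp add: ac_simps)
qed (use assms in simp)

lemma hnorm_level_le: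
  assumes x: "x \<in> carr (X n)" and c: "0 \<le> c" "\<And>h. norm (lv n x h) \<le> c * norm h"
  shows "hnorm (X n) x \<le> 3 * c"
proof -
  have "norm (ip (X n) x x) \<le> 8 * (c * c)"
  proof (rule norm_le_if_form_le)
    fix h k
    have "cmod (cinner h (\<pi> (ip (X n) x x) k)) = cmod (cinner (lv n x h) (lv n x k))" by (simp add: lv_cinner x)
    also have "\<dots> \<le> (c * norm h) * (c * norm k)"
      by (rule order_trans[OF cmod_cinner_le]) (intro mult_mono c, use c in auto)
    finally show "cmod (cinner h (\<pi> (ip (X n) x x) k)) \<le> c * c * norm h * norm k" by (simp add: ac_simps)
  qed (use c in simp)
  \<comment> \<open>The constant 3 comes from rounding 8 up to the square 9.\<close>
  also have "8 * (c * c) \<le> (3 * c)\<^sup>2" using c by (simp add: power2_eq_square mult_right_mono)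
  finally show ?thesis unfolding hnorm_def using c by (intro real_le_lsqrt) auto
qed

text \<open>A sequence belongs to the Fock module as soon as its components are those of a family of
  vectors \<open>u h\<close> bounded by a multiple of \<open>norm h\<close>: Bessel's inequality
  gives square-summability. Closure properties of the Fock module are proved by exhibiting
  \<open>u\<close>.\<close>

lemma fock_memI2:
  assumes x: "\<And>n. x n \<in> carr (X n)" and c: "0 \<le> c" "\<And>h. norm (u h) \<le> c * norm h"
    and u: "\<And>n h. P n \<cdot> u h = lv n (x n) h"
  shows "x \<in> carr F" "t x h = u h"
proof -
  show m: "x \<in> carr F"
  proof (rule fock_memI[OF x])
    fix N h
    have "(\<Sum>n<N. (norm (lv n (x n) h))\<^sup>2) \<le> (norm (u h))\<^sup>2" using P_bessel[of "u h" N] by (simp add: u)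
    also have "\<dots> \<le> (c * norm h)\<^sup>2" by (intro power_mono c) simp
    finally show "(\<Sum>n<N. (norm (lv n (x n) h))\<^sup>2) \<le> c\<^sup>2 * (norm h)\<^sup>2" by (simp add: power_mult_distrib)
  qed simp
  show "t x h = u h" by (rule P_eqI) (simp add: P_t[OF m] u)
qed

lemma P_norm_le: "norm (P m \<cdot> w) \<le> norm w"
proof (rule power2_le_imp_le)
  have "0 \<le> (\<Sum>n<m. (norm (P n \<cdot> w))\<^sup>2)" by (rule sum_nonneg) simp
  then show "(norm (P m \<cdot> w))\<^sup>2 \<le> (norm w)\<^sup>2"
    using P_bessel[of w "Suc m"] unfolding sum.lessThan_Suc by linarith
qed simp

lemma hnorm_nonneg: "0 \<le> hnorm G x"
  by (simp add: hnorm_def)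

lemma fock_add: "x \<in> carr F \<Longrightarrow> y \<in> carr F \<Longrightarrow> x + y \<in> carr F"
proof (rule fock_memI2(1)[where u = "\<lambda>h. t x h + t y h"])
  assume x: "x \<in> carr F" and y: "y \<in> carr F"
  show "norm (t x h + t y h) \<le> (hnorm F x + hnorm F y) * norm h" for h
    using norm_triangle_ineq[of "t x h" "t y h"] t_norm_le[OF x, of h] t_norm_le[OF y, of h]
    by (simp add: distrib_right)
qed (auto simp: capp_simps P_t lv_add_left fock_nth Xm.carr_add hnorm_nonneg)

lemma fock_scaleC: "x \<in> carr F \<Longrightarrow> c *\<^sub>C x \<in> carr F"
proof (rule fock_memI2(1)[where u = "\<lambda>h. c *\<^sub>C t x h"])
  assume x: "x \<in> carr F"
  show "norm (c *\<^sub>C t x h) \<le> (cmod c * hnorm F x) * norm h" for h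
    using mult_left_mono[OF t_norm_le[OF x, of h], of "cmod c"] by (simp add: norm_scaleC mult.assoc)
qed (auto simp: capp_simps P_t lv_scaleC_left fock_nth Xm.carr_scaleC hnorm_nonneg scaleC_fun_def)

lemma fock_zero: "0 \<in> carr F"
  using incl_closed[OF Xm.carr_zero[of 0]] by (simp add: fock_incl_def zero_fun_def)

text \<open>The part of completeness of the Fock module that the gliding hump requires. The partial
  sums converge in each \<open>X m\<close> by completeness of that module, and the resulting
  sequence is recognised through the sum of the vectors \<open>t (v k) h\<close>.\<close>

lemma fock_series:
  assumes v: "\<And>k. v k \<in> carr F" and r: "\<And>k h. norm (t (v k) h) \<le> r k * norm h" "summable r" "\<And>k. 0 \<le> r k"
  shows "\<exists>y\<in>carr F. \<forall>h. (\<lambda>k. t (v k) h) sums t y h"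
proof -
  have sm: "summable (\<lambda>k. t (v k) h)" for h
    by (rule summable_comparison_test[OF _ summable_mult2[OF r(2), of "norm h"]]) (use r(1) in auto)
  define u where "u h = (\<Sum>k. t (v k) h)" for h
  have u: "(\<lambda>k. t (v k) h) sums u h" for h unfolding u_def by (rule summable_sums[OF sm])
  have nu: "norm (u h) \<le> (\<Sum>k. r k) * norm h" for h
  proof -
    have "norm (u h) \<le> (\<Sum>k. r k * norm h)"
      unfolding u_def by (rule norm_suminf_le) (use r summable_mult2 in auto)
    then show ?thesis by (simp add: suminf_mult2[OF r(2)])
  qed
  have ex: "\<exists>y\<in>carr (X m). \<forall>h. P m \<cdot> u h = lv m y h" for m
  proof -
    define p where "p n = (\<Sum>k<n. v k m)" for n
    have vm: "v k m \<in> carr (X m)" for k by (rule fock_nth[OF v])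
    have pc: "p n \<in> carr (X m)" for n
      unfolding p_def by (induction n) (auto simp: Xm.carr_zero Xm.carr_add vm)
    have lvp: "lv m (p n) h = P m \<cdot> (\<Sum>k<n. t (v k) h)" for n h
    proof (induction n)
      case (Suc n)
      have "p (Suc n) = p n + v n m" by (simp add: p_def)
      then show ?case using Suc by (simp add: lv_add_left pc vm capp_simps P_t[OF v])
    qed (simp add: p_def lv_zero)
    have pdiff: "hnorm (X m) (p i - p j) \<le> 3 * (\<Sum>k=j..<i. r k)" if "j \<le> i" for i j
    proof (rule hnorm_level_le[OF Xm.carr_diff[OF pc pc]])
      fix h
      have "lv m (p i - p j) h = P m \<cdot> (\<Sum>k=j..<i. t (v k) h)"
        using sum_diff_nat_ivl[of 0 j i "\<lambda>k. t (v k) h"] that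
        by (simp add: lv_diff_left pc lvp capp_diff_right[symmetric] atLeast0LessThan)
      also have "norm \<dots> \<le> norm (\<Sum>k=j..<i. t (v k) h)"
        by (rule P_norm_le)
      also have "\<dots> \<le> (\<Sum>k=j..<i. r k * norm h)" by (rule order_trans[OF norm_sum]) (intro sum_mono r)
      finally show "norm (lv m (p i - p j) h) \<le> (\<Sum>k=j..<i. r k) * norm h" by (simp add: sum_distrib_right)
    qed (simp add: sum_nonneg r)
    have "\<exists>y\<in>carr (X m). (\<lambda>n. hnorm (X m) (p n - y)) \<longlonglongrightarrow> 0"
    proof (rule Xm.complete[OF pc])
      fix e :: real assume "0 < e"
      then have "0 < e / 3" by simp
      then obtain N where N: "\<And>m n. m \<ge> N \<Longrightarrow> norm (\<Sum>k=m..<n. r k) < e / 3"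
        using r(2) unfolding summable_Cauchy by blast
      have sym: "hnorm (X m) (x - y) = hnorm (X m) (y - x)" if "x \<in> carr (X m)" "y \<in> carr (X m)" for x y
      proof -
        have w: "y - x \<in> carr (X m)" by (rule Xm.carr_diff[OF that(2,1)])
        have "ip (X m) (c *\<^sub>C (y - x)) (c *\<^sub>C (y - x)) = (c * cnj c) *\<^sub>C ip (X m) (y - x) (y - x)" for c
          by (simp only: Xm.ip_scaleC[OF Xm.carr_scaleC[OF w] w] Xm.ip_scaleC_left[OF w w] scaleC_scaleC)
        from this[of "-1"] have "ip (X m) (x - y) (x - y) = ip (X m) (y - x) (y - x)" by simp
        then show ?thesis by (simp add: hnorm_def)
      qed
      have "hnorm (X m) (p i - p j) < e" if "i \<ge> N" "j \<ge> N" for i j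
      proof -
        have le: "hnorm (X m) (p i - p j) < e" if "i \<ge> N" "j \<ge> N" "j \<le> i" for i j
          using pdiff[OF that(3)] N[OF that(2), of i] by (simp add: sum_nonneg r)
        show ?thesis using le[OF that] le[OF that(2,1)] sym[OF pc pc, of i j] by (cases "j \<le> i") auto
      qed
      then show "\<exists>N. \<forall>i\<ge>N. \<forall>j\<ge>N. hnorm (X m) (p i - p j) < e" by blast
    qed
    then obtain y where y: "y \<in> carr (X m)" "(\<lambda>n. hnorm (X m) (p n - y)) \<longlonglongrightarrow> 0" by blast
    have "P m \<cdot> u h = lv m y h" for h
    proof (rule LIMSEQ_unique)
      show "(\<lambda>n. lv m (p n) h) \<longlonglongrightarrow> P m \<cdot> u h"
        unfolding lvp using u[of h] by (intro tendsto_capp tendsto_const) (simp add: sums_def)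
      have "(\<lambda>n. lv m (p n) h - lv m y h) \<longlonglongrightarrow> 0"
      proof (rule Lim_null_comparison)
        show "\<forall>\<^sub>F n in sequentially. norm (lv m (p n) h - lv m y h) \<le> hnorm (X m) (p n - y) * norm h"
          using lv_norm_le[OF Xm.carr_diff[OF pc y(1)], of _ h] by (simp add: lv_diff_left pc y)
        show "(\<lambda>n. hnorm (X m) (p n - y) * norm h) \<longlonglongrightarrow> 0" by (rule tendsto_mult_left_zero[OF y(2)])
      qed
      then show "(\<lambda>n. lv m (p n) h) \<longlonglongrightarrow> lv m y h" by (rule LIM_zero_cancel)
    qed
    with y(1) show ?thesis by blast
  qed
  then obtain y where y: "\<And>m. y m \<in> carr (X m)" "\<And>m h. P m \<cdot> u h = lv m (y m) h" by metis
  have "0 \<le> (\<Sum>k. r k)" by (rule suminf_nonneg[OF r(2,3)])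
  from fock_memI2[OF y(1) this nu y(2)] u show ?thesis by metis
qed

lemma fock_ip_add: "x \<in> carr F \<Longrightarrow> y \<in> carr F \<Longrightarrow> z \<in> carr F \<Longrightarrow> ip F x (y + z) = ip F x y + ip F x z"
  by (rule eq_if_forms_eq)
    (simp add: rep.rep_add ten.tensor_cinner[symmetric] fock_add ten.tensor_add_left cinner_simps)

lemma fock_ip_scaleC: "x \<in> carr F \<Longrightarrow> y \<in> carr F \<Longrightarrow> ip F x (c *\<^sub>C y) = c *\<^sub>C ip F x y"
  by (rule eq_if_forms_eq)
    (simp add: rep.rep_scaleC ten.tensor_cinner[symmetric] fock_scaleC ten.tensor_scaleC_left cinner_simps)

lemma fock_ip_star: "x \<in> carr F \<Longrightarrow> y \<in> carr F \<Longrightarrow> star (ip F x y) = ip F y x"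
proof (rule eq_if_forms_eq)
  fix h k assume xy: "x \<in> carr F" "y \<in> carr F"
  have "cinner h (\<pi> (star (ip F x y)) k) = cinner (\<pi> (ip F x y) h) k" using rep.rep_star by simp
  also have "\<dots> = cnj (cinner k (\<pi> (ip F x y) h))" by (rule cinner_commute)
  also have "\<dots> = cinner h (\<pi> (ip F y x) k)"
    using xy by (simp add: ten.tensor_cinner[symmetric]) (rule cinner_commute[symmetric])
  finally show "cinner h (\<pi> (star (ip F x y)) k) = cinner h (\<pi> (ip F y x) k)" .
qed

lemma fock_adjointE:
  assumes "T \<in> adjointable F"
  obtains S where "S \<in> adjointable F"
    "\<And>x y. x \<in> carr F \<Longrightarrow> y \<in> carr F \<Longrightarrow> ip F (T x) y = ip F x (S y)"
    "\<And>x y. x \<in> carr F \<Longrightarrow> y \<in> carr F \<Longrightarrow> ip F (S x) y = ip F x (T y)"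
proof -
  obtain S where S: "S \<in> carr F \<rightarrow>\<^sub>E carr F" "\<forall>x\<in>carr F. \<forall>y\<in>carr F. ip F (T x) y = ip F x (S y)"
    using assms by (auto simp: adjointable_def)
  have T: "T \<in> carr F \<rightarrow>\<^sub>E carr F" using assms by (auto simp: adjointable_def)
  have 2: "ip F (S x) y = ip F x (T y)" if "x \<in> carr F" "y \<in> carr F" for x y
  proof -
    have "S x \<in> carr F" "T y \<in> carr F" using S T that by auto
    then show ?thesis using fock_ip_star[of y "S x"] fock_ip_star[of "T y" x] S(2) that by simp
  qed
  with S T have "S \<in> adjointable F" unfolding adjointable_def by blast
  with 2 S(2) that show thesis by blast
qed

lemma fock_adjointable_closed: "T \<in> adjointable F \<Longrightarrow> x \<in> carr F \<Longrightarrow> T x \<in> carr F"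
  by (auto simp: adjointable_def)

text \<open>Uniform boundedness by a gliding hump: if \<open>T\<close> were unbounded, a rapidly convergent series of
  normalised \<open>T (x n)\<close> with suitable signs would give \<open>y\<close> with unbounded \<open>ip (x n) (S y)\<close>.\<close>

lemma fock_adjointable_bounded:
  assumes T: "T \<in> adjointable F"
  shows "\<exists>C>0. \<forall>x\<in>carr F. hnorm F (T x) \<le> C * hnorm F x"
proof (rule ccontr)
  assume neg: "\<not> (\<exists>C>0. \<forall>x\<in>carr F. hnorm F (T x) \<le> C * hnorm F x)"
  \<comment> \<open>The factor \<open>100 ^ n\<close> compensates the geometric weights used below,
    and \<open>Suc n\<close> is what remains for the contradiction.\<close>
  have "\<exists>x\<in>carr F. real (Suc n) * 100 ^ n * hnorm F x < hnorm F (T x)" for n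
  proof -
    have "0 < real (Suc n) * 100 ^ n" by simp
    with neg show ?thesis by (meson not_le)
  qed
  then obtain x where x: "\<And>n. x n \<in> carr F" "\<And>n. real (Suc n) * 100 ^ n * hnorm F (x n) < hnorm F (T (x n))"
    by metis
  obtain S where S: "S \<in> adjointable F" "\<And>x y. x \<in> carr F \<Longrightarrow> y \<in> carr F \<Longrightarrow> ip F (T x) y = ip F x (S y)"
    using fock_adjointE[OF T] by metis
  have Tx: "T (x n) \<in> carr F" for n using T x(1) by (rule fock_adjointable_closed)
  define N where "N n = hnorm F (T (x n))" for n
  have N: "0 < N n" for n
  proof -
    have "0 \<le> real (Suc n) * 100 ^ n * hnorm F (x n)" by (simp add: hnorm_nonneg)
    with x(2)[of n] show ?thesis by (simp add: N_def)
  qed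
  define v where "v n = of_real ((1/100) ^ n / N n) *\<^sub>C T (x n)" for n
  have v: "v n \<in> carr F" for n unfolding v_def by (rule fock_scaleC[OF Tx])
  have tv: "norm (t (v n) h) \<le> (1/100) ^ n * norm h" for n h
  proof -
    have "norm (t (v n) h) = (1/100) ^ n / N n * norm (t (T (x n)) h)"
      using N[of n] by (simp add: v_def ten.tensor_scaleC_left Tx norm_scaleC norm_divide norm_power del: of_real_divide of_real_power)
    also have "\<dots> \<le> (1/100) ^ n / N n * (N n * norm h)"
      using N[of n] t_norm_le[OF Tx] by (intro mult_left_mono) (auto simp: N_def)
    finally show ?thesis using N[of n] by simp
  qed
  have ipv: "ip F (T (x n)) (v n) = of_real ((1/100) ^ n / N n) *\<^sub>C ip F (T (x n)) (T (x n))" for n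
    unfolding v_def by (rule fock_ip_scaleC[OF Tx Tx])
  have nipv: "norm (ip F (T (x n)) (v n)) = (1/100) ^ n * N n" for n
  proof -
    have "norm (ip F (T (x n)) (T (x n))) = (N n)\<^sup>2" by (simp add: N_def hnorm_def)
    then show ?thesis using N[of n]
      by (simp add: ipv norm_scaleC power2_eq_square del: of_real_divide of_real_power)
  qed
  define good where "good n s y \<longleftrightarrow> cmod s = 1 \<and> (1/100) ^ n * N n \<le> norm (ip F (T (x n)) (y + s *\<^sub>C v n))" for n s y
  \<comment> \<open>Of the sum and the difference of two elements, at least one is as large as the
    second element, so \<open>s = 1\<close> or \<open>s = -1\<close> prevents cancellation by the
    earlier terms.\<close>
  have "\<exists>s. good n s y" if y: "y \<in> carr F" for n y
  proof (rule ccontr)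
    assume "\<nexists>s. good n s y"
    then have "cmod s = 1 \<Longrightarrow> norm (ip F (T (x n)) (y + s *\<^sub>C v n)) < (1/100) ^ n * N n" for s
      by (auto simp: good_def not_le)
    note small = this
    let ?a = "ip F (T (x n)) y" and ?b = "ip F (T (x n)) (v n)"
    have ip: "ip F (T (x n)) (y + s *\<^sub>C v n) = ?a + s *\<^sub>C ?b" for s
      by (simp add: fock_ip_add fock_ip_scaleC Tx y v fock_scaleC)
    have "norm (?a + ?b) < norm ?b" "norm (?a - ?b) < norm ?b"
      using small[of 1] small[of "-1"] ip[of 1] ip[of "-1"] by (simp_all add: nipv)
    moreover have "norm (2 *\<^sub>R ?b) \<le> norm (?a + ?b) + norm (?a - ?b)"
      using norm_triangle_ineq4[of "?a + ?b" "?a - ?b"] by (simp add: scaleR_2 algebra_simps)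
    ultimately show False by simp
  qed
  note good_ex = this
  define \<sigma> where "\<sigma> n y = (SOME s. good n s y)" for n y
  have \<sigma>: "good n (\<sigma> n y) y" if "y \<in> carr F" for n y
    unfolding \<sigma>_def by (rule someI_ex[OF good_ex[OF that]])
  define ys where "ys = rec_nat 0 (\<lambda>n y. y + \<sigma> n y *\<^sub>C v n)"
  have ys0: "ys 0 = 0" and ysS: "ys (Suc n) = ys n + \<sigma> n (ys n) *\<^sub>C v n" for n by (simp_all add: ys_def)
  have ysF: "ys n \<in> carr F" for n
    by (induction n) (simp only: ys0 fock_zero, simp only: ysS, intro fock_add fock_scaleC v)
  define w where "w n = \<sigma> n (ys n) *\<^sub>C v n" for n
  have w: "w n \<in> carr F" for n unfolding w_def by (rule fock_scaleC[OF v])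
  have tw: "norm (t (w n) h) \<le> (1/100) ^ n * norm h" for n h
    using \<sigma>[OF ysF, of n n] tv[of n h] by (simp add: w_def good_def ten.tensor_scaleC_left v norm_scaleC)
  obtain y where y: "y \<in> carr F" "\<And>h. (\<lambda>k. t (w k) h) sums t y h"
    using fock_series[of w "\<lambda>n. (1/100) ^ n", OF w tw] by (auto simp: summable_geometric)
  have tys: "t (ys n) h = (\<Sum>k<n. t (w k) h)" for n h
  proof (induction n)
    case 0
    have "t 0 h = 0" using ten.tensor_scaleC_left[OF fock_zero, of 0 h] by simp
    then show ?case unfolding ys0 by (simp only: lessThan_0 sum.empty)
  next
    case (Suc n)
    then show ?case using ten.tensor_add_left[OF ysF w, of n n h]
      by (simp only: ysS w_def[symmetric] sum.lessThan_Suc)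
  qed
  have yd: "y + (-1) *\<^sub>C ys (Suc n) \<in> carr F" for n by (intro fock_add fock_scaleC y ysF)
  \<comment> \<open>The ratio 1/100 makes the tail at most 1/99 of the \<open>n\<close>-th weight.
    Even after the factor 8 from \<open>fock_ip_norm_le\<close> this is less than half, so half of
    the \<open>n\<close>-th term survives in the pairing with \<open>y\<close>.\<close>
  have tail: "norm (t (y + (-1) *\<^sub>C ys (Suc n)) h) \<le> (1/100) ^ n / 99 * norm h" for n h
  proof -
    have "(\<lambda>k. t (w (k + Suc n)) h) sums (t y h - (\<Sum>k<Suc n. t (w k) h))"
      by (rule sums_split_initial_segment[OF y(2)])
    moreover have "t (y + (-1) *\<^sub>C ys (Suc n)) h = t y h - (\<Sum>k<Suc n. t (w k) h)"
      using ten.tensor_add_left[OF y(1) fock_scaleC[OF ysF[of "Suc n"], where c = "-1"], of h]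
        ten.tensor_scaleC_left[OF ysF[of "Suc n"], of "-1" h]
      by (simp add: tys)
    ultimately have s: "(\<lambda>k. t (w (k + Suc n)) h) sums t (y + (-1) *\<^sub>C ys (Suc n)) h" by simp
    have g: "(\<lambda>k. (1/100::real) ^ Suc n * norm h * (1/100) ^ k) sums ((1/100) ^ Suc n * norm h * (1 / (1 - 1/100)))"
      by (intro sums_mult geometric_sums) simp
    have "norm (t (y + (-1) *\<^sub>C ys (Suc n)) h) \<le> (1/100) ^ Suc n * norm h * (1 / (1 - 1/100))"
      unfolding sums_unique[OF s] sums_unique[OF g]
    proof (rule norm_suminf_le)
      show "norm (t (w (k + Suc n)) h) \<le> (1/100) ^ Suc n * norm h * (1/100) ^ k" for k
        using tw[of "k + Suc n" h] by (simp add: power_add ac_simps)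
    qed (rule sums_summable[OF g])
    then show ?thesis by simp
  qed
  have "real n < 16 * hnorm F (S y)" for n
  proof -
    have 1: "(1/100) ^ n * N n \<le> norm (ip F (T (x n)) (ys (Suc n)))"
      using \<sigma>[OF ysF, of n n] by (simp add: good_def ysS)
    have 2: "norm (ip F (T (x n)) (y + (-1) *\<^sub>C ys (Suc n))) \<le> 8 * (N n * ((1/100) ^ n / 99))"
      by (rule fock_ip_norm_le[OF Tx yd _ _ t_norm_le[OF Tx, folded N_def] tail]) (use N[of n] in auto)
    have "ip F (T (x n)) (y + (-1) *\<^sub>C ys (Suc n)) = ip F (T (x n)) y - ip F (T (x n)) (ys (Suc n))"
      using fock_ip_add[OF Tx[of n] y(1) fock_scaleC[OF ysF[of "Suc n"], where c = "-1"]]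
        fock_ip_scaleC[OF Tx[of n] ysF[of "Suc n"], of "-1"] by simp
    then have "norm (ip F (T (x n)) (ys (Suc n))) \<le> norm (ip F (T (x n)) y) + 8 * (N n * ((1/100) ^ n / 99))"
      using 2 norm_triangle_ineq4[of "ip F (T (x n)) y" "ip F (T (x n)) y - ip F (T (x n)) (ys (Suc n))"] by simp
    then have "(1/100) ^ n * N n / 2 \<le> norm (ip F (T (x n)) y)"
      using 1 mult_nonneg_nonneg[of "(1/100) ^ n" "N n"] N[of n] by (simp add: field_simps)
    also have "ip F (T (x n)) y = ip F (x n) (S y)" by (rule S(2)[OF x(1) y(1)])
    also have "norm \<dots> \<le> 8 * (hnorm F (x n) * hnorm F (S y))"
      by (rule fock_ip_norm_le[OF x(1) fock_adjointable_closed[OF S(1) y(1)] hnorm_nonneg hnorm_nonneg])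
        (intro t_norm_le x fock_adjointable_closed[OF S(1) y(1)])+
    finally have le: "N n \<le> 16 * 100 ^ n * hnorm F (S y) * hnorm F (x n)" by (simp add: field_simps power_one_over)
    have "100 ^ n * (real (Suc n) * hnorm F (x n)) = real (Suc n) * 100 ^ n * hnorm F (x n)" by simp
    also have "\<dots> < N n" unfolding N_def by (rule x(2))
    also have "\<dots> \<le> 100 ^ n * (16 * hnorm F (S y) * hnorm F (x n))" using le by (simp add: ac_simps)
    finally have "real (Suc n) * hnorm F (x n) < 16 * hnorm F (S y) * hnorm F (x n)" by simp
    then have "real (Suc n) < 16 * hnorm F (S y)"
      using hnorm_nonneg[of F "x n"] by (simp only: mult_less_cancel_right)
    then show ?thesis by simp
  qed
  moreover obtain n :: nat where "16 * hnorm F (S y) < n" using reals_Archimedean2 by blast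
  ultimately show False by (metis less_asym)
qed

text \<open>\<open>\<alpha>\<close> applies the composite of the adjoint \<open>S\<close> with
  \<open>T\<close>, the module version of \<open>T\<^sup>* T\<close>. Boundedness of
  \<open>T\<close> and of \<open>S\<close> on the module yields the geometric growth at rate
  \<open>d * c\<close>.\<close>

lemma fock_ext_exists:
  assumes T: "T \<in> adjointable F"
  shows "\<exists>A. \<forall>x\<in>carr F. \<forall>h. A \<cdot> t x h = t (T x) h"
proof -
  obtain S where S: "S \<in> adjointable F" "\<And>x y. x \<in> carr F \<Longrightarrow> y \<in> carr F \<Longrightarrow> ip F (T x) y = ip F x (S y)"
    "\<And>x y. x \<in> carr F \<Longrightarrow> y \<in> carr F \<Longrightarrow> ip F (S x) y = ip F x (T y)"
    using fock_adjointE[OF T] by metis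
  obtain c where c: "0 < c" "\<And>x. x \<in> carr F \<Longrightarrow> hnorm F (T x) \<le> c * hnorm F x"
    using fock_adjointable_bounded[OF T] by blast
  obtain d where d: "0 < d" "\<And>x. x \<in> carr F \<Longrightarrow> hnorm F (S x) \<le> d * hnorm F x"
    using fock_adjointable_bounded[OF S(1)] by blast
  note closed = fock_adjointable_closed[OF T] fock_adjointable_closed[OF S(1)]
  define \<alpha> :: "(nat \<Rightarrow> 't) \<times> 'h \<Rightarrow> (nat \<Rightarrow> 't) \<times> 'h" where "\<alpha> = (\<lambda>(x, h). (S (T x), h))"
  have "\<exists>A. (\<forall>i\<in>carr F \<times> UNIV. A \<cdot> (\<lambda>(x, h). t x h) i = (\<lambda>(x, h). t (T x) h) i) \<and> norm A \<le> sqrt (d * c)"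
  proof (rule gram_extension[where \<alpha> = \<alpha>])
    have "(\<lambda>(x, h). t x h) ` (carr F \<times> UNIV) = {t x h | x h. x \<in> carr F}" by force
    then show "clspan ((\<lambda>(x, h). t x h) ` (carr F \<times> UNIV)) = UNIV" using tensor_total by simp
    show "\<exists>b. \<forall>n. norm ((\<lambda>(x, h). t x h) ((\<alpha> ^^ n) i)) \<le> b * (d * c) ^ n" if iI: "i \<in> carr F \<times> UNIV" for i
    proof -
      obtain x h where i: "i = (x, h)" "x \<in> carr F" using iI by auto
      have "\<exists>y. (\<alpha> ^^ n) i = (y, h) \<and> y \<in> carr F \<and> hnorm F y \<le> hnorm F x * (d * c) ^ n" for n
      proof (induction n)
        case (Suc n)
        then obtain y where y: "(\<alpha> ^^ n) i = (y, h)" "y \<in> carr F" "hnorm F y \<le> hnorm F x * (d * c) ^ n" by blast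
        have "hnorm F (S (T y)) \<le> d * (c * (hnorm F x * (d * c) ^ n))"
          using d(2)[OF closed(1)[OF y(2)]] c(2)[OF y(2)] y(3) c(1) d(1)
          by (meson mult_left_mono order_trans less_imp_le)
        then show ?case using y closed by (intro exI[of _ "S (T y)"]) (simp add: \<alpha>_def ac_simps)
      qed (simp add: i)
      then have "norm ((\<lambda>(x, h). t x h) ((\<alpha> ^^ n) i)) \<le> hnorm F x * norm h * (d * c) ^ n" for n
      proof -
        obtain y where y: "(\<alpha> ^^ n) i = (y, h)" "y \<in> carr F" "hnorm F y \<le> hnorm F x * (d * c) ^ n"
          using \<open>\<And>n. \<exists>y. (\<alpha> ^^ n) i = (y, h) \<and> y \<in> carr F \<and> hnorm F y \<le> hnorm F x * (d * c) ^ n\<close> by blast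
        have "norm (t y h) \<le> hnorm F x * (d * c) ^ n * norm h"
          by (rule order_trans[OF t_norm_le[OF y(2)]]) (intro mult_right_mono y, simp)
        then show ?thesis by (simp add: y ac_simps)
      qed
      then show ?thesis by blast
    qed
  qed (use c d closed in \<open>auto simp: \<alpha>_def ten.tensor_cinner S(2,3)\<close>)
  then show ?thesis by fastforce
qed

definition ext :: "((nat \<Rightarrow> 't) \<Rightarrow> nat \<Rightarrow> 't) \<Rightarrow> 'k cop"
  where "ext T = (SOME A. \<forall>x\<in>carr F. \<forall>h. A \<cdot> t x h = t (T x) h)"

lemma ext_t: "T \<in> adjointable F \<Longrightarrow> x \<in> carr F \<Longrightarrow> ext T \<cdot> t x h = t (T x) h"
  using someI_ex[OF fock_ext_exists] unfolding ext_def by blast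

lemma amplification_cop:
  assumes "\<And>x h. x \<in> carr F \<Longrightarrow> A \<cdot> t x h = t (T x) h"
  shows "amplification F t T = (\<lambda>u. A \<cdot> u)"
proof -
  have "tensor_space (carr F) t = UNIV" using tensor_total by (simp add: tensor_space_def)
  then show ?thesis using tensor_op_cop[of "carr F" A t t T] assms by (simp add: amplification_def restrict_UNIV)
qed

lemma amplification_ext: "T \<in> adjointable F \<Longrightarrow> amplification F t T = (\<lambda>u. ext T \<cdot> u)"
  by (rule amplification_cop) (rule ext_t)

end

section \<open>The Hardy algebra and its invariant subspaces\<close>

context fock_representation
begin

section \<open>Hardy algebra elements as left multiplications\<close>

definition fin_fock :: "(nat \<Rightarrow> 't) set"
  where "fin_fock = {\<zeta>. (\<forall>n. \<zeta> n \<in> carr (X n)) \<and> (\<exists>N. \<forall>n\<ge>N. \<zeta> n = 0)}"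

definition vac :: "nat \<Rightarrow> 't"
  where "vac = fock_incl 0 (\<iota> 1)"

text \<open>The map that tensors with \<open>x\<close> on the right,
  \<open>\<zeta> \<mapsto> \<zeta> \<otimes> x\<close>, taken degree by degree.\<close>

definition right_tensor :: "nat \<Rightarrow> 't \<Rightarrow> (nat \<Rightarrow> 't) \<Rightarrow> nat \<Rightarrow> 't"
  where "right_tensor n x \<zeta> = (\<lambda>m. if n \<le> m then \<tau> (m - n) n (\<zeta> (m - n)) x else 0)"

lemma fin_fock_nth: "\<zeta> \<in> fin_fock \<Longrightarrow> \<zeta> n \<in> carr (X n)"
  by (simp add: fin_fock_def)

lemma fin_fock_subset: "\<zeta> \<in> fin_fock \<Longrightarrow> \<zeta> \<in> carr F"
proof -
  assume \<zeta>: "\<zeta> \<in> fin_fock"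
  then obtain N where N: "\<And>n. n \<ge> N \<Longrightarrow> \<zeta> n = 0" by (auto simp: fin_fock_def)
  note z = fin_fock_nth[OF \<zeta>]
  show ?thesis
  proof (rule fock_memI2(1)[where u = "\<lambda>h. \<Sum>n<N. lv n (\<zeta> n) h" and c = "\<Sum>n<N. hnorm (X n) (\<zeta> n)"])
    show "norm (\<Sum>n<N. lv n (\<zeta> n) h) \<le> (\<Sum>n<N. hnorm (X n) (\<zeta> n)) * norm h" for h
      unfolding sum_distrib_right by (rule order_trans[OF norm_sum]) (intro sum_mono lv_norm_le z)
    show "P m \<cdot> (\<Sum>n<N. lv n (\<zeta> n) h) = lv m (\<zeta> m) h" for m h
    proof -
      have "P m \<cdot> (\<Sum>n<N. lv n (\<zeta> n) h) = (\<Sum>n<N. if m = n then lv m (\<zeta> m) h else 0)"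
        unfolding capp_sum_right by (intro sum.cong) (auto simp: P_lv z)
      also have "\<dots> = lv m (\<zeta> m) h" using N[of m] by (auto simp: lv_zero)
      finally show ?thesis .
    qed
  qed (auto simp: z sum_nonneg hnorm_nonneg)
qed

lemma incl_fin: "x \<in> carr (X n) \<Longrightarrow> fock_incl n x \<in> fin_fock"
  unfolding fin_fock_def
proof (intro CollectI conjI allI exI impI)
  show "x \<in> carr (X n) \<Longrightarrow> fock_incl n x k \<in> carr (X k)" for k by (auto simp: fock_incl_def Xm.carr_zero)
  show "Suc n \<le> k \<Longrightarrow> fock_incl n x k = 0" for k by (simp add: fock_incl_def)
qed

lemma vac_fin: "vac \<in> fin_fock"
  unfolding vac_def by (rule incl_fin[OF \<iota>_closed])

lemma right_tensor_nth: "right_tensor n x \<zeta> (j + n) = \<tau> j n (\<zeta> j) x"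
  by (simp add: right_tensor_def)

lemma right_tensor_eqI:
  assumes "\<And>m. m < n \<Longrightarrow> \<eta> m = 0" "\<And>j. \<eta> (j + n) = \<tau> j n (\<zeta> j) x"
  shows "\<eta> = right_tensor n x \<zeta>"
proof
  fix m show "\<eta> m = right_tensor n x \<zeta> m"
    using assms(1)[of m] assms(2)[of "m - n"] by (auto simp: right_tensor_def)
qed

lemma right_tensor_fin:
  assumes \<zeta>: "\<zeta> \<in> fin_fock" and x: "x \<in> carr (X n)"
  shows "right_tensor n x \<zeta> \<in> fin_fock"
proof -
  obtain N where N: "\<And>n. n \<ge> N \<Longrightarrow> \<zeta> n = 0" using \<zeta> by (auto simp: fin_fock_def)
  have "right_tensor n x \<zeta> m \<in> carr (X m)" for m
    using \<tau>_closed[OF fin_fock_nth[OF \<zeta>, of "m - n"] x] by (auto simp: right_tensor_def Xm.carr_zero)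
  moreover have "right_tensor n x \<zeta> m = 0" if "m \<ge> N + n" for m
    using N[of "m - n"] that by (simp add: right_tensor_def \<tau>_zero_left x)
  ultimately show ?thesis by (auto simp: fin_fock_def)
qed

lemma incl_eq_right_tensor:
  assumes x: "x \<in> carr (X n)"
  shows "fock_incl n x = right_tensor n x vac"
proof (rule right_tensor_eqI)
  show "fock_incl n x (j + n) = \<tau> j n (vac j) x" for j
    using x by (cases j) (auto simp: fock_incl_def vac_def pow.tensor_unit_left \<psi>_one \<tau>_zero_left)
qed (simp add: fock_incl_def)

lemma creation_fin:
  assumes \<xi>: "\<xi> \<in> carr (X 1)" and \<zeta>: "\<zeta> \<in> fin_fock"
  shows "creation X \<tau> 1 \<xi> \<zeta> \<in> fin_fock"
proof -
  have c: "creation X \<tau> 1 \<xi> \<zeta> = (\<lambda>n. if 1 \<le> n then \<tau> 1 (n - 1) \<xi> (\<zeta> (n - 1)) else 0)"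
    using fin_fock_subset[OF \<zeta>] by (simp only: creation_def restrict_apply')
  obtain N where N: "\<And>n. n \<ge> N \<Longrightarrow> \<zeta> n = 0" using \<zeta> by (auto simp: fin_fock_def)
  have "creation X \<tau> 1 \<xi> \<zeta> m \<in> carr (X m)" for m
    unfolding c using \<tau>_closed[OF \<xi> fin_fock_nth[OF \<zeta>, of "m - 1"]] by (auto simp: Xm.carr_zero)
  moreover have "creation X \<tau> 1 \<xi> \<zeta> m = 0" if "m \<ge> Suc N" for m
    unfolding c using N[of "m - 1"] that \<tau>_zero_right[OF \<xi>] by auto
  ultimately show ?thesis unfolding fin_fock_def by blast
qed

lemma fock_left_fin:
  assumes \<zeta>: "\<zeta> \<in> fin_fock"
  shows "fock_left X \<psi> a \<zeta> \<in> fin_fock"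
proof -
  have c: "fock_left X \<psi> a \<zeta> = (\<lambda>n. \<psi> n a (\<zeta> n))"
    using fin_fock_subset[OF \<zeta>] by (simp only: fock_left_def restrict_apply')
  have "\<psi> n a 0 = 0" for n
    using Xm.adjointable_scaleC[OF pow.left_adjointable Xm.carr_zero, of n a 0] by simp
  moreover obtain N where "\<forall>n\<ge>N. \<zeta> n = 0" using \<zeta> by (auto simp: fin_fock_def)
  ultimately have "\<forall>n\<ge>N. \<psi> n a (\<zeta> n) = 0" by simp
  moreover have "\<forall>n. \<psi> n a (\<zeta> n) \<in> carr (X n)" using fin_fock_nth[OF \<zeta>] \<psi>_closed by blast
  ultimately show ?thesis unfolding fin_fock_def c by blast
qed

text \<open>Creation operators and left actions work on the left, so they commute with tensoring on
  the right. Every vector of degree \<open>n\<close> is \<open>vac\<close> tensored with itself,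
  hence such a map is determined there by its value at \<open>vac\<close>. Finite sequences suffice
  because the generators preserve them.\<close>

definition level_shift :: "((nat \<Rightarrow> 't) \<Rightarrow> nat \<Rightarrow> 't) \<Rightarrow> bool"
  where "level_shift T \<longleftrightarrow> (\<forall>\<zeta>\<in>fin_fock. T \<zeta> \<in> fin_fock \<and>
    (\<forall>n. \<forall>x\<in>carr (X n). T (right_tensor n x \<zeta>) = right_tensor n x (T \<zeta>)))"

lemma level_shift_creation:
  assumes \<xi>: "\<xi> \<in> carr (X 1)"
  shows "level_shift (creation X \<tau> 1 \<xi>)"
  unfolding level_shift_def
proof (intro ballI conjI allI)
  fix \<zeta> assume \<zeta>: "\<zeta> \<in> fin_fock"
  show "creation X \<tau> 1 \<xi> \<zeta> \<in> fin_fock" by (rule creation_fin[OF \<xi> \<zeta>])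
  fix n x assume x: "x \<in> carr (X n)"
  have c: "creation X \<tau> 1 \<xi> \<eta> = (\<lambda>n. if 1 \<le> n then \<tau> 1 (n - 1) \<xi> (\<eta> (n - 1)) else 0)" if "\<eta> \<in> fin_fock" for \<eta>
    using fin_fock_subset[OF that] by (simp only: creation_def restrict_apply')
  show "creation X \<tau> 1 \<xi> (right_tensor n x \<zeta>) = right_tensor n x (creation X \<tau> 1 \<xi> \<zeta>)"
  proof (rule right_tensor_eqI)
    show "creation X \<tau> 1 \<xi> (right_tensor n x \<zeta>) m = 0" if "m < n" for m
      unfolding c[OF right_tensor_fin[OF \<zeta> x]] using that \<tau>_zero_right[OF \<xi>] by (auto simp: right_tensor_def)
    show "creation X \<tau> 1 \<xi> (right_tensor n x \<zeta>) (j + n) = \<tau> j n (creation X \<tau> 1 \<xi> \<zeta> j) x" for j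
    proof (cases j)
      case 0
      then show ?thesis
        unfolding c[OF right_tensor_fin[OF \<zeta> x]] c[OF \<zeta>]
        using \<tau>_zero_right[OF \<xi>] \<tau>_zero_left[OF x] by (auto simp: right_tensor_def)
    next
      case (Suc i)
      have "\<tau> 1 (i + n) \<xi> (\<tau> i n (\<zeta> i) x) = \<tau> (1 + i) n (\<tau> 1 i \<xi> (\<zeta> i)) x"
        by (rule pow.tensor_assoc[symmetric]) (intro \<xi> fin_fock_nth[OF \<zeta>] x)+
      then show ?thesis
        unfolding c[OF right_tensor_fin[OF \<zeta> x]] c[OF \<zeta>]
        using right_tensor_nth[of n x \<zeta> i] by (simp add: Suc)
    qed
  qed
qed

lemma level_shift_fock_left: "level_shift (fock_left X \<psi> a)"
  unfolding level_shift_def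
proof (intro ballI conjI allI)
  fix \<zeta> assume \<zeta>: "\<zeta> \<in> fin_fock"
  show "fock_left X \<psi> a \<zeta> \<in> fin_fock" by (rule fock_left_fin[OF \<zeta>])
  fix n x assume x: "x \<in> carr (X n)"
  have c: "fock_left X \<psi> a \<eta> = (\<lambda>n. \<psi> n a (\<eta> n))" if "\<eta> \<in> fin_fock" for \<eta>
    using fin_fock_subset[OF that] by (simp only: fock_left_def restrict_apply')
  have z: "\<psi> m a 0 = 0" for m
    using Xm.adjointable_scaleC[OF pow.left_adjointable Xm.carr_zero, of m a 0] by simp
  show "fock_left X \<psi> a (right_tensor n x \<zeta>) = right_tensor n x (fock_left X \<psi> a \<zeta>)"
  proof (rule right_tensor_eqI)
    show "fock_left X \<psi> a (right_tensor n x \<zeta>) m = 0" if "m < n" for m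
      unfolding c[OF right_tensor_fin[OF \<zeta> x]] using that by (simp add: right_tensor_def z)
    show "fock_left X \<psi> a (right_tensor n x \<zeta>) (j + n) = \<tau> j n (fock_left X \<psi> a \<zeta> j) x" for j
      using pow.left_tensor[OF fin_fock_nth[OF \<zeta>] x, of j a]
      by (simp add: c right_tensor_fin[OF \<zeta> x] \<zeta> right_tensor_nth)
  qed
qed

lemma right_tensor_add:
  assumes "\<zeta> \<in> fin_fock" "\<eta> \<in> fin_fock" "x \<in> carr (X n)"
  shows "right_tensor n x (\<zeta> + \<eta>) = right_tensor n x \<zeta> + right_tensor n x \<eta>"
  by (auto simp: right_tensor_def fun_eq_iff \<tau>_add_left fin_fock_nth assms)

lemma right_tensor_scaleC:
  assumes "\<zeta> \<in> fin_fock" "x \<in> carr (X n)"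
  shows "right_tensor n x (c *\<^sub>C \<zeta>) = c *\<^sub>C right_tensor n x \<zeta>"
  by (auto simp: right_tensor_def fun_eq_iff \<tau>_scaleC_left fin_fock_nth assms scaleC_fun_def)

lemma fin_fock_add: "\<zeta> \<in> fin_fock \<Longrightarrow> \<eta> \<in> fin_fock \<Longrightarrow> \<zeta> + \<eta> \<in> fin_fock"
proof -
  assume a: "\<zeta> \<in> fin_fock" "\<eta> \<in> fin_fock"
  then obtain N M where "\<And>n. n \<ge> N \<Longrightarrow> \<zeta> n = 0" "\<And>n. n \<ge> M \<Longrightarrow> \<eta> n = 0" by (auto simp: fin_fock_def)
  then have "\<forall>n\<ge>max N M. (\<zeta> + \<eta>) n = 0" by simp
  moreover have "\<forall>n. (\<zeta> + \<eta>) n \<in> carr (X n)" using a by (auto simp: fin_fock_def Xm.carr_add)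
  ultimately show ?thesis unfolding fin_fock_def by blast
qed

lemma fin_fock_scaleC: "\<zeta> \<in> fin_fock \<Longrightarrow> c *\<^sub>C \<zeta> \<in> fin_fock"
  by (auto simp: fin_fock_def scaleC_fun_def Xm.carr_scaleC)

lemma level_shift_algebra:
  assumes "T \<in> operator_algebra F (creation X \<tau> 1 ` carr (X 1) \<union> range (fock_left X \<psi>))"
  shows "level_shift T"
  using assms
proof induction
  case (generator T)
  then show ?case using level_shift_creation level_shift_fock_left by blast
next
  case (add S T)
  have r: "restrict (\<lambda>x. S x + T x) (carr F) \<zeta> = S \<zeta> + T \<zeta>" if "\<zeta> \<in> fin_fock" for \<zeta>
    using fin_fock_subset[OF that] by simp
  have IH: "S \<zeta> \<in> fin_fock" "T \<zeta> \<in> fin_fock"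
    "x \<in> carr (X n) \<Longrightarrow> S (right_tensor n x \<zeta>) = right_tensor n x (S \<zeta>)"
    "x \<in> carr (X n) \<Longrightarrow> T (right_tensor n x \<zeta>) = right_tensor n x (T \<zeta>)" if "\<zeta> \<in> fin_fock" for \<zeta> n x
    using add.IH that unfolding level_shift_def by auto
  show ?case
    unfolding level_shift_def
  proof (intro ballI conjI allI)
    fix \<zeta> assume \<zeta>: "\<zeta> \<in> fin_fock"
    show "restrict (\<lambda>x. S x + T x) (carr F) \<zeta> \<in> fin_fock" unfolding r[OF \<zeta>] by (intro fin_fock_add IH \<zeta>)
    fix n x assume x: "x \<in> carr (X n)"
    show "restrict (\<lambda>x. S x + T x) (carr F) (right_tensor n x \<zeta>) = right_tensor n x (restrict (\<lambda>x. S x + T x) (carr F) \<zeta>)"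
      unfolding r[OF \<zeta>] r[OF right_tensor_fin[OF \<zeta> x]] by (simp only: IH \<zeta> x right_tensor_add)
  qed
next
  case (scale T c)
  have r: "restrict (\<lambda>x. c *\<^sub>C T x) (carr F) \<zeta> = c *\<^sub>C T \<zeta>" if "\<zeta> \<in> fin_fock" for \<zeta>
    using fin_fock_subset[OF that] by simp
  have IH: "T \<zeta> \<in> fin_fock"
    "x \<in> carr (X n) \<Longrightarrow> T (right_tensor n x \<zeta>) = right_tensor n x (T \<zeta>)" if "\<zeta> \<in> fin_fock" for \<zeta> n x
    using scale.IH that unfolding level_shift_def by auto
  show ?case
    unfolding level_shift_def
  proof (intro ballI conjI allI)
    fix \<zeta> assume \<zeta>: "\<zeta> \<in> fin_fock"
    show "restrict (\<lambda>x. c *\<^sub>C T x) (carr F) \<zeta> \<in> fin_fock" unfolding r[OF \<zeta>] by (intro fin_fock_scaleC IH \<zeta>)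
    fix n x assume x: "x \<in> carr (X n)"
    show "restrict (\<lambda>x. c *\<^sub>C T x) (carr F) (right_tensor n x \<zeta>) = right_tensor n x (restrict (\<lambda>x. c *\<^sub>C T x) (carr F) \<zeta>)"
      unfolding r[OF \<zeta>] r[OF right_tensor_fin[OF \<zeta> x]] by (simp only: IH \<zeta> x right_tensor_scaleC)
  qed
next
  case (mult S T)
  have r: "compose (carr F) S T \<zeta> = S (T \<zeta>)" if "\<zeta> \<in> fin_fock" for \<zeta>
    using fin_fock_subset[OF that] by (simp add: compose_def)
  have IH: "S \<zeta> \<in> fin_fock" "T \<zeta> \<in> fin_fock"
    "x \<in> carr (X n) \<Longrightarrow> S (right_tensor n x \<zeta>) = right_tensor n x (S \<zeta>)"
    "x \<in> carr (X n) \<Longrightarrow> T (right_tensor n x \<zeta>) = right_tensor n x (T \<zeta>)" if "\<zeta> \<in> fin_fock" for \<zeta> n x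
    using mult.IH that unfolding level_shift_def by auto
  show ?case
    unfolding level_shift_def
  proof (intro ballI conjI allI)
    fix \<zeta> assume \<zeta>: "\<zeta> \<in> fin_fock"
    show "compose (carr F) S T \<zeta> \<in> fin_fock" unfolding r[OF \<zeta>] by (intro IH \<zeta>)
    fix n x assume x: "x \<in> carr (X n)"
    show "compose (carr F) S T (right_tensor n x \<zeta>) = right_tensor n x (compose (carr F) S T \<zeta>)"
      unfolding r[OF \<zeta>] r[OF right_tensor_fin[OF \<zeta> x]] by (simp only: IH \<zeta> x)
  qed
qed

lemma hardy_adjointable: "T \<in> hardy_algebra X \<psi> \<tau> \<Longrightarrow> T \<in> adjointable F"
  unfolding hardy_algebra_def operator_weakstar_def in_closure_of
  by (elim conjE) (rule subsetD[OF topspace_weak_topology_subset])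

text \<open>For the generated algebra these are instances of commuting with right tensoring. They
  pass to the weak* closure because each side, tested by a predual functional, is a functional of
  \<open>T\<close> that belongs to \<open>operator_functionals\<close>.\<close>

lemma hardy_level:
  assumes T: "T \<in> hardy_algebra X \<psi> \<tau>" and x: "x \<in> carr (X n)"
  shows "m < n \<Longrightarrow> T (fock_incl n x) m = 0"
    and "T (fock_incl n x) (j + n) = \<tau> j n (T vac j) x"
proof -
  have Tc: "T (fock_incl n x) k \<in> carr (X k)" "T vac k \<in> carr (X k)" for k
    using fock_nth fock_adjointable_closed[OF hardy_adjointable[OF T]] fin_fock_subset vac_fin incl_fin[OF x] by blast+
  let ?A = "operator_algebra F (creation X \<tau> 1 ` carr (X 1) \<union> range (fock_left X \<psi>))"
  have Tcl: "T \<in> weak_topology (adjointable F) (operator_functionals F) closure_of ?A"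
    using T by (simp add: hardy_algebra_def operator_weakstar_def)
  have alg: "S (fock_incl n x) = right_tensor n x (S vac)" "S vac \<in> fin_fock" if "S \<in> ?A" for S
    using level_shift_algebra[OF that] vac_fin x incl_eq_right_tensor[OF x] unfolding level_shift_def by auto
  have fx: "fock_incl n x \<in> carr F" by (rule incl_closed[OF x])
  show "T (fock_incl n x) m = 0" if m: "m < n"
  proof (rule Xm.ip_eqI[OF Tc(1) Xm.carr_zero])
    fix y assume y: "y \<in> carr (X m)"
    show "ip (X m) y (T (fock_incl n x) m) = ip (X m) y 0"
    proof (rule predual_separates)
      fix f :: "'m \<Rightarrow> complex" assume f: "f \<in> predual"
      have "f (ip F (fock_incl m y) (T (fock_incl n x))) = (\<lambda>_. 0) (ip F (fock_incl m y) (T (fock_incl n x)))"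
      proof (rule weak_topology_closure_eq[OF Tcl])
        show "(\<lambda>T. f (ip F (fock_incl m y) (T (fock_incl n x)))) \<in> operator_functionals F"
          by (rule operator_functional_single[OF f incl_closed[OF y] fx])
        show "(\<lambda>T. (\<lambda>_. 0) (ip F (fock_incl m y) (T (fock_incl n x)))) \<in> operator_functionals F"
          by (rule operator_functional_single[OF predual_zero incl_closed[OF y] fx])
        fix S assume S: "S \<in> ?A"
        have "ip F (fock_incl m y) (S (fock_incl n x)) = ip (X m) y (S (fock_incl n x) m)"
          using alg(1)[OF S] fin_fock_nth[OF right_tensor_fin[OF alg(2)[OF S] x]] ip_incl_left[OF y] by simp
        also have "\<dots> = 0" using m y by (simp add: alg(1)[OF S] right_tensor_def Xm.ip_zero_right)
        finally show "f (ip F (fock_incl m y) (S (fock_incl n x))) = 0" by (simp add: predual_map_zero[OF f])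
      qed
      then show "f (ip (X m) y (T (fock_incl n x) m)) = f (ip (X m) y 0)"
        using ip_incl_left[OF y, of "T (fock_incl n x)"] Tc(1) by (simp add: Xm.ip_zero_right y predual_map_zero[OF f])
    qed
  qed
  show "T (fock_incl n x) (j + n) = \<tau> j n (T vac j) x"
  proof (rule \<tau>_eqI[OF Tc(1) \<tau>_closed[OF Tc(2) x]])
    fix \<eta> z assume \<eta>: "\<eta> \<in> carr (X j)" and z: "z \<in> carr (X n)"
    let ?y = "\<tau> j n \<eta> z"
    have y: "?y \<in> carr (X (j + n))" by (rule \<tau>_closed[OF \<eta> z])
    show "ip (X (j + n)) ?y (T (fock_incl n x) (j + n)) = ip (X (j + n)) ?y (\<tau> j n (T vac j) x)"
    proof (rule eq_if_forms_eq)
      fix h k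
      define f where "f a = cinner h (\<pi> a k)" for a
      \<comment> \<open>Pairing \<open>\<xi> \<otimes> x\<close> with
        \<open>\<eta> \<otimes> z\<close> depends on \<open>\<xi>\<close> only through
        \<open>ip (X j) \<eta> \<xi>\<close>. Normality of the left action in degree
        \<open>n\<close> makes this dependence a predual functional \<open>g\<close>.\<close>
      define g where "g a = cinner (lv n z h) (Th a \<cdot> (P n \<cdot> lv n x k))" for a
      have f: "f \<in> predual" unfolding f_def by (rule \<pi>_normal)
      have g: "g \<in> predual" unfolding g_def by (rule Th_normal)
      have fg: "f (ip (X (j + n)) ?y (\<tau> j n \<xi> x)) = g (ip (X j) \<eta> \<xi>)" if "\<xi> \<in> carr (X j)" for \<xi>
        using that \<eta> z x by (simp add: f_def g_def \<tau>_ip P_lv Th_lv lv_cinner \<psi>_closed)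
      have vacF: "vac \<in> carr F" by (rule fin_fock_subset[OF vac_fin])
      have "f (ip F (fock_incl (j + n) ?y) (T (fock_incl n x))) = g (ip F (fock_incl j \<eta>) (T vac))"
      proof (rule weak_topology_closure_eq[OF Tcl])
        show "(\<lambda>T. f (ip F (fock_incl (j + n) ?y) (T (fock_incl n x)))) \<in> operator_functionals F"
          by (rule operator_functional_single[OF f incl_closed[OF y] fx])
        show "(\<lambda>T. g (ip F (fock_incl j \<eta>) (T vac))) \<in> operator_functionals F"
          by (rule operator_functional_single[OF g incl_closed[OF \<eta>] vacF])
        fix S assume S: "S \<in> ?A"
        have "ip F (fock_incl (j + n) ?y) (S (fock_incl n x)) = ip (X (j + n)) ?y (\<tau> j n (S vac j) x)"
          using alg(1)[OF S] fin_fock_nth[OF right_tensor_fin[OF alg(2)[OF S] x]] ip_incl_left[OF y]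
          by (simp add: right_tensor_nth)
        moreover have "ip F (fock_incl j \<eta>) (S vac) = ip (X j) \<eta> (S vac j)"
          by (rule ip_incl_left[OF \<eta>]) (rule fin_fock_nth[OF alg(2)[OF S]])
        ultimately show "f (ip F (fock_incl (j + n) ?y) (S (fock_incl n x))) = g (ip F (fock_incl j \<eta>) (S vac))"
          using fg[OF fin_fock_nth[OF alg(2)[OF S]]] by simp
      qed
      then have "f (ip (X (j + n)) ?y (T (fock_incl n x) (j + n))) = f (ip (X (j + n)) ?y (\<tau> j n (T vac j) x))"
        using ip_incl_left[OF y, of "T (fock_incl n x)"] ip_incl_left[OF \<eta>, of "T vac"] Tc fg[OF Tc(2)] by simp
      then show "cinner h (\<pi> (ip (X (j + n)) ?y (T (fock_incl n x) (j + n))) k) =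
        cinner h (\<pi> (ip (X (j + n)) ?y (\<tau> j n (T vac j) x)) k)" by (simp add: f_def)
    qed
  qed
qed

lemma P_ext_lv:
  assumes T: "T \<in> adjointable F" and x: "x \<in> carr (X n)"
  shows "P m \<cdot> (ext T \<cdot> lv n x h) = lv m (T (fock_incl n x) m) h"
  using ext_t[OF T incl_closed[OF x], of h] P_t[OF fock_adjointable_closed[OF T incl_closed[OF x]], of m h]
  by (simp add: level_def)

lemma hardy_ext:
  assumes T: "T \<in> hardy_algebra X \<psi> \<tau>"
  shows "m < n \<Longrightarrow> P m * ext T * P n = 0" "P (j + n) * ext T * P n = Lam j (T vac j) * P n"
proof -
  have v: "T vac j \<in> carr (X j)" for j
    using fock_nth fock_adjointable_closed[OF hardy_adjointable[OF T]] fin_fock_subset vac_fin by blast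
  show "P m * ext T * P n = 0" if "m < n"
    by (rule cop_lv_eqI) (use that in \<open>auto simp: capp_mult P_lv P_ext_lv[OF hardy_adjointable[OF T]] hardy_level(1)[OF T] lv_zero\<close>)
  show "P (j + n) * ext T * P n = Lam j (T vac j) * P n"
    by (rule cop_lv_eqI) (auto simp: capp_mult P_lv P_ext_lv[OF hardy_adjointable[OF T]] hardy_level(2)[OF T] Lam_lv v)
qed

theorem AlgLat_level:
  assumes Y: "Y \<in> adjointable F"
    and AL: "amplification F t Y \<in> AlgLat (amplification F t ` hardy_algebra X \<psi> \<tau>)"
  shows "\<exists>\<xi>\<in>carr (X j). P (j + s) * ext Y * P s = Lam j \<xi> * P s"
proof -
  have "(P (j + s) * ext Y) \<cdot> (P s \<cdot> k) \<in> closure {Lam j \<xi> \<cdot> (P s \<cdot> k) | \<xi>. \<xi> \<in> carr (X j)}" for k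
  proof -
    define u where "u = P s \<cdot> k"
    \<comment> \<open>All degrees \<open>i\<close> are included so that the closed span is invariant
      under the Hardy algebra; \<open>i = 0\<close> and \<open>\<iota> 1\<close> put
      \<open>u\<close> itself into it.\<close>
    define D where "D = {Lam i \<xi> \<cdot> u | i \<xi>. \<xi> \<in> carr (X i)}"
    define N where "N = clspan D"
    have N: "csubspace N" "closed N" unfolding N_def by (auto intro: csubspace_clspan)
    have base: "Lam i \<xi> \<cdot> u \<in> N" if "\<xi> \<in> carr (X i)" for i \<xi>
      unfolding N_def D_def by (rule clspan_base) (use that in blast)
    have inv: "ext T \<cdot> v \<in> N" if T: "T \<in> hardy_algebra X \<psi> \<tau>" and v: "v \<in> N" for T v
    proof -
      have gen: "ext T \<cdot> (Lam i \<xi> \<cdot> u) \<in> N" if \<xi>: "\<xi> \<in> carr (X i)" for i \<xi>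
      proof -
        define w where "w = Lam i \<xi> \<cdot> u"
        have w: "P (i + s) \<cdot> w = w" unfolding w_def u_def by (simp add: P_Lam_P \<xi>)
        \<comment> \<open>Elements of the weak* closure are handled one component at a time: each
          component of \<open>ext T \<cdot> w\<close> is again a generator or zero, and the
          components sum in norm to \<open>ext T \<cdot> w\<close>.\<close>
        have piece: "P m \<cdot> (ext T \<cdot> w) \<in> N" for m
        proof (cases "m < i + s")
          case True
          have "P m \<cdot> (ext T \<cdot> w) = 0"
            using arg_cong[OF hardy_ext(1)[OF T True], of "\<lambda>A. A \<cdot> w"] by (simp add: capp_mult w)
          then show ?thesis using N by (simp add: csubspace_iff)
        next
          case False
          then obtain l where l: "m = l + (i + s)" by (metis le_add_diff_inverse2 not_less)
          have v: "T vac l \<in> carr (X l)"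
            using fock_nth fock_adjointable_closed[OF hardy_adjointable[OF T]] fin_fock_subset vac_fin by blast
          have "P m \<cdot> (ext T \<cdot> w) = Lam l (T vac l) \<cdot> w"
            using arg_cong[OF hardy_ext(2)[OF T, of l "i + s"], of "\<lambda>A. A \<cdot> w"] by (simp add: capp_mult w l)
          also have "\<dots> = Lam (l + i) (\<tau> l i (T vac l) \<xi>) \<cdot> u"
            unfolding w_def using arg_cong[OF Lam_Lam[OF v \<xi>], of "\<lambda>A. A \<cdot> u"] by (simp add: capp_mult)
          finally show ?thesis using base[OF \<tau>_closed[OF v \<xi>]] by simp
        qed
        have "(\<Sum>m<n. P m \<cdot> (ext T \<cdot> w)) \<in> N" for n
          by (rule complex_vector.subspace_sum[OF N(1)]) (rule piece)
        from closed_sequentially[OF N(2) this P_sums[of "ext T \<cdot> w", unfolded sums_def]]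
        show ?thesis by (simp only: w_def)
      qed
      have "N \<subseteq> {v. ext T \<cdot> v \<in> N}"
        unfolding N_def
      proof (rule clspan_minimal)
        show "D \<subseteq> {v. ext T \<cdot> v \<in> clspan D}" using gen unfolding D_def N_def by blast
        show "csubspace {v. ext T \<cdot> v \<in> clspan D}"
          using N(1) unfolding N_def by (auto simp: csubspace_iff capp_simps)
        have "closed ((\<lambda>v. ext T \<cdot> v) -` clspan D)"
          by (intro continuous_closed_vimage) (auto intro!: continuous_on_interior[of UNIV] continuous_intros)
        then show "closed {v. ext T \<cdot> v \<in> clspan D}" by (simp add: vimage_def)
      qed
      with v show ?thesis by blast
    qed
    have "N \<in> Lat (amplification F t ` hardy_algebra X \<psi> \<tau>)"
      unfolding Lat_def using N inv by (auto simp: amplification_ext hardy_adjointable)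
    then have "amplification F t Y ` N \<subseteq> N" using AL by (simp add: AlgLat_def)
    moreover have "u \<in> N" using base[OF \<iota>_closed, of 1] by (simp add: Lam_\<iota> Th_one)
    ultimately have Yu: "ext Y \<cdot> u \<in> N" by (auto simp: amplification_ext[OF Y])
    let ?S = "closure {Lam j \<xi> \<cdot> u | \<xi>. \<xi> \<in> carr (X j)}"
    have S: "csubspace ?S" by (rule csubspace_closure[OF Lam_orbit_subspace])
    have "N \<subseteq> {v. P (j + s) \<cdot> v \<in> ?S}"
      unfolding N_def
    proof (rule clspan_minimal)
      show "D \<subseteq> {v. P (j + s) \<cdot> v \<in> ?S}"
      proof
        fix v assume "v \<in> D"
        then obtain i \<xi> where v: "v = Lam i \<xi> \<cdot> u" "\<xi> \<in> carr (X i)" by (auto simp: D_def)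
        show "v \<in> {v. P (j + s) \<cdot> v \<in> ?S}"
        proof (cases "i = j")
          case True
          then have "P (j + s) \<cdot> v = Lam j \<xi> \<cdot> u" using v by (simp add: u_def P_Lam_P)
          then show ?thesis using v True closure_subset[of "{Lam j \<xi> \<cdot> u | \<xi>. \<xi> \<in> carr (X j)}"] by auto
        next
          case False
          then have "P (j + s) \<cdot> v = 0" using v by (simp add: u_def P_Lam_P)
          then show ?thesis using S by (simp add: csubspace_iff)
        qed
      qed
      show "csubspace {v. P (j + s) \<cdot> v \<in> ?S}" using S by (auto simp: csubspace_iff capp_simps)
      have "closed ((\<lambda>v. P (j + s) \<cdot> v) -` ?S)"
        by (intro continuous_closed_vimage) (auto intro!: continuous_on_interior[of UNIV] continuous_intros)
      then show "closed {v. P (j + s) \<cdot> v \<in> ?S}" by (simp add: vimage_def)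
    qed
    then have "P (j + s) \<cdot> (ext Y \<cdot> u) \<in> ?S" using Yu by blast
    then show ?thesis by (simp only: capp_mult u_def)
  qed
  from level_reflexive[OF this] obtain \<xi>
    where \<xi>: "\<xi> \<in> carr (X j)" "\<forall>k. (P (j + s) * ext Y) \<cdot> (P s \<cdot> k) = Lam j \<xi> \<cdot> (P s \<cdot> k)" by blast
  have "P (j + s) * ext Y * P s = Lam j \<xi> * P s"
    by (rule cop_eqI) (simp only: capp_mult[of _ "P s"] \<xi>(2)[rule_format])
  with \<xi>(1) show ?thesis by blast
qed

end

section \<open>Fourier coefficients\<close>

lemma cis_has_integral:
  "((\<lambda>\<theta>. cis (real_of_int p * \<theta>)) has_integral (if p = 0 then of_real (2 * pi) else 0)) {0..2 * pi}"
proof (cases "p = 0")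
  case True
  then show ?thesis using has_integral_const_real[of "1::complex" 0 "2 * pi"] by (simp add: scaleR_conv_of_real)
next
  case False
  have "((\<lambda>\<theta>. cis (real_of_int p * \<theta>)) has_integral
      (cis (real_of_int p * (2 * pi)) / (\<i> * of_int p) - cis (real_of_int p * 0) / (\<i> * of_int p))) {0..2 * pi}"
  proof (rule fundamental_theorem_of_calculus)
    fix \<theta> :: real
    have "((\<lambda>\<theta>. cis (real_of_int p * \<theta>)) has_vector_derivative (of_int p * (\<i> * cis (real_of_int p * \<theta>)))) (at \<theta> within {0..2 * pi})"
      unfolding cis_conv_exp
      by (auto intro!: derivative_eq_intros exp_scaleR_has_vector_derivative_right[THEN has_vector_derivative_eq_rhs]
          has_vector_derivative_real_field simp: algebra_simps)
    then have "((\<lambda>\<theta>. cis (real_of_int p * \<theta>) / (\<i> * of_int p)) has_vector_derivative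
        (of_int p * (\<i> * cis (real_of_int p * \<theta>))) / (\<i> * of_int p)) (at \<theta> within {0..2 * pi})"
      by (rule bounded_linear.has_vector_derivative[OF bounded_linear_divide])
    then show "((\<lambda>\<theta>. cis (real_of_int p * \<theta>) / (\<i> * of_int p)) has_vector_derivative cis (real_of_int p * \<theta>)) (at \<theta> within {0..2 * pi})"
      using False by simp
  qed simp
  moreover have "cis (real_of_int p * (2 * pi)) = 1"
    using cis_multiple_2pi[of "real_of_int p"] by (simp add: mult.commute)
  ultimately show ?thesis using False by simp
qed

context fock_representation
begin

lemma cop_t_eqI:
  assumes "\<And>x h. x \<in> carr F \<Longrightarrow> A \<cdot> t x h = B \<cdot> t x h"
  shows "A = B"
  by (rule cop_lv_eqI) (simp add: level_def assms incl_closed)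

lemma star_ext:
  assumes Y: "Y \<in> adjointable F" and S: "S \<in> adjointable F"
    and adj: "\<And>x y. x \<in> carr F \<Longrightarrow> y \<in> carr F \<Longrightarrow> ip F (Y x) y = ip F x (S y)"
  shows "star (ext Y) = ext S"
proof (rule cop_t_eqI, rule K_eqI)
  fix x h n z k assume x: "x \<in> carr F" and z: "z \<in> carr (X n)"
  have w: "fock_incl n z \<in> carr F" by (rule incl_closed[OF z])
  show "cinner (lv n z k) (star (ext Y) \<cdot> t x h) = cinner (lv n z k) (ext S \<cdot> t x h)"
    unfolding level_def cinner_star_right ext_t[OF Y w] ext_t[OF S x]
    using fock_adjointable_closed[OF Y w] fock_adjointable_closed[OF S x] by (simp add: ten.tensor_cinner w x adj)
qed

text \<open>The expected value of the \<open>j\<close>-th Fourier coefficient: the sum of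
  \<open>P (n + j) Y P n\<close> over all \<open>n\<close>, in coordinates.\<close>

definition shift_part :: "nat \<Rightarrow> ((nat \<Rightarrow> 't) \<Rightarrow> nat \<Rightarrow> 't) \<Rightarrow> (nat \<Rightarrow> 't) \<Rightarrow> nat \<Rightarrow> 't"
  where "shift_part j Y = restrict (\<lambda>x m. if j \<le> m then Y (fock_incl (m - j) (x (m - j))) m else 0) (carr F)"

definition shift_op :: "nat \<Rightarrow> ((nat \<Rightarrow> 't) \<Rightarrow> nat \<Rightarrow> 't) \<Rightarrow> 'k cop"
  where "shift_op j Y = (SOME A. \<forall>u. (\<lambda>n. P (j + n) \<cdot> (ext Y \<cdot> (P n \<cdot> u))) sums (A \<cdot> u))"

text \<open>The terms lie in different summands, so they are orthogonal, and Bessel's inequality for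
  \<open>u\<close> bounds the sum of their squares. The diagonal part is thus bounded by
  \<open>norm (ext Y)\<close> directly on \<open>'k\<close>.\<close>

lemma shift_op_sums: "(\<lambda>n. P (j + n) \<cdot> (ext Y \<cdot> (P n \<cdot> u))) sums (shift_op j Y \<cdot> u)"
proof -
  define f where "f u n = P (j + n) \<cdot> (ext Y \<cdot> (P n \<cdot> u))" for u n
  have orth: "cinner (f u m) (f u n) = 0" if "m \<noteq> n" for u m n
    unfolding f_def by (rule P_orth) (use that in simp)
  have bound: "(\<Sum>n<N. (norm (f u n))\<^sup>2) \<le> (norm (ext Y) * norm u)\<^sup>2" for u N
  proof -
    have "(norm (f u n))\<^sup>2 \<le> (norm (ext Y))\<^sup>2 * (norm (P n \<cdot> u))\<^sup>2" for n
      unfolding f_def power_mult_distrib[symmetric]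
      by (intro power_mono order_trans[OF P_norm_le] capp_norm_le) simp
    then have "(\<Sum>n<N. (norm (f u n))\<^sup>2) \<le> (\<Sum>n<N. (norm (ext Y))\<^sup>2 * (norm (P n \<cdot> u))\<^sup>2)" by (rule sum_mono)
    also have "\<dots> \<le> (norm (ext Y))\<^sup>2 * (norm u)\<^sup>2"
      unfolding sum_distrib_left[symmetric] by (intro mult_left_mono P_bessel) simp
    finally show ?thesis by (simp add: power_mult_distrib)
  qed
  have sm: "summable (f u)" for u by (rule orthogonal_summable[OF orth bound])
  have nf: "norm (\<Sum>n. f u n) \<le> norm (ext Y) * norm u" for u
  proof (rule LIMSEQ_le_const2[OF tendsto_norm[OF summable_LIMSEQ[OF sm]]])
    have "norm (\<Sum>n<N. f u n) \<le> norm (ext Y) * norm u" for N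
    proof (rule power2_le_imp_le)
      have "(norm (\<Sum>n<N. f u n))\<^sup>2 = (\<Sum>n<N. (norm (f u n))\<^sup>2)" by (rule norm_sum_orthogonal) (auto simp: orth)
      then show "(norm (\<Sum>n<N. f u n))\<^sup>2 \<le> (norm (ext Y) * norm u)\<^sup>2" using bound by simp
    qed simp
    then show "\<exists>N. \<forall>n\<ge>N. norm (\<Sum>n<n. f u n) \<le> norm (ext Y) * norm u" by blast
  qed
  have lin: "f (u + v) n = f u n + f v n" "f (c *\<^sub>C u) n = c *\<^sub>C f u n" for u v c n
    by (simp_all add: f_def capp_simps)
  have "\<exists>A. \<forall>u. A \<cdot> u = (\<Sum>n. f u n)"
  proof (rule cop_exists[OF _ _ nf])
    show "(\<Sum>n. f (u + v) n) = (\<Sum>n. f u n) + (\<Sum>n. f v n)" for u v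
      unfolding lin by (rule suminf_add[OF sm sm, symmetric])
    show "(\<Sum>n. f (c *\<^sub>C u) n) = c *\<^sub>C (\<Sum>n. f u n)" for c u
      unfolding lin by (rule bounded_linear.suminf[OF bounded_linear_scaleC sm, symmetric])
  qed
  then have "\<exists>A. \<forall>u. (\<lambda>n. P (j + n) \<cdot> (ext Y \<cdot> (P n \<cdot> u))) sums (A \<cdot> u)"
    using summable_sums[OF sm] unfolding f_def by metis
  then have "\<forall>u. (\<lambda>n. P (j + n) \<cdot> (ext Y \<cdot> (P n \<cdot> u))) sums (shift_op j Y \<cdot> u)"
    unfolding shift_op_def by (rule someI_ex)
  then show ?thesis by blast
qed

lemma P_shift_op: "P m \<cdot> (shift_op j Y \<cdot> u) = (if j \<le> m then P m \<cdot> (ext Y \<cdot> (P (m - j) \<cdot> u)) else 0)"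
proof -
  have "(\<lambda>N. P m \<cdot> (\<Sum>n<N. P (j + n) \<cdot> (ext Y \<cdot> (P n \<cdot> u)))) \<longlonglongrightarrow> P m \<cdot> (shift_op j Y \<cdot> u)"
    using shift_op_sums[of j Y u] unfolding sums_def by (intro tendsto_capp tendsto_const)
  then have 1: "(\<lambda>n. P m \<cdot> (P (j + n) \<cdot> (ext Y \<cdot> (P n \<cdot> u)))) sums (P m \<cdot> (shift_op j Y \<cdot> u))"
    by (simp add: sums_def capp_sum_right)
  have "(\<lambda>n. P m \<cdot> (P (j + n) \<cdot> (ext Y \<cdot> (P n \<cdot> u)))) sums
    (\<Sum>n\<in>(if j \<le> m then {m - j} else {}). P m \<cdot> (P (j + n) \<cdot> (ext Y \<cdot> (P n \<cdot> u))))"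
    by (rule sums_finite) (auto simp: P_P split: if_splits)
  then have "(\<lambda>n. P m \<cdot> (P (j + n) \<cdot> (ext Y \<cdot> (P n \<cdot> u)))) sums (if j \<le> m then P m \<cdot> (ext Y \<cdot> (P (m - j) \<cdot> u)) else 0)"
    by (simp add: P_P split: if_splits)
  with 1 show ?thesis by (rule sums_unique2)
qed

lemma shift_op_P: "shift_op j Y \<cdot> (P s \<cdot> u) = P (j + s) \<cdot> (ext Y \<cdot> (P s \<cdot> u))"
  by (rule P_eqI) (auto simp: P_shift_op P_P)

lemma P_ext_t:
  assumes "Y \<in> adjointable F" "x \<in> carr F"
  shows "P m \<cdot> (ext Y \<cdot> (P n \<cdot> t x h)) = lv m (Y (fock_incl n (x n)) m) h"
  using P_ext_lv[OF assms(1) fock_nth[OF assms(2)]] by (simp add: P_t assms)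

lemma shift_part_eq: "x \<in> carr F \<Longrightarrow> shift_part j Y x = (\<lambda>m. if j \<le> m then Y (fock_incl (m - j) (x (m - j))) m else 0)"
  by (simp only: shift_part_def restrict_apply')

lemma shift_part_t:
  assumes Y: "Y \<in> adjointable F" and x: "x \<in> carr F"
  shows "shift_part j Y x \<in> carr F" "t (shift_part j Y x) h = shift_op j Y \<cdot> t x h"
proof -
  let ?c = "norm (shift_op j Y) * hnorm F x"
  have Yc: "Y (fock_incl n (x n)) m \<in> carr (X m)" for n m
    by (rule fock_nth[OF fock_adjointable_closed[OF Y incl_closed[OF fock_nth[OF x]]]])
  have c: "shift_part j Y x m \<in> carr (X m)" for m
    by (simp add: shift_part_eq[OF x] Yc Xm.carr_zero)
  have n: "norm (shift_op j Y \<cdot> t x h) \<le> ?c * norm h" for h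
    unfolding mult.assoc by (rule order_trans[OF capp_norm_le]) (intro mult_left_mono t_norm_le x, simp)
  have p: "P m \<cdot> (shift_op j Y \<cdot> t x h) = lv m (shift_part j Y x m) h" for m h
    by (simp add: P_shift_op P_ext_t[OF Y x] shift_part_eq[OF x] lv_zero)
  have c0: "0 \<le> ?c" by (simp add: hnorm_nonneg)
  from fock_memI2[OF c c0 n p] show "shift_part j Y x \<in> carr F" "t (shift_part j Y x) h = shift_op j Y \<cdot> t x h" by auto
qed

text \<open>The adjoint \<open>R\<close> is guessed from the matrix of the Hilbert space adjoint of
  \<open>shift_op j Y\<close>, whose entries are those of the adjoint \<open>S\<close> of
  \<open>Y\<close>. Boundedness on \<open>'k\<close> then places \<open>R y\<close> in the Fock
  module.\<close>

lemma shift_part_adjointable: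
  assumes Y: "Y \<in> adjointable F"
  shows "shift_part j Y \<in> adjointable F"
proof -
  obtain S where S: "S \<in> adjointable F"
    "\<And>x y. x \<in> carr F \<Longrightarrow> y \<in> carr F \<Longrightarrow> ip F (Y x) y = ip F x (S y)"
    using fock_adjointE[OF Y] by metis
  let ?A = "star (shift_op j Y)"
  define R where "R = restrict (\<lambda>y n. S (fock_incl (j + n) (y (j + n))) n) (carr F)"
  have pA: "P n * ?A = P n * star (ext Y) * P (j + n)" for n
  proof -
    have "shift_op j Y * P n = P (j + n) * ext Y * P n"
      by (rule cop_eqI) (simp add: capp_mult shift_op_P)
    then have "star (shift_op j Y * P n) = star (P (j + n) * ext Y * P n)" by simp
    then show ?thesis by (simp add: star_mult P_star mult.assoc)
  qed
  have R: "R y \<in> carr F" "t (R y) h = ?A \<cdot> t y h" if y: "y \<in> carr F" for y h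
  proof -
    let ?c = "norm ?A * hnorm F y"
    have Ry: "R y = (\<lambda>n. S (fock_incl (j + n) (y (j + n))) n)" using y by (simp only: R_def restrict_apply')
    have c: "R y n \<in> carr (X n)" for n
      unfolding Ry by (rule fock_nth[OF fock_adjointable_closed[OF S(1) incl_closed[OF fock_nth[OF y]]]])
    have n: "norm (?A \<cdot> t y h) \<le> ?c * norm h" for h
      unfolding mult.assoc by (rule order_trans[OF capp_norm_le]) (intro mult_left_mono t_norm_le y, simp)
    have p: "P n \<cdot> (?A \<cdot> t y h) = lv n (R y n) h" for n h
      using arg_cong[OF pA[of n], of "\<lambda>B. B \<cdot> t y h"] P_ext_t[OF S(1) y, of n "j + n" h] star_ext[OF Y S]
      by (simp add: capp_mult Ry)
    have c0: "0 \<le> ?c" by (simp add: hnorm_nonneg)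
    from fock_memI2[OF c c0 n p] show "R y \<in> carr F" "t (R y) h = ?A \<cdot> t y h" by auto
  qed
  have "ip F (shift_part j Y x) y = ip F x (R y)" if x: "x \<in> carr F" and y: "y \<in> carr F" for x y
    by (rule eq_if_forms_eq)
      (simp add: ten.tensor_cinner[symmetric] shift_part_t[OF Y x] R[OF y] x y cinner_star_right)
  moreover have "shift_part j Y \<in> carr F \<rightarrow>\<^sub>E carr F"
    using shift_part_t(1)[OF Y] by (auto simp: shift_part_def)
  moreover have "R \<in> carr F \<rightarrow>\<^sub>E carr F" using R(1) by (auto simp: R_def)
  ultimately show ?thesis unfolding adjointable_def by blast
qed

section \<open>The gauge action on the Hilbert space and the Fourier integral\<close>

lemma gauge_op_exists: "\<exists>T. (\<forall>n x h. x \<in> carr (X n) \<longrightarrow> T \<cdot> lv n x h = cis (real n * \<theta>) *\<^sub>C lv n x h) \<and> norm T \<le> sqrt 1"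
proof (rule gram_extension_lv[where A = "\<lambda>n x. x" and B = "\<lambda>h. h"])
  fix n m x y h k assume "x \<in> carr (X n)" "y \<in> carr (X m)"
  then show "cinner (cis (real n * \<theta>) *\<^sub>C lv n x h) (cis (real m * \<theta>) *\<^sub>C lv m y k) = cinner (lv n x h) (lv m y k)"
    by (cases "n = m") (auto simp: cinner_simps lv_cinner cis_cnj cis_mult simp flip: mult.assoc)
next
  fix n and x :: 't and h :: 'h
  have "((\<lambda>x. x) ^^ i) x = x" "((\<lambda>h. h) ^^ i) h = h" for i by (induction i) auto
  then show "\<exists>c. \<forall>i. norm (lv n (((\<lambda>x. x) ^^ i) x) (((\<lambda>h. h) ^^ i) h)) \<le> c * 1 ^ i" by auto
qed auto

definition gauge_op :: "real \<Rightarrow> 'k cop"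
  where "gauge_op \<theta> = (SOME T. (\<forall>n x h. x \<in> carr (X n) \<longrightarrow> T \<cdot> lv n x h = cis (real n * \<theta>) *\<^sub>C lv n x h) \<and> norm T \<le> sqrt 1)"

lemma gauge_op_lv: "x \<in> carr (X n) \<Longrightarrow> gauge_op \<theta> \<cdot> lv n x h = cis (real n * \<theta>) *\<^sub>C lv n x h"
  and gauge_op_norm_le: "norm (gauge_op \<theta>) \<le> 1"
  using someI_ex[OF gauge_op_exists[of \<theta>]] unfolding gauge_op_def by auto

lemma star_gauge_op: "star (gauge_op \<theta>) = gauge_op (- \<theta>)"
proof (rule cop_lv_eqI, rule K_eqI)
  fix n x h m y k assume "x \<in> carr (X n)" "y \<in> carr (X m)"
  then show "cinner (lv m y k) (star (gauge_op \<theta>) \<cdot> lv n x h) = cinner (lv m y k) (gauge_op (- \<theta>) \<cdot> lv n x h)"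
    by (simp add: cinner_star_right gauge_op_lv cinner_simps lv_cinner cis_cnj)
qed

lemma P_gauge_op: "P n \<cdot> (gauge_op \<theta> \<cdot> u) = cis (real n * \<theta>) *\<^sub>C (P n \<cdot> u)"
proof -
  have "P n * gauge_op \<theta> = cis (real n * \<theta>) *\<^sub>C P n"
    by (rule cop_lv_eqI) (simp add: capp_simps gauge_op_lv P_lv)
  from arg_cong[OF this, of "\<lambda>T. T \<cdot> u"] show ?thesis by (simp add: capp_simps)
qed

lemma gauge_unitary_t:
  assumes x: "x \<in> carr F"
  shows "gauge_unitary \<theta> x \<in> carr F" "t (gauge_unitary \<theta> x) h = gauge_op \<theta> \<cdot> t x h"
proof -
  have c: "gauge_unitary \<theta> x n \<in> carr (X n)" for n by (simp add: gauge_unitary_def Xm.carr_scaleC fock_nth[OF x])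
  have n: "norm (gauge_op \<theta> \<cdot> t x h) \<le> hnorm F x * norm h" for h
    using order_trans[OF capp_norm_le mult_mono[OF gauge_op_norm_le t_norm_le[OF x]]] by simp
  have p: "P n \<cdot> (gauge_op \<theta> \<cdot> t x h) = lv n (gauge_unitary \<theta> x n) h" for n h
    by (simp add: P_gauge_op P_t[OF x] gauge_unitary_def lv_scaleC_left fock_nth[OF x])
  from fock_memI2[OF c hnorm_nonneg n p]
  show "gauge_unitary \<theta> x \<in> carr F" "t (gauge_unitary \<theta> x) h = gauge_op \<theta> \<cdot> t x h" by auto
qed

lemma gauge_t:
  assumes T: "T \<in> adjointable F" and x: "x \<in> carr F"
  shows "gauge X \<theta> T x \<in> carr F" "t (gauge X \<theta> T x) h = gauge_op \<theta> \<cdot> (ext T \<cdot> (gauge_op (- \<theta>) \<cdot> t x h))"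
proof -
  have g: "gauge X \<theta> T x = gauge_unitary \<theta> (T (gauge_unitary (- \<theta>) x))"
    using x by (simp only: gauge_def restrict_apply')
  have 1: "gauge_unitary (- \<theta>) x \<in> carr F" by (rule gauge_unitary_t(1)[OF x])
  have 2: "T (gauge_unitary (- \<theta>) x) \<in> carr F" by (rule fock_adjointable_closed[OF T 1])
  show "gauge X \<theta> T x \<in> carr F" unfolding g by (rule gauge_unitary_t(1)[OF 2])
  show "t (gauge X \<theta> T x) h = gauge_op \<theta> \<cdot> (ext T \<cdot> (gauge_op (- \<theta>) \<cdot> t x h))"
    unfolding g gauge_unitary_t(2)[OF 2] ext_t[OF T 1, symmetric] gauge_unitary_t(2)[OF x] ..
qed

lemma gauge_form:
  assumes "T \<in> adjointable F" "x \<in> carr F" "y \<in> carr F"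
  shows "cinner h (\<pi> (ip F x (gauge X \<theta> T y)) k) = cinner (gauge_op (- \<theta>) \<cdot> t x h) (ext T \<cdot> (gauge_op (- \<theta>) \<cdot> t y k))"
  using ten.tensor_cinner[OF assms(2) gauge_t(1)[OF assms(1,3)], of h \<theta> k]
    cinner_star_left[of "gauge_op (- \<theta>)" _ "t x h"]
  by (simp add: gauge_t(2)[OF assms(1,3)] star_gauge_op[of \<theta>, symmetric] cinner_star_left)

lemma gauge_ip_norm_le:
  assumes T: "T \<in> adjointable F" and x: "x \<in> carr F" and y: "y \<in> carr F"
  shows "norm (ip F x (gauge X \<theta> T y)) \<le> 8 * (norm (ext T) * hnorm F x * hnorm F y)"
proof (rule norm_le_if_form_le)
  fix h k
  have "norm (gauge_op (- \<theta>) \<cdot> u) \<le> norm u" for u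
    using order_trans[OF capp_norm_le mult_right_mono[OF gauge_op_norm_le norm_ge_zero]] by simp
  then have g: "norm (gauge_op (- \<theta>) \<cdot> t z l) \<le> hnorm F z * norm l" if "z \<in> carr F" for z l
    using t_norm_le[OF that] order_trans by blast
  have "cmod (cinner (gauge_op (- \<theta>) \<cdot> t x h) (ext T \<cdot> (gauge_op (- \<theta>) \<cdot> t y k)))
    \<le> (hnorm F x * norm h) * (norm (ext T) * (hnorm F y * norm k))"
    by (intro order_trans[OF cmod_cinner_le] mult_mono order_trans[OF capp_norm_le] g x y mult_left_mono)
      (auto simp: hnorm_nonneg)
  then show "cmod (cinner h (\<pi> (ip F x (gauge X \<theta> T y)) k)) \<le> norm (ext T) * hnorm F x * hnorm F y * norm h * norm k"
    unfolding gauge_form[OF T x y] by (simp add: ac_simps)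
qed (simp add: hnorm_nonneg)

text \<open>Truncating both vectors turns the integrand into a trigonometric polynomial; the truncations
  converge boundedly, so dominated convergence applies.\<close>

lemma gauge_integral:
  assumes Y: "Y \<in> adjointable F" and x: "x \<in> carr F" and y: "y \<in> carr F" and f: "f \<in> predual"
  shows "((\<lambda>\<theta>. cis (- (real j * \<theta>)) * f (ip F x (gauge X \<theta> Y y))) has_integral
    of_real (2 * pi) * f (ip F x (shift_part j Y y))) {0..2 * pi}"
proof -
  have Yc: "Y (fock_incl n (y n)) m \<in> carr (X m)" for n m
    by (rule fock_nth[OF fock_adjointable_closed[OF Y incl_closed[OF fock_nth[OF y]]]])
  define c where "c m n = ip (X m) (x m) (Y (fock_incl n (y n)) m)" for m n
  \<comment> \<open>The inner product of the truncation of \<open>x\<close> with the gauge transform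
    of \<open>Y\<close> applied to the truncation of \<open>y\<close>; a trigonometric polynomial in
    \<open>\<theta>\<close> with coefficients in \<open>M\<close>.\<close>
  define G where "G N \<theta> = (\<Sum>m<N. \<Sum>n<N. cis ((real m - real n) * \<theta>) *\<^sub>C c m n)" for N \<theta>
  define Q where "Q N u = (\<Sum>n<N. P n \<cdot> u)" for N u
  have Qn: "norm (Q N u) \<le> norm u" for N u
  proof (rule power2_le_imp_le)
    have "(norm (Q N u))\<^sup>2 = (\<Sum>n<N. (norm (P n \<cdot> u))\<^sup>2)"
      unfolding Q_def by (rule norm_sum_orthogonal) (auto simp: P_orth)
    then show "(norm (Q N u))\<^sup>2 \<le> (norm u)\<^sup>2" using P_bessel by simp
  qed simp
  have form: "cinner h (\<pi> (G N \<theta>) k) = cinner (gauge_op (- \<theta>) \<cdot> Q N (t x h)) (ext Y \<cdot> (gauge_op (- \<theta>) \<cdot> Q N (t y k)))" for N \<theta> h k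
  proof -
    have e: "cinner (gauge_op (- \<theta>) \<cdot> (P m \<cdot> t x h)) (ext Y \<cdot> (gauge_op (- \<theta>) \<cdot> (P n \<cdot> t y k)))
        = cis ((real m - real n) * \<theta>) * cinner h (\<pi> (c m n) k)" for m n
    proof -
      have "cinner (lv m (x m) h) (ext Y \<cdot> lv n (y n) k) = cinner (lv m (x m) h) (P m \<cdot> (ext Y \<cdot> lv n (y n) k))"
        by (simp add: P_cinner[symmetric] P_lv fock_nth[OF x])
      also have "\<dots> = cinner h (\<pi> (c m n) k)"
        unfolding P_ext_lv[OF Y fock_nth[OF y]] c_def by (simp add: lv_cinner fock_nth[OF x] Yc)
      finally show ?thesis
        by (simp add: P_t[OF x] P_t[OF y] gauge_op_lv fock_nth[OF x] fock_nth[OF y] cinner_simps capp_simps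
            cis_cnj mult.assoc[symmetric] cis_mult algebra_simps)
    qed
    have "\<pi> (G N \<theta>) k = (\<Sum>m<N. \<Sum>n<N. cis ((real m - real n) * \<theta>) *\<^sub>C \<pi> (c m n) k)"
      by (simp add: G_def \<pi>_sum rep.rep_scaleC)
    then have "cinner h (\<pi> (G N \<theta>) k) = (\<Sum>m<N. \<Sum>n<N. cis ((real m - real n) * \<theta>) * cinner h (\<pi> (c m n) k))"
      by (simp add: cinner_sum_right cinner_scaleC_right)
    also have "\<dots> = (\<Sum>m<N. \<Sum>n<N. cinner (gauge_op (- \<theta>) \<cdot> (P m \<cdot> t x h)) (ext Y \<cdot> (gauge_op (- \<theta>) \<cdot> (P n \<cdot> t y k))))"
      by (simp only: e)
    finally show ?thesis by (simp only: Q_def capp_sum_right cinner_sum_left cinner_sum_right)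
        (subst sum.swap, rule refl)
  qed
  define C where "C = 8 * (norm (ext Y) * hnorm F x * hnorm F y)"
  have nG: "norm (G N \<theta>) \<le> C" for N \<theta>
    unfolding C_def
  proof (rule norm_le_if_form_le)
    fix h k
    have "norm (gauge_op (- \<theta>) \<cdot> u) \<le> norm u" for u
      using order_trans[OF capp_norm_le mult_right_mono[OF gauge_op_norm_le norm_ge_zero]] by simp
    then have g: "norm (gauge_op (- \<theta>) \<cdot> Q N (t z l)) \<le> hnorm F z * norm l" if "z \<in> carr F" for z l
      using t_norm_le[OF that] Qn order_trans by meson
    have "cmod (cinner (gauge_op (- \<theta>) \<cdot> Q N (t x h)) (ext Y \<cdot> (gauge_op (- \<theta>) \<cdot> Q N (t y k))))
      \<le> (hnorm F x * norm h) * (norm (ext Y) * (hnorm F y * norm k))"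
      by (intro order_trans[OF cmod_cinner_le] mult_mono order_trans[OF capp_norm_le] g x y mult_left_mono)
        (auto simp: hnorm_nonneg)
    then show "cmod (cinner h (\<pi> (G N \<theta>) k)) \<le> norm (ext Y) * hnorm F x * hnorm F y * norm h * norm k"
      unfolding form by (simp add: ac_simps)
  qed (simp add: hnorm_nonneg)
  have Glim: "(\<lambda>N. f (G N \<theta>)) \<longlonglongrightarrow> f (ip F x (gauge X \<theta> Y y))" for \<theta>
  proof -
    let ?L = "\<lambda>h k. cinner h (\<pi> (ip F x (gauge X \<theta> Y y)) k)"
    have Ql: "(\<lambda>N. Q N u) \<longlonglongrightarrow> u" for u using P_sums[of u] by (simp add: sums_def Q_def)
    have lim: "(\<lambda>N. cinner h (\<pi> (G N \<theta>) k)) \<longlonglongrightarrow> ?L h k" for h k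
      unfolding form gauge_form[OF Y x y] by (intro tendsto_intros Ql)
    obtain a where "\<forall>f\<in>predual. (\<lambda>N. f (G N \<theta>)) \<longlonglongrightarrow> f a"
      using weakstar_convergent[of sequentially "\<lambda>N. G N \<theta>" C ?L, OF sequentially_bot nG lim] by blast
    then have a: "\<And>f. f \<in> predual \<Longrightarrow> (\<lambda>N. f (G N \<theta>)) \<longlonglongrightarrow> f a" by blast
    have "a = ip F x (gauge X \<theta> Y y)"
      by (rule eq_if_forms_eq) (rule LIMSEQ_unique[OF a[OF \<pi>_normal] lim])
    with a[OF f] show ?thesis by simp
  qed
  \<comment> \<open>The integral against \<open>cis (- (j \<theta>))\<close> keeps exactly the terms
    with \<open>m - n = j\<close>, that is, one entry of \<open>shift_part j Y\<close> in each
    degree.\<close>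
  define I where "I N = of_real (2 * pi) * f (\<Sum>m<N. ip (X m) (x m) (shift_part j Y y m))" for N
  show ?thesis
  proof (rule has_integral_dominated_convergence[where f = "\<lambda>N \<theta>. cis (- (real j * \<theta>)) * f (G N \<theta>)" and y = I])
    fix N
    have "((\<lambda>\<theta>. \<Sum>m<N. \<Sum>n<N. cis (real_of_int (int m - int n - int j) * \<theta>) * f (c m n)) has_integral
      (\<Sum>m<N. \<Sum>n<N. (if int m - int n - int j = 0 then of_real (2 * pi) else 0) * f (c m n))) {0..2 * pi}"
      by (intro has_integral_sum has_integral_mult_left cis_has_integral) auto
    moreover have "cis (- (real j * \<theta>)) * f (G N \<theta>) = (\<Sum>m<N. \<Sum>n<N. cis (real_of_int (int m - int n - int j) * \<theta>) * f (c m n))" for \<theta>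
    proof -
      have "cis (- (real j * \<theta>)) * cis ((real m - real n) * \<theta>) = cis (real_of_int (int m - int n - int j) * \<theta>)" for m n
        by (simp add: cis_mult algebra_simps)
      then show ?thesis
        by (simp add: G_def predual_map_sum[OF f] predual_map_scaleC[OF f] sum_distrib_left flip: mult.assoc)
    qed
    moreover have "(\<Sum>m<N. \<Sum>n<N. (if int m - int n - int j = 0 then of_real (2 * pi) else 0) * f (c m n)) = I N"
    proof -
      have "(\<Sum>n<N. (if int m - int n - int j = 0 then of_real (2 * pi) else 0) * f (c m n)) =
          of_real (2 * pi) * f (ip (X m) (x m) (shift_part j Y y m))" if m: "m < N" for m
      proof (cases "j \<le> m")
        case True
        have "(\<Sum>n<N. (if int m - int n - int j = 0 then of_real (2 * pi) else 0) * f (c m n)) =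
            (\<Sum>n<N. if n = m - j then of_real (2 * pi) * f (c m n) else 0)"
          by (intro sum.cong refl) (use True in auto)
        also have "\<dots> = of_real (2 * pi) * f (c m (m - j))" using m by simp
        finally show ?thesis using True by (simp add: shift_part_eq[OF y] c_def)
      next
        case False
        have "(\<Sum>n<N. (if int m - int n - int j = 0 then of_real (2 * pi) else 0) * f (c m n)) = (\<Sum>n<N. 0)"
          by (intro sum.cong refl) (use False in auto)
        then show ?thesis using False
          by (simp add: shift_part_eq[OF y] Xm.ip_zero_right fock_nth[OF x] predual_map_zero[OF f])
      qed
      then show ?thesis by (simp add: I_def predual_map_sum[OF f] sum_distrib_left)
    qed
    ultimately show "((\<lambda>\<theta>. cis (- (real j * \<theta>)) * f (G N \<theta>)) has_integral I N) {0..2 * pi}" by simp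
    have "cmod (f (G N \<theta>)) \<le> functional_norm f * C" for \<theta>
      by (rule order_trans[OF predual_map_le[OF f] mult_left_mono[OF nG predual_norm_nonneg[OF f]]])
    then show "\<forall>\<theta>\<in>{0..2 * pi}. norm (cis (- (real j * \<theta>)) * f (G N \<theta>)) \<le> functional_norm f * C"
      by (simp add: norm_mult)
  next
    show "I \<longlonglongrightarrow> of_real (2 * pi) * f (ip F x (shift_part j Y y))"
      using fock_ip_sums[OF x shift_part_t(1)[OF Y y] f]
      unfolding I_def predual_map_sum[OF f] sums_def by (intro tendsto_mult tendsto_const)
  qed (auto intro!: tendsto_mult Glim)
qed

lemma shift_ip_norm_le:
  assumes Y: "Y \<in> adjointable F" and x: "x \<in> carr F" and y: "y \<in> carr F"
  shows "norm (ip F x (shift_part j Y y)) \<le> 8 * (norm (shift_op j Y) * hnorm F x * hnorm F y)"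
proof -
  have "norm (ip F x (shift_part j Y y)) \<le> 8 * (hnorm F x * (norm (shift_op j Y) * hnorm F y))"
  proof (rule fock_ip_norm_le[OF x shift_part_t(1)[OF Y y]])
    show "norm (t (shift_part j Y y) h) \<le> norm (shift_op j Y) * hnorm F y * norm h" for h
      unfolding shift_part_t(2)[OF Y y] mult.assoc
      by (rule order_trans[OF capp_norm_le]) (intro mult_left_mono t_norm_le y, simp)
  qed (auto simp: hnorm_nonneg t_norm_le x)
  then show ?thesis by (simp add: ac_simps)
qed

text \<open>A general element of \<open>operator_functionals\<close> is an absolutely convergent
  series of simple ones. The simple terms are bounded uniformly in \<open>\<theta>\<close> by a
  multiple of the summable weights \<open>w\<close>, so dominated convergence extends the
  formula.\<close>

lemma fourier_integral:
  assumes Y: "Y \<in> adjointable F" and \<omega>: "\<omega> \<in> operator_functionals F"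
  shows "((\<lambda>\<theta>. cis (- (real j * \<theta>)) * \<omega> (gauge X \<theta> Y)) has_integral
    of_real (2 * pi) * \<omega> (shift_part j Y)) {0..2 * pi}"
proof -
  obtain f x y where \<omega>': "\<omega> = (\<lambda>T. \<Sum>n. f n (ip F (x n) (T (y n))))"
    and fxy: "\<And>n. f n \<in> predual" "\<And>n. x n \<in> carr F" "\<And>n. y n \<in> carr F"
    and sm: "summable (\<lambda>n::nat. functional_norm (f n) * hnorm F (x n) * hnorm F (y n))"
    using \<omega> unfolding operator_functionals_def by blast
  define w where "w n = functional_norm (f n) * hnorm F (x n) * hnorm F (y n)" for n
  have w0: "0 \<le> w n" for n by (simp add: w_def hnorm_nonneg predual_norm_nonneg[OF fxy(1)])
  have sw: "summable w" using sm by (simp add: w_def[abs_def])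
  have term_le: "cmod (f n a) \<le> (8 * c) * w n" if "norm a \<le> 8 * (c * hnorm F (x n) * hnorm F (y n))" for n a c
  proof -
    have "cmod (f n a) \<le> functional_norm (f n) * (8 * (c * hnorm F (x n) * hnorm F (y n)))"
      by (rule order_trans[OF predual_map_le[OF fxy(1)] mult_left_mono[OF that predual_norm_nonneg[OF fxy(1)]]])
    then show ?thesis by (simp add: w_def ac_simps)
  qed
  have g_le: "cmod (f n (ip F (x n) (gauge X \<theta> Y (y n)))) \<le> (8 * norm (ext Y)) * w n" for n \<theta>
    by (rule term_le[OF gauge_ip_norm_le[OF Y fxy(2,3)]])
  have s_le: "cmod (f n (ip F (x n) (shift_part j Y (y n)))) \<le> (8 * norm (shift_op j Y)) * w n" for n
    by (rule term_le[OF shift_ip_norm_le[OF Y fxy(2,3)]])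
  have sg: "summable (\<lambda>n. f n (ip F (x n) (gauge X \<theta> Y (y n))))" for \<theta>
    by (rule summable_comparison_test[OF _ summable_mult[OF sw]]) (use g_le in auto)
  have ss: "summable (\<lambda>n. f n (ip F (x n) (shift_part j Y (y n))))"
    by (rule summable_comparison_test[OF _ summable_mult[OF sw]]) (use s_le in auto)
  show ?thesis
    unfolding \<omega>'
  proof (rule has_integral_dominated_convergence[where
        f = "\<lambda>N \<theta>. \<Sum>n<N. cis (- (real j * \<theta>)) * f n (ip F (x n) (gauge X \<theta> Y (y n)))" and
        y = "\<lambda>N. \<Sum>n<N. of_real (2 * pi) * f n (ip F (x n) (shift_part j Y (y n)))"])
    fix N
    show "((\<lambda>\<theta>. \<Sum>n<N. cis (- (real j * \<theta>)) * f n (ip F (x n) (gauge X \<theta> Y (y n)))) has_integral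
        (\<Sum>n<N. of_real (2 * pi) * f n (ip F (x n) (shift_part j Y (y n))))) {0..2 * pi}"
      by (intro has_integral_sum gauge_integral Y fxy) simp
    have "norm (\<Sum>n<N. cis (- (real j * \<theta>)) * f n (ip F (x n) (gauge X \<theta> Y (y n)))) \<le> (8 * norm (ext Y)) * (\<Sum>n. w n)" for \<theta>
    proof -
      have "norm (\<Sum>n<N. cis (- (real j * \<theta>)) * f n (ip F (x n) (gauge X \<theta> Y (y n)))) \<le> (\<Sum>n<N. (8 * norm (ext Y)) * w n)"
        by (rule order_trans[OF norm_sum]) (intro sum_mono, simp add: norm_mult g_le)
      also have "\<dots> \<le> (8 * norm (ext Y)) * (\<Sum>n. w n)"
        unfolding sum_distrib_left[symmetric] by (intro mult_left_mono sum_le_suminf sw) (auto simp: w0)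
      finally show ?thesis .
    qed
    then show "\<forall>\<theta>\<in>{0..2 * pi}. norm (\<Sum>n<N. cis (- (real j * \<theta>)) * f n (ip F (x n) (gauge X \<theta> Y (y n))))
        \<le> (8 * norm (ext Y)) * (\<Sum>n. w n)" by blast
  next
    show "\<forall>\<theta>\<in>{0..2 * pi}. (\<lambda>N. \<Sum>n<N. cis (- (real j * \<theta>)) * f n (ip F (x n) (gauge X \<theta> Y (y n))))
        \<longlonglongrightarrow> cis (- (real j * \<theta>)) * (\<Sum>n. f n (ip F (x n) (gauge X \<theta> Y (y n))))"
      unfolding sum_distrib_left[symmetric] by (intro ballI tendsto_mult tendsto_const summable_LIMSEQ sg)
    show "(\<lambda>N. \<Sum>n<N. of_real (2 * pi) * f n (ip F (x n) (shift_part j Y (y n))))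
        \<longlonglongrightarrow> of_real (2 * pi) * (\<Sum>n. f n (ip F (x n) (shift_part j Y (y n))))"
      unfolding sum_distrib_left[symmetric] by (intro tendsto_mult tendsto_const summable_LIMSEQ ss)
  qed auto
qed

text \<open>The integral determines every functional of \<open>S\<close>; the simple functionals
  \<open>f (ip F (fock_incl m z) (T x))\<close> already separate the components of
  \<open>S x\<close>.\<close>

lemma fourier_coeff_eq:
  assumes Y: "Y \<in> adjointable F"
  shows "fourier_coeff X (int j) Y = shift_part j Y"
  unfolding fourier_coeff_def
proof (rule the_equality)
  show "shift_part j Y \<in> adjointable F \<and> (\<forall>\<omega>\<in>operator_functionals F.
    ((\<lambda>\<theta>. cis (- (real_of_int (int j) * \<theta>)) * \<omega> (gauge X \<theta> Y)) has_integral
      complex_of_real (2 * pi) * \<omega> (shift_part j Y)) {0..2 * pi})"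
    using shift_part_adjointable[OF Y] fourier_integral[OF Y] by simp
  fix S assume S: "S \<in> adjointable F \<and> (\<forall>\<omega>\<in>operator_functionals F.
    ((\<lambda>\<theta>. cis (- (real_of_int (int j) * \<theta>)) * \<omega> (gauge X \<theta> Y)) has_integral
      complex_of_real (2 * pi) * \<omega> S) {0..2 * pi})"
  have eq: "\<omega> S = \<omega> (shift_part j Y)" if \<omega>: "\<omega> \<in> operator_functionals F" for \<omega>
  proof -
    have "complex_of_real (2 * pi) * \<omega> S = complex_of_real (2 * pi) * \<omega> (shift_part j Y)"
      using S \<omega> fourier_integral[OF Y \<omega>] by (intro has_integral_unique) auto
    then show ?thesis by simp
  qed
  have "S x = shift_part j Y x" if x: "x \<in> carr F" for x
  proof
    fix m
    have c: "S x k \<in> carr (X k)" "shift_part j Y x k \<in> carr (X k)" for k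
      using fock_nth[OF fock_adjointable_closed[OF conjunct1[OF S] x]] fock_nth[OF shift_part_t(1)[OF Y x]] by auto
    show "S x m = shift_part j Y x m"
    proof (rule Xm.ip_eqI[OF c])
      fix z assume z: "z \<in> carr (X m)"
      show "ip (X m) z (S x m) = ip (X m) z (shift_part j Y x m)"
      proof (rule predual_separates)
        fix f :: "'m \<Rightarrow> complex" assume f: "f \<in> predual"
        show "f (ip (X m) z (S x m)) = f (ip (X m) z (shift_part j Y x m))"
          using eq[OF operator_functional_single[OF f incl_closed[OF z] x]]
            ip_incl_left[OF z c(1)] ip_incl_left[OF z c(2)] by simp
      qed
    qed
  qed
  moreover have "S \<in> extensional (carr F)" "shift_part j Y \<in> extensional (carr F)"
    using S by (simp_all add: adjointable_def shift_part_def PiE_iff)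
  ultimately show "S = shift_part j Y" by (metis extensionalityI)
qed

lemma amplification_fourier_coeff:
  assumes Y: "Y \<in> adjointable F"
  shows "amplification F t (fourier_coeff X (int j) Y) = (\<lambda>u. shift_op j Y \<cdot> u)"
  unfolding fourier_coeff_eq[OF Y] by (rule amplification_cop) (simp add: shift_part_t[OF Y])

end

section \<open>The matrices of the Fourier coefficients\<close>

context fock_representation
begin

lemma level_op_\<psi>: "level_op X t s (\<psi> s a) = restrict (\<lambda>u. Th a \<cdot> u) (summand X t s)"
  unfolding level_op_def summand_def by (rule tensor_op_cop) (rule Th_lv)

lemma level_creation_eq:
  assumes "\<xi> \<in> carr (X j)"
  shows "level_creation X \<tau> t j s \<xi> = restrict (\<lambda>u. Lam j \<xi> \<cdot> u) (summand X t s)"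
  unfolding level_creation_def summand_def add.commute[of s] by (rule tensor_op_cop) (rule Lam_lv[OF assms])

lemma amplification_creation:
  assumes \<xi>: "\<xi> \<in> carr (X j)"
  shows "amplification F t (creation X \<tau> j \<xi>) = (\<lambda>u. Lam j \<xi> \<cdot> u)"
proof (rule amplification_cop)
  fix x h assume x: "x \<in> carr F"
  define z where "z m = (if j \<le> m then \<tau> j (m - j) \<xi> (x (m - j)) else 0)" for m
  have z: "z m \<in> carr (X m)" for m
    using \<tau>_closed[OF \<xi> fock_nth[OF x, of "m - j"]] by (auto simp: z_def Xm.carr_zero)
  have P: "P m \<cdot> (Lam j \<xi> \<cdot> t x h) = lv m (z m) h" for m h
  proof (cases "j \<le> m")
    case True
    then obtain n where m: "m = j + n" using le_Suc_ex by blast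
    show ?thesis
      using arg_cong[OF P_Lam[OF \<xi>, of n], of "\<lambda>T. T \<cdot> t x h"]
      by (simp add: m z_def capp_mult P_t[OF x] Lam_lv \<xi> fock_nth[OF x])
  next
    case False
    have "(\<lambda>N. P m \<cdot> (Lam j \<xi> \<cdot> (\<Sum>n<N. P n \<cdot> t x h))) \<longlonglongrightarrow> P m \<cdot> (Lam j \<xi> \<cdot> t x h)"
      using P_sums[of "t x h"] unfolding sums_def by (intro tendsto_capp tendsto_const)
    then have "(\<lambda>N. 0) \<longlonglongrightarrow> P m \<cdot> (Lam j \<xi> \<cdot> t x h)"
      using False by (simp add: capp_sum_right P_Lam_P[OF \<xi>])
    with False show ?thesis by (simp add: z_def lv_zero LIMSEQ_const_iff)
  qed
  have "norm (Lam j \<xi> \<cdot> t x h) \<le> (norm (Lam j \<xi>) * hnorm F x) * norm h" for h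
    unfolding mult.assoc by (rule order_trans[OF capp_norm_le]) (intro mult_left_mono t_norm_le x, simp)
  from fock_memI2(2)[OF z _ this P] have "t z h = Lam j \<xi> \<cdot> t x h" by (simp add: hnorm_nonneg)
  moreover have "creation X \<tau> j \<xi> x = z" unfolding creation_def z_def by (simp only: restrict_apply' x)
  ultimately show "Lam j \<xi> \<cdot> t x h = t (creation X \<tau> j \<xi> x) h" by simp
qed

lemma vacuum_cinner: "cinner (vacuum \<iota> t h) (vacuum \<iota> t k) = cinner h k"
  by (simp add: vacuum_def lv_cinner \<iota>_closed pow.zeroth_ip \<pi>_one)

lemma inj_vacuum: "inj (vacuum \<iota> t)"
proof (rule injI)
  fix h k assume eq: "vacuum \<iota> t h = vacuum \<iota> t k"
  have "cinner h h = cinner h k" "cinner k h = cinner k k"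
    by (simp_all add: vacuum_cinner[symmetric] eq)
  then have "cinner (h - k) (h - k) = 0" by (simp add: cinner_simps)
  then show "h = k" by simp
qed

lemma lv_\<iota>: "lv 0 (\<iota> a) h = vacuum \<iota> t (\<pi> a h)"
  using lv_act[OF \<iota>_closed, of 1 a h] by (simp add: vacuum_def pow.zeroth_act)

lemma Th_vacuum: "Th a \<cdot> vacuum \<iota> t h = vacuum \<iota> t (\<pi> a h)"
  unfolding lv_\<iota>[symmetric] by (simp add: vacuum_def Th_lv \<iota>_closed pow.zeroth_left)

text \<open>The vacuum map is an isometry, so its range is complete and hence closed, and taking the
  closed span in the definition of the summand adds nothing to it.\<close>

lemma summand_0: "summand X t 0 = range (vacuum \<iota> t)"
proof
  have add: "vacuum \<iota> t (h + k) = vacuum \<iota> t h + vacuum \<iota> t k"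
    and scale: "vacuum \<iota> t (c *\<^sub>C h) = c *\<^sub>C vacuum \<iota> t h" for h k c
    by (simp_all add: vacuum_def lv_add_right lv_scaleC_right \<iota>_closed)
  have n: "norm (vacuum \<iota> t h) = norm h" for h
    using vacuum_cinner[of h h] norm_sq_cinner[of h] norm_sq_cinner[of "vacuum \<iota> t h"]
    by (metis norm_ge_zero power2_eq_iff_nonneg)
  have "bounded_linear (vacuum \<iota> t)"
    by (rule bounded_linear_intro[where K = 1]) (simp_all add: add scale scaleR_scaleC' n)
  then have "complete (range (vacuum \<iota> t))"
    by (rule complete_isometric_image[where e = 1, rotated 2]) (auto simp: n complete_UNIV)
  then have "closed (range (vacuum \<iota> t))" by (rule complete_imp_closed)
  moreover have "csubspace (range (vacuum \<iota> t))"
    unfolding csubspace_iff by (auto simp: add[symmetric] scale[symmetric]) (metis add rangeI scale scaleC_zero_left)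
  moreover have "{lv 0 x h | x h. x \<in> carr (X 0)} \<subseteq> range (vacuum \<iota> t)"
    by (auto elim!: zeroth_cases simp: lv_\<iota>)
  ultimately show "summand X t 0 \<subseteq> range (vacuum \<iota> t)" unfolding summand_def' by (intro clspan_minimal)
  show "range (vacuum \<iota> t) \<subseteq> summand X t 0"
    by (auto simp: vacuum_def intro: lv_in_summand \<iota>_closed)
qed

lemma on_vacuum_\<pi>: "on_vacuum X \<iota> t (\<pi> a) = restrict (\<lambda>u. Th a \<cdot> u) (summand X t 0)"
  unfolding on_vacuum_def
  by (rule restrict_ext) (auto simp: summand_0 inv_f_f[OF inj_vacuum] Th_vacuum)

lemma orthogonal_projection_summand: "orthogonal_projection (summand X t n) u = P n \<cdot> u"
  unfolding orthogonal_projection_def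
proof (rule the_equality)
  have "cinner q (u - P n \<cdot> u) = 0" if "q \<in> summand X t n" for q
    using P_cinner[of n q u] by (simp add: P_id[OF that] cinner_diff_right)
  then show *: "P n \<cdot> u \<in> summand X t n \<and> (\<forall>q\<in>summand X t n. cinner q (u - P n \<cdot> u) = 0)"
    by (simp add: P_in)
  show "p = P n \<cdot> u" if "p \<in> summand X t n \<and> (\<forall>q\<in>summand X t n. cinner q (u - p) = 0)" for p
    using that * projection_unique[OF summand_csubspace] by blast
qed

lemma has_matrixI:
  assumes in_summand: "\<And>s u. u \<in> summand X t s \<Longrightarrow> Z u \<in> summand X t (j + s)"
    and diagonal: "\<And>s. A (j + s) s = restrict Z (summand X t s)"
    and zero: "\<And>r s. r \<noteq> j + s \<Longrightarrow> A r s = zero_entry X t s"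
  shows "has_matrix X t Z A"
  unfolding has_matrix_def
proof (intro allI)
  fix r s
  have "P r \<cdot> Z u = (if r = j + s then Z u else 0)" if "u \<in> summand X t s" for u
    using that by (rule P_summand[OF in_summand])
  then have "restrict (\<lambda>u. orthogonal_projection (summand X t r) (Z u)) (summand X t s)
      = restrict (\<lambda>u. if r = j + s then Z u else 0) (summand X t s)"
    by (intro restrict_ext) (simp add: orthogonal_projection_summand)
  then show "restrict (\<lambda>u. orthogonal_projection (summand X t r) (Z u)) (summand X t s) = A r s"
    by (cases "r = j + s") (simp_all add: diagonal zero zero_entry_def)
qed

lemma shift_op_summand: "u \<in> summand X t s \<Longrightarrow> shift_op j Y \<cdot> u \<in> summand X t (j + s)"
  using shift_op_P[of j Y s u] by (simp add: P_id P_in)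

lemma AlgLat_shift_op:
  assumes "Y \<in> adjointable F" "amplification F t Y \<in> AlgLat (amplification F t ` hardy_algebra X \<psi> \<tau>)"
  obtains \<xi> where "\<And>s. \<xi> s \<in> carr (X j)"
    and "\<And>s u. u \<in> summand X t s \<Longrightarrow> shift_op j Y \<cdot> u = Lam j (\<xi> s) \<cdot> u"
proof -
  obtain \<xi> where \<xi>: "\<And>s. \<xi> s \<in> carr (X j)" "\<And>s. P (j + s) * ext Y * P s = Lam j (\<xi> s) * P s"
    using AlgLat_level[OF assms, of j] by metis
  moreover have "shift_op j Y \<cdot> u = Lam j (\<xi> s) \<cdot> u" if "u \<in> summand X t s" for s u
    using shift_op_P[of j Y s u] arg_cong[OF \<xi>(2)[of s], of "\<lambda>T. T \<cdot> u"] by (simp add: capp_mult P_id[OF that])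
  ultimately show thesis using that by blast
qed

end

theorem theorem3p7:
  fixes E :: "('m::wstar_algebra, 't::complex_vector) hmod"
    and \<phi> :: "'m \<Rightarrow> 't \<Rightarrow> 't"
    and X :: "nat \<Rightarrow> ('m, 't) hmod"
    and \<psi> :: "nat \<Rightarrow> 'm \<Rightarrow> 't \<Rightarrow> 't"
    and \<iota> :: "'m \<Rightarrow> 't"
    and \<tau> :: "nat \<Rightarrow> nat \<Rightarrow> 't \<Rightarrow> 't \<Rightarrow> 't"
    and \<pi> :: "'m \<Rightarrow> 'h::chilbert_space \<Rightarrow> 'h"
    and t :: "(nat \<Rightarrow> 't) \<Rightarrow> 'h \<Rightarrow> 'k::chilbert_space"
    and Y :: "(nat \<Rightarrow> 't) \<Rightarrow> nat \<Rightarrow> 't"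
  assumes "wstar_correspondence E \<phi>"
    and "tensor_powers E \<phi> X \<psi> \<iota> \<tau>"
    and "normal_representation \<pi>" and "inj \<pi>"
    and "hilbert_tensor (fock X) \<pi> t"
    and "Y \<in> adjointable (fock X)"
    and "amplification (fock X) t Y \<in>
           AlgLat (amplification (fock X) t ` hardy_algebra X \<psi> \<tau>)"
  shows "(\<exists>a :: nat \<Rightarrow> 'm.
            restrict (amplification (fock X) t (fourier_coeff X 0 Y)) (summand X t 0)
              = on_vacuum X \<iota> t (\<pi> (a 0)) \<and>
            (\<forall>s>0. restrict (amplification (fock X) t (fourier_coeff X 0 Y)) (summand X t s)
              = level_op X t s (\<psi> s (a s))) \<and>
            has_matrix X t (amplification (fock X) t (fourier_coeff X 0 Y))
              (\<lambda>r s. if r \<noteq> s then zero_entry X t s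
                     else if s = 0 then on_vacuum X \<iota> t (\<pi> (a 0))
                     else level_op X t s (\<psi> s (a s)))) \<and>
         (\<forall>j\<ge>1. \<exists>\<xi> :: nat \<Rightarrow> 't.
            (\<forall>s. \<xi> s \<in> carr (X j)) \<and>
            (\<forall>s. restrict (amplification (fock X) t (fourier_coeff X (int j) Y)) (summand X t s)
                   = restrict (amplification (fock X) t (creation X \<tau> j (\<xi> s))) (summand X t s) \<and>
                 restrict (amplification (fock X) t (creation X \<tau> j (\<xi> s))) (summand X t s)
                   = level_creation X \<tau> t j s (\<xi> s)) \<and>
            has_matrix X t (amplification (fock X) t (fourier_coeff X (int j) Y))
              (\<lambda>r s. if r = s + j then level_creation X \<tau> t j s (\<xi> s)
                     else zero_entry X t s))"
proof -
  interpret fock_representation E \<phi> X \<psi> \<iota> \<tau> \<pi> t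
    using assms by (simp add: fock_representation_def fock_representation_axioms_def)
  note Y = assms(6,7)
  let ?Z = "\<lambda>j u. shift_op j Y \<cdot> u"
  have Z: "amplification F t (fourier_coeff X (int j) Y) = ?Z j" for j
    by (rule amplification_fourier_coeff[OF Y(1)])
  show ?thesis
  proof (intro conjI allI impI)
    obtain \<xi> where \<xi>: "\<And>s. \<xi> s \<in> carr (X 0)"
      "\<And>s u. u \<in> summand X t s \<Longrightarrow> ?Z 0 u = Lam 0 (\<xi> s) \<cdot> u"
      using AlgLat_shift_op[OF Y, of 0] by blast
    \<comment> \<open>In degree 0 the vectors are elements of \<open>M\<close>, and tensoring with
      \<open>\<iota> a\<close> on the left is the left action of \<open>a\<close>; part 1 is the
      case \<open>j = 0\<close> of the argument for part 2.\<close>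
    then have "\<forall>s. \<exists>a. \<xi> s = \<iota> a" by (metis zeroth_cases)
    then obtain a where a: "\<And>s. \<xi> s = \<iota> (a s)" by metis
    have eq: "restrict (?Z 0) (summand X t s) = restrict (\<lambda>u. Th (a s) \<cdot> u) (summand X t s)" for s
      by (rule restrict_ext) (simp add: \<xi>(2) a Lam_\<iota>)
    show "\<exists>a. restrict (amplification F t (fourier_coeff X 0 Y)) (summand X t 0) = on_vacuum X \<iota> t (\<pi> (a 0)) \<and>
      (\<forall>s>0. restrict (amplification F t (fourier_coeff X 0 Y)) (summand X t s) = level_op X t s (\<psi> s (a s))) \<and>
      has_matrix X t (amplification F t (fourier_coeff X 0 Y))
        (\<lambda>r s. if r \<noteq> s then zero_entry X t s else if s = 0 then on_vacuum X \<iota> t (\<pi> (a 0))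
          else level_op X t s (\<psi> s (a s)))"
      unfolding Z[of 0, unfolded of_nat_0]
    proof (intro exI[of _ a] conjI allI impI)
      show "has_matrix X t (?Z 0) (\<lambda>r s. if r \<noteq> s then zero_entry X t s
          else if s = 0 then on_vacuum X \<iota> t (\<pi> (a 0)) else level_op X t s (\<psi> s (a s)))"
        by (rule has_matrixI[where j = 0]) (simp_all add: shift_op_summand[of _ _ 0, simplified] eq on_vacuum_\<pi> level_op_\<psi>)
    qed (simp_all add: eq on_vacuum_\<pi> level_op_\<psi>)
  next
    fix j :: nat
    obtain \<xi> where \<xi>: "\<And>s. \<xi> s \<in> carr (X j)"
      "\<And>s u. u \<in> summand X t s \<Longrightarrow> ?Z j u = Lam j (\<xi> s) \<cdot> u"
      using AlgLat_shift_op[OF Y, of j] by blast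
    have eq: "restrict (?Z j) (summand X t s) = restrict (\<lambda>u. Lam j (\<xi> s) \<cdot> u) (summand X t s)" for s
      by (rule restrict_ext) (rule \<xi>(2))
    show "\<exists>\<xi>. (\<forall>s. \<xi> s \<in> carr (X j)) \<and>
      (\<forall>s. restrict (amplification F t (fourier_coeff X (int j) Y)) (summand X t s)
           = restrict (amplification F t (creation X \<tau> j (\<xi> s))) (summand X t s) \<and>
         restrict (amplification F t (creation X \<tau> j (\<xi> s))) (summand X t s) = level_creation X \<tau> t j s (\<xi> s)) \<and>
      has_matrix X t (amplification F t (fourier_coeff X (int j) Y))
        (\<lambda>r s. if r = s + j then level_creation X \<tau> t j s (\<xi> s) else zero_entry X t s)"
      unfolding Z
    proof (intro exI[of _ \<xi>] conjI allI)
      show "has_matrix X t (?Z j) (\<lambda>r s. if r = s + j then level_creation X \<tau> t j s (\<xi> s) else zero_entry X t s)"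
        by (rule has_matrixI[where j = j]) (simp_all add: shift_op_summand eq level_creation_eq \<xi>(1) add.commute[of _ j])
    qed (simp_all add: eq amplification_creation level_creation_eq \<xi>(1))
  qed
qed

end
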